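(* Suppose that Assumption 1 (stated in the context) is satisfied. Then there exist constants $\alpha, \epsilon\in (0,\infty )$ and a continuous non-decreasing concave function $f:[0,\infty )\to [0,\infty )$ with $f(0)=0$ such that, with the semimetric $\rho$ and the transportation cost $\mathcal W_\rho$ defined from $\alpha,\epsilon,f$ as in the context, for all probability measures $\mu ,\nu$ on $\mathbb R^{2d}$, \[ \mathcal W_\rho (\mu p_t,\nu p_t)\ \le \ e^{-ct}\,\mathcal W_\rho (\mu ,\nu )\qquad\mbox{for any }t\ge 0, \] where the contraction rate $c$ is given by \[ c = \frac{\gamma}{384}\,\min\left( \lambda L u \gamma^{-2},\,\Lambda^{1/2}e^{-\Lambda}Lu\gamma^{-2},\, \Lambda^{1/2}e^{-\Lambda}\right)\qquad\mbox{with}\qquad \Lambda := LR_1^2/8\ =\ \frac{12}{5}(1+2\alpha +2\alpha^2 )(d+A)Lu\gamma^{-2}\lambda^{-1}(1-2\lambda )^{-1}. \] Explicitly, one can choose the constants $\alpha ,\epsilon $ and the function $f$ determining $\rho$ in such a way that \[ \alpha\ =\ (1+\Lambda^{-1})Lu\gamma^{-2}\ \le \ \frac{11}{6}Lu\gamma^{-2},\qquad \epsilon\ =\ 4\gamma^{-1}c/(d+A), \] and $f$ is constant on $[R_1,\infty )$ and $C^2$ on $(0,R_1)$ with \[ \frac 12 e^{-2}\exp (-Lr^2/8)\ \le\ f'(r)\ \le\ \exp (-Lr^2/8)\quad\mbox{for }r\in (0,R_1). \] More precisely, $f$ is defined by $f(r)=\int_0^{r\wedge R_1}\varphi (s)\,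 g(s)\, ds$, where, with $\eta=\Lambda^{-1}$ (so that $\alpha=(1+\eta)Lu\gamma^{-2}$), \[ \varphi (s) = \exp\left( -(1+\eta )Ls^2/8-\gamma^2u^{-1}\epsilon\max(1,(2\alpha)^{-1})s^2/2\right),\qquad g(r) = 1 - \frac 94c\gamma u^{-1}\int_0^r\Phi (s)\varphi (s)^{-1}\, ds,\quad \Phi (s)=\int_0^s\varphi (x)\, dx. \]
   Context: Let $U\in C^1(\mathbb R^d)$ with $\nabla U$ Lipschitz, and $u,\gamma\in(0,\infty)$. Consider the (kinetic) Langevin diffusion $(X_t,V_t)$ on $\mathbb R^{2d}$ given by $dX_t=V_t\,dt$, $dV_t=-\gamma V_t\,dt-u\nabla U(X_t)\,dt+\sqrt{2\gamma u}\,dB_t$, with $B$ a $d$-dimensional Brownian motion, generator $\mathcal L=u\gamma\Delta_v-\gamma v\cdot\nabla_v-u\nabla U(x)\cdot\nabla_v+v\cdot\nabla_x$, and transition semigroup $(p_t)_{t\ge0}$; $\mu p_t$ denotes the law at time $t$ with initial law $\mu$. Assumption 1: there exist constants $L,A\in(0,\infty)$ and $\lambda\in(0,1/4]$ such that $U(x)\ge 0$ for all $x$, $|\nabla U(x)-\nabla U(y)|\le L|x-y|$ for all $x,y$, and $x\cdot\nabla U(x)/2\ge\lambda\,(U(x)+u^{-1}\gamma^2|x|^2/4)-A$ for all $x\in\mathbb R^d$. Lyapunov function: $H(x,v)=U(x)+\frac14u^{-1}\gamma^2\left(|x+\gamma^{-1}v|^2+|\gamma^{-1}v|^2-\lambda|x|^2\right)$.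 For constants $\alpha,\epsilon>0$ and a function $f$, define for $(x,v),(x',v')\in\mathbb R^{2d}$: $r((x,v),(x',v'))=\alpha|x-x'|+|x-x'+\gamma^{-1}(v-v')|$ and $\rho((x,v),(x',v'))=f(r((x,v),(x',v')))\cdot(1+\epsilon H(x,v)+\epsilon H(x',v'))$, and for probability measures $\mu,\nu$ on $\mathbb R^{2d}$, $\mathcal W_\rho(\mu,\nu)=\inf_{\Gamma\in\Pi(\mu,\nu)}\int\rho\,d\Gamma$, the infimum over all couplings of $\mu$ and $\nu$. The radius $R_1$ is defined by $R_1:=4\cdot(6/5)^{1/2}(1+2\alpha+2\alpha^2)^{1/2}(d+A)^{1/2}u^{1/2}\gamma^{-1}(\lambda-2\lambda^2)^{-1/2}$. *)

theory Defs
  imports "HOL-Probability.Probability"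
begin

type_synonym ('n) state = "(real^('n::finite)) \<times> (real^('n::finite))"

definition lyapH :: "(real^('n::finite) \<Rightarrow> real) \<Rightarrow> real \<Rightarrow> real \<Rightarrow> real \<Rightarrow> ('n::finite) state \<Rightarrow> real" where
  "lyapH U u \<gamma> lam z = U (fst z) + 1/4 * (\<gamma>^2 / u) *
     ((norm (fst z + inverse \<gamma> *\<^sub>R snd z))^2 + (norm (inverse \<gamma> *\<^sub>R snd z))^2
      - lam * (norm (fst z))^2)"

definition r_dist :: "real \<Rightarrow> real \<Rightarrow> ('n::finite) state \<Rightarrow> ('n::finite) state \<Rightarrow> real" where
  "r_dist \<gamma> \<alpha> z z' = \<alpha> * norm (fst z - fst z')
     + norm (fst z - fst z' + inverse \<gamma> *\<^sub>R (snd z - snd z'))"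

definition rho_cost :: "(real^('n::finite) \<Rightarrow> real) \<Rightarrow> real \<Rightarrow> real \<Rightarrow> real \<Rightarrow> real \<Rightarrow> real
     \<Rightarrow> (real \<Rightarrow> real) \<Rightarrow> ('n::finite) state \<Rightarrow> ('n::finite) state \<Rightarrow> real" where
  "rho_cost U u \<gamma> lam \<alpha> \<epsilon> f z z' =
     f (r_dist \<gamma> \<alpha> z z') * (1 + \<epsilon> * lyapH U u \<gamma> lam z + \<epsilon> * lyapH U u \<gamma> lam z')"

definition couplings :: "'a::topological_space measure \<Rightarrow> 'a measure \<Rightarrow> ('a \<times> 'a) measure set" where
  "couplings \<mu> \<nu> = {\<Gamma>. prob_space \<Gamma> \<and> sets \<Gamma> = sets borel \<and>
        distr \<Gamma> borel fst = \<mu> \<and> distr \<Gamma> borel snd = \<nu>}"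

definition W_cost :: "('a::topological_space \<Rightarrow> 'a \<Rightarrow> real) \<Rightarrow> 'a measure \<Rightarrow> 'a measure \<Rightarrow> ennreal" where
  "W_cost \<rho> \<mu> \<nu> = (INF \<Gamma>\<in>couplings \<mu> \<nu>. \<integral>\<^sup>+ p. ennreal (\<rho> (fst p) (snd p)) \<partial>\<Gamma>)"

definition std_BM :: "'a measure \<Rightarrow> (real \<Rightarrow> 'a \<Rightarrow> real^('n::finite)) \<Rightarrow> bool" where
  "std_BM M B \<longleftrightarrow> prob_space M \<and>
     (\<forall>t\<ge>0. B t \<in> borel_measurable M) \<and>
     (\<forall>\<omega>\<in>space M. B 0 \<omega> = 0 \<and> continuous_on {0..} (\<lambda>t. B t \<omega>)) \<and>
     (\<forall>(ts::nat \<Rightarrow> real) (k::nat). 0 \<le> ts 0 \<and> (\<forall>i<k. ts i < ts (Suc i)) \<longrightarrow>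
        prob_space.indep_vars M (\<lambda>_. borel)
          (\<lambda>(i,j) \<omega>. (B (ts (Suc i)) \<omega> - B (ts i) \<omega>) $ j) ({..<k} \<times> (UNIV :: 'n set)) \<and>
        (\<forall>i<k. \<forall>j::'n. distributed M lborel (\<lambda>\<omega>. (B (ts (Suc i)) \<omega> - B (ts i) \<omega>) $ j)
            (normal_density 0 (sqrt (ts (Suc i) - ts i)))))"

text \<open>(X,V) is a (strong, pathwise) solution of the kinetic Langevin SDE
  dX = V dt, dV = -gamma V dt - u gradU(X) dt + sqrt(2 gamma u) dB
  driven by the Brownian motion B, with initial condition (X_0,V_0) independent of B.
  Since the noise is additive, the SDE is written in pathwise integral form.\<close>
definition langevin_solution :: "(real^('n::finite) \<Rightarrow> real^('n::finite)) \<Rightarrow> real \<Rightarrow> real \<Rightarrow> 'a measure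
     \<Rightarrow> (real \<Rightarrow> 'a \<Rightarrow> real^('n::finite)) \<Rightarrow> (real \<Rightarrow> 'a \<Rightarrow> real^('n::finite)) \<Rightarrow> (real \<Rightarrow> 'a \<Rightarrow> real^('n::finite)) \<Rightarrow> bool" where
  "langevin_solution gradU u \<gamma> M B X V \<longleftrightarrow>
     std_BM M B \<and>
     (\<forall>t\<ge>0. X t \<in> borel_measurable M \<and> V t \<in> borel_measurable M) \<and>
     prob_space.indep_set M
       (sigma_sets (space M) {(\<lambda>\<omega>. (X 0 \<omega>, V 0 \<omega>)) -` A \<inter> space M | A. A \<in> sets borel})
       (sigma_sets (space M) (\<Union>t\<in>{0..}. {B t -` A \<inter> space M | A. A \<in> sets borel})) \<and>
     (\<forall>\<omega>\<in>space M.
        continuous_on {0..} (\<lambda>t. X t \<omega>) \<and> continuous_on {0..} (\<lambda>t. V t \<omega>) \<and>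
        (\<forall>t\<ge>0. X t \<omega> = X 0 \<omega> + integral {0..t} (\<lambda>s. V s \<omega>) \<and>
                V t \<omega> = V 0 \<omega> - integral {0..t} (\<lambda>s. \<gamma> *\<^sub>R V s \<omega> + u *\<^sub>R gradU (X s \<omega>))
                          + sqrt (2 * \<gamma> * u) *\<^sub>R B t \<omega>))"

text \<open>Law of (X_t,V_t): for a solution with initial law mu this is mu p_t.\<close>
definition law_at :: "'a measure \<Rightarrow> (real \<Rightarrow> 'a \<Rightarrow> real^('n::finite)) \<Rightarrow> (real \<Rightarrow> 'a \<Rightarrow> real^('n::finite))
     \<Rightarrow> real \<Rightarrow> ('n::finite) state measure" where
  "law_at M X V t = distr M borel (\<lambda>\<omega>. (X t \<omega>, V t \<omega>))"

end

theory Submission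
  imports Defs
begin

text \<open>Both solutions are approximated by Euler schemes with Gaussian increments, and the two schemes are
coupled step by step. With \<open>z = x - x'\<close> and \<open>q = z + \<gamma>\<^sup>-\<^sup>1 (v - v')\<close>, the second scheme uses the
noise of the first one reflected in the direction of \<open>q\<close> if \<open>|q|\<close> is not small and the distance is below
\<open>R\<^sub>1\<close>, and the same noise otherwise. In the reflected regime the concavity of \<open>f\<close> beats the drift;
beyond \<open>R\<^sub>1\<close> the Lyapunov function decays; close to \<open>q = 0\<close> either \<open>|z|\<close> contracts or, in the outer half
of the ball, the Lyapunov function decays. A step of length \<open>h\<close> thus contracts the expectation of \<open>\<rho>\<close> by
\<open>1 - ch\<close>, up to an error \<open>o(h)\<close> times a quadratic weight. The Euler schemes converge pathwise to the
diffusions, so a weak limit point of the discrete couplings is a coupling of the two laws. The initial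
condition is truncated in this limit, so that no moments of the initial laws are required.\<close>

section \<open>Weak compactness of measures on Euclidean spaces\<close>

text \<open>The discretisation replaces stochastic calculus by Taylor expansions in s, the square
  root of the step length: noise enters with s, drift with s^2, and after averaging over the
  Gaussian noise the terms of order s vanish while those of order s^2 reproduce the generator. The
  obstacle is that reflection in the direction of q is singular at q = 0. A threshold \<xi> keeps
  away from it, but the remainder then carries a factor \<xi>^-2; hence the order of choice: error
  tolerance, then \<xi>, then the step size. The constants are interlocked as well: \<alpha> enters
  R1, R1 enters \<Lambda>, and \<Lambda> enters \<alpha>, so \<alpha> is found as a fixed point. The
  budget of the rate is 9c: eight parts compensate the worst growth of the Lyapunov part, whose
  constant term is 8c by the choice of \<epsilon>, and one part is left as contraction. The coupled
  chain stores its starting pair, so that a cut-off of the initial condition can be applied inside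
  the expectation.\<close>

lemma sums_binary_digits:
  fixes y :: real
  assumes "0 \<le> y" "y < 1"
  shows "(\<lambda>i. (1/2) ^ Suc i * of_int (\<lfloor>2 ^ Suc i * y\<rfloor> mod 2)) sums y"
proof -
  \<comment> \<open>\<open>a i\<close> is the dyadic truncation of y after i binary digits; each
    summand is an increment of it, and a 0 = 0 because 0 <= y < 1.\<close>
  define a where "a i = of_int \<lfloor>2 ^ i * y\<rfloor> / (2::real) ^ i" for i
  have *: "\<lfloor>2 * w\<rfloor> mod 2 = \<lfloor>2 * w\<rfloor> - 2 * \<lfloor>w\<rfloor>" for w :: real
  proof -
    have "\<lfloor>2 * w\<rfloor> = 2 * \<lfloor>w\<rfloor> \<or> \<lfloor>2 * w\<rfloor> = 2 * \<lfloor>w\<rfloor> + 1"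
      by linarith
    then show ?thesis by auto
  qed
  have eq: "(1/2) ^ Suc i * of_int (\<lfloor>2 ^ Suc i * y\<rfloor> mod 2) = a (Suc i) - a i" for i
    using *[of "2 ^ i * y"] by (simp add: a_def field_simps)
  have "a \<longlonglongrightarrow> y"
  proof (rule LIMSEQ_I)
    fix e :: real assume "e > 0"
    then obtain N where N: "(1/2::real) ^ N < e"
      using real_arch_pow_inv[of e "1/2"] by auto
    have "norm (a n - y) < e" if "n \<ge> N" for n
    proof -
      have "a n - y = (of_int \<lfloor>2 ^ n * y\<rfloor> - 2 ^ n * y) * (1/2) ^ n"
        by (simp add: a_def field_simps)
      moreover have "\<bar>of_int \<lfloor>2 ^ n * y\<rfloor> - 2 ^ n * y\<bar> \<le> 1" by linarith
      ultimately have "norm (a n - y) \<le> 1 * (1/2) ^ n"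
        by (simp add: abs_mult mult_right_mono del: power_one_over)
      also have "\<dots> \<le> (1/2) ^ N" using that by (simp add: power_decreasing)
      finally show ?thesis using N by simp
    qed
    then show "\<exists>no. \<forall>n\<ge>no. norm (a n - y) < e" by blast
  qed
  then have "(\<lambda>i. a (Suc i) - a i) sums (y - a 0)" by (rule telescope_sums)
  moreover have "a 0 = 0" using assms by (simp add: a_def floor_eq_iff)
  ultimately show ?thesis unfolding eq by simp
qed

section \<open>Cantor numbers and a continuous reading of their digits\<close>

definition cantor_code :: "(nat \<Rightarrow> real) \<Rightarrow> real" where
  "cantor_code b = (\<Sum>m. 2 * b m * (1/3) ^ Suc m)"

text \<open>On [0,1/3] it is 3c and on [2/3,1] it is 3c - 2, so on the Cantor set it deletes the
  first ternary digit; the branch 2 - 3c only joins the two continuously over the gap.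
  \<open>cantor_digit\<close> bridges the same gap linearly.\<close>

definition cantor_shift :: "real \<Rightarrow> real" where
  "cantor_shift c = max (min (3 * c) (2 - 3 * c)) (3 * c - 2)"

definition cantor_digit :: "real \<Rightarrow> real" where
  "cantor_digit c = max 0 (min 1 (3 * c - 1))"

lemma summable_cantor:
  assumes "\<And>m. b m \<in> {0, 1 :: real}"
  shows "summable (\<lambda>m. 2 * b m * (1/3) ^ Suc m)"
proof (rule summable_comparison_test')
  show "summable (\<lambda>m. 2 * (1/3::real) ^ Suc m)"
    by (intro summable_mult) (simp add: summable_mult)
  show "norm (2 * b m * (1/3) ^ Suc m) \<le> 2 * (1/3) ^ Suc m" for m
    using assms[of m] by auto
qed

lemma cantor_code_Suc:
  assumes "\<And>m. b m \<in> {0, 1 :: real}"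
  shows "cantor_code b = (2 * b 0 + cantor_code (\<lambda>m. b (Suc m))) / 3"
proof -
  let ?t = "\<lambda>m. 2 * b m * (1/3) ^ Suc m" and ?t' = "\<lambda>m. 2 * b (Suc m) * (1/3) ^ Suc m"
  have "summable ?t'"
    using assms by (intro summable_cantor) auto
  then have "(\<Sum>m. 1/3 * ?t' m) = 1/3 * suminf ?t'"
    by (rule suminf_mult)
  moreover have "(\<lambda>m. ?t (Suc m)) = (\<lambda>m. 1/3 * ?t' m)"
    by (simp add: fun_eq_iff)
  ultimately show ?thesis
    using suminf_split_head[OF summable_cantor[where b = b, OF assms]]
    unfolding cantor_code_def by simp
qed

lemma cantor_code_bounds:
  assumes "\<And>m. b m \<in> {0, 1 :: real}"
  shows "0 \<le> cantor_code b" "cantor_code b \<le> 1"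
proof -
  show "0 \<le> cantor_code b"
    unfolding cantor_code_def
  proof (intro suminf_nonneg summable_cantor assms)
    show "0 \<le> 2 * b m * (1 / 3) ^ Suc m" for m using assms[of m] by auto
  qed
  have s: "(\<lambda>m. 2 * (1/3::real) ^ Suc m) sums 1"
    using sums_mult[OF geometric_sums[of "1/3::real"], of "2/3"] by (simp add: mult_ac)
  have "cantor_code b \<le> (\<Sum>m. 2 * (1/3::real) ^ Suc m)"
    unfolding cantor_code_def
  proof (rule suminf_le)
    show "2 * b n * (1 / 3) ^ Suc n \<le> 2 * (1 / 3) ^ Suc n" for n
      using assms[of n] by auto
  qed (use summable_cantor[OF assms] s in \<open>auto simp: sums_iff\<close>)
  also have "\<dots> = 1" using s by (simp add: sums_iff)
  finally show "cantor_code b \<le> 1" .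
qed

text \<open>A leading digit 0 puts the code into [0,1/3], a leading digit 1 into [2/3,1]. On both
  intervals the interpolated maps read off and delete that digit exactly, so the induction peels off
  one digit at a time.\<close>

lemma cantor_digit_code:
  assumes "\<And>m. b m \<in> {0, 1 :: real}"
  shows "cantor_digit ((cantor_shift ^^ m) (cantor_code b)) = b m"
  using assms
proof (induction m arbitrary: b)
  case 0
  note * = cantor_code_Suc[where b = b, OF 0] cantor_code_bounds[of "\<lambda>m. b (Suc m)"]
  show ?case using *(1) *(2,3)[OF 0] 0[of 0] by (auto simp: cantor_digit_def)
next
  case (Suc m)
  note * = cantor_code_Suc[where b = b, OF Suc.prems] cantor_code_bounds[of "\<lambda>m. b (Suc m)"]
  have "cantor_shift (cantor_code b) = cantor_code (\<lambda>m. b (Suc m))"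
    using *(1) *(2,3)[OF Suc.prems] Suc.prems[of 0] by (auto simp: cantor_shift_def)
  then have "(cantor_shift ^^ Suc m) (cantor_code b) = (cantor_shift ^^ m) (cantor_code (\<lambda>m. b (Suc m)))"
    by (simp only: funpow_Suc_right comp_apply)
  then show ?case
    using Suc.IH[of "\<lambda>m. b (Suc m)"] Suc.prems by (simp only:)
qed

lemma continuous_cantor_digit_iter:
  "continuous_on UNIV (\<lambda>c. cantor_digit ((cantor_shift ^^ m) c))"
proof -
  have "continuous_on UNIV cantor_shift"
    unfolding cantor_shift_def by (intro continuous_intros)
  then have "continuous_on UNIV (cantor_shift ^^ m)"
    by (induction m) (auto intro: continuous_on_compose2[of UNIV cantor_shift] simp: o_def)
  then show ?thesis unfolding cantor_digit_def by (intro continuous_intros)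
qed

text \<open>A continuous surjection from the real line onto the unit cube: the ternary digits of \<open>c\<close> are
  distributed among the binary digits of the coordinates. The digits of a Cantor number depend
  continuously on it, so continuity is preserved.\<close>

lemma unit_cube_curve:
  obtains P :: "real \<Rightarrow> 'e::euclidean_space" and s :: "'e \<Rightarrow> real"
  where "continuous_on UNIV P" "s \<in> borel_measurable borel" "\<And>y. 0 \<le> s y" "\<And>y. s y \<le> 1"
    "\<And>y. (\<And>b. b \<in> Basis \<Longrightarrow> 0 \<le> y \<bullet> b \<and> y \<bullet> b < 1) \<Longrightarrow> P (s y) = y"
proof -
  obtain j :: "'e \<Rightarrow> nat" where j: "bij_betw j Basis {..<DIM('e)}"
    using ex_bij_betw_finite_nat[of "Basis::'e set"] by (auto simp: atLeast0LessThan)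
  define e where "e = inv_into Basis j"
  have ej: "e (j b) = b" and jk: "j b < DIM('e)" if "b \<in> Basis" for b
    using j that by (auto simp: e_def bij_betw_def)
  \<comment> \<open>Interleaving: position m carries binary digit m div DIM (counted from 0) of
    coordinate m mod DIM, so digit i of coordinate b sits at i * DIM + j b.\<close>
  define d :: "'e \<Rightarrow> nat \<Rightarrow> real" where
    "d y m = of_int (\<lfloor>2 ^ Suc (m div DIM('e)) * (y \<bullet> e (m mod DIM('e)))\<rfloor> mod 2)" for y m
  have d01: "d y m \<in> {0, 1}" for y m
  proof -
    have "k mod 2 = 0 \<or> k mod 2 = 1" for k :: int by linarith
    then show ?thesis unfolding d_def by (smt (verit) insert_iff of_int_0 of_int_1)
  qed
  define P :: "real \<Rightarrow> 'e" where
    "P c = (\<Sum>b\<in>Basis. (\<Sum>i. (1/2) ^ Suc i *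
        cantor_digit ((cantor_shift ^^ (i * DIM('e) + j b)) c)) *\<^sub>R b)" for c
  define s where "s y = cantor_code (d y)" for y
  have "continuous_on UNIV P"
    unfolding P_def
  proof (intro continuous_intros)
    fix b :: 'e
    let ?f = "\<lambda>i c. (1/2) ^ Suc i * cantor_digit ((cantor_shift ^^ (i * DIM('e) + j b)) c)"
    have "uniform_limit UNIV (\<lambda>n c. \<Sum>i<n. ?f i c) (\<lambda>c. \<Sum>i. ?f i c) sequentially"
    proof (rule Weierstrass_m_test)
      show "norm (?f i c) \<le> (1/2) ^ Suc i" for i c
        by (auto simp: cantor_digit_def abs_mult intro!: mult_left_le)
      show "summable (\<lambda>i. (1 / 2::real) ^ Suc i)" by (simp add: summable_mult)
    qed
    then show "continuous_on UNIV (\<lambda>c. \<Sum>i. ?f i c)"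
      by (rule uniform_limit_theorem[rotated])
        (auto intro!: always_eventually continuous_intros continuous_cantor_digit_iter)
  qed
  moreover have "s \<in> borel_measurable borel"
    unfolding s_def cantor_code_def d_def by measurable
  moreover have "P (s y) = y" if y: "\<And>b. b \<in> Basis \<Longrightarrow> 0 \<le> y \<bullet> b \<and> y \<bullet> b < 1" for y
  proof -
    have "(\<Sum>i. (1/2) ^ Suc i * cantor_digit ((cantor_shift ^^ (i * DIM('e) + j b)) (s y))) = y \<bullet> b"
      if "b \<in> Basis" for b
    proof -
      have "(1/2) ^ Suc i * cantor_digit ((cantor_shift ^^ (i * DIM('e) + j b)) (s y)) =
          (1/2) ^ Suc i * of_int (\<lfloor>2 ^ Suc i * (y \<bullet> b)\<rfloor> mod 2)" for i
        unfolding s_def cantor_digit_code[OF d01] using that jk[OF that]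
        by (simp add: d_def ej)
      then show ?thesis using sums_binary_digits[of "y \<bullet> b"] y[OF that] by (simp add: sums_iff)
    qed
    then show ?thesis by (simp add: P_def euclidean_representation)
  qed
  ultimately show ?thesis
    using that[of P s] cantor_code_bounds[OF d01] by (auto simp: s_def)
qed

text \<open>Scaled copies of the cube curve are run on the intervals \<open>[2N, 2N + 1]\<close>; the triangle wave
  \<open>arccos (cos (\<pi> c)) / \<pi>\<close> equals \<open>c - 2N\<close> there.\<close>

lemma euclidean_curve:
  obtains p :: "real \<Rightarrow> 'e::euclidean_space" and s :: "'e \<Rightarrow> real"
  where "continuous_on UNIV p" "s \<in> borel_measurable borel" "\<And>x. p (s x) = x"
    "\<And>x. 0 \<le> s x" "\<And>x. s x \<le> 2 * norm x + 3"
proof -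
  obtain P :: "real \<Rightarrow> 'e" and s0 where P: "continuous_on UNIV P"
    and s0[measurable]: "s0 \<in> borel_measurable borel" and s01: "\<And>y. 0 \<le> s0 y" "\<And>y. s0 y \<le> 1"
    and Ps: "\<And>y. (\<And>b. b \<in> Basis \<Longrightarrow> 0 \<le> y \<bullet> b \<and> y \<bullet> b < 1) \<Longrightarrow> P (s0 y) = y"
    using unit_cube_curve by blast
  define B where "B c = arccos (cos (pi * c)) / pi" for c
  define h :: 'e where "h = (\<Sum>b\<in>Basis. (1/2) *\<^sub>R b)"
  \<comment> \<open>For c in [2N, 2N + 1] the factor c + 2 - B c is the constant 2N + 2. With the
    centre h of the unit cube subtracted, the curve then covers the open cube of side 2N + 2 around
    0, and the ball of radius N lies well inside it, as the half-open unit cube requires.\<close>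
  define p where "p c = (c + 2 - B c) *\<^sub>R (P (B c) - h)" for c
  define N where "N x = real_of_int \<lceil>norm x\<rceil>" for x :: 'e
  define q where "q x = (1 / (2 * N x + 2)) *\<^sub>R x + h" for x
  define s where "s x = 2 * N x + s0 (q x)" for x
  have N0: "N x \<ge> 0" "norm x \<le> N x" "N x \<le> norm x + 1" for x
    unfolding N_def using norm_ge_zero[of x] by linarith+
  have B: "continuous_on UNIV B"
    unfolding B_def by (intro continuous_intros) auto
  have "continuous_on UNIV p"
    unfolding p_def by (intro continuous_intros continuous_on_compose2[OF P] B) auto
  moreover have "s \<in> borel_measurable borel"
    unfolding s_def q_def N_def by measurable
  moreover have "p (s x) = x" for x
  proof -
    have "cos (pi * s x) = cos (pi * s0 (q x) + of_int \<lceil>norm x\<rceil> * (2 * pi))"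
      by (simp add: s_def N_def algebra_simps)
    also have "\<dots> = cos (pi * s0 (q x))"
      using cos_int_2pin[of "\<lceil>norm x\<rceil>"] sin_int_2pin[of "\<lceil>norm x\<rceil>"]
      by (simp add: cos_add mult_ac)
    finally have "B (s x) = s0 (q x)"
      using s01[of "q x"] by (simp add: B_def arccos_cos)
    moreover have "P (s0 (q x)) = q x"
    proof (rule Ps)
      fix b :: 'e assume b: "b \<in> Basis"
      have "\<bar>x \<bullet> b\<bar> \<le> N x" using Basis_le_norm[OF b, of x] N0[of x] by linarith
      moreover have "h \<bullet> b = 1/2" using b by (simp add: h_def inner_sum_left inner_Basis if_distrib cong: if_cong)
      ultimately show "0 \<le> q x \<bullet> b \<and> q x \<bullet> b < 1"
        using N0(1)[of x] by (auto simp: q_def inner_add_left field_simps abs_le_iff)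
    qed
    ultimately show ?thesis using N0(1)[of x] by (simp add: p_def s_def q_def)
  qed
  moreover have "0 \<le> s x" "s x \<le> 2 * norm x + 3" for x
    using N0[of x] s01[of "q x"] by (auto simp: s_def)
  ultimately show ?thesis using that by blast
qed

text \<open>The measures are pushed to the real line by the measurable section s, where Helly's
  selection theorem applies, and the limit is pushed back by the continuous curve p. As p (s x) = x,
  integrals of g against the measures are integrals of the bounded continuous g o p against their
  images. The linear growth of s carries tightness over to the line.\<close>

theorem prokhorov_euclidean:
  fixes \<mu> :: "nat \<Rightarrow> 'e::euclidean_space measure"
  assumes prob: "\<And>n. prob_space (\<mu> n)" and sets: "\<And>n. sets (\<mu> n) = sets borel"
    and tight: "\<And>e. e > 0 \<Longrightarrow> \<exists>K. \<forall>n. measure (\<mu> n) {x. norm x > K} < e"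
  obtains r :: "nat \<Rightarrow> nat" and \<nu> where "strict_mono r" "prob_space \<nu>" "sets \<nu> = sets borel"
    "\<And>g :: 'e \<Rightarrow> real. continuous_on UNIV g \<Longrightarrow> (\<exists>B. \<forall>x. \<bar>g x\<bar> \<le> B) \<Longrightarrow>
      (\<lambda>n. integral\<^sup>L (\<mu> (r n)) g) \<longlonglongrightarrow> integral\<^sup>L \<nu> g"
proof -
  obtain p :: "real \<Rightarrow> 'e" and s where p: "continuous_on UNIV p"
    and s[measurable]: "s \<in> borel_measurable borel" and ps: "\<And>x. p (s x) = x"
    and s_bounds: "\<And>x. 0 \<le> s x" "\<And>x. s x \<le> 2 * norm x + 3"
    using euclidean_curve by blast
  have p'[measurable]: "p \<in> borel_measurable borel"
    by (rule borel_measurable_continuous_onI[OF p])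
  interpret prob_space "\<mu> n" for n by fact
  note sets[measurable_cong]
  define m where "m n = distr (\<mu> n) borel s" for n
  have s'[measurable]: "s \<in> borel_measurable (\<mu> n)" for n by measurable
  have rd: "real_distribution (m n)" for n
    unfolding m_def by (intro real_distribution.intro prob_space_distr real_distribution_axioms.intro) auto
  have "Helly_Selection.tight m"
    unfolding tight_def
  proof (intro conjI allI impI rd)
    fix e :: real assume "e > 0"
    then obtain K where K: "\<And>n. measure (\<mu> n) {x. norm x > K} < e" using tight by blast
    let ?b = "2 * \<bar>K\<bar> + 3"
    \<comment> \<open>The left end is -1 because the interval is open on the left and s may take the
      value 0; the right end is the growth bound of s on the ball of radius K.\<close>
    have "1 - e < measure (m n) {-1<..?b}" for n
    proof -
      have "1 - e < 1 - measure (\<mu> n) {x. norm x > K}" using K[of n] by simp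
      also have "\<dots> = measure (\<mu> n) (space (\<mu> n) - {x. norm x > K})"
        by (subst prob_compl) (auto simp: sets)
      also have "\<dots> \<le> measure (\<mu> n) (s -` {-1<..?b} \<inter> space (\<mu> n))"
      proof (rule finite_measure_mono)
        have "- 1 < s x \<and> s x \<le> ?b" if "norm x \<le> K" for x
          using s_bounds[of x] that by linarith
        then show "space (\<mu> n) - {x. norm x > K} \<subseteq> s -` {-1<..?b} \<inter> space (\<mu> n)"
          by auto
      qed measurable
      also have "\<dots> = measure (m n) {-1<..?b}"
        unfolding m_def by (subst measure_distr) auto
      finally show ?thesis .
    qed
    then show "\<exists>a b. a < b \<and> (\<forall>n. 1 - e < measure (m n) {a<..b})"
      by (intro exI[of _ "-1"] exI[of _ ?b]) auto
  qed
  from tight_imp_convergent_subsubsequence[OF this strict_mono_id]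
  obtain r :: "nat \<Rightarrow> nat" and M where r: "strict_mono r" and M: "real_distribution M"
    and conv: "weak_conv_m (m \<circ> r) M" by auto
  interpret M: real_distribution M by fact
  define \<nu> where "\<nu> = distr M borel p"
  have "(\<lambda>n. integral\<^sup>L (\<mu> (r n)) g) \<longlonglongrightarrow> integral\<^sup>L \<nu> g"
    if g: "continuous_on UNIV g" "\<exists>B. \<forall>x. \<bar>g x\<bar> \<le> B" for g :: "'e \<Rightarrow> real"
  proof -
    obtain B where B: "\<And>x. \<bar>g x\<bar> \<le> B" using g(2) by blast
    have g'[measurable]: "g \<in> borel_measurable borel"
      by (rule borel_measurable_continuous_onI[OF g(1)])
    have "continuous_on UNIV (g \<circ> p)"
      using g(1) p by (intro continuous_on_compose) (auto intro: continuous_on_subset)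
    then have "(\<lambda>n. integral\<^sup>L ((m \<circ> r) n) (g \<circ> p)) \<longlonglongrightarrow> integral\<^sup>L M (g \<circ> p)"
      using B rd by (intro weak_conv_imp_integral_bdd_continuous_conv[OF _ M conv, where B = B])
        (auto simp: continuous_on_eq_continuous_at o_def)
    moreover have "integral\<^sup>L ((m \<circ> r) n) (g \<circ> p) = integral\<^sup>L (\<mu> (r n)) g" for n
      unfolding m_def comp_def by (subst integral_distr) (auto simp: ps)
    moreover have "integral\<^sup>L M (g \<circ> p) = integral\<^sup>L \<nu> g"
      unfolding \<nu>_def comp_def by (subst integral_distr) auto
    ultimately show ?thesis by simp
  qed
  moreover have "prob_space \<nu>" unfolding \<nu>_def by (rule M.prob_space_distr) simp
  moreover have "sets \<nu> = sets borel" by (simp add: \<nu>_def)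
  ultimately show ?thesis using that r by blast
qed

text \<open>Closed sets form an intersection-stable generator, and the indicator of a nonempty
  closed set is the pointwise limit of the continuous functions max 0 (1 - n dist(x, C)).\<close>

lemma borel_measure_eqI_bounded_continuous:
  fixes M N :: "'a::metric_space measure"
  assumes "prob_space M" "prob_space N" and sets: "sets M = sets borel" "sets N = sets borel"
    and eq: "\<And>g :: 'a \<Rightarrow> real. continuous_on UNIV g \<Longrightarrow> (\<And>x. 0 \<le> g x \<and> g x \<le> 1) \<Longrightarrow>
      integral\<^sup>L M g = integral\<^sup>L N g"
  shows "M = N"
proof -
  interpret M: prob_space M by fact
  interpret N: prob_space N by fact
  have closed_eq: "emeasure M C = emeasure N C" if C: "closed C" for C
  proof (cases "C = {}")
    case False
    \<comment> \<open>The empty set is treated apart since \<open>infdist\<close> to it is 0, which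
      would make every g n equal to 1.\<close>
    define g where "g n x = max 0 (1 - real n * infdist x C)" for n x
    have g: "continuous_on UNIV (g n)" for n unfolding g_def by (intro continuous_intros)
    have g01: "0 \<le> g n x \<and> g n x \<le> 1" for n x by (auto simp: g_def infdist_nonneg)
    have lim: "(\<lambda>n. g n x) \<longlonglongrightarrow> indicator C x" for x
    proof (cases "x \<in> C")
      case True then show ?thesis by (simp add: g_def)
    next
      case x: False
      then have pos: "infdist x C > 0"
        using C False in_closed_iff_infdist_zero[of C x] infdist_nonneg[of x C] by fastforce
      obtain n0 :: nat where n0: "1 / infdist x C < real n0" using reals_Archimedean2 by blast
      have "g n x = 0" if "n \<ge> n0" for n
      proof -
        have "1 / infdist x C < real n" using n0 that by linarith
        then show ?thesis using pos by (simp add: g_def field_simps)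
      qed
      then have "eventually (\<lambda>n. g n x = 0) sequentially" by (auto simp: eventually_sequentially)
      then show ?thesis using x by (simp add: tendsto_eventually)
    qed
    have "(\<lambda>n. integral\<^sup>L K (g n)) \<longlonglongrightarrow> measure K C"
      if "prob_space K" "sets K = sets borel" for K
    proof -
      interpret K: prob_space K by fact
      have "(\<lambda>n. integral\<^sup>L K (g n)) \<longlonglongrightarrow> integral\<^sup>L K (indicator C)"
        using that g01 lim C g
        by (intro integral_dominated_convergence[where w = "\<lambda>_. 1"])
          (auto simp: measurable_cong_sets[OF that(2) refl] intro!: borel_measurable_continuous_onI)
      then show ?thesis using C that by simp
    qed
    from this[OF assms(1,3)] this[OF assms(2,4)] have "measure M C = measure N C"
      using eq[OF g g01] LIMSEQ_unique by simp
    then show ?thesis by (simp add: M.emeasure_eq_measure N.emeasure_eq_measure)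
  qed simp
  show ?thesis
  proof (rule measure_eqI_generator_eq[where E = "Collect closed" and \<Omega> = UNIV and A = "\<lambda>_. UNIV"])
    have *: "sets (borel :: 'a measure) = sigma_sets UNIV (Collect closed)"
      unfolding borel_eq_closed by (rule sets_measure_of) simp
    show "sets M = sigma_sets UNIV (Collect closed)" "sets N = sigma_sets UNIV (Collect closed)"
      using sets * by simp_all
    show "Int_stable (Collect closed :: 'a set set)"
      unfolding Int_stable_def by (simp add: closed_Int)
    show "emeasure M X = emeasure N X" if "X \<in> Collect closed" for X
      using that closed_eq by simp
  qed simp_all
qed

section \<open>The standard Gaussian measure\<close>

text \<open>Haar argument: both measures are translation invariant and agree on the unit ball.\<close>

lemma lborel_distr_involution:
  fixes T :: "'a::euclidean_space \<Rightarrow> 'a"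
  assumes lin: "linear T" and nrm: "\<And>x. norm (T x) = norm x" and inv: "\<And>x. T (T x) = x"
  shows "distr lborel borel T = lborel"
proof -
  have T[measurable]: "T \<in> borel_measurable borel"
    using lin by (intro borel_measurable_continuous_onI linear_continuous_on) (simp add: linear_conv_bounded_linear)
  define \<mu> where "\<mu> = distr lborel borel T"
  have [measurable_cong, simp]: "sets \<mu> = sets borel" by (simp add: \<mu>_def)
  have ball: "emeasure \<mu> (ball 0 r) = emeasure lborel (ball (0::'a) r)" for r
  proof -
    have "T -` ball 0 r \<inter> space lborel = ball 0 r" using nrm by auto
    then show ?thesis unfolding \<mu>_def by (subst emeasure_distr) auto
  qed
  have sfin: "sigma_finite_measure \<mu>"
  proof
    have "x \<in> (\<Union>n. ball 0 (real n))" for x :: 'a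
      using reals_Archimedean2[of "norm x"] by auto
    then show "\<exists>A. countable A \<and> A \<subseteq> sets \<mu> \<and> \<Union> A = space \<mu> \<and> (\<forall>a\<in>A. emeasure \<mu> a \<noteq> \<infinity>)"
      using ball emeasure_lborel_ball_finite[of 0]
      by (intro exI[of _ "range (\<lambda>n. ball 0 (real n))"]) (auto simp: \<mu>_def less_top)
  qed
  interpret pair_sigma_finite \<mu> "lborel :: 'a measure"
    by (intro pair_sigma_finite.intro sfin sigma_finite_lborel)
  \<comment> \<open>A translation of \<mu> by a is a translation of Lebesgue measure by T a, because
    a + T x = T (T a + x).\<close>
  have shift: "(\<integral>\<^sup>+ x. f (a + x) \<partial>\<mu>) = (\<integral>\<^sup>+ x. f x \<partial>\<mu>)" if [measurable]: "f \<in> borel_measurable borel" for f a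
  proof -
    have "(\<integral>\<^sup>+ x. f (a + x) \<partial>\<mu>) = (\<integral>\<^sup>+ x. f (T (T a + x)) \<partial>lborel)"
      unfolding \<mu>_def by (subst nn_integral_distr) (auto simp: linear_add[OF lin] inv)
    also have "\<dots> = (\<integral>\<^sup>+ x. f (T x) \<partial>distr lborel borel ((+) (T a)))"
      by (subst nn_integral_distr) auto
    also have "\<dots> = (\<integral>\<^sup>+ x. f x \<partial>\<mu>)"
      unfolding lborel_distr_plus \<mu>_def by (subst nn_integral_distr) auto
    finally show ?thesis .
  qed
  have shift_l: "(\<integral>\<^sup>+ x. f (a + x) \<partial>lborel) = (\<integral>\<^sup>+ x. f x \<partial>lborel)"
    if [measurable]: "f \<in> borel_measurable borel" for f and a :: 'a
    by (subst (2) lborel_distr_plus[of a, symmetric], subst nn_integral_distr) auto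
  have "emeasure \<mu> A = emeasure lborel A" if A[measurable]: "A \<in> sets borel" for A
  proof -
    define \<psi> :: "'a \<Rightarrow> ennreal" where "\<psi> = indicator (ball 0 1)"
    have [measurable]: "\<psi> \<in> borel_measurable borel"
      unfolding \<psi>_def by (intro borel_measurable_indicator) auto
    have \<psi>_sym: "\<psi> (y - x) = \<psi> (x - y)" for x y
      by (simp add: \<psi>_def indicator_def norm_minus_commute)
    \<comment> \<open>The double integral of \<psi>(y) 1_A(y + x) over \<mu>(dx) and Lebesgue dy is
      evaluated in both orders. Invariance of \<mu> in x gives \<mu>(A) vol(B); a shift of y in
      Lebesgue measure, followed by the symmetry of \<psi> and the invariance of \<mu>, gives vol(B)
      vol(A).\<close>
    have "emeasure \<mu> A * emeasure lborel (ball (0::'a) 1)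
        = (\<integral>\<^sup>+y. \<psi> y * (\<integral>\<^sup>+x. indicator A (y + x) \<partial>\<mu>) \<partial>lborel)"
      by (subst shift[of "indicator A"]) (auto simp: \<psi>_def nn_integral_cmult_indicator mult.commute)
    also have "\<dots> = (\<integral>\<^sup>+y. \<integral>\<^sup>+x. \<psi> y * indicator A (y + x) \<partial>\<mu> \<partial>lborel)"
      by (rule nn_integral_cong, rule nn_integral_cmult[symmetric]) auto
    also have "\<dots> = (\<integral>\<^sup>+x. \<integral>\<^sup>+y. \<psi> y * indicator A (y + x) \<partial>lborel \<partial>\<mu>)"
      by (rule Fubini') measurable
    also have "\<dots> = (\<integral>\<^sup>+x. \<integral>\<^sup>+y. \<psi> (y - x) * indicator A y \<partial>lborel \<partial>\<mu>)"
    proof (rule nn_integral_cong)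
      fix x
      show "(\<integral>\<^sup>+y. \<psi> y * indicator A (y + x) \<partial>lborel) = (\<integral>\<^sup>+y. \<psi> (y - x) * indicator A y \<partial>lborel)"
        using shift_l[of "\<lambda>y. \<psi> (y - x) * indicator A y" x] by (simp add: add.commute)
    qed
    also have "\<dots> = (\<integral>\<^sup>+y. \<integral>\<^sup>+x. \<psi> (y - x) * indicator A y \<partial>\<mu> \<partial>lborel)"
      by (rule Fubini'[symmetric]) measurable
    also have "\<dots> = (\<integral>\<^sup>+y. (\<integral>\<^sup>+x. \<psi> (y - x) \<partial>\<mu>) * indicator A y \<partial>lborel)"
      by (rule nn_integral_cong, rule nn_integral_multc) auto
    also have "\<dots> = (\<integral>\<^sup>+y. emeasure lborel (ball (0::'a) 1) * indicator A y \<partial>lborel)"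
    proof (rule nn_integral_cong)
      fix y
      have "(\<integral>\<^sup>+x. \<psi> (y - x) \<partial>\<mu>) = (\<integral>\<^sup>+x. \<psi> (- y + x) \<partial>\<mu>)"
        by (subst \<psi>_sym) simp
      also have "\<dots> = emeasure \<mu> (ball 0 1)" by (subst shift) (simp_all add: \<psi>_def \<open>\<psi> \<in> borel_measurable borel\<close>[unfolded \<psi>_def])
      finally show "(\<integral>\<^sup>+x. \<psi> (y - x) \<partial>\<mu>) * indicator A y = emeasure lborel (ball (0::'a) 1) * indicator A y"
        by (simp add: ball)
    qed
    also have "\<dots> = emeasure lborel (ball (0::'a) 1) * emeasure lborel A"
      by (subst nn_integral_cmult) auto
    finally have "emeasure \<mu> A * emeasure lborel (ball (0::'a) 1)
        = emeasure lborel A * emeasure lborel (ball (0::'a) 1)" by (simp add: mult.commute)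
    moreover have "emeasure lborel (ball (0::'a) 1) \<noteq> 0"
      by (simp add: emeasure_ball unit_ball_vol_pos ennreal_eq_0_iff not_le)
    moreover have "emeasure lborel (ball (0::'a) 1) < \<top>" using emeasure_lborel_ball_finite[of "0::'a" 1] by simp
    ultimately show ?thesis
      by (auto simp: ennreal_mult_cancel_left mult.commute[of _ "emeasure lborel (ball _ _)"])
  qed
  then show ?thesis unfolding \<mu>_def by (intro measure_eqI) auto
qed

section \<open>The standard Gaussian measure: product form, symmetries and moments\<close>

definition std_gauss :: "'a::euclidean_space measure" where
  "std_gauss = density lborel (\<lambda>x. ennreal (\<Prod>b\<in>Basis. std_normal_density (x \<bullet> b)))"

abbreviation std_normal :: "real measure" where
  "std_normal \<equiv> density lborel (\<lambda>x. ennreal (std_normal_density x))"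

lemma prob_space_std_normal: "prob_space std_normal"
  by (rule prob_space_normal_density) simp

lemma sets_std_gauss[measurable_cong, simp]: "sets std_gauss = sets borel"
  by (simp add: std_gauss_def)

lemma space_std_gauss[simp]: "space std_gauss = UNIV"
  by (simp add: std_gauss_def)

text \<open>Exhibits the density as a function of the norm alone, which is what makes it invariant
  under norm-preserving maps.\<close>

lemma std_gauss_density_norm:
  fixes x :: "'a::euclidean_space"
  shows "(\<Prod>b\<in>Basis. std_normal_density (x \<bullet> b)) = (1 / sqrt (2 * pi)) ^ DIM('a) * exp (- (norm x)\<^sup>2 / 2)"
proof -
  have "(\<Prod>b\<in>Basis. std_normal_density (x \<bullet> b)) =
      (1 / sqrt (2 * pi)) ^ DIM('a) * exp (\<Sum>b\<in>(Basis::'a set). - (x \<bullet> b)\<^sup>2 / 2)"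
    unfolding std_normal_density_def prod.distrib by (simp add: exp_sum)
  also have "(\<Sum>b\<in>(Basis::'a set). - (x \<bullet> b)\<^sup>2 / 2) = - (norm x)\<^sup>2 / 2"
    unfolding power2_norm_eq_inner euclidean_inner[of x x]
    by (simp add: sum_negf sum_divide_distrib power2_eq_square)
  finally show ?thesis .
qed

text \<open>Both Lebesgue measure and the density factor over the coordinates. The product form
  gives total mass one and the coordinate laws, and links the measure to families of independent
  normal variables.\<close>

lemma std_gauss_eq_PiM:
  "std_gauss = distr (\<Pi>\<^sub>M b\<in>Basis. std_normal) borel (\<lambda>f. \<Sum>b\<in>Basis. f b *\<^sub>R b :: 'a::euclidean_space)"
proof -
  interpret L: product_sigma_finite "\<lambda>_::'a. lborel :: real measure"
    by standard
  interpret N: product_prob_space "\<lambda>_::'a. std_normal"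
    by (intro product_prob_space.intro product_sigma_finite.intro prob_space_std_normal
        prob_space_imp_sigma_finite product_prob_space_axioms.intro)
  let ?D = "\<lambda>f::'a \<Rightarrow> real. ennreal (\<Prod>b\<in>Basis. std_normal_density (f b))"
  have eq: "density (\<Pi>\<^sub>M b\<in>Basis. lborel) ?D = (\<Pi>\<^sub>M b\<in>Basis. std_normal)"
  proof (rule N.PiM_eqI)
    show "sets (density (\<Pi>\<^sub>M b\<in>Basis. lborel) ?D) = sets (\<Pi>\<^sub>M b\<in>Basis. std_normal)"
      by (simp cong: sets_PiM_cong)
    fix A :: "'a \<Rightarrow> real set" assume A: "\<And>i. i \<in> Basis \<Longrightarrow> A i \<in> sets std_normal"
    then have A'[measurable]: "\<And>i. i \<in> Basis \<Longrightarrow> A i \<in> sets borel" by simp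
    have "Pi\<^sub>E Basis A \<in> sets (\<Pi>\<^sub>M b\<in>Basis. lborel)" using A by auto
    then have "emeasure (density (\<Pi>\<^sub>M b\<in>Basis. lborel) ?D) (Pi\<^sub>E Basis A) =
        (\<integral>\<^sup>+ f. ?D f * indicator (Pi\<^sub>E Basis A) f \<partial>(\<Pi>\<^sub>M b\<in>Basis. lborel))"
      by (subst emeasure_density) auto
    also have "\<dots> = (\<integral>\<^sup>+ f. (\<Prod>b\<in>Basis. ennreal (std_normal_density (f b)) * indicator (A b) (f b)) \<partial>(\<Pi>\<^sub>M b\<in>Basis. lborel))"
    proof (rule nn_integral_cong)
      fix f :: "'a \<Rightarrow> real" assume "f \<in> space (\<Pi>\<^sub>M b\<in>Basis. lborel)"
      then have "f \<in> extensional Basis" by (auto simp: space_PiM PiE_def)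
      then have "indicator (Pi\<^sub>E Basis A) f = (\<Prod>b\<in>Basis. indicator (A b) (f b) :: ennreal)"
        by (auto simp: indicator_def PiE_def Pi_def prod_zero_iff)
      then show "?D f * indicator (Pi\<^sub>E Basis A) f = (\<Prod>b\<in>Basis. ennreal (std_normal_density (f b)) * indicator (A b) (f b))"
        by (simp add: prod.distrib prod_ennreal)
    qed
    also have "\<dots> = (\<Prod>b\<in>Basis. \<integral>\<^sup>+ x. ennreal (std_normal_density x) * indicator (A b) x \<partial>lborel)"
      by (rule L.product_nn_integral_prod) auto
    also have "\<dots> = (\<Prod>b\<in>Basis. emeasure std_normal (A b))"
      by (intro prod.cong refl, subst emeasure_density) auto
    finally show "emeasure (density (\<Pi>\<^sub>M b\<in>Basis. lborel) ?D) (Pi\<^sub>E Basis A) = (\<Prod>b\<in>Basis. emeasure std_normal (A b))" .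
  qed simp
  have "std_gauss = density (distr (\<Pi>\<^sub>M b\<in>Basis. lborel) borel (\<lambda>f. \<Sum>b\<in>Basis. f b *\<^sub>R b :: 'a))
      (\<lambda>x. ennreal (\<Prod>b\<in>Basis. std_normal_density (x \<bullet> b)))"
    unfolding std_gauss_def by (subst lborel_eq) simp
  also have "\<dots> = distr (density (\<Pi>\<^sub>M b\<in>Basis. lborel)
      (\<lambda>f. ennreal (\<Prod>b\<in>Basis. std_normal_density ((\<Sum>b\<in>Basis. f b *\<^sub>R b :: 'a) \<bullet> b)))) borel
      (\<lambda>f. \<Sum>b\<in>Basis. f b *\<^sub>R b)"
    by (rule density_distr) auto
  also have "(\<lambda>f. ennreal (\<Prod>b\<in>Basis. std_normal_density ((\<Sum>b\<in>Basis. f b *\<^sub>R b :: 'a) \<bullet> b))) = ?D"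
    by (simp add: inner_sum_left inner_Basis if_distrib cong: if_cong)
  finally show ?thesis unfolding eq .
qed

text \<open>Needed when the coordinates are not indexed by the basis itself: the components of the
  Brownian increments are indexed by pairs of time step and coordinate.\<close>

lemma std_gauss_eq_PiM_reindex:
  fixes e :: "'j \<Rightarrow> 'a::euclidean_space"
  assumes e: "bij_betw e J Basis"
  shows "std_gauss = distr (\<Pi>\<^sub>M j\<in>J. std_normal) borel (\<lambda>f. \<Sum>j\<in>J. f j *\<^sub>R e j)"
proof -
  have inj: "inj_on e J" "e \<in> J \<rightarrow> Basis" using e by (auto simp: bij_betw_def)
  have [measurable]: "(\<lambda>\<omega>. \<omega> (e j)) \<in> borel_measurable (\<Pi>\<^sub>M b\<in>Basis. std_normal)" if "j \<in> J" for j
  proof -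
    have "(\<lambda>\<omega>. \<omega> (e j)) \<in> measurable (\<Pi>\<^sub>M b\<in>Basis. std_normal) std_normal"
      using inj that by (intro measurable_component_singleton) auto
    then show ?thesis by simp
  qed
  have [measurable]: "(\<lambda>f. \<Sum>j\<in>J. f j *\<^sub>R e j) \<in> borel_measurable (\<Pi>\<^sub>M j\<in>J. std_normal)"
  proof (intro borel_measurable_sum borel_measurable_scaleR borel_measurable_const)
    fix j assume "j \<in> J"
    then have "(\<lambda>f. f j) \<in> measurable (\<Pi>\<^sub>M j\<in>J. std_normal) std_normal"
      by (rule measurable_component_singleton)
    then show "(\<lambda>f. f j) \<in> borel_measurable (\<Pi>\<^sub>M j\<in>J. std_normal)" by simp
  qed
  have "(\<Pi>\<^sub>M j\<in>J. std_normal) =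
      distr (\<Pi>\<^sub>M b\<in>Basis. std_normal) (\<Pi>\<^sub>M j\<in>J. std_normal) (\<lambda>\<omega>. \<lambda>j\<in>J. \<omega> (e j))"
    by (rule distr_PiM_reindex[symmetric]) (auto simp: inj prob_space_std_normal)
  then have "distr (\<Pi>\<^sub>M j\<in>J. std_normal) borel (\<lambda>f. \<Sum>j\<in>J. f j *\<^sub>R e j) =
      distr (distr (\<Pi>\<^sub>M b\<in>Basis. std_normal) (\<Pi>\<^sub>M j\<in>J. std_normal) (\<lambda>\<omega>. \<lambda>j\<in>J. \<omega> (e j))) borel
        (\<lambda>f. \<Sum>j\<in>J. f j *\<^sub>R e j)" by simp
  also have "\<dots> = distr (\<Pi>\<^sub>M b\<in>Basis. std_normal) borel ((\<lambda>f. \<Sum>j\<in>J. f j *\<^sub>R e j) \<circ> (\<lambda>\<omega>. \<lambda>j\<in>J. \<omega> (e j)))"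
    using inj by (intro distr_distr measurable_restrict) auto
  also have "(\<lambda>f. \<Sum>j\<in>J. f j *\<^sub>R e j) \<circ> (\<lambda>\<omega>. \<lambda>j\<in>J. \<omega> (e j)) = (\<lambda>\<omega>. \<Sum>b\<in>Basis. \<omega> b *\<^sub>R b)"
    by (auto simp: fun_eq_iff intro!: sum.reindex_bij_betw[OF e, of "\<lambda>b. _ b *\<^sub>R b"])
  finally show ?thesis by (simp add: std_gauss_eq_PiM)
qed

lemma prob_space_std_gauss: "prob_space (std_gauss :: 'a::euclidean_space measure)"
  unfolding std_gauss_eq_PiM
  by (intro prob_space.prob_space_distr prob_space_PiM prob_space_std_normal) auto

interpretation std_gauss: prob_space "std_gauss :: 'a::euclidean_space measure"
  by (rule prob_space_std_gauss)

lemma distr_std_gauss_involution: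
  fixes T :: "'a::euclidean_space \<Rightarrow> 'a"
  assumes lin: "linear T" and nrm: "\<And>x. norm (T x) = norm x" and inv: "\<And>x. T (T x) = x"
  shows "distr std_gauss borel T = std_gauss"
proof -
  let ?D = "\<lambda>x::'a. ennreal (\<Prod>b\<in>Basis. std_normal_density (x \<bullet> b))"
  have [measurable]: "T \<in> borel_measurable borel"
    using lin by (intro borel_measurable_continuous_onI linear_continuous_on) (simp add: linear_conv_bounded_linear)
  have "?D (T x) = ?D x" for x by (simp add: std_gauss_density_norm nrm)
  then have "distr std_gauss borel T = distr (density lborel (\<lambda>x. ?D (T x))) borel T"
    by (simp add: std_gauss_def)
  also have "\<dots> = density (distr lborel borel T) ?D"
    by (rule density_distr[symmetric]) auto
  finally show ?thesis by (simp add: lborel_distr_involution[OF assms] std_gauss_def)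
qed

lemma distr_std_gauss_component:
  assumes "b \<in> (Basis :: 'a::euclidean_space set)"
  shows "distr (std_gauss :: 'a measure) borel (\<lambda>x. x \<bullet> b) = std_normal"
proof -
  have "distr (std_gauss :: 'a measure) borel (\<lambda>x. x \<bullet> b) =
      distr (\<Pi>\<^sub>M b\<in>(Basis::'a set). std_normal) borel ((\<lambda>x. x \<bullet> b) \<circ> (\<lambda>f. \<Sum>b\<in>Basis. f b *\<^sub>R b))"
    unfolding std_gauss_eq_PiM by (subst distr_distr) auto
  also have "(\<lambda>x. x \<bullet> b) \<circ> (\<lambda>f. \<Sum>b\<in>Basis. f b *\<^sub>R b) = (\<lambda>f. f b)"
    using assms by (simp add: inner_sum_left inner_Basis if_distrib fun_eq_iff cong: if_cong)
  also have "distr (\<Pi>\<^sub>M b\<in>(Basis::'a set). std_normal) borel (\<lambda>f. f b) =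
      distr (\<Pi>\<^sub>M b\<in>(Basis::'a set). std_normal) std_normal (\<lambda>f. f b)"
    by (intro distr_cong) auto
  also have "\<dots> = std_normal"
    using assms by (intro distr_PiM_component prob_space_std_normal)
  finally show ?thesis .
qed

text \<open>Reduces to the one-dimensional absolute moments: the largest coordinate is at least |x|
  / DIM in modulus, so |x|^p is dominated by DIM^p times the sum of the |x . b|^p.\<close>

lemma integrable_std_gauss_norm_power:
  "integrable (std_gauss :: 'a::euclidean_space measure) (\<lambda>x. (1 + norm x) ^ p)"
proof -
  have "integrable std_gauss (\<lambda>x::'a. \<bar>x \<bullet> b\<bar> ^ p)" if "b \<in> Basis" for b
  proof -
    have "integrable std_normal (\<lambda>x. \<bar>x\<bar> ^ p)"
      using integrable_std_normal_moment_abs[of p] by (subst integrable_real_density) auto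
    then show ?thesis
      unfolding distr_std_gauss_component[OF that, symmetric] by (subst (asm) integrable_distr_eq) auto
  qed
  then have int: "integrable std_gauss (\<lambda>x::'a. 2 ^ p * (1 + real DIM('a) ^ p * (\<Sum>b\<in>Basis. \<bar>x \<bullet> b\<bar> ^ p)))"
    by (intro Bochner_Integration.integrable_mult_right Bochner_Integration.integrable_add Bochner_Integration.integrable_sum) auto
  show ?thesis
  proof (rule Bochner_Integration.integrable_bound[OF int])
    have bound: "norm x ^ p \<le> real DIM('a) ^ p * (\<Sum>b\<in>Basis. \<bar>x \<bullet> b\<bar> ^ p)" for x :: 'a
    proof -
      obtain b where b: "b \<in> Basis" "norm x \<le> real DIM('a) * \<bar>x \<bullet> b\<bar>"
      proof (rule ccontr)
        assume "\<not> thesis"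
        then have "\<And>b. b \<in> Basis \<Longrightarrow> \<bar>x \<bullet> b\<bar> < norm x / real DIM('a)"
          using that by (force simp: field_simps)
        then have "(\<Sum>b\<in>Basis. \<bar>x \<bullet> b\<bar>) < (\<Sum>b\<in>(Basis::'a set). norm x / real DIM('a))"
          by (intro sum_strict_mono) auto
        then show False using norm_le_l1[of x] by simp
      qed
      have "norm x ^ p \<le> (real DIM('a) * \<bar>x \<bullet> b\<bar>) ^ p"
        using b by (intro power_mono) auto
      also have "\<dots> \<le> real DIM('a) ^ p * (\<Sum>b\<in>Basis. \<bar>x \<bullet> b\<bar> ^ p)"
        unfolding power_mult_distrib using b
        by (intro mult_left_mono member_le_sum) auto
      finally show ?thesis .
    qed
    have "(1 + norm x) ^ p \<le> 2 ^ p * (1 + norm x ^ p)" for x :: 'a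
    proof -
      have "(1 + norm x) ^ p \<le> (2 * max 1 (norm x)) ^ p" by (intro power_mono) auto
      also have "\<dots> = 2 ^ p * (max 1 (norm x)) ^ p" by (simp add: power_mult_distrib)
      also have "(max 1 (norm x)) ^ p \<le> 1 + norm x ^ p" by (simp add: max_def)
      finally show ?thesis by simp
    qed
    then have "(1 + norm x) ^ p \<le> 2 ^ p * (1 + real DIM('a) ^ p * (\<Sum>b\<in>Basis. \<bar>x \<bullet> b\<bar> ^ p))" for x :: 'a
      by (rule order_trans) (intro mult_left_mono add_left_mono bound, simp)
    then have "norm ((1 + norm x) ^ p) \<le>
        norm (2 ^ p * (1 + real DIM('a) ^ p * (\<Sum>b\<in>Basis. \<bar>x \<bullet> b\<bar> ^ p)))" for x :: 'a
      by (simp only: real_norm_def abs_of_nonneg add_nonneg_nonneg norm_ge_zero zero_le_one zero_le_power)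
        (rule order_trans[OF _ abs_ge_self])
    then show "AE x in std_gauss. norm ((1 + norm x) ^ p) \<le>
        norm (2 ^ p * (1 + real DIM('a) ^ p * (\<Sum>b\<in>(Basis :: 'a set). \<bar>x \<bullet> b\<bar> ^ p)))"
      by (intro always_eventually allI)
  qed auto
qed

lemma integrable_std_gauss_bound:
  fixes f :: "'a::euclidean_space \<Rightarrow> real"
  assumes "f \<in> borel_measurable borel" "\<And>x. \<bar>f x\<bar> \<le> C * (1 + norm x) ^ p"
  shows "integrable std_gauss f"
proof (rule Bochner_Integration.integrable_bound)
  show "integrable std_gauss (\<lambda>x::'a. C * (1 + norm x) ^ p)"
    by (intro Bochner_Integration.integrable_mult_right integrable_std_gauss_norm_power)
  show "AE x in std_gauss. norm (f x) \<le> norm (C * (1 + norm x) ^ p)"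
    using assms(2) by (auto intro!: always_eventually order_trans[OF _ abs_ge_self])
qed (use assms in auto)

lemma integral_std_gauss_involution:
  fixes f :: "'a::euclidean_space \<Rightarrow> real"
  assumes "linear T" "\<And>x. norm (T x) = norm x" "\<And>x. T (T x) = x" and [measurable]: "f \<in> borel_measurable borel"
  shows "(\<integral>x. f (T x) \<partial>std_gauss) = (\<integral>x. f x \<partial>std_gauss)"
proof -
  have [measurable]: "T \<in> borel_measurable borel"
    using assms(1) by (intro borel_measurable_continuous_onI linear_continuous_on) (simp add: linear_conv_bounded_linear)
  show ?thesis
    by (subst (2) distr_std_gauss_involution[OF assms(1-3), symmetric], subst integral_distr) auto
qed

lemma integrable_std_gauss_inner[intro, simp]:
  "integrable std_gauss (\<lambda>x::'a::euclidean_space. x \<bullet> a)"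
  by (rule integrable_std_gauss_bound[where C = "norm a" and p = 1])
    (auto intro!: order_trans[OF Cauchy_Schwarz_ineq2] simp: algebra_simps)

lemma integrable_std_gauss_inner_mult[intro, simp]:
  "integrable std_gauss (\<lambda>x::'a::euclidean_space. (x \<bullet> a) * (x \<bullet> b))"
proof (rule integrable_std_gauss_bound[where C = "norm a * norm b" and p = 2])
  fix x :: 'a
  have "\<bar>(x \<bullet> a) * (x \<bullet> b)\<bar> \<le> (norm x * norm a) * (norm x * norm b)"
    unfolding abs_mult by (intro mult_mono Cauchy_Schwarz_ineq2) auto
  also have "\<dots> = (norm a * norm b) * norm x ^ 2" by (simp add: power2_eq_square)
  also have "\<dots> \<le> (norm a * norm b) * (1 + norm x) ^ 2"
    by (intro mult_left_mono power_mono) auto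
  finally show "\<bar>(x \<bullet> a) * (x \<bullet> b)\<bar> \<le> norm a * norm b * (1 + norm x)\<^sup>2" .
qed auto

lemma integral_std_gauss_inner[simp]: "(\<integral>x. x \<bullet> a \<partial>std_gauss) = 0"
proof -
  have "(\<integral>x. - x \<bullet> a \<partial>std_gauss) = (\<integral>x. x \<bullet> a \<partial>std_gauss)"
    by (rule integral_std_gauss_involution[of uminus "\<lambda>x. x \<bullet> a"])
      (auto intro!: linearI)
  then show ?thesis by simp
qed

text \<open>By bilinearity only basis vectors matter. For i different from j, the reflection that
  flips the i-th coordinate preserves the measure and changes the sign of the integrand.\<close>

lemma integral_std_gauss_inner_mult:
  "(\<integral>x. (x \<bullet> a) * (x \<bullet> b) \<partial>std_gauss) = a \<bullet> (b :: 'a::euclidean_space)"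
proof -
  have basis: "(\<integral>x. (x \<bullet> i) * (x \<bullet> j) \<partial>std_gauss) = (if i = j then 1 else 0)"
    if ij: "i \<in> Basis" "j \<in> Basis" for i j :: 'a
  proof (cases "i = j")
    case True
    have "(\<integral>x. (x \<bullet> i) * (x \<bullet> i) \<partial>std_gauss) = (\<integral>x. x * x \<partial>std_normal)"
      unfolding distr_std_gauss_component[OF ij(1), symmetric] by (subst integral_distr) auto
    also have "\<dots> = 1"
      using integral_std_normal_moment_even[of 1]
      by (subst integral_real_density) (auto simp: power2_eq_square)
    finally show ?thesis using True by simp
  next
    case False
    define T where "T x = x - (2 * (x \<bullet> i)) *\<^sub>R i" for x
    have lin: "linear T" unfolding T_def by (intro linearI) (auto simp: algebra_simps inner_add_left)
    have ii: "i \<bullet> i = 1" using ij by simp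
    have "(norm (T x))\<^sup>2 = (norm x)\<^sup>2" for x
      unfolding T_def power2_norm_eq_inner using ii
      by (simp add: inner_diff_left inner_diff_right inner_commute algebra_simps)
    then have nrm: "norm (T x) = norm x" for x by (simp add: power2_eq_iff_nonneg)
    have inv: "T (T x) = x" for x
      using ii by (simp add: T_def inner_diff_left algebra_simps)
    have "(\<integral>x. (T x \<bullet> i) * (T x \<bullet> j) \<partial>std_gauss) = (\<integral>x. (x \<bullet> i) * (x \<bullet> j) \<partial>std_gauss)"
      by (rule integral_std_gauss_involution[OF lin nrm inv]) auto
    moreover have "(T x \<bullet> i) * (T x \<bullet> j) = - ((x \<bullet> i) * (x \<bullet> j))" for x
      using ii False ij by (simp add: T_def inner_diff_left inner_Basis)
    ultimately show ?thesis using False by simp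
  qed
  have "(x \<bullet> a) * (x \<bullet> b) = (\<Sum>i\<in>Basis. \<Sum>j\<in>Basis. (a \<bullet> i) * (b \<bullet> j) * ((x \<bullet> i) * (x \<bullet> j)))" for x :: 'a
    unfolding euclidean_inner[of x a] euclidean_inner[of x b] sum_product
    by (intro sum.cong refl) (simp add: mult_ac)
  then have "(\<integral>x. (x \<bullet> a) * (x \<bullet> b) \<partial>std_gauss) =
      (\<Sum>i\<in>Basis. \<Sum>j\<in>Basis. (a \<bullet> i) * (b \<bullet> j) * (\<integral>x. (x \<bullet> i) * (x \<bullet> j) \<partial>std_gauss))"
    by (simp add: Bochner_Integration.integral_sum)
  also have "\<dots> = (\<Sum>i\<in>Basis. \<Sum>j\<in>Basis. (a \<bullet> i) * (b \<bullet> j) * (if i = j then 1 else 0))"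
    by (intro sum.cong refl) (simp add: basis)
  also have "\<dots> = a \<bullet> b"
    by (simp add: if_distrib euclidean_inner[of a b] cong: if_cong)
  finally show ?thesis .
qed

lemma integral_std_gauss_norm_square:
  "(\<integral>x. (norm x)\<^sup>2 \<partial>(std_gauss :: 'a::euclidean_space measure)) = real DIM('a)"
proof -
  have "(norm x)\<^sup>2 = (\<Sum>b\<in>Basis. (x \<bullet> b) * (x \<bullet> b))" for x :: 'a
    unfolding power2_norm_eq_inner by (rule euclidean_inner)
  then have "(\<integral>x. (norm x)\<^sup>2 \<partial>(std_gauss :: 'a measure)) = (\<Sum>b\<in>(Basis::'a set). b \<bullet> b)"
    by (simp add: Bochner_Integration.integral_sum integral_std_gauss_inner_mult del: inner_same_Basis)
  then show ?thesis by simp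
qed

section \<open>The concave profile\<close>

lemma has_derivative_imp_continuous_on:
  assumes "\<And>x. (P has_real_derivative D x) (at x)"
  shows "continuous_on A P"
  using assms by (intro continuous_at_imp_continuous_on ballI) (rule DERIV_isCont)

text \<open>Gives a primitive on the whole line, so two-sided derivatives are available at 0 as
  well. The branch for x < 0 is explicit since \<open>integral {0..x}\<close> is 0 there, the
  interval being empty.\<close>

lemma antiderivative_exists:
  fixes \<phi> :: "real \<Rightarrow> real"
  assumes cont: "continuous_on UNIV \<phi>"
  obtains P where "\<And>x. (P has_real_derivative \<phi> x) (at x)" "\<And>x. 0 \<le> x \<Longrightarrow> P x = integral {0..x} \<phi>"
proof -
  define P where "P x = (if 0 \<le> x then integral {0..x} \<phi> else - integral {x..0} \<phi>)" for x
  have int: "\<phi> integrable_on {a..b}" for a b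
    using cont by (intro integrable_continuous_real) (auto intro: continuous_on_subset)
  have "(P has_real_derivative \<phi> x) (at x)" for x
  proof -
    define n where "n = \<bar>x\<bar> + 1"
    have eq: "P y = integral {-n..y} \<phi> - integral {-n..0} \<phi>" if "y \<in> {-n<..<n}" for y
    proof (cases "0 \<le> y")
      case True
      then have "integral {-n..0} \<phi> + integral {0..y} \<phi> = integral {-n..y} \<phi>"
        by (intro Henstock_Kurzweil_Integration.integral_combine int) (auto simp: n_def)
      then show ?thesis using True by (simp add: P_def)
    next
      case False
      then have "integral {-n..y} \<phi> + integral {y..0} \<phi> = integral {-n..0} \<phi>"
        using that by (intro Henstock_Kurzweil_Integration.integral_combine int) auto
      then show ?thesis using False by (simp add: P_def)
    qed
    have "((\<lambda>y. integral {-n..y} \<phi>) has_real_derivative \<phi> x) (at x within {-n..n})"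
      using cont by (intro integral_has_real_derivative) (auto intro: continuous_on_subset simp: n_def)
    then have "((\<lambda>y. integral {-n..y} \<phi>) has_real_derivative \<phi> x) (at x)"
      by (subst (asm) at_within_interior) (auto simp: n_def)
    then have "((\<lambda>y. integral {-n..y} \<phi> - integral {-n..0} \<phi>) has_real_derivative \<phi> x) (at x)"
      by (auto intro!: derivative_eq_intros)
    then show ?thesis
      by (rule has_field_derivative_transform_within_open[where S = "{-n<..<n}"])
        (auto simp: eq n_def)
  qed
  moreover have "P x = integral {0..x} \<phi>" if "0 \<le> x" for x using that by (simp add: P_def)
  ultimately show ?thesis using that by blast
qed

section \<open>The profile built from a Gaussian weight and a slowly decreasing factor\<close>

definition gphi :: "real \<Rightarrow> real \<Rightarrow> real" where
  "gphi a s = exp (- a * s\<^sup>2 / 2)"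

definition gPhi :: "real \<Rightarrow> real \<Rightarrow> real" where
  "gPhi a s = integral {0..s} (gphi a)"

definition gfac :: "real \<Rightarrow> real \<Rightarrow> real \<Rightarrow> real" where
  "gfac a \<kappa> r = 1 - \<kappa> * integral {0..r} (\<lambda>s. gPhi a s / gphi a s)"

definition prof :: "real \<Rightarrow> real \<Rightarrow> real \<Rightarrow> real \<Rightarrow> real" where
  "prof a \<kappa> R r = integral {0..min r R} (\<lambda>s. gphi a s * gfac a \<kappa> s)"

definition prof' :: "real \<Rightarrow> real \<Rightarrow> real \<Rightarrow> real" where
  "prof' a \<kappa> r = gphi a r * gfac a \<kappa> r"

text \<open>From \<phi>' = - a r \<phi> and g' = - \<kappa> \<Phi> / \<phi>, the derivative of
  \<phi> g is - a r f' - \<kappa> \<Phi>. The first summand is there to beat the drift, the second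
  to produce the contraction rate, since \<Phi> >= f up to R.\<close>

definition prof'' :: "real \<Rightarrow> real \<Rightarrow> real \<Rightarrow> real" where
  "prof'' a \<kappa> r = - a * r * prof' a \<kappa> r - \<kappa> * gPhi a r"

lemma gphi_pos[simp]: "gphi a s > 0" by (simp add: gphi_def)

lemma DERIV_gphi: "(gphi a has_real_derivative - a * s * gphi a s) (at s)"
  unfolding gphi_def by (auto intro!: derivative_eq_intros simp: field_simps)

lemma continuous_gphi: "continuous_on A (gphi a)"
  unfolding gphi_def by (intro continuous_intros) auto

text \<open>The assumption \<open>half\<close> keeps g between 1/2 and 1 on [0, R]; therefore f' is
  comparable to \<phi> and positive up to the kink at R.\<close>

locale concave_profile =
  fixes a \<kappa> R :: real
  assumes a: "a > 0" and \<kappa>: "\<kappa> \<ge> 0" and R: "R > 0"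
    and half: "\<kappa> * integral {0..R} (\<lambda>s. gPhi a s / gphi a s) \<le> 1/2"
begin

abbreviation "f \<equiv> prof a \<kappa> R"
abbreviation "f' \<equiv> prof' a \<kappa>"
abbreviation "f'' \<equiv> prof'' a \<kappa>"

text \<open>Integrals from 0 are one-sided objects at the left end. Primitives on the whole line
  that agree with \<Phi>, g, f on the relevant range allow derivative rules, the mean value theorem
  and Taylor's theorem to be used up to both end points.\<close>

lemma smooth_extension:
  obtains P G F :: "real \<Rightarrow> real"
  where "\<And>x. (P has_real_derivative gphi a x) (at x)" "\<And>x. 0 \<le> x \<Longrightarrow> P x = gPhi a x"
    "\<And>x. (G has_real_derivative - \<kappa> * (P x / gphi a x)) (at x)" "\<And>x. 0 \<le> x \<Longrightarrow> G x = gfac a \<kappa> x"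
    "\<And>x. (F has_real_derivative gphi a x * G x) (at x)" "\<And>x. 0 \<le> x \<Longrightarrow> F (min x R) = f x"
proof -
  obtain P where P: "\<And>x. (P has_real_derivative gphi a x) (at x)"
    "\<And>x. 0 \<le> x \<Longrightarrow> P x = integral {0..x} (gphi a)"
    using antiderivative_exists[OF continuous_gphi] by blast
  have P2: "P x = gPhi a x" if "0 \<le> x" for x using P that by (simp add: gPhi_def)
  have "continuous_on UNIV P" using P(1) by (rule has_derivative_imp_continuous_on)
  then have "continuous_on UNIV (\<lambda>x. P x / gphi a x)"
    by (intro continuous_intros continuous_gphi) (auto simp: less_imp_neq[THEN not_sym])
  then obtain Q where Q: "\<And>x. (Q has_real_derivative P x / gphi a x) (at x)"
    "\<And>x. 0 \<le> x \<Longrightarrow> Q x = integral {0..x} (\<lambda>x. P x / gphi a x)"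
    using antiderivative_exists by blast
  define G where "G x = 1 - \<kappa> * Q x" for x
  have G1: "(G has_real_derivative - \<kappa> * (P x / gphi a x)) (at x)" for x
    unfolding G_def using Q(1)[of x] by (auto intro!: derivative_eq_intros)
  have G2: "G x = gfac a \<kappa> x" if "0 \<le> x" for x
  proof -
    have "integral {0..x} (\<lambda>x. P x / gphi a x) = integral {0..x} (\<lambda>s. gPhi a s / gphi a s)"
      by (rule Henstock_Kurzweil_Integration.integral_cong) (simp add: P2)
    then show ?thesis using that by (simp add: G_def gfac_def Q(2))
  qed
  have "continuous_on UNIV G" using G1 by (rule has_derivative_imp_continuous_on)
  then have "continuous_on UNIV (\<lambda>x. gphi a x * G x)"
    by (intro continuous_intros continuous_gphi)
  then obtain F where F: "\<And>x. (F has_real_derivative gphi a x * G x) (at x)"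
    "\<And>x. 0 \<le> x \<Longrightarrow> F x = integral {0..x} (\<lambda>x. gphi a x * G x)"
    using antiderivative_exists by blast
  have F2: "F (min x R) = f x" if "0 \<le> x" for x
  proof -
    have "integral {0..min x R} (\<lambda>x. gphi a x * G x) = integral {0..min x R} (\<lambda>s. gphi a s * gfac a \<kappa> s)"
      by (rule Henstock_Kurzweil_Integration.integral_cong) (simp add: G2)
    then show ?thesis using that R by (simp add: F(2) prof_def)
  qed
  show ?thesis using that[OF P(1) P2 G1 G2 F(1) F2] .
qed

lemma gPhi_bounds:
  assumes "0 \<le> r"
  shows "0 \<le> gPhi a r" "gPhi a r \<le> r"
proof -
  have int: "gphi a integrable_on {0..r}"
    by (intro integrable_continuous_real continuous_gphi)
  show "0 \<le> gPhi a r" unfolding gPhi_def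
    by (rule Henstock_Kurzweil_Integration.integral_nonneg[OF int]) (simp add: less_imp_le)
  have "gPhi a r \<le> integral {0..r} (\<lambda>_. 1)" unfolding gPhi_def
    using a by (intro integral_le int) (auto simp: gphi_def)
  then show "gPhi a r \<le> r" using assms by simp
qed

lemma continuous_gPhi: "continuous_on {0..} (gPhi a)"
proof -
  obtain P where P: "\<And>x. (P has_real_derivative gphi a x) (at x)" "\<And>x. 0 \<le> x \<Longrightarrow> P x = gPhi a x"
    using smooth_extension by metis
  then have "continuous_on {0..} P" by (intro has_derivative_imp_continuous_on)
  then show ?thesis by (rule continuous_on_eq) (simp add: P(2))
qed

lemma gfac_bounds:
  assumes "0 \<le> r" "r \<le> R"
  shows "1/2 \<le> gfac a \<kappa> r" "gfac a \<kappa> r \<le> 1"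
proof -
  have int: "(\<lambda>s. gPhi a s / gphi a s) integrable_on {0..x}" for x
    by (intro integrable_continuous_real continuous_intros continuous_gphi continuous_on_subset[OF continuous_gPhi])
      (auto simp: less_imp_neq[THEN not_sym])
  have nn: "0 \<le> gPhi a s / gphi a s" if "s \<in> {0..x}" for s x
    using that gPhi_bounds[of s] by (simp add: less_imp_le)
  have 0: "0 \<le> integral {0..r} (\<lambda>s. gPhi a s / gphi a s)"
    by (rule Henstock_Kurzweil_Integration.integral_nonneg[OF int nn])
  then show "gfac a \<kappa> r \<le> 1" using \<kappa> by (simp add: gfac_def)
  have "integral {0..r} (\<lambda>s. gPhi a s / gphi a s) \<le> integral {0..R} (\<lambda>s. gPhi a s / gphi a s)"
    using assms nn by (intro integral_subset_le int) auto
  then have "\<kappa> * integral {0..r} (\<lambda>s. gPhi a s / gphi a s) \<le> 1/2"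
    using half \<kappa> by (meson mult_left_mono order_trans)
  then show "1/2 \<le> gfac a \<kappa> r" by (simp add: gfac_def)
qed

lemma f'_bounds:
  assumes "0 \<le> r" "r \<le> R"
  shows "gphi a r / 2 \<le> f' r" "f' r \<le> gphi a r" "0 < f' r" "f' r \<le> 1"
proof -
  show 1: "gphi a r / 2 \<le> f' r" and 2: "f' r \<le> gphi a r"
    using gfac_bounds[OF assms] gphi_pos[of a r] by (simp_all add: prof'_def field_simps)
  have "gphi a r \<le> 1" using a by (simp add: gphi_def)
  with 1 2 gphi_pos[of a r] show "0 < f' r" "f' r \<le> 1" by linarith+
qed

lemma f''_bounds:
  assumes "0 \<le> r" "r \<le> R"
  shows "f'' r \<le> 0" "\<bar>f'' r\<bar> \<le> (a + \<kappa>) * R"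
proof -
  have 1: "0 \<le> a * r * f' r" using f'_bounds[OF assms] a assms by simp
  have 2: "0 \<le> \<kappa> * gPhi a r" using gPhi_bounds[OF assms(1)] \<kappa> by simp
  have 3: "a * r * f' r \<le> a * R" 
    using f'_bounds[OF assms] a assms mult_mono[of "a * r" "a * R" "f' r" 1] by simp
  have 4: "\<kappa> * gPhi a r \<le> \<kappa> * R" using gPhi_bounds[OF assms(1)] \<kappa> assms by (intro mult_left_mono) auto
  show "f'' r \<le> 0" "\<bar>f'' r\<bar> \<le> (a + \<kappa>) * R"
    using 1 2 3 4 by (simp_all add: prof''_def algebra_simps)
qed

lemma f_derivs:
  assumes r: "0 < r" "r < R"
  shows "(f has_real_derivative f' r) (at r)" "(f' has_real_derivative f'' r) (at r)" "isCont f'' r"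
proof -
  obtain P G F where PGF: "\<And>x. (P has_real_derivative gphi a x) (at x)" "\<And>x. 0 \<le> x \<Longrightarrow> P x = gPhi a x"
    "\<And>x. (G has_real_derivative - \<kappa> * (P x / gphi a x)) (at x)" "\<And>x. 0 \<le> x \<Longrightarrow> G x = gfac a \<kappa> x"
    "\<And>x. (F has_real_derivative gphi a x * G x) (at x)" "\<And>x. 0 \<le> x \<Longrightarrow> F (min x R) = f x"
    using smooth_extension by metis
  show "(f has_real_derivative f' r) (at r)"
  proof (rule has_field_derivative_transform_within_open[where S = "{0<..<R}"])
    show "(F has_real_derivative f' r) (at r)" using PGF(5)[of r] r by (simp add: prof'_def PGF(4))
    show "F x = f x" if "x \<in> {0<..<R}" for x using PGF(6)[of x] that by simp
  qed (use r in auto)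
  show 1: "(f' has_real_derivative f'' r) (at r)"
  proof (rule has_field_derivative_transform_within_open[where S = "{0<..<R}"])
    have nz: "gphi a r \<noteq> 0" using gphi_pos[of a r] by linarith
    show "((\<lambda>x. gphi a x * G x) has_real_derivative f'' r) (at r)"
      using PGF(2,4)[of r] r nz
      by (auto intro!: derivative_eq_intros PGF(3) DERIV_gphi simp: prof''_def prof'_def field_simps)
    show "gphi a x * G x = f' x" if "x \<in> {0<..<R}" for x using PGF(4)[of x] that by (simp add: prof'_def)
  qed (use r in auto)
  have "isCont (gPhi a) r"
    using continuous_on_interior[OF continuous_gPhi, of r] r by simp
  then show "isCont f'' r"
    unfolding prof''_def by (intro continuous_intros DERIV_isCont[OF 1])
qed

lemma f_ge_R: "R \<le> r \<Longrightarrow> f r = f R"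
  by (simp add: prof_def min_def)

lemma f_0[simp]: "f 0 = 0" using R by (simp add: prof_def)

text \<open>The cubic remainder also covers arguments beyond the kink at \<open>R\<close>, where the Taylor polynomial
  stays above the constant \<open>f R\<close> because \<open>f'\<close> is bounded below.\<close>

lemma f_calculus:
  obtains C where "C \<ge> 0"
    "\<And>r s. \<lbrakk>0 \<le> r; r \<le> R; 0 \<le> s\<rbrakk> \<Longrightarrow>
      f s \<le> f r + f' r * (s - r) + f'' r / 2 * (s - r)\<^sup>2 + C * \<bar>s - r\<bar> ^ 3"
    "\<And>r s. \<lbrakk>0 \<le> r; r \<le> R; 0 \<le> s\<rbrakk> \<Longrightarrow> f s \<le> f r + f' r * (s - r)"
    "\<And>r s. 0 \<le> r \<Longrightarrow> r \<le> s \<Longrightarrow> f r \<le> f s"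
    "\<And>r. 0 \<le> r \<Longrightarrow> r \<le> R \<Longrightarrow> f r \<le> gPhi a r"
    "continuous_on {0..} f"
proof -
  obtain P G F where PGF: "\<And>x. (P has_real_derivative gphi a x) (at x)" "\<And>x. 0 \<le> x \<Longrightarrow> P x = gPhi a x"
    "\<And>x. (G has_real_derivative - \<kappa> * (P x / gphi a x)) (at x)" "\<And>x. 0 \<le> x \<Longrightarrow> G x = gfac a \<kappa> x"
    "\<And>x. (F has_real_derivative gphi a x * G x) (at x)" "\<And>x. 0 \<le> x \<Longrightarrow> F (min x R) = f x"
    using smooth_extension by metis
  define F1 where "F1 x = gphi a x * G x" for x
  define F2 where "F2 x = - a * x * F1 x - \<kappa> * P x" for x
  \<comment> \<open>The third derivative; its bound K on the compact interval [0, R] is the constant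
    of the cubic Taylor remainder.\<close>
  define F3 where "F3 x = - a * F1 x - a * x * F2 x - \<kappa> * gphi a x" for x
  have Ff: "F x = f x" if "0 \<le> x" "x \<le> R" for x using PGF(6)[of x] that by simp
  have F1f: "F1 x = f' x" if "0 \<le> x" for x using that by (simp add: F1_def prof'_def PGF)
  have F2f: "F2 x = f'' x" if "0 \<le> x" for x using that by (simp add: F2_def prof''_def PGF F1f)
  have D0: "(F has_real_derivative F1 x) (at x)" for x using PGF(5) by (simp add: F1_def)
  have D1: "(F1 has_real_derivative F2 x) (at x)" for x
    unfolding F1_def F2_def using less_imp_neq[OF gphi_pos[of a x]]
    by (auto intro!: derivative_eq_intros PGF(3) DERIV_gphi simp: field_simps)
  have D2: "(F2 has_real_derivative F3 x) (at x)" for x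
    unfolding F2_def F3_def by (auto intro!: derivative_eq_intros D1 PGF(1) simp: F2_def field_simps)
  have cont: "continuous_on A F1" "continuous_on A F2" for A
    using D1 D2 by (auto intro: has_derivative_imp_continuous_on)
  have "continuous_on {0..R} F3"
    unfolding F3_def by (intro continuous_intros cont continuous_gphi)
  then have "bounded (F3 ` {0..R})" by (intro compact_imp_bounded compact_continuous_image) auto
  then obtain K where K: "K > 0" "\<And>x. x \<in> {0..R} \<Longrightarrow> \<bar>F3 x\<bar> \<le> K"
    unfolding bounded_pos by fastforce
  have taylor: "f s \<le> f r + f' r * (s - r) + f'' r / 2 * (s - r)\<^sup>2 + K * \<bar>s - r\<bar> ^ 3"
    if "0 \<le> r" "r \<le> R" "0 \<le> s" "s \<le> R" for r s
  proof (cases "r = s")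
    case False
    define diff where "diff m = (if m = 0 then F else if m = 1 then F1 else if m = 2 then F2 else F3)" for m :: nat
    have "\<exists>t. (if s < r then s < t \<and> t < r else r < t \<and> t < s) \<and>
      F s = (\<Sum>m<3. diff m r / fact m * (s - r) ^ m) + diff 3 t / fact 3 * (s - r) ^ 3"
    proof (rule Taylor[where a = 0 and b = R])
      show "\<forall>m t. m < 3 \<and> 0 \<le> t \<and> t \<le> R \<longrightarrow> (diff m has_real_derivative diff (Suc m) t) (at t)"
        using D0 D1 D2 by (auto simp: diff_def less_Suc_eq numeral_3_eq_3)
    qed (use False that in \<open>auto simp: diff_def\<close>)
    then obtain t where t': "if s < r then s < t \<and> t < r else r < t \<and> t < s"
      and eq: "F s = (\<Sum>m<3. diff m r / fact m * (s - r) ^ m) + diff 3 t / fact 3 * (s - r) ^ 3"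
      by blast
    from t' have t: "t \<in> {0..R}" using that by (auto split: if_splits)
    have "F s = F r + F1 r * (s - r) + F2 r / 2 * (s - r)\<^sup>2 + F3 t / 6 * (s - r) ^ 3"
      using eq by (simp add: diff_def numeral_3_eq_3 numeral_2_eq_2 lessThan_Suc fact_numeral)
    moreover have "F3 t / 6 * (s - r) ^ 3 \<le> K * \<bar>s - r\<bar> ^ 3"
    proof -
      have "F3 t / 6 * (s - r) ^ 3 \<le> \<bar>F3 t / 6\<bar> * \<bar>s - r\<bar> ^ 3"
        by (metis abs_ge_self abs_mult power_abs)
      also have "\<dots> \<le> K * \<bar>s - r\<bar> ^ 3"
        using K(2)[OF t] by (intro mult_right_mono) auto
      finally show ?thesis .
    qed
    ultimately show ?thesis using that by (simp add: Ff F1f F2f)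
  qed simp
  define m0 where "m0 = gphi a R / 2"
  define K2 where "K2 = (a + \<kappa>) * R"
  \<comment> \<open>K is the Taylor constant; the other two summands are for s > R far from r: once
    y = s - r is at least m0 / K2, they make C y^3 exceed R + K2 y^2, which covers both f R and the
    negative quadratic term.\<close>
  define C where "C = K + R * (K2 / m0) ^ 3 + K2 * (K2 / m0)"
  have m0: "m0 > 0" by (simp add: m0_def)
  have K2: "K2 > 0" using a \<kappa> R by (simp add: K2_def add_pos_nonneg)
  have C: "C \<ge> K" using m0 K2 R by (simp add: C_def)
  have fR: "f r \<le> R" "0 \<le> f r" "f r \<le> gPhi a r" if "0 \<le> r" "r \<le> R" for r
  proof -
    have nn: "0 \<le> gphi a s * gfac a \<kappa> s \<and> gphi a s * gfac a \<kappa> s \<le> gphi a s" if "s \<in> {0..r}" for s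
      using f'_bounds[of s] that \<open>r \<le> R\<close> by (simp add: prof'_def less_imp_le)
    have int: "(\<lambda>s. gphi a s * gfac a \<kappa> s) integrable_on {0..r}"
    proof -
      have "F1 integrable_on {0..r}" by (intro integrable_continuous_real cont)
      then show ?thesis by (rule integrable_eq) (simp add: F1_def PGF)
    qed
    have "f r = integral {0..r} (\<lambda>s. gphi a s * gfac a \<kappa> s)" using that by (simp add: prof_def)
    moreover have "integral {0..r} (\<lambda>s. gphi a s * gfac a \<kappa> s) \<le> gPhi a r"
      unfolding gPhi_def using nn by (intro integral_le int integrable_continuous_real continuous_gphi) auto
    moreover have "0 \<le> integral {0..r} (\<lambda>s. gphi a s * gfac a \<kappa> s)"
      using nn by (intro Henstock_Kurzweil_Integration.integral_nonneg int) auto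
    ultimately show "f r \<le> R" "0 \<le> f r" "f r \<le> gPhi a r" using gPhi_bounds[of r] that by auto
  qed
  have "f s \<le> f r + f' r * (s - r) + f'' r / 2 * (s - r)\<^sup>2 + C * \<bar>s - r\<bar> ^ 3"
    if rs: "0 \<le> r" "r \<le> R" "0 \<le> s" for r s
  proof (cases "s \<le> R")
    case True
    then show ?thesis
      using taylor[OF rs(1,2,3) True] mult_right_mono[OF C, of "\<bar>s - r\<bar> ^ 3"] by simp
  next
    case False
    define x where "x = R - r"
    define y where "y = s - r"
    have xy: "0 \<le> x" "x < y" using False rs by (auto simp: x_def y_def)
    have fs: "f s = f R" using False by (intro f_ge_R) simp
    have f1: "m0 \<le> f' r"
    proof -
      have "r\<^sup>2 \<le> R\<^sup>2" using rs by (intro power_mono)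
      then have "gphi a R \<le> gphi a r" using a by (simp add: gphi_def)
      then show ?thesis using f'_bounds(1)[OF rs(1,2)] by (simp add: m0_def)
    qed
    have f2: "\<bar>f'' r\<bar> \<le> K2" using f''_bounds(2)[OF rs(1,2)] by (simp add: K2_def)
    show ?thesis
    proof (cases "K2 * y \<le> m0")
      case True
      \<comment> \<open>Here the quadratic Taylor polynomial does not decrease from x = R - r to y =
        s - r: its difference quotient f' + f''/2 (x + y) is nonnegative because f' >= m0 dominates
        K2 y. So its value at y, with the cubic term, bounds the constant f R.\<close>
      have "\<bar>f'' r / 2 * (x + y)\<bar> \<le> K2 * y"
      proof -
        have "\<bar>f'' r / 2 * (x + y)\<bar> = \<bar>f'' r\<bar> * ((x + y) / 2)" using xy by (simp add: abs_mult)
        also have "\<dots> \<le> K2 * y" using f2 xy K2 by (intro mult_mono) auto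
        finally show ?thesis .
      qed
      then have "0 \<le> (y - x) * (f' r + f'' r / 2 * (x + y))"
        using True f1 xy by (intro mult_nonneg_nonneg) auto
      then have "f' r * x + f'' r / 2 * x\<^sup>2 \<le> f' r * y + f'' r / 2 * y\<^sup>2"
        by (simp add: algebra_simps power2_eq_square diff_divide_distrib)
      moreover have "K * x ^ 3 \<le> C * y ^ 3"
        using C K xy by (intro mult_mono power_mono) auto
      moreover have "f R \<le> f r + f' r * x + f'' r / 2 * x\<^sup>2 + K * x ^ 3"
        using taylor[OF rs(1,2) _ order_refl] R xy by (simp add: x_def)
      ultimately show ?thesis using xy unfolding fs y_def[symmetric] by simp
    next
      case False
      then have y: "y \<ge> m0 / K2" using K2 by (simp add: field_simps)
      then have y1: "1 \<le> K2 / m0 * y" using m0 K2 by (simp add: field_simps)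
      have "R * 1 \<le> R * (K2 / m0 * y) ^ 3"
        using R y1 by (intro mult_left_mono one_le_power) auto
      moreover have "K2 * y\<^sup>2 * 1 \<le> K2 * y\<^sup>2 * (K2 / m0 * y)"
        using K2 y1 by (intro mult_left_mono) auto
      moreover have "C * y ^ 3 = K * y ^ 3 + R * (K2 / m0 * y) ^ 3 + K2 * y\<^sup>2 * (K2 / m0 * y)"
        by (simp add: C_def field_simps power2_eq_square power3_eq_cube)
      moreover have "0 \<le> K * y ^ 3" using K xy by simp
      ultimately have "R + K2 * y\<^sup>2 \<le> C * y ^ 3" by linarith
      moreover have "- (K2 * y\<^sup>2) \<le> f'' r / 2 * y\<^sup>2"
        using mult_right_mono[of "- K2" "f'' r / 2" "y\<^sup>2"] f2 by simp
      moreover have "0 \<le> f' r * y" using f1 m0 xy by simp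
      moreover have "0 \<le> f r" "f R \<le> R" using fR rs R by auto
      ultimately show ?thesis using xy unfolding fs y_def[symmetric] by simp
    qed
  qed
  moreover have tangent: "f s \<le> f r + f' r * (s - r)" if rs: "0 \<le> r" "r \<le> R" "0 \<le> s" for r s
  proof -
    \<comment> \<open>f is constant beyond R and f' > 0, so the tangent inequality at min s R
      implies the one at s.\<close>
    define s' where "s' = min s R"
    have s': "0 \<le> s'" "s' \<le> R" "s' \<le> s" using rs R by (auto simp: s'_def)
    have mono: "F1 y \<le> F1 x" if "0 \<le> x" "x \<le> y" "y \<le> R" for x y
    proof (rule DERIV_nonpos_imp_nonincreasing[OF that(2)])
      fix t assume "x \<le> t" "t \<le> y"
      then show "\<exists>D. (F1 has_real_derivative D) (at t) \<and> D \<le> 0"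
        using D1[of t] f''_bounds(1)[of t] F2f[of t] that by (intro exI[of _ "F2 t"]) auto
    qed
    have "f s' \<le> f r + f' r * (s' - r)"
    proof (cases s' r rule: linorder_cases)
      case less
      then obtain t where t: "s' < t" "t < r" "F r - F s' = (r - s') * F1 t"
        using MVT2[of s' r F F1] D0 by auto
      have "F1 r \<le> F1 t" using mono[of t r] t s' rs by auto
      then have "(r - s') * F1 r \<le> F r - F s'" using less unfolding t(3) by (intro mult_left_mono) auto
      then show ?thesis using rs s' by (simp add: Ff F1f algebra_simps)
    next
      case greater
      then obtain t where t: "r < t" "t < s'" "F s' - F r = (s' - r) * F1 t"
        using MVT2[of r s' F F1] D0 by auto
      have "F1 t \<le> F1 r" using mono[of r t] t s' rs by auto
      then have "F s' - F r \<le> (s' - r) * F1 r" using greater unfolding t(3) by (intro mult_left_mono) auto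
      then show ?thesis using rs s' by (simp add: Ff F1f algebra_simps)
    qed simp
    also have "\<dots> \<le> f r + f' r * (s - r)"
      using s' f'_bounds(3)[OF rs(1,2)] by (intro add_left_mono mult_left_mono) auto
    also have "f s' = f s" by (simp add: s'_def prof_def)
    finally show ?thesis .
  qed
  moreover have "f r \<le> f s" if "0 \<le> r" "r \<le> s" for r s
  proof -
    have "F (min r R) \<le> F (min s R)"
    proof (rule DERIV_nonneg_imp_nondecreasing[of "min r R" "min s R" F])
      fix t assume t: "min r R \<le> t" "t \<le> min s R"
      then have "0 \<le> t" using that R by (meson min.boundedI less_imp_le order_trans)
      with t show "\<exists>D. (F has_real_derivative D) (at t) \<and> D \<ge> 0"
        using D0[of t] F1f[of t] f'_bounds(3)[of t] that R by (intro exI[of _ "F1 t"]) auto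
    qed (use that in auto)
    then show ?thesis using that PGF(6) by auto
  qed
  moreover have "continuous_on {0..} f"
  proof -
    have "continuous_on UNIV F" using D0 by (rule has_derivative_imp_continuous_on)
    then have "continuous_on {0..} (\<lambda>x. F (min x R))"
      by (rule continuous_on_compose2) (auto intro!: continuous_intros)
    then show ?thesis by (rule continuous_on_eq) (simp add: PGF(6))
  qed
  ultimately show ?thesis using that[of C] C K fR by force
qed

lemma f_mono: "0 \<le> r \<Longrightarrow> r \<le> s \<Longrightarrow> f r \<le> f s"
  and f_tangent: "\<lbrakk>0 \<le> r; r \<le> R; 0 \<le> s\<rbrakk> \<Longrightarrow> f s \<le> f r + f' r * (s - r)"
  and f_le_gPhi: "0 \<le> r \<Longrightarrow> r \<le> R \<Longrightarrow> f r \<le> gPhi a r"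
  and continuous_f: "continuous_on {0..} f"
  using f_calculus by metis+

lemma f_nonneg: "0 \<le> r \<Longrightarrow> 0 \<le> f r"
  using f_mono[of 0 r] by simp

lemma f_le_R: "0 \<le> r \<Longrightarrow> f r \<le> R"
  using f_mono[of r "max r R"] f_ge_R[of "max r R"] f_le_gPhi[of R] gPhi_bounds(2)[of R] R by auto

text \<open>A function with a supporting line from above at every point is concave; the slope is f'
  r up to R and 0 beyond, where f has its maximum.\<close>

lemma concave_f: "concave_on {0..} f"
proof -
  have "\<exists>m. \<forall>s\<ge>0. f s \<le> f r + m * (s - r)" if "0 \<le> r" for r
  proof (cases "r \<le> R")
    case False
    have "f s \<le> f r" if "0 \<le> s" for s
      using f_mono[of s "max s r"] f_ge_R[of "max s r"] f_ge_R[of r] False that by auto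
    then show ?thesis by (intro exI[of _ 0]) auto
  qed (use f_tangent that in blast)
  then obtain m where m: "\<And>r s. 0 \<le> r \<Longrightarrow> 0 \<le> s \<Longrightarrow> f s \<le> f r + m r * (s - r)" by metis
  show ?thesis
    unfolding concave_on_iff
  proof (intro conjI ballI allI impI)
    fix x y u v :: real
    assume *: "x \<in> {0..}" "y \<in> {0..}" "0 \<le> u" "0 \<le> v" "u + v = 1"
    let ?r = "u * x + v * y"
    have r: "0 \<le> ?r" using * by simp
    have "u * f x + v * f y \<le> u * (f ?r + m ?r * (x - ?r)) + v * (f ?r + m ?r * (y - ?r))"
      using * m[OF r, of x] m[OF r, of y] by (intro add_mono mult_left_mono) auto
    also have "\<dots> = (u + v) * f ?r + m ?r * (?r - (u + v) * ?r)" by (simp add: algebra_simps)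
    also have "\<dots> = f ?r" using * by simp
    finally show "u * f x + v * f y \<le> f (u *\<^sub>R x + v *\<^sub>R y)" by simp
  qed simp
qed

end

section \<open>The contraction constants\<close>

text \<open>\<Lambda> contains R1 and hence \<alpha>, so the prescribed relation is an equation for
  \<alpha>. It amounts to \<alpha> = w + 1 / (C (1 + 2\<alpha> + 2\<alpha>^2)), whose last term lies
  in (0, 1/C] for \<alpha> >= 0; the intermediate value theorem on [w, w + 1/C] gives a solution. C
  stands for \<Lambda> divided by (1 + 2\<alpha> + 2\<alpha>^2) w.\<close>

lemma fixpoint_alpha_exists:
  fixes C w :: real
  assumes C: "C > 0" and w: "w > 0"
  obtains \<alpha> where "\<alpha> > 0" "\<alpha> = (1 + 1 / (C * (1 + 2*\<alpha> + 2*\<alpha>\<^sup>2) * w)) * w"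
proof -
  define h where "h x = x - w - 1 / (C * (1 + 2*x + 2*x\<^sup>2))" for x
  have pos: "C * (1 + 2*x + 2*x\<^sup>2) > 0" if "x \<ge> 0" for x
    using C that by (intro mult_pos_pos add_pos_nonneg) auto
  have "C \<le> C * (1 + 2 * (w + 1/C) + 2 * (w + 1/C)\<^sup>2)"
    using C w by (simp add: mult_le_cancel_left1)
  then have "1 / (C * (1 + 2 * (w + 1/C) + 2 * (w + 1/C)\<^sup>2)) \<le> 1 / C"
    using C by (intro divide_left_mono mult_pos_pos) auto
  then have "h w \<le> 0" "0 \<le> h (w + 1/C)"
    using pos[of w] w by (simp_all add: h_def)
  moreover have "continuous_on {w..w + 1/C} h"
    unfolding h_def
  proof (intro continuous_intros ballI)
    fix x assume "x \<in> {w..w + 1/C}"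
    then show "C * (1 + 2 * x + 2 * x\<^sup>2) \<noteq> 0" using pos[of x] w by auto
  qed
  ultimately obtain x where x: "w \<le> x" "h x = 0"
    using IVT'[of h w 0 "w + 1/C"] C by auto
  have "x = (1 + 1 / (C * (1 + 2*x + 2*x\<^sup>2) * w)) * w"
  proof -
    have "y > 0 \<Longrightarrow> x = w + 1 / y \<Longrightarrow> x = (1 + 1 / (y * w)) * w" for y using w by (simp add: field_simps)
    from this[of "C * (1 + 2*x + 2*x\<^sup>2)"] show ?thesis using x(2) pos[of x] x(1) w by (simp add: h_def)
  qed
  then show ?thesis using that[of x] x(1) w by auto
qed

lemma exp_quadratic_lower:
  fixes x :: real
  assumes "0 \<le> x"
  shows "1 + x + x\<^sup>2 / 2 \<le> exp x"
  using exp_lower_Taylor_quadratic[OF assms] .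

lemma sqrt_le_half:
  assumes "0 \<le> x"
  shows "sqrt x \<le> (1 + x) / 2"
  using arith_geo_mean_sqrt[of 1 x] assms by simp

text \<open>With x = \<Lambda> this bounds \<Lambda>^(3/2) exp (- \<Lambda>) by 1, the form in which
  the exponentially small rate meets powers of \<Lambda>.\<close>

lemma sqrt_mult_exp_le:
  fixes x :: real
  assumes "0 \<le> x"
  shows "x * sqrt x \<le> exp x"
proof -
  have "x * sqrt x \<le> x * ((1 + x) / 2)"
    using assms by (intro mult_left_mono sqrt_le_half)
  also have "\<dots> \<le> 1 + x + x\<^sup>2 / 2" using assms by (simp add: power2_eq_square field_simps)
  also have "\<dots> \<le> exp x" using assms by (rule exp_quadratic_lower)
  finally show ?thesis .
qed

lemma gphi_eq_inverse: "gphi a s = inverse (exp (a * s\<^sup>2 / 2))"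
  unfolding gphi_def exp_minus[symmetric] by simp

text \<open>The exponent of 1/\<phi> at R1 will be at most \<Lambda> + 5/4; after exp \<Lambda> has
  cancelled, this factor remains, and 16/3 is exactly what the budget 3/32 * exp (5/4) <= 1/2
  allows. Taking fourth powers reduces the claim to exp 1 <= 3.\<close>

lemma exp_5_4_le: "exp (5/4 :: real) \<le> 16/3"
proof (rule power_le_imp_le_base)
  have "exp (5/4 :: real) ^ Suc 3 = exp 1 ^ 5"
    by (simp flip: exp_of_nat_mult)
  also have "\<dots> \<le> 3 ^ 5" using exp_le by (intro power_mono) auto
  also have "\<dots> \<le> (16/3 :: real) ^ Suc 3" by (simp add: power_divide)
  finally show "exp (5/4 :: real) ^ Suc 3 \<le> (16/3) ^ Suc 3" .
qed simp

lemma exp_5_8_le: "exp (5/8 :: real) \<le> 7/3"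
proof (rule power_le_imp_le_base)
  have "exp (5/8 :: real) ^ Suc 1 = exp (5/8 + 5/8)"
    unfolding exp_add by simp
  also have "\<dots> = exp (5/4 :: real)" by simp
  also have "exp (5/4) \<le> (7/3 :: real) ^ Suc 1" using exp_5_4_le by (simp add: power_divide)
  finally show "exp (5/8 :: real) ^ Suc 1 \<le> (7/3) ^ Suc 1" .
qed simp

text \<open>Collects the purely numerical part. \<open>fixpoint\<close> is \<alpha> = (1 +
  1/\<Lambda>) L u / \<gamma>^2 with \<Lambda> written out; \<open>lam_le\<close> follows from the
  drift condition by \<open>lambda_le_of_drift\<close> and serves to bound \<Lambda> from
  below.\<close>

locale contraction_constants =
  fixes d A u \<gamma> L lam \<alpha> :: real
  assumes d: "d \<ge> 1" and A: "A > 0" and u: "u > 0" and \<gamma>: "\<gamma> > 0" and L: "L > 0"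
    and lam: "lam > 0" "lam \<le> 1/4" and \<alpha>: "\<alpha> > 0"
    and lam_le: "lam \<le> 2 * (L * u / \<gamma>\<^sup>2)"
    and fixpoint: "\<alpha> = (1 + 1 / (12/5 * (1 + 2*\<alpha> + 2*\<alpha>\<^sup>2) * (d + A) * L * u / \<gamma>\<^sup>2 / lam / (1 - 2*lam)))
      * L * u / \<gamma>\<^sup>2"
begin

definition R1 where
  "R1 = 4 * sqrt (6/5) * sqrt (1 + 2*\<alpha> + 2*\<alpha>^2) * sqrt (d + A) * sqrt u / \<gamma> / sqrt (lam - 2*lam^2)"
definition \<Lambda> where "\<Lambda> = L * R1^2 / 8"
definition c where
  "c = \<gamma> / 384 * min (lam * L * u / \<gamma>^2)
    (min (sqrt \<Lambda> * exp (-\<Lambda>) * L * u / \<gamma>^2) (sqrt \<Lambda> * exp (-\<Lambda>)))"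
definition \<epsilon> where "\<epsilon> = 4 / \<gamma> * c / (d + A)"
definition mx where "mx = max 1 (1 / (2*\<alpha>))"
definition a where "a = (1 + 1 / \<Lambda>) * L / 4 + \<gamma>^2 / u * \<epsilon> * mx"
definition \<kappa> where "\<kappa> = 9/4 * c * \<gamma> / u"

definition p where "p = 1 + 2*\<alpha> + 2*\<alpha>\<^sup>2"
definition w where "w = L * u / \<gamma>\<^sup>2"

lemma p_ge_1: "p \<ge> 1" unfolding p_def using \<alpha> by simp

lemma w_pos: "w > 0" unfolding w_def using L u \<gamma> by simp

lemma lam2: "lam * (1 - 2 * lam) > 0" "1 - 2 * lam \<ge> 1/2" "1 - 2 * lam > 0" "1 - 2 * lam \<le> 1"
  using lam by auto

lemma R1_pos: "R1 > 0"
proof -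
  have "lam - 2 * lam\<^sup>2 > 0" using lam2(1) by (simp add: power2_eq_square algebra_simps)
  moreover have "p > 0" "d + A > 0" using p_ge_1 d A by auto
  ultimately show ?thesis unfolding R1_def p_def[symmetric] using u \<gamma> by (intro divide_pos_pos mult_pos_pos) auto
qed

lemma R1_sq: "R1\<^sup>2 = 96/5 * p * (d + A) * u / \<gamma>\<^sup>2 / (lam * (1 - 2 * lam))"
proof -
  have "lam - 2 * lam\<^sup>2 = lam * (1 - 2 * lam)" by (simp add: power2_eq_square algebra_simps)
  moreover have "p \<ge> 0" "d + A \<ge> 0" using p_ge_1 d A by auto
  ultimately show ?thesis
    unfolding R1_def p_def[symmetric] power_mult_distrib power_divide using lam2 u by simp
qed

lemma \<Lambda>_eq: "\<Lambda> = 12/5 * p * (d + A) * w / (lam * (1 - 2 * lam))"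
proof -
  have "L * (96/5 * q * e * u / \<gamma>\<^sup>2 / D) / 8 = 12/5 * q * e * w / D" for q e D :: real
    by (simp add: w_def mult_ac)
  then show ?thesis unfolding \<Lambda>_def R1_sq .
qed

lemma \<Lambda>_formula: "\<Lambda> = 12/5 * (1 + 2*\<alpha> + 2*\<alpha>\<^sup>2) * (d + A) * L * u / \<gamma>\<^sup>2 / lam / (1 - 2*lam)"
  unfolding \<Lambda>_eq p_def[symmetric] by (simp add: w_def divide_divide_eq_left mult_ac)

lemma \<alpha>_eq: "\<alpha> = (1 + 1 / \<Lambda>) * w"
  using fixpoint unfolding \<Lambda>_formula w_def by simp

lemma \<Lambda>_ge_w: "12/5 * w / lam \<le> \<Lambda>"
proof -
  have "12/5 * w / lam \<le> 12/5 * (p * (d + A)) * w / (lam * (1 - 2 * lam))"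
  proof (rule frac_le)
    have "1 * 1 \<le> p * (d + A)" using p_ge_1 d A by (intro mult_mono) auto
    then have "12/5 * 1 * w \<le> 12/5 * (p * (d + A)) * w" using w_pos by (intro mult_right_mono mult_left_mono) auto
    then show "12/5 * w \<le> 12/5 * (p * (d + A)) * w" by simp
    show "lam * (1 - 2 * lam) \<le> lam" using lam lam2 by (simp add: mult_le_cancel_left1)
    show "0 \<le> 12 / 5 * (p * (d + A)) * w"
      using w_pos p_ge_1 d A by (intro mult_nonneg_nonneg) auto
  qed (use lam2 in auto)
  then show ?thesis unfolding \<Lambda>_eq by (simp add: mult.assoc)
qed

text \<open>Combines \<Lambda> >= (12/5) w / lam with lam <= 2 w. The value 6/5 is the source of the
  constant 11/6 = 1 + 5/6 in the bound on \<alpha>.\<close>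

lemma \<Lambda>_ge: "\<Lambda> \<ge> 6/5"
proof -
  have "6/5 * lam \<le> 12/5 * w" using lam_le unfolding w_def by linarith
  then have "6/5 \<le> 12/5 * w / lam" using lam by (simp only: pos_le_divide_eq)
  then show ?thesis using \<Lambda>_ge_w by linarith
qed

lemma \<Lambda>_pos: "\<Lambda> > 0" using \<Lambda>_ge by simp

lemma \<alpha>_le: "\<alpha> \<le> 11/6 * w"
proof -
  have "1 / \<Lambda> \<le> 5/6" using \<Lambda>_ge by (simp add: field_simps)
  then have "(1 + 1 / \<Lambda>) * w \<le> 11/6 * w" using w_pos by (intro mult_right_mono) auto
  then show ?thesis using \<alpha>_eq by simp
qed

lemma w_le_\<alpha>: "w \<le> \<alpha>"
proof -
  have "1 * w \<le> (1 + 1 / \<Lambda>) * w" using w_pos \<Lambda>_pos by (intro mult_right_mono) auto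
  then show ?thesis using \<alpha>_eq by simp
qed

lemma c_pos: "c > 0"
  unfolding c_def using \<Lambda>_pos \<gamma> lam L u by (intro mult_pos_pos) (auto intro!: divide_pos_pos mult_pos_pos)

lemma c_le1: "c \<le> \<gamma> / 384 * (lam * w)"
  and c_le2: "c \<le> \<gamma> / 384 * (sqrt \<Lambda> * exp (-\<Lambda>) * w)"
  and c_le3: "c \<le> \<gamma> / 384 * (sqrt \<Lambda> * exp (-\<Lambda>))"
  unfolding c_def using \<gamma> by (intro mult_left_mono; simp add: w_def mult.assoc min_le_iff_disj)+

lemma \<epsilon>_pos: "\<epsilon> > 0" unfolding \<epsilon>_def using c_pos \<gamma> d A by simp

lemma mx_ge_1: "mx \<ge> 1" "mx \<ge> 1 / (2 * \<alpha>)" by (auto simp: mx_def)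

text \<open>For w <= 1 the first entry of the minimum suffices. For w > 1 the third one does: sqrt
  \<Lambda> exp (- \<Lambda>) <= 1/\<Lambda>, and \<Lambda> >= 1/lam. The bound lets the term c
  \<epsilon> H be absorbed by the Lyapunov decay lam \<gamma> \<epsilon> H.\<close>

lemma c_le_lam: "c \<le> \<gamma> / 384 * lam"
proof (cases "w \<le> 1")
  case True
  have "\<gamma> / 384 * (lam * w) \<le> \<gamma> / 384 * (lam * 1)"
    using True lam \<gamma> by (intro mult_left_mono) auto
  then show ?thesis using c_le1 by simp
next
  case False
  have "sqrt \<Lambda> * exp (-\<Lambda>) \<le> 1 / \<Lambda>"
    using sqrt_mult_exp_le[of \<Lambda>] \<Lambda>_pos by (simp add: exp_minus field_simps)
  also have "\<dots> \<le> lam"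
  proof -
    have "1 / lam \<le> 12/5 * w / lam" using False lam by (intro divide_right_mono) auto
    then have "1 / lam \<le> \<Lambda>" using \<Lambda>_ge_w by linarith
    then show ?thesis using lam \<Lambda>_pos by (simp add: field_simps)
  qed
  finally have "\<gamma> / 384 * (sqrt \<Lambda> * exp (-\<Lambda>)) \<le> \<gamma> / 384 * lam" using \<gamma> by (intro mult_left_mono) auto
  then show ?thesis using c_le3 by simp
qed

text \<open>The contribution of the \<epsilon>-term of \<phi> to the exponent at r = R1.\<close>

definition E where "E = \<gamma>\<^sup>2 / u * \<epsilon> * mx * R1\<^sup>2 / 2"

lemma E_nonneg: "E \<ge> 0" unfolding E_def using \<epsilon>_pos mx_ge_1 u by simp

lemma E_eq: "E = 192/5 * (c / \<gamma>) * mx * p / (lam * (1 - 2 * lam))"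
proof -
  have "d + A > 0" using d A by simp
  have "\<gamma>\<^sup>2 / u * (4 / \<gamma> * c / e) * mx * (96/5 * p * e * u / \<gamma>\<^sup>2 / D) / 2 = 192/5 * (c / \<gamma>) * mx * p / D"
    if "e \<noteq> 0" for e D
    using \<gamma> u that by (cases "D = 0") (simp_all add: field_simps power2_eq_square)
  from this[of "d + A" "lam * (1 - 2 * lam)"] \<open>d + A > 0\<close> show ?thesis
    unfolding E_def R1_sq \<epsilon>_def by linarith
qed

text \<open>The factor d + A of R1^2 cancels against \<epsilon>. If \<alpha> <= 1/2, then mx =
  1/(2\<alpha>), and c <= \<gamma> lam w / 384 with w <= \<alpha> supplies the missing \<alpha>;
  here the constant 384 gives exactly 1/4. Otherwise mx = 1, and p / (lam (1 - 2 lam)) is expressed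
  through \<Lambda>, so that \<Lambda>^(3/2) exp (- \<Lambda>) <= 1 finishes.\<close>

lemma E_le: "E \<le> 1/4"
proof (cases "\<alpha> \<le> 1/2")
  case True
  then have mx: "mx = 1 / (2 * \<alpha>)" using \<alpha> by (simp add: mx_def field_simps max_def)
  have p: "p \<le> 5/2" unfolding p_def using True \<alpha> power_mono[of \<alpha> "1/2" 2] by (simp add: power2_eq_square)
  have cg: "c / \<gamma> \<le> lam * \<alpha> / 384"
  proof -
    have "c \<le> \<gamma> / 384 * (lam * \<alpha>)"
      by (rule order_trans[OF c_le1]) (use lam \<gamma> w_le_\<alpha> in \<open>auto intro!: mult_left_mono\<close>)
    then show ?thesis using \<gamma> by (simp add: field_simps)
  qed
  define X where "X = c / \<gamma>"
  have X: "0 < X" "X \<le> lam * \<alpha> / 384" using cg c_pos \<gamma> by (auto simp: X_def)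
  have "E = 192/5 * X * (1 / (2 * \<alpha>)) * p / (lam * (1 - 2 * lam))" by (simp add: E_eq mx X_def)
  also have "\<dots> \<le> 192/5 * (lam * \<alpha> / 384) * (1 / (2 * \<alpha>)) * (5/2) / (lam * (1/2))"
    using X p lam lam2 \<alpha> p_ge_1 by (intro frac_le mult_mono mult_left_mono) auto
  also have "\<dots> = 1/4" using lam \<alpha> by (simp add: field_simps)
  finally show ?thesis .
next
  case False
  then have mx: "mx = 1" using \<alpha> by (simp add: mx_def field_simps max_def)
  have cg: "c / \<gamma> \<le> sqrt \<Lambda> * exp (-\<Lambda>) * w / 384"
    using c_le2 \<gamma> by (simp add: field_simps)
  have dA: "d + A \<ge> 1" using d A by simp
  define X where "X = c / \<gamma>"
  have X: "0 < X" "X \<le> sqrt \<Lambda> * exp (-\<Lambda>) * w / 384" using cg c_pos \<gamma> by (auto simp: X_def)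
  have "E = 192/5 * X * (p / (lam * (1 - 2 * lam)))" by (simp add: E_eq mx X_def)
  also have "p / (lam * (1 - 2 * lam)) = 5/12 * \<Lambda> / ((d + A) * w)"
  proof -
    have "(d + A) * w \<noteq> 0" using dA w_pos by simp
    moreover have "\<Lambda> = 12/5 * (p / (lam * (1 - 2 * lam))) * ((d + A) * w)"
      unfolding \<Lambda>_eq by simp
    ultimately show ?thesis by simp
  qed
  also have "192/5 * X * (5/12 * \<Lambda> / ((d + A) * w)) \<le>
      192/5 * (sqrt \<Lambda> * exp (-\<Lambda>) * w / 384) * (5/12 * \<Lambda> / (1 * w))"
    using X dA w_pos \<Lambda>_pos
    by (intro mult_mono frac_le mult_left_mono mult_right_mono) auto
  also have "\<dots> = 1/24 * (\<Lambda> * sqrt \<Lambda> * exp (-\<Lambda>))" using w_pos by (simp add: field_simps)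
  also have "\<dots> \<le> 1/24 * 1"
    using sqrt_mult_exp_le[of \<Lambda>] \<Lambda>_pos by (intro mult_left_mono) (auto simp: exp_minus field_simps)
  finally show ?thesis by simp
qed

lemma a_R1: "a * R1\<^sup>2 / 2 = \<Lambda> + 1 + E"
proof -
  have "a * R1\<^sup>2 / 2 = (1 + 1 / \<Lambda>) * (L * R1\<^sup>2 / 8) + E"
    by (simp add: a_def E_def algebra_simps)
  also have "L * R1\<^sup>2 / 8 = \<Lambda>" by (simp add: \<Lambda>_def)
  finally show ?thesis using \<Lambda>_pos by (simp add: algebra_simps)
qed

lemma a_ge: "a \<ge> L / 4"
  unfolding a_def using \<Lambda>_pos \<epsilon>_pos mx_ge_1 u L by (simp add: field_simps add_nonneg_nonneg)

lemma a_pos: "a > 0" using a_ge L by simp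

lemma \<kappa>_pos: "\<kappa> > 0" unfolding \<kappa>_def using c_pos \<gamma> u by simp

text \<open>exp (- t^2) <= 1 / (1 + t^2), whose primitive arctan is bounded by pi/2 < 2; compared
  with the Gaussian integral this costs only a constant factor.\<close>

lemma gPhi_le: "0 \<le> s \<Longrightarrow> gPhi a s \<le> 2 * sqrt (2 / a)"
proof -
  assume s: "0 \<le> s"
  define b where "b = sqrt (a / 2)"
  have b: "b > 0" "b\<^sup>2 = a / 2" using a_pos by (auto simp: b_def)
  have "((\<lambda>x. 1 / (1 + (b * x)\<^sup>2)) has_integral (arctan (b * s) / b - arctan (b * 0) / b)) {0..s}"
    using s b by (intro fundamental_theorem_of_calculus)
      (auto intro!: derivative_eq_intros simp: has_real_derivative_iff_has_vector_derivative[symmetric] inverse_eq_divide)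
  then have I: "integral {0..s} (\<lambda>x. 1 / (1 + (b * x)\<^sup>2)) = arctan (b * s) / b"
    "(\<lambda>x. 1 / (1 + (b * x)\<^sup>2)) integrable_on {0..s}"
    by (auto simp: has_integral_iff)
  have "gphi a x \<le> 1 / (1 + (b * x)\<^sup>2)" for x
  proof -
    have "1 + (b * x)\<^sup>2 \<le> exp ((b * x)\<^sup>2)" by (rule exp_ge_add_one_self)
    moreover have "1 + (b * x)\<^sup>2 > 0" by (simp add: add_pos_nonneg)
    moreover have "gphi a x = 1 / exp ((b * x)\<^sup>2)"
      using b by (simp add: gphi_eq_inverse power_mult_distrib inverse_eq_divide)
    ultimately show ?thesis by (simp add: frac_le)
  qed
  then have "gPhi a s \<le> arctan (b * s) / b"
    unfolding gPhi_def I(1)[symmetric]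
    by (intro integral_le I(2) integrable_continuous_real continuous_gphi) auto
  also have "\<dots> \<le> 2 / b" using arctan_ubound[of "b * s"] pi_less_4 b by (intro divide_right_mono) auto
  also have "2 / b = 2 * sqrt (2 / a)" by (simp add: b_def real_sqrt_divide)
  finally show ?thesis .
qed

text \<open>1/\<phi>(s) = exp (a s^2 / 2) <= exp (q s) on [0, R1] with q = a R1 / 2, a bound that is
  sharp at R1 and can be integrated explicitly. Together with the bound on \<Phi> the integral is at
  most of order exp \<Lambda> / (L sqrt \<Lambda>), and the factor sqrt \<Lambda> exp (- \<Lambda>)
  in the rate c is made to compensate it.\<close>

lemma gfac_integral_half: "\<kappa> * integral {0..R1} (\<lambda>s. gPhi a s / gphi a s) \<le> 1/2"
proof -
  define q where "q = a * R1 / 2"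
  have q: "q > 0" using a_pos R1_pos by (simp add: q_def)
  have "((\<lambda>x. 2 * sqrt (2 / a) * exp (q * x)) has_integral
      (2 * sqrt (2 / a) * exp (q * R1) / q - 2 * sqrt (2 / a) * exp (q * 0) / q)) {0..R1}"
    using R1_pos q by (intro fundamental_theorem_of_calculus)
      (auto intro!: derivative_eq_intros simp: has_real_derivative_iff_has_vector_derivative[symmetric])
  moreover have "2 * sqrt (2 / a) * exp (q * R1) / q - 2 * sqrt (2 / a) * exp (q * 0) / q =
      2 * sqrt (2 / a) * (exp (q * R1) - 1) / q"
    by (simp add: right_diff_distrib diff_divide_distrib)
  ultimately have I: "integral {0..R1} (\<lambda>x. 2 * sqrt (2 / a) * exp (q * x)) = 2 * sqrt (2 / a) * (exp (q * R1) - 1) / q"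
    "(\<lambda>x. 2 * sqrt (2 / a) * exp (q * x)) integrable_on {0..R1}"
    by (auto dest: integral_unique has_integral_integrable)
  have le: "gPhi a s / gphi a s \<le> 2 * sqrt (2 / a) * exp (q * s)" if "s \<in> {0..R1}" for s
  proof -
    have "a * s\<^sup>2 / 2 \<le> q * s"
      using that a_pos by (simp add: q_def power2_eq_square mult_left_mono mult_right_mono)
    then have "exp (a * s\<^sup>2 / 2) \<le> exp (q * s)" by simp
    moreover have "gPhi a s / gphi a s = gPhi a s * exp (a * s\<^sup>2 / 2)"
      unfolding gphi_eq_inverse by (simp only: divide_inverse[of "gPhi a s"] inverse_inverse_eq)
    ultimately show ?thesis using gPhi_le[of s] that a_pos
      by (simp only:) (intro mult_mono, auto)
  qed
  have "integral {0..R1} (\<lambda>s. gPhi a s / gphi a s) \<le> 2 * sqrt (2 / a) * (exp (q * R1) - 1) / q"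
  proof (cases "(\<lambda>s. gPhi a s / gphi a s) integrable_on {0..R1}")
    case True
    then show ?thesis unfolding I(1)[symmetric] using le by (intro integral_le I(2)) auto
  next
    \<comment> \<open>The integral of a non-integrable function is 0 by convention, so the bound is
      immediate here.\<close>
    case False
    then show ?thesis using a_pos q R1_pos by (simp add: not_integrable_integral)
  qed
  also have "\<dots> \<le> 2 * sqrt (2 / a) * exp (\<Lambda> + 5/4) / q"
  proof (intro divide_right_mono mult_left_mono)
    have "q * R1 = \<Lambda> + 1 + E" using a_R1 by (simp add: q_def power2_eq_square)
    then have "exp (q * R1) \<le> exp (\<Lambda> + 5/4)" using E_le by simp
    then show "exp (q * R1) - 1 \<le> exp (\<Lambda> + 5/4)" by linarith
  qed (use a_pos q in auto)
  finally have 1: "integral {0..R1} (\<lambda>s. gPhi a s / gphi a s) \<le> 2 * sqrt (2 / a) * exp (\<Lambda> + 5/4) / q" .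
  have 2: "sqrt (2 / a) / q \<le> 8 / (L * sqrt \<Lambda>)"
  proof -
    have "sqrt \<Lambda> \<le> sqrt (a / 2) * R1"
    proof (rule real_le_lsqrt[THEN order_trans])
      show "\<Lambda> \<le> (sqrt (a / 2) * R1)\<^sup>2"
        using a_R1 E_nonneg a_pos by (simp add: power_mult_distrib)
    qed (use \<Lambda>_pos a_pos R1_pos in auto)
    then have "L / 4 * sqrt \<Lambda> \<le> a * (sqrt (a / 2) * R1)"
      using a_ge a_pos \<Lambda>_pos by (intro mult_mono) auto
    moreover have "sqrt (2 / a) / q = 2 / (a * (sqrt (a / 2) * R1))"
      using a_pos R1_pos by (simp add: q_def real_sqrt_divide field_simps)
    ultimately have "sqrt (2 / a) / q \<le> 2 / (L / 4 * sqrt \<Lambda>)"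
      using L \<Lambda>_pos a_pos R1_pos by (simp only:) (intro divide_left_mono mult_pos_pos, auto)
    then show ?thesis by (simp add: field_simps)
  qed
  have 3: "\<kappa> \<le> 9/4 * (sqrt \<Lambda> * exp (-\<Lambda>) * L / 384)"
  proof -
    have "c * \<gamma> / u \<le> (\<gamma> / 384 * (sqrt \<Lambda> * exp (-\<Lambda>) * w)) * \<gamma> / u"
      using c_le2 \<gamma> u by (intro divide_right_mono mult_right_mono) auto
    also have "\<dots> = sqrt \<Lambda> * exp (-\<Lambda>) * L / 384"
      using \<gamma> u by (simp add: w_def field_simps power2_eq_square)
    finally have "9/4 * (c * \<gamma> / u) \<le> 9/4 * (sqrt \<Lambda> * exp (-\<Lambda>) * L / 384)" by (rule mult_left_mono) simp
    moreover have "\<kappa> = 9/4 * (c * \<gamma> / u)" by (simp add: \<kappa>_def)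
    ultimately show ?thesis by (simp only:)
  qed
  have "\<kappa> * integral {0..R1} (\<lambda>s. gPhi a s / gphi a s) \<le> \<kappa> * (2 * sqrt (2 / a) * exp (\<Lambda> + 5/4) / q)"
    using 1 \<kappa>_pos by (intro mult_left_mono) auto
  also have "\<dots> = \<kappa> * 2 * exp (\<Lambda> + 5/4) * (sqrt (2 / a) / q)" by simp
  also have "\<dots> \<le> (9/4 * (sqrt \<Lambda> * exp (-\<Lambda>) * L / 384)) * 2 * exp (\<Lambda> + 5/4) * (8 / (L * sqrt \<Lambda>))"
    using 2 3 a_pos q \<kappa>_pos L \<Lambda>_pos by (intro mult_mono) auto
  also have "\<dots> = 3/32 * exp (5/4)"
    unfolding exp_add exp_minus using L \<Lambda>_pos by simp
  also have "\<dots> \<le> 1/2" using exp_5_4_le by simp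
  finally show ?thesis .
qed

sublocale concave_profile a \<kappa> R1
  by standard (use a_pos \<kappa>_pos R1_pos gfac_integral_half in auto)

lemma gphi_upper: "gphi a r \<le> exp (- L * r\<^sup>2 / 8)"
proof -
  have "L / 4 * r\<^sup>2 \<le> a * r\<^sup>2" using a_ge by (intro mult_right_mono) auto
  then show ?thesis by (simp add: gphi_def)
qed

text \<open>The exponents differ by (a - L/4) r^2 / 2, which at R1 is 1 + E <= 2: the 1 comes from
  the factor 1 + 1/\<Lambda>, the rest from \<epsilon>.\<close>

lemma gphi_lower:
  assumes "0 \<le> r" "r \<le> R1"
  shows "exp (-2) * exp (- L * r\<^sup>2 / 8) \<le> gphi a r"
proof -
  have "r\<^sup>2 \<le> R1\<^sup>2" using assms by (intro power_mono)
  then have "(a - L / 4) * r\<^sup>2 \<le> (a - L / 4) * R1\<^sup>2"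
    using a_ge by (intro mult_left_mono) auto
  moreover have "(a - L / 4) * R1\<^sup>2 / 2 = 1 + E" using a_R1 by (simp add: \<Lambda>_def algebra_simps)
  ultimately have "(a - L / 4) * r\<^sup>2 / 2 \<le> 2" using E_le by linarith
  then have "- 2 + (- L * r\<^sup>2 / 8) \<le> - a * r\<^sup>2 / 2" by (simp add: algebra_simps)
  then show ?thesis unfolding gphi_def exp_add[symmetric] by simp
qed

text \<open>Up to r^2 = R1^2 / 2 the exponent of \<phi> is at most half its value at R1, so f' loses
  little more than exp (- \<Lambda>/2) while c carries exp (- \<Lambda>); the difference dominates
  the factor sqrt \<Lambda> (1 + \<Lambda>). The left side has 9c because the Lyapunov part may grow
  at rate 8c.\<close>

lemma inner_contraction:
  assumes r: "0 \<le> r" "r\<^sup>2 \<le> R1\<^sup>2 / 2"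
  shows "9 * c * f r \<le> \<gamma> / (1 + \<Lambda>) * r * f' r"
proof -
  have rR: "r \<le> R1"
  proof (rule power2_le_imp_le)
    show "r\<^sup>2 \<le> R1\<^sup>2" using r(2) zero_le_power2[of R1] by linarith
  qed (use R1_pos in simp)
  have fr: "f r \<le> r" using f_le_gPhi[OF r(1) rR] gPhi_bounds(2)[OF r(1)] by simp
  have "a * r\<^sup>2 / 2 \<le> (\<Lambda> + 1 + E) / 2"
    using mult_left_mono[OF r(2), of a] a_pos a_R1 by simp
  then have "a * r\<^sup>2 / 2 \<le> \<Lambda> / 2 + 5/8" using E_le by simp
  then have "exp (- (\<Lambda> / 2 + 5/8)) \<le> gphi a r" by (simp add: gphi_def)
  then have f': "exp (- (\<Lambda> / 2 + 5/8)) / 2 \<le> f' r" using f'_bounds(1)[OF r(1) rR] by linarith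
  have key: "9 * c \<le> \<gamma> / (1 + \<Lambda>) * (exp (- (\<Lambda> / 2 + 5/8)) / 2)"
  proof -
    have "sqrt \<Lambda> * (1 + \<Lambda>) \<le> (1 + \<Lambda>) / 2 * (1 + \<Lambda>)"
      using \<Lambda>_pos by (intro mult_right_mono sqrt_le_half) auto
    \<comment> \<open>64/7 = 64/(3 * 7/3) anticipates exp (5/8) <= 7/3; 64/3 is the value for which
      9/384 * 64/3 = 1/2, the factor lost in f' >= \<phi>/2.\<close>
    also have "\<dots> \<le> 64 / 7 * (1 + \<Lambda> / 2 + (\<Lambda> / 2)\<^sup>2 / 2)"
    proof -
      have "0 \<le> 121 / 14 + 25 / 7 * \<Lambda> + 9 / 14 * (\<Lambda> * \<Lambda>)" using \<Lambda>_pos by simp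
      then show ?thesis by (simp add: power2_eq_square algebra_simps)
    qed
    also have "\<dots> \<le> 64 / 7 * exp (\<Lambda> / 2)"
      using \<Lambda>_pos by (intro mult_left_mono exp_quadratic_lower) auto
    also have "\<dots> \<le> (64 / (3 * exp (5/8))) * exp (\<Lambda> / 2)"
      using exp_5_8_le by (intro mult_right_mono) (auto simp: field_simps)
    finally have "sqrt \<Lambda> * (1 + \<Lambda>) \<le> 64 / (3 * exp (5/8)) * exp (\<Lambda> / 2)" .
    then have "9 * (\<gamma> / 384 * exp (-\<Lambda>)) * (sqrt \<Lambda> * (1 + \<Lambda>)) \<le>
        9 * (\<gamma> / 384 * exp (-\<Lambda>)) * (64 / (3 * exp (5/8)) * exp (\<Lambda> / 2))"
      using \<gamma> by (intro mult_left_mono) auto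
    also have "\<dots> = \<gamma> * (exp (-\<Lambda>) * exp (\<Lambda> / 2) / exp (5/8) / 2)" by simp
    also have "exp (-\<Lambda>) * exp (\<Lambda> / 2) / exp (5/8) = exp (- (\<Lambda> / 2 + 5/8))"
      by (simp flip: exp_add exp_diff)
    finally have 1: "9 * (\<gamma> / 384 * exp (-\<Lambda>)) * (sqrt \<Lambda> * (1 + \<Lambda>)) \<le> \<gamma> * (exp (- (\<Lambda> / 2 + 5/8)) / 2)" .
    have "9 * c * (1 + \<Lambda>) \<le> 9 * (\<gamma> / 384 * (sqrt \<Lambda> * exp (-\<Lambda>))) * (1 + \<Lambda>)"
      using c_le3 \<Lambda>_pos by (intro mult_right_mono mult_left_mono) auto
    also have "\<dots> = 9 * (\<gamma> / 384 * exp (-\<Lambda>)) * (sqrt \<Lambda> * (1 + \<Lambda>))" by (simp only: mult_ac)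
    finally have "9 * c * (1 + \<Lambda>) \<le> \<gamma> * (exp (- (\<Lambda> / 2 + 5/8)) / 2)" using 1 by linarith
    then show ?thesis using \<Lambda>_pos by (simp add: field_simps)
  qed
  have "9 * c * f r \<le> 9 * c * r" using fr c_pos by (intro mult_left_mono) auto
  also have "\<dots> \<le> \<gamma> / (1 + \<Lambda>) * (exp (- (\<Lambda> / 2 + 5/8)) / 2) * r"
    using key r by (intro mult_right_mono) auto
  also have "\<dots> \<le> \<gamma> / (1 + \<Lambda>) * f' r * r"
    using f' r \<gamma> \<Lambda>_pos by (intro mult_right_mono mult_left_mono) auto
  finally show ?thesis by (simp add: mult_ac)
qed

end

section \<open>The Lyapunov function along an Euler step\<close>

text \<open>An exact expansion in s, to be used with v for \<gamma>^-1 times the velocity, w =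
  u/\<gamma> and \<tau> = \<gamma>^-1 sqrt (2 \<gamma> u). The coefficient of s is the martingale
  part, that of s^2 the drift including the second-order term 2 \<tau>^2 |N|^2, and the rest is
  remainder.\<close>

lemma quadratic_step_identity:
  fixes x v g N :: "'a::real_inner" and s \<gamma> lam w \<tau> :: real
  shows "(norm ((x + (s\<^sup>2 * \<gamma>) *\<^sub>R v) + (v - s\<^sup>2 *\<^sub>R (\<gamma> *\<^sub>R v + w *\<^sub>R g) + (s * \<tau>) *\<^sub>R N)))\<^sup>2
      + (norm (v - s\<^sup>2 *\<^sub>R (\<gamma> *\<^sub>R v + w *\<^sub>R g) + (s * \<tau>) *\<^sub>R N))\<^sup>2
      - lam * (norm (x + (s\<^sup>2 * \<gamma>) *\<^sub>R v))\<^sup>2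
    = (norm (x + v))\<^sup>2 + (norm v)\<^sup>2 - lam * (norm x)\<^sup>2
      + s * (2 * \<tau> * ((x + 2 *\<^sub>R v) \<bullet> N))
      + s\<^sup>2 * (- 2 * w * ((x + v) \<bullet> g) - 2 * (v \<bullet> (\<gamma> *\<^sub>R v + w *\<^sub>R g)) + 2 * \<tau>\<^sup>2 * (norm N)\<^sup>2 - 2 * lam * \<gamma> * (x \<bullet> v))
      - s ^ 3 * (2 * \<tau> * (N \<bullet> (\<gamma> *\<^sub>R v + (2 * w) *\<^sub>R g)))
      + s ^ 4 * (w\<^sup>2 * (norm g)\<^sup>2 + (norm (\<gamma> *\<^sub>R v + w *\<^sub>R g))\<^sup>2 - lam * \<gamma>\<^sup>2 * (norm v)\<^sup>2)"
  unfolding power2_norm_eq_inner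
  by (simp add: inner_simps inner_commute[of v x] inner_commute[of g x] inner_commute[of g v]
      inner_commute[of N x] inner_commute[of N v] inner_commute[of N g])
    (simp add: algebra_simps power2_eq_square power3_eq_cube power4_eq_xxxx)

lemma young_product: "x * y \<le> (x\<^sup>2 + y\<^sup>2) / 2" for x y :: real
  using sum_squares_bound[of x y] by simp

locale langevin = contraction_constants "real CARD('n)" A u \<gamma> L lam \<alpha>
  for A u \<gamma> L lam \<alpha> :: real +
  fixes U :: "real^('n::finite) \<Rightarrow> real" and gradU :: "real^'n \<Rightarrow> real^'n"
  assumes U_C1: "(U has_derivative (\<lambda>h. gradU x \<bullet> h)) (at x)"
    and U_nonneg: "U x \<ge> 0"
    and grad_Lip: "norm (gradU x - gradU y) \<le> L * norm (x - y)"
    and drift: "x \<bullet> gradU x / 2 \<ge> lam * (U x + \<gamma>^2 / u * (norm x)^2 / 4) - A"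
begin

lemma grad_growth: "norm (gradU x) \<le> norm (gradU 0) + L * norm x"
  using grad_Lip[of x 0] norm_triangle_ineq2[of "gradU x" "gradU 0"] by simp

lemma continuous_gradU: "continuous_on S gradU"
proof -
  have "L-lipschitz_on UNIV gradU"
    using grad_Lip L by (intro lipschitz_onI) (auto simp: dist_norm)
  then show ?thesis by (rule continuous_on_subset[OF lipschitz_on_continuous_on]) simp
qed

lemma continuous_U: "continuous_on S U"
  using U_C1 by (intro continuous_at_imp_continuous_on ballI has_derivative_continuous)

text \<open>The mean value theorem along the segment suffices; it gives the constant L instead of
  the sharp L/2, which only enters remainders and growth bounds.\<close>

lemma U_step: "U (x + y) \<le> U x + gradU x \<bullet> y + L * (norm y)\<^sup>2"
proof -
  have "((\<lambda>t. U (x + t *\<^sub>R y)) has_real_derivative gradU (x + t *\<^sub>R y) \<bullet> y) (at t)" for t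
  proof -
    have "((\<lambda>t. U (x + t *\<^sub>R y)) has_derivative (\<lambda>h. gradU (x + t *\<^sub>R y) \<bullet> (h *\<^sub>R y))) (at t)"
      by (rule has_derivative_compose[OF _ U_C1]) (auto intro!: derivative_eq_intros)
    then show ?thesis by (simp add: has_field_derivative_def mult.commute[of _ "_ \<bullet> _"])
  qed
  then obtain t where t: "0 < t" "t < 1" "U (x + 1 *\<^sub>R y) - U (x + 0 *\<^sub>R y) = (1 - 0) * (gradU (x + t *\<^sub>R y) \<bullet> y)"
    using MVT2[of 0 1 "\<lambda>t. U (x + t *\<^sub>R y)" "\<lambda>t. gradU (x + t *\<^sub>R y) \<bullet> y"] by auto
  have "gradU (x + t *\<^sub>R y) \<bullet> y - gradU x \<bullet> y = (gradU (x + t *\<^sub>R y) - gradU x) \<bullet> y"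
    by (simp add: inner_diff_left)
  also have "\<dots> \<le> norm (gradU (x + t *\<^sub>R y) - gradU x) * norm y" by (rule norm_cauchy_schwarz)
  also have "\<dots> \<le> (L * norm (t *\<^sub>R y)) * norm y"
    using grad_Lip[of "x + t *\<^sub>R y" x] by (intro mult_right_mono) auto
  also have "\<dots> \<le> (L * norm y) * norm y"
    using t L by (intro mult_right_mono mult_left_mono) (auto simp: mult_left_le_one_le)
  finally show ?thesis using t(3) by (simp add: power2_eq_square)
qed

abbreviation "H \<equiv> lyapH U u \<gamma> lam"

text \<open>The parameter s is the square root of the step length, so that a standard Gaussian N
  enters with factor s and the drift with s^2.\<close>

definition euler :: "real \<Rightarrow> 'n state \<Rightarrow> real^'n \<Rightarrow> 'n state" where
  "euler s z N = (fst z + s\<^sup>2 *\<^sub>R snd z,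
    snd z - s\<^sup>2 *\<^sub>R (\<gamma> *\<^sub>R snd z + u *\<^sub>R gradU (fst z)) + (s * sqrt (2 * \<gamma> * u)) *\<^sub>R N)"

text \<open>This is sqrt (2 \<gamma> u) times the velocity gradient of \<open>H\<close>, the
  coefficient of the noise in its increment.\<close>

definition noise_coeff :: "'n state \<Rightarrow> real^'n" where
  "noise_coeff z = sqrt (2 * \<gamma> / u) *\<^sub>R ((\<gamma> / 2) *\<^sub>R fst z + snd z)"

lemma norm_state: "(norm z)\<^sup>2 = (norm (fst z))\<^sup>2 + (norm (snd z))\<^sup>2" for z :: "'n state"
  by (simp add: norm_prod_def)

lemma norm_fst_snd_le: "norm (fst z) \<le> norm z" "norm (snd z) \<le> norm z" for z :: "'n state"
  by (auto simp: norm_prod_def intro!: real_le_rsqrt)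

lemma H_expand:
  "H z = U (fst z) + \<gamma>\<^sup>2 / (4 * u) * ((norm (fst z + inverse \<gamma> *\<^sub>R snd z))\<^sup>2 + (norm (inverse \<gamma> *\<^sub>R snd z))\<^sup>2
      - lam * (norm (fst z))\<^sup>2)"
  by (simp add: lyapH_def)

text \<open>Reverse triangle inequality. It reduces the quadratic part of \<open>H\<close>, with y =
  x + \<gamma>^-1 v, to a form in the two numbers |x| and |y|, which can be treated by completing
  squares.\<close>

lemma quad_lower:
  fixes x y :: "real^'n"
  shows "(norm y - norm x)\<^sup>2 + (norm y)\<^sup>2 - lam * (norm x)\<^sup>2 \<le>
    (norm (x + (y - x)))\<^sup>2 + (norm (y - x))\<^sup>2 - lam * (norm x)\<^sup>2"
proof -
  have "\<bar>norm y - norm x\<bar> \<le> norm (y - x)" by (rule norm_triangle_ineq3)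
  then have "(norm y - norm x)\<^sup>2 \<le> (norm (y - x))\<^sup>2" by (metis abs_ge_zero power2_abs power_mono)
  then show ?thesis by simp
qed

lemma H_nonneg: "H z \<ge> 0"
proof -
  let ?x = "norm (fst z)" and ?y = "norm (fst z + inverse \<gamma> *\<^sub>R snd z)"
  have "lam * ?x\<^sup>2 \<le> 1/4 * ?x\<^sup>2" using lam by (intro mult_right_mono) auto
  moreover have "1/4 * ?x\<^sup>2 \<le> (?y - ?x)\<^sup>2 + ?y\<^sup>2"
  proof -
    have "0 \<le> 2 * (?y - ?x / 2)\<^sup>2 + 1/4 * ?x\<^sup>2" by simp
    also have "\<dots> = (?y - ?x)\<^sup>2 + ?y\<^sup>2 - 1/4 * ?x\<^sup>2" by (simp add: power2_eq_square algebra_simps)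
    finally show ?thesis by simp
  qed
  ultimately have "0 \<le> (norm (fst z + inverse \<gamma> *\<^sub>R snd z))\<^sup>2 + (norm (inverse \<gamma> *\<^sub>R snd z))\<^sup>2 - lam * (norm (fst z))\<^sup>2"
    using quad_lower[of "fst z + inverse \<gamma> *\<^sub>R snd z" "fst z"] by simp
  then show ?thesis unfolding H_expand using U_nonneg[of "fst z"] u by simp
qed

lemma grad_growth_sq:
  obtains K where "K > 0" "\<And>z :: 'n state. norm (gradU (fst z)) \<le> K * (1 + norm z)"
proof
  show "norm (gradU 0) + L > 0" using L by (simp add: add_nonneg_pos)
  show "norm (gradU (fst z)) \<le> (norm (gradU 0) + L) * (1 + norm z)" for z :: "'n state"
  proof -
    have "L * norm (fst z) \<le> L * norm z" using L norm_fst_snd_le(1)[of z] by (intro mult_left_mono) auto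
    moreover have "(norm (gradU 0) + L) * (1 + norm z) =
        norm (gradU 0) + L + norm (gradU 0) * norm z + L * norm z" by (simp add: algebra_simps)
    moreover have "0 \<le> norm (gradU 0) * norm z" by simp
    ultimately show ?thesis using grad_growth[of "fst z"] L by linarith
  qed
qed

lemma one_plus_norm_square: "(1 + t)\<^sup>2 \<le> 2 * (1 + t\<^sup>2)" for t :: real
  using sum_squares_bound[of 1 t] by (simp add: power2_sum)

lemma H_growth:
  obtains K where "K > 0" "\<And>z. H z \<le> K * (1 + (norm z)\<^sup>2)"
proof -
  define K where "K = U 0 + 2 * (norm (gradU 0) + L) + \<gamma>\<^sup>2 / (4 * u) * (3 * (1 + inverse \<gamma>) ^ 2)"
  have K: "K > 0"
  proof -
    have "1 + inverse \<gamma> > 0" using \<gamma> by (simp add: add_pos_pos)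
    then have "0 < \<gamma>\<^sup>2 / (4 * u) * (3 * (1 + inverse \<gamma>) ^ 2)" using u \<gamma> by simp
    then show ?thesis unfolding K_def using U_nonneg[of 0] L by (intro add_nonneg_pos add_nonneg_nonneg) auto
  qed
  have "H z \<le> K * (1 + (norm z)\<^sup>2)" for z
  proof -
    let ?n = "norm z"
    have 1: "U (fst z) \<le> U 0 + norm (gradU 0) * ?n + L * ?n\<^sup>2"
    proof -
      have "U (fst z) \<le> U 0 + gradU 0 \<bullet> fst z + L * (norm (fst z))\<^sup>2" using U_step[of 0 "fst z"] by simp
      moreover have "gradU 0 \<bullet> fst z \<le> norm (gradU 0) * ?n"
        using norm_cauchy_schwarz[of "gradU 0" "fst z"] mult_left_mono[OF norm_fst_snd_le(1)[of z], of "norm (gradU 0)"] by simp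
      moreover have "L * (norm (fst z))\<^sup>2 \<le> L * ?n\<^sup>2"
        using norm_fst_snd_le[of z] L by (intro mult_left_mono power_mono) auto
      ultimately show ?thesis by linarith
    qed
    have n: "?n \<le> 1 + ?n\<^sup>2" using young_product[of 1 ?n] by simp (smt (verit) zero_le_power2)
    have "norm (gradU 0) * ?n \<le> norm (gradU 0) * (1 + ?n\<^sup>2)" using n by (intro mult_left_mono) auto
    moreover have "U 0 \<le> U 0 * (1 + ?n\<^sup>2)" using U_nonneg[of 0] by (simp add: algebra_simps)
    moreover have "L * ?n\<^sup>2 \<le> L * (1 + ?n\<^sup>2)" using L by (intro mult_left_mono) auto
    ultimately have 2: "U (fst z) \<le> U 0 * (1 + ?n\<^sup>2) + norm (gradU 0) * (1 + ?n\<^sup>2) + L * (1 + ?n\<^sup>2)"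
      using 1 by linarith
    have U: "U (fst z) \<le> (U 0 + 2 * (norm (gradU 0) + L)) * (1 + ?n\<^sup>2)"
    proof -
      have "(U 0 + 2 * (norm (gradU 0) + L)) * (1 + ?n\<^sup>2) =
          U 0 * (1 + ?n\<^sup>2) + 2 * (norm (gradU 0) * (1 + ?n\<^sup>2)) + 2 * (L * (1 + ?n\<^sup>2))"
        by (simp add: algebra_simps)
      moreover have "0 \<le> norm (gradU 0) * (1 + ?n\<^sup>2)" "0 \<le> L * (1 + ?n\<^sup>2)" using L by simp_all
      ultimately show ?thesis using 2 by linarith
    qed
    have a1: "norm (fst z + inverse \<gamma> *\<^sub>R snd z) \<le> (1 + inverse \<gamma>) * ?n"
    proof -
      have "norm (fst z + inverse \<gamma> *\<^sub>R snd z) \<le> norm (fst z) + inverse \<gamma> * norm (snd z)"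
        using norm_triangle_ineq[of "fst z" "inverse \<gamma> *\<^sub>R snd z"] \<gamma> by simp
      also have "\<dots> \<le> ?n + inverse \<gamma> * ?n"
        using norm_fst_snd_le[of z] \<gamma> by (intro add_mono mult_left_mono) auto
      finally show ?thesis by (simp add: algebra_simps)
    qed
    have a2: "norm (inverse \<gamma> *\<^sub>R snd z) \<le> (1 + inverse \<gamma>) * ?n"
    proof -
      have "norm (inverse \<gamma> *\<^sub>R snd z) \<le> inverse \<gamma> * ?n"
        using norm_fst_snd_le[of z] \<gamma> by (simp add: mult_left_mono)
      then show ?thesis by (simp add: algebra_simps) (smt (verit) norm_ge_zero)
    qed
    have "(norm (fst z + inverse \<gamma> *\<^sub>R snd z))\<^sup>2 + (norm (inverse \<gamma> *\<^sub>R snd z))\<^sup>2 - lam * (norm (fst z))\<^sup>2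
        \<le> ((1 + inverse \<gamma>) * ?n)\<^sup>2 + ((1 + inverse \<gamma>) * ?n)\<^sup>2 - 0"
      using a1 a2 lam by (intro diff_mono add_mono power_mono) auto
    also have "\<dots> \<le> 3 * (1 + inverse \<gamma>)\<^sup>2 * (1 + ?n\<^sup>2)"
    proof -
      have q: "(B * t)\<^sup>2 + (B * t)\<^sup>2 - 0 = 2 * (B\<^sup>2 * t\<^sup>2)" "3 * B\<^sup>2 * (1 + t\<^sup>2) = 3 * B\<^sup>2 + 3 * (B\<^sup>2 * t\<^sup>2)"
        "0 \<le> B\<^sup>2" "0 \<le> B\<^sup>2 * t\<^sup>2" for B t :: real
        by (simp_all add: power_mult_distrib algebra_simps)
      show ?thesis
        using q(1,2,4)[of "1 + inverse \<gamma>" ?n] q(3)[of "1 + inverse \<gamma>"] by linarith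
    qed
    finally have "\<gamma>\<^sup>2 / (4 * u) * ((norm (fst z + inverse \<gamma> *\<^sub>R snd z))\<^sup>2 + (norm (inverse \<gamma> *\<^sub>R snd z))\<^sup>2 - lam * (norm (fst z))\<^sup>2)
        \<le> \<gamma>\<^sup>2 / (4 * u) * (3 * (1 + inverse \<gamma>)\<^sup>2 * (1 + ?n\<^sup>2))"
      using u by (intro mult_left_mono) auto
    moreover have "K * (1 + ?n\<^sup>2) = (U 0 + 2 * (norm (gradU 0) + L)) * (1 + ?n\<^sup>2) +
        \<gamma>\<^sup>2 / (4 * u) * (3 * (1 + inverse \<gamma>)\<^sup>2 * (1 + ?n\<^sup>2))"
      unfolding K_def by (simp only: distrib_right mult.assoc)
    ultimately show ?thesis using U unfolding H_expand by linarith
  qed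
  then show ?thesis using that K by blast
qed

text \<open>The left side is the first-order part of the generator applied to \<open>H\<close>; the
  second-order part is kept apart as |N|^2. The terms with gradU . v cancel, the drift assumption is
  applied to x . gradU x, and the slack is a nonnegative combination of |x|^2 and |v|^2.\<close>

lemma H_drift:
  defines "k \<equiv> inverse \<gamma>"
  shows "gradU (fst z) \<bullet> snd z + \<gamma>\<^sup>2 / (4 * u) *
      (- 2 * (u * k) * ((fst z + k *\<^sub>R snd z) \<bullet> gradU (fst z))
       - 2 * ((k *\<^sub>R snd z) \<bullet> (\<gamma> *\<^sub>R (k *\<^sub>R snd z) + (u * k) *\<^sub>R gradU (fst z)))
       - 2 * lam * \<gamma> * (fst z \<bullet> (k *\<^sub>R snd z)))
    \<le> \<gamma> * (A - lam * H z)"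
proof -
  obtain x v where z: "z = (x, v)" by (cases z)
  let ?g = "gradU x"
  have k: "k * \<gamma> = 1" "\<gamma> * k = 1" using \<gamma> by (auto simp: k_def)
  have "gradU x \<bullet> v + \<gamma>\<^sup>2 / (4 * u) *
      (- 2 * (u * k) * ((x + k *\<^sub>R v) \<bullet> ?g) - 2 * ((k *\<^sub>R v) \<bullet> (\<gamma> *\<^sub>R (k *\<^sub>R v) + (u * k) *\<^sub>R ?g))
       - 2 * lam * \<gamma> * (x \<bullet> (k *\<^sub>R v)))
    = - \<gamma> * (x \<bullet> ?g / 2) - \<gamma> * (norm v)\<^sup>2 / (2 * u) - lam * \<gamma>\<^sup>2 / (2 * u) * (x \<bullet> v)"
    using u \<gamma> unfolding k_def power2_norm_eq_inner
    by (simp add: inner_simps inner_commute[of v ?g] field_simps power2_eq_square)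
  also have "\<dots> \<le> - \<gamma> * (lam * (U x + \<gamma>\<^sup>2 / u * (norm x)\<^sup>2 / 4) - A)
      - \<gamma> * (norm v)\<^sup>2 / (2 * u) - lam * \<gamma>\<^sup>2 / (2 * u) * (x \<bullet> v)"
    using mult_left_mono[OF drift[of x], of \<gamma>] \<gamma> by simp
  also have "\<dots> \<le> \<gamma> * (A - lam * H z)"
  proof -
    have H: "H z = U x + \<gamma>\<^sup>2 / (4 * u) * ((1 - lam) * (norm x)\<^sup>2 + 2 / \<gamma> * (x \<bullet> v) + 2 / \<gamma>\<^sup>2 * (norm v)\<^sup>2)"
      unfolding H_expand z power2_norm_eq_inner
      by (simp add: inner_simps inner_commute[of v x] inverse_eq_divide algebra_simps power2_eq_square)
    have "\<gamma> * (A - lam * H z) - (- \<gamma> * (lam * (U x + \<gamma>\<^sup>2 / u * (norm x)\<^sup>2 / 4) - A)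
      - \<gamma> * (norm v)\<^sup>2 / (2 * u) - lam * \<gamma>\<^sup>2 / (2 * u) * (x \<bullet> v))
      = \<gamma> * lam\<^sup>2 * \<gamma>\<^sup>2 / (4 * u) * (norm x)\<^sup>2 + \<gamma> * (1 - lam) / (2 * u) * (norm v)\<^sup>2"
      unfolding H using u \<gamma> by (simp add: field_simps power2_eq_square)
    moreover have "\<dots> \<ge> 0" using u \<gamma> lam by (intro add_nonneg_nonneg mult_nonneg_nonneg) auto
    ultimately show ?thesis by linarith
  qed
  finally show ?thesis by (simp add: z)
qed

text \<open>A pathwise substitute for Ito's formula: the bound holds for every value of N, and |N|^2
  stays visible because its mean, the dimension d, turns the drift into \<gamma> (d + A - lam H).
  The remainder grows only quadratically in z, so that \<open>size2\<close> can absorb it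
  later.\<close>

lemma H_step:
  obtains K where "K > 0"
    "\<And>s z N. 0 < s \<Longrightarrow> s \<le> 1 \<Longrightarrow>
      H (euler s z N) \<le> H z + s * (noise_coeff z \<bullet> N) + s\<^sup>2 * (\<gamma> * (A - lam * H z + (norm N)\<^sup>2))
        + K * s ^ 3 * ((1 + (norm z)\<^sup>2) * (1 + norm N)\<^sup>2)"
proof -
  obtain Kg where Kg: "Kg > 0" "\<And>z :: 'n state. norm (gradU (fst z)) \<le> Kg * (1 + norm z)"
    using grad_growth_sq by blast
  define k where "k = inverse \<gamma>"
  define \<tau> where "\<tau> = k * sqrt (2 * \<gamma> * u)"
  have k: "k > 0" "k * \<gamma> = 1" "\<gamma> * k = 1" using \<gamma> by (auto simp: k_def)
  have \<tau>: "\<tau> > 0" using k \<gamma> u by (simp add: \<tau>_def)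
  have \<tau>2: "\<tau>\<^sup>2 = 2 * u / \<gamma>"
    using \<gamma> u by (simp add: \<tau>_def power_mult_distrib k_def power_inverse) (simp add: field_simps power2_eq_square)
  define C where "C = 1 + 2 * u * k * Kg"
  have C: "C > 0" using u k Kg by (simp add: C_def add_pos_pos)
  define K where "K = \<gamma>\<^sup>2 / (4 * u) * (4 * \<tau> * C + 4 * C\<^sup>2) + L"
  have K: "K > 0" using u \<gamma> C \<tau> L by (simp add: K_def add_pos_pos)
  have "H (euler s z N) \<le> H z + s * (noise_coeff z \<bullet> N) + s\<^sup>2 * (\<gamma> * (A - lam * H z + (norm N)\<^sup>2))
        + K * s ^ 3 * ((1 + (norm z)\<^sup>2) * (1 + norm N)\<^sup>2)" if s: "0 < s" "s \<le> 1" for s z N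
  proof -
    obtain x v where z: "z = (x, v)" by (cases z)
    define g where "g = gradU x"
    define q where "q = k *\<^sub>R v"
    have v: "v = \<gamma> *\<^sub>R q" using k by (simp add: q_def)
    let ?y = "1 + norm N" and ?n = "norm z"
    define q1 where "q1 = q - s\<^sup>2 *\<^sub>R (\<gamma> *\<^sub>R q + (u * k) *\<^sub>R g) + (s * \<tau>) *\<^sub>R N"
    define x1 where "x1 = x + (s\<^sup>2 * \<gamma>) *\<^sub>R q"
    have e: "fst (euler s z N) = x1" "inverse \<gamma> *\<^sub>R snd (euler s z N) = q1"
      using k by (auto simp: euler_def z x1_def q1_def v g_def \<tau>_def k_def[symmetric] algebra_simps)
    have Hz: "H z = U x + \<gamma>\<^sup>2 / (4 * u) * ((norm (x + q))\<^sup>2 + (norm q)\<^sup>2 - lam * (norm x)\<^sup>2)"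
      by (simp add: H_expand z q_def k_def)
    have He: "H (euler s z N) = U x1 + \<gamma>\<^sup>2 / (4 * u) * ((norm (x1 + q1))\<^sup>2 + (norm q1)\<^sup>2 - lam * (norm x1)\<^sup>2)"
      unfolding H_expand e ..
    define R3 where "R3 = 2 * \<tau> * (N \<bullet> (\<gamma> *\<^sub>R q + (2 * (u * k)) *\<^sub>R g))"
    define R4 where "R4 = (u * k)\<^sup>2 * (norm g)\<^sup>2 + (norm (\<gamma> *\<^sub>R q + (u * k) *\<^sub>R g))\<^sup>2 - lam * \<gamma>\<^sup>2 * (norm q)\<^sup>2"
    note id = quadratic_step_identity[of x s \<gamma> q "u * k" g \<tau> N lam, folded q1_def x1_def R3_def R4_def]
    have U1: "U x1 \<le> U x + s\<^sup>2 * (g \<bullet> v) + s ^ 3 * (L * (1 + ?n\<^sup>2))"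
    proof -
      have "U x1 \<le> U x + s\<^sup>2 * (g \<bullet> v) + L * (norm ((s\<^sup>2 * \<gamma>) *\<^sub>R q))\<^sup>2"
        using U_step[of x "(s\<^sup>2 * \<gamma>) *\<^sub>R q"] by (simp add: x1_def g_def v mult_ac)
      moreover have "L * (norm ((s\<^sup>2 * \<gamma>) *\<^sub>R q))\<^sup>2 \<le> s ^ 3 * (L * (1 + ?n\<^sup>2))"
      proof -
        have "(norm ((s\<^sup>2 * \<gamma>) *\<^sub>R q))\<^sup>2 = s ^ 4 * (norm v)\<^sup>2"
          using s by (simp add: v power_mult_distrib)
        also have "\<dots> \<le> s ^ 3 * (1 + ?n\<^sup>2)"
          using s norm_fst_snd_le(2)[of z] unfolding z
          by (intro mult_mono power_decreasing) (auto intro!: add_increasing power_mono)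
        finally show ?thesis using L by simp
      qed
      ultimately show ?thesis by linarith
    qed
    have ng: "norm g \<le> Kg * (1 + ?n)" using Kg(2)[of z] by (simp add: g_def z)
    have nv: "norm v \<le> 1 + ?n" using norm_fst_snd_le(2)[of z] by (simp add: z)
    have nb: "norm (\<gamma> *\<^sub>R q + (2 * (u * k)) *\<^sub>R g) \<le> C * (1 + ?n)"
      "norm (\<gamma> *\<^sub>R q + (u * k) *\<^sub>R g) \<le> C * (1 + ?n)" "u * k * norm g \<le> C * (1 + ?n)"
    proof -
      have uk: "0 \<le> u * k" using u k by simp
      have ukg: "u * k * norm g \<le> u * k * (Kg * (1 + ?n))" using ng uk by (rule mult_left_mono)
      have nn: "0 \<le> u * k * (Kg * (1 + ?n))" using u k Kg(1) by (intro mult_nonneg_nonneg) auto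
      have CC: "C * (1 + ?n) = 1 + ?n + 2 * (u * k * (Kg * (1 + ?n)))" by (simp add: C_def algebra_simps)
      have "norm (\<gamma> *\<^sub>R q + (2 * (u * k)) *\<^sub>R g) \<le> norm v + 2 * (u * k * norm g)"
        using norm_triangle_ineq[of v "(2 * (u * k)) *\<^sub>R g"] uk u k by (simp add: v)
      then show "norm (\<gamma> *\<^sub>R q + (2 * (u * k)) *\<^sub>R g) \<le> C * (1 + ?n)" using ukg nv CC by linarith
      have "norm (\<gamma> *\<^sub>R q + (u * k) *\<^sub>R g) \<le> norm v + u * k * norm g"
        using norm_triangle_ineq[of v "(u * k) *\<^sub>R g"] uk u k by (simp add: v)
      then show "norm (\<gamma> *\<^sub>R q + (u * k) *\<^sub>R g) \<le> C * (1 + ?n)" using ukg nv CC nn by linarith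
      show "u * k * norm g \<le> C * (1 + ?n)" using ukg CC nn norm_ge_zero[of z] by linarith
    qed
    let ?S = "(1 + ?n\<^sup>2) * ?y\<^sup>2"
    have S1: "1 + ?n\<^sup>2 \<le> ?S" by (simp add: power2_eq_square algebra_simps add_nonneg_nonneg)
    have n2: "1 + ?n \<le> 2 * (1 + ?n\<^sup>2)"
      using young_product[of 1 ?n] by simp (smt (verit) zero_le_power2)
    have R3: "- R3 \<le> 4 * \<tau> * C * ?S"
    proof -
      have "\<bar>N \<bullet> (\<gamma> *\<^sub>R q + (2 * (u * k)) *\<^sub>R g)\<bar> \<le> norm N * (C * (1 + ?n))"
        using Cauchy_Schwarz_ineq2[of N] nb(1) by (meson mult_left_mono norm_ge_zero order_trans)
      also have "\<dots> \<le> ?y\<^sup>2 * (C * (2 * (1 + ?n\<^sup>2)))"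
        using n2 C by (intro mult_mono mult_left_mono) (auto simp: power2_eq_square algebra_simps add_nonneg_nonneg)
      finally have "2 * \<tau> * \<bar>N \<bullet> (\<gamma> *\<^sub>R q + (2 * (u * k)) *\<^sub>R g)\<bar> \<le> 2 * \<tau> * (?y\<^sup>2 * (C * (2 * (1 + ?n\<^sup>2))))"
        using \<tau> by (intro mult_left_mono) auto
      moreover have "- R3 \<le> 2 * \<tau> * \<bar>N \<bullet> (\<gamma> *\<^sub>R q + (2 * (u * k)) *\<^sub>R g)\<bar>"
        using \<tau> by (simp add: R3_def abs_if mult_less_0_iff)
      moreover have "2 * \<tau> * (?y\<^sup>2 * (C * (2 * (1 + ?n\<^sup>2)))) = 4 * \<tau> * C * ?S" by simp
      ultimately show ?thesis by linarith
    qed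
    have R4: "R4 \<le> 4 * C\<^sup>2 * ?S"
    proof -
      have "R4 \<le> (C * (1 + ?n))\<^sup>2 + (C * (1 + ?n))\<^sup>2 - 0"
        unfolding R4_def power_mult_distrib[symmetric, of "u * k"]
        using nb u k Kg lam by (intro diff_mono add_mono power_mono) auto
      also have "\<dots> = 2 * C\<^sup>2 * (1 + ?n)\<^sup>2" by (simp add: power_mult_distrib)
      also have "\<dots> \<le> 2 * C\<^sup>2 * (2 * (1 + ?n\<^sup>2))"
        by (intro mult_left_mono one_plus_norm_square) auto
      also have "\<dots> \<le> 2 * C\<^sup>2 * (2 * ?S)" using S1 by (intro mult_left_mono) auto
      finally show ?thesis by simp
    qed
    have s43: "s ^ 4 \<le> s ^ 3" using s by (intro power_decreasing) auto
    have rem: "- (s ^ 3 * R3) + s ^ 4 * R4 \<le> s ^ 3 * ((4 * \<tau> * C + 4 * C\<^sup>2) * ?S)"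
    proof -
      have "s ^ 3 * (- R3) \<le> s ^ 3 * (4 * \<tau> * C * ?S)" using R3 s by (intro mult_left_mono) auto
      moreover have "s ^ 4 * R4 \<le> s ^ 4 * (4 * C\<^sup>2 * ?S)" using R4 s by (intro mult_left_mono) auto
      moreover have "s ^ 4 * (4 * C\<^sup>2 * ?S) \<le> s ^ 3 * (4 * C\<^sup>2 * ?S)" using s43 by (intro mult_right_mono) auto
      ultimately show ?thesis by (simp add: algebra_simps)
    qed
    define D1 where "D1 = 2 * \<tau> * ((x + 2 *\<^sub>R q) \<bullet> N)"
    define D2 where "D2 = - 2 * (u * k) * ((x + q) \<bullet> g) - 2 * (q \<bullet> (\<gamma> *\<^sub>R q + (u * k) *\<^sub>R g)) - 2 * lam * \<gamma> * (x \<bullet> q)"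
    have D1: "\<gamma>\<^sup>2 / (4 * u) * D1 = noise_coeff z \<bullet> N"
    proof -
      have eq: "sqrt (2 * \<gamma> / u) = sqrt (2 * \<gamma> * u) / u"
        using u \<gamma> by (simp add: real_sqrt_divide real_sqrt_mult field_simps)
      show ?thesis
        unfolding D1_def noise_coeff_def eq using u \<gamma>
        by (simp add: z v \<tau>_def k_def inner_simps field_simps power2_eq_square)
    qed
    have D2: "g \<bullet> v + \<gamma>\<^sup>2 / (4 * u) * D2 \<le> \<gamma> * (A - lam * H z)"
      using H_drift[of z] unfolding D2_def g_def q_def k_def z by simp
    have N2: "\<gamma>\<^sup>2 / (4 * u) * (2 * \<tau>\<^sup>2 * (norm N)\<^sup>2) = \<gamma> * (norm N)\<^sup>2"
      unfolding \<tau>2 using u \<gamma> by (simp add: field_simps power2_eq_square)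
    have "H (euler s z N) \<le> U x + s\<^sup>2 * (g \<bullet> v) + s ^ 3 * (L * (1 + ?n\<^sup>2)) + \<gamma>\<^sup>2 / (4 * u) *
        ((norm (x + q))\<^sup>2 + (norm q)\<^sup>2 - lam * (norm x)\<^sup>2 + s * D1 + s\<^sup>2 * (D2 + 2 * \<tau>\<^sup>2 * (norm N)\<^sup>2)
          + (- (s ^ 3 * R3) + s ^ 4 * R4))"
      using U1 unfolding He id D1_def D2_def by (simp add: algebra_simps)
    also have "\<dots> = H z + s * (\<gamma>\<^sup>2 / (4 * u) * D1) + s\<^sup>2 * ((g \<bullet> v + \<gamma>\<^sup>2 / (4 * u) * D2) + \<gamma>\<^sup>2 / (4 * u) * (2 * \<tau>\<^sup>2 * (norm N)\<^sup>2))
        + s ^ 3 * (L * (1 + ?n\<^sup>2)) + \<gamma>\<^sup>2 / (4 * u) * (- (s ^ 3 * R3) + s ^ 4 * R4)"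
      unfolding Hz by (simp only: distrib_left mult.assoc mult.left_commute add_ac)
    also have "\<dots> \<le> H z + s * (noise_coeff z \<bullet> N) + s\<^sup>2 * (\<gamma> * (A - lam * H z) + \<gamma> * (norm N)\<^sup>2)
        + s ^ 3 * (L * ?S) + \<gamma>\<^sup>2 / (4 * u) * (s ^ 3 * ((4 * \<tau> * C + 4 * C\<^sup>2) * ?S))"
      unfolding D1 N2 using D2 rem S1 s L u
      by (intro add_mono mult_left_mono order_refl) auto
    also have "\<dots> = H z + s * (noise_coeff z \<bullet> N) + s\<^sup>2 * (\<gamma> * (A - lam * H z + (norm N)\<^sup>2)) + K * s ^ 3 * ?S"
      unfolding K_def by (simp only: distrib_left distrib_right mult_ac add_ac)
    finally show ?thesis .
  qed
  then show ?thesis using that K by blast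
qed

end

section \<open>Drift inequalities\<close>

lemma abs_mult_power_bound:
  fixes a b A B y :: real
  assumes "\<bar>a\<bar> \<le> A * y ^ i" "\<bar>b\<bar> \<le> B * y ^ j" "i + j \<le> n" "1 \<le> y" "0 \<le> A" "0 \<le> B"
  shows "\<bar>a * b\<bar> \<le> A * B * y ^ n"
proof -
  have "\<bar>a * b\<bar> \<le> (A * y ^ i) * (B * y ^ j)"
    unfolding abs_mult using assms by (intro mult_mono) auto
  also have "\<dots> = A * B * y ^ (i + j)" by (simp add: power_add)
  also have "\<dots> \<le> A * B * y ^ n" using assms by (intro mult_left_mono power_increasing) auto
  finally show ?thesis .
qed

text \<open>Multiplies two expansions to second order, one bounded in the state and one of size X.
  The ten products of order s^3 and higher are each at most K^2 X y^11 s^3; the exponent 11 = 9 + 2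
  comes from the product of the two remainders.\<close>

lemma product_expansion:
  fixes F G f p1 p2 g q1 q2 s y K X :: real
  assumes y: "1 \<le> y" and s: "0 < s" "s \<le> 1" and X: "1 \<le> X" and K: "0 \<le> K"
    and f: "\<bar>f\<bar> \<le> K" and p1: "\<bar>p1\<bar> \<le> K * y" and p2: "\<bar>p2\<bar> \<le> K * y\<^sup>2"
    and g: "\<bar>g\<bar> \<le> K * X" and q1: "\<bar>q1\<bar> \<le> K * X * y" and q2: "\<bar>q2\<bar> \<le> K * X * y\<^sup>2"
    and F: "0 \<le> F" "F \<le> f + s * p1 + s\<^sup>2 * p2 + K * s ^ 3 * y ^ 9"
    and G: "0 \<le> G" "G \<le> g + s * q1 + s\<^sup>2 * q2 + K * s ^ 3 * (X * y\<^sup>2)"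
  shows "F * G \<le> f * g + s * (p1 * g + f * q1) + s\<^sup>2 * (p2 * g + p1 * q1 + f * q2) + 10 * (K\<^sup>2 * X * y ^ 11) * s ^ 3"
proof -
  define M where "M = K * (K * X) * y ^ 11"
  define a where "a = K * y ^ 9"
  define b where "b = K * X * y\<^sup>2"
  have M0: "0 \<le> M" using K X y by (simp add: M_def)
  have KX: "0 \<le> K * X" using K X by simp
  have ya: "\<bar>f\<bar> \<le> K * y ^ 0" "\<bar>p1\<bar> \<le> K * y ^ 1" "\<bar>a\<bar> \<le> K * y ^ 9"
      "\<bar>g\<bar> \<le> K * X * y ^ 0" "\<bar>q1\<bar> \<le> K * X * y ^ 1" "\<bar>b\<bar> \<le> K * X * y ^ 2"
    using f p1 g q1 K y X by (auto simp: a_def b_def)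
  note bnd = abs_mult_power_bound[where n = 11, OF _ _ _ y K KX, folded M_def]
  have t: "p1 * q2 \<le> M" "p2 * q1 \<le> M" "p2 * q2 \<le> M" "a * g \<le> M" "a * q1 \<le> M" "a * q2 \<le> M" "a * b \<le> M"
     "f * b \<le> M" "p1 * b \<le> M" "p2 * b \<le> M"
    using bnd[OF ya(2) q2] bnd[OF p2 ya(5)] bnd[OF p2 q2] bnd[OF ya(3,4)] bnd[OF ya(3,5)] bnd[OF ya(3) q2]
      bnd[OF ya(3,6)] bnd[OF ya(1,6)] bnd[OF ya(2,6)] bnd[OF p2 ya(6)] by (auto simp: abs_le_iff)
  have "F * G \<le> (f + s * p1 + s\<^sup>2 * p2 + s ^ 3 * a) * (g + s * q1 + s\<^sup>2 * q2 + s ^ 3 * b)"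
    using F G by (intro mult_mono) (auto simp: a_def b_def mult_ac)
  also have "\<dots> = f * g + s * (p1 * g + f * q1) + s\<^sup>2 * (p2 * g + p1 * q1 + f * q2) +
      (s ^ 3 * (p1 * q2) + s ^ 3 * (p2 * q1) + s ^ 4 * (p2 * q2) + s ^ 3 * (a * g) + s ^ 4 * (a * q1) + s ^ 5 * (a * q2)
      + s ^ 6 * (a * b) + s ^ 3 * (f * b) + s ^ 4 * (p1 * b) + s ^ 5 * (p2 * b))"
    by (simp add: algebra_simps power2_eq_square power3_eq_cube eval_nat_numeral)
  also have "\<dots> \<le> f * g + s * (p1 * g + f * q1) + s\<^sup>2 * (p2 * g + p1 * q1 + f * q2) +
      (s ^ 3 * M + s ^ 3 * M + s ^ 3 * M + s ^ 3 * M + s ^ 3 * M + s ^ 3 * M + s ^ 3 * M + s ^ 3 * M + s ^ 3 * M + s ^ 3 * M)"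
  proof -
    have "s ^ i * x \<le> s ^ 3 * M" if "x \<le> M" "3 \<le> i" for x i
    proof -
      have "s ^ i * x \<le> s ^ i * M" using that s by (intro mult_left_mono) auto
      also have "\<dots> \<le> s ^ 3 * M" using that s M0 by (intro mult_right_mono power_decreasing) auto
      finally show ?thesis .
    qed
    then show ?thesis by (intro add_mono order_refl t) (use t in auto)
  qed
  also have "\<dots> = f * g + s * (p1 * g + f * q1) + s\<^sup>2 * (p2 * g + p1 * q1 + f * q2) + 10 * (K\<^sup>2 * X * y ^ 11) * s ^ 3"
    by (simp add: M_def power2_eq_square)
  finally show ?thesis .
qed

text \<open>With Gaussian N the terms of order s vanish, (N . e)^2 has mean 1, |N|^2 has the
  dimension as mean, and (N . e)(N . m) has mean e . m. The last one is the covariation of the two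
  factors. Integrability comes from the upper bound because both factors are nonnegative.\<close>

lemma gauss_product_bound:
  fixes F G :: "'a::euclidean_space \<Rightarrow> real" and e m :: 'a
  assumes meas: "F \<in> borel_measurable borel" "G \<in> borel_measurable borel"
    and s: "0 < s" "s \<le> 1" and X: "1 \<le> X" and K: "0 \<le> K" and e: "norm e = 1"
    and f: "\<bar>f\<bar> \<le> K" and A1: "\<bar>A1\<bar> \<le> K" and BC: "\<bar>B\<bar> + \<bar>C\<bar> \<le> K"
    and g: "\<bar>g\<bar> \<le> K * X" and m: "norm m \<le> K * X" and DE: "\<bar>D\<bar> + \<bar>E\<bar> \<le> K * X"
    and F: "\<And>N. 0 \<le> F N" "\<And>N. F N \<le> f + s * (A1 * (N \<bullet> e)) + s\<^sup>2 * (B + C * (N \<bullet> e)\<^sup>2) + K * s ^ 3 * (1 + norm N) ^ 9"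
    and G: "\<And>N. 0 \<le> G N" "\<And>N. G N \<le> g + s * (N \<bullet> m) + s\<^sup>2 * (D + E * (norm N)\<^sup>2) + K * s ^ 3 * (X * (1 + norm N)\<^sup>2)"
  shows "integrable std_gauss (\<lambda>N. F N * G N)"
    and "(\<integral>N. F N * G N \<partial>std_gauss) \<le> f * g + s\<^sup>2 * ((B + C) * g + A1 * (e \<bullet> m) + f * (D + E * real DIM('a)))
      + 10 * (K\<^sup>2 * X) * (\<integral>N. (1 + norm N) ^ 11 \<partial>(std_gauss :: 'a measure)) * s ^ 3"
proof -
  define h where "h N = f * g + s * ((A1 * g) * (N \<bullet> e) + f * (N \<bullet> m))
    + s\<^sup>2 * (B * g + f * D + (C * g) * ((N \<bullet> e) * (N \<bullet> e)) + A1 * ((N \<bullet> e) * (N \<bullet> m)) + (f * E) * (norm N)\<^sup>2)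
    + 10 * (K\<^sup>2 * X) * s ^ 3 * (1 + norm N) ^ 11" for N
  have n2: "norm N ^ 2 \<le> (1 + norm N)\<^sup>2" for N :: 'a by (intro power_mono) auto
  have le: "F N * G N \<le> h N" for N
  proof -
    let ?y = "1 + norm N"
    have Ne: "\<bar>N \<bullet> e\<bar> \<le> norm N" using Cauchy_Schwarz_ineq2[of N e] e by simp
    have Ne2: "(N \<bullet> e)\<^sup>2 \<le> ?y\<^sup>2"
      using Ne n2[of N] by (metis abs_ge_zero order_trans power2_abs power_mono)
    have "F N * G N \<le> f * g + s * (A1 * (N \<bullet> e) * g + f * (N \<bullet> m))
      + s\<^sup>2 * ((B + C * (N \<bullet> e)\<^sup>2) * g + A1 * (N \<bullet> e) * (N \<bullet> m) + f * (D + E * (norm N)\<^sup>2)) + 10 * (K\<^sup>2 * X * ?y ^ 11) * s ^ 3"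
    proof (rule product_expansion[OF _ s X K f _ _ g _ _ F G])
      show "\<bar>A1 * (N \<bullet> e)\<bar> \<le> K * ?y"
        unfolding abs_mult using A1 Ne K by (intro mult_mono) auto
      have "\<bar>B + C * (N \<bullet> e)\<^sup>2\<bar> \<le> \<bar>B\<bar> * 1 + \<bar>C\<bar> * (N \<bullet> e)\<^sup>2"
        using abs_triangle_ineq[of B "C * (N \<bullet> e)\<^sup>2"] by (simp add: abs_mult)
      also have "\<dots> \<le> \<bar>B\<bar> * ?y\<^sup>2 + \<bar>C\<bar> * ?y\<^sup>2"
        using Ne2 by (intro add_mono mult_left_mono) (auto simp: power2_eq_square algebra_simps)
      also have "\<dots> \<le> K * ?y\<^sup>2" using BC by (simp add: distrib_right[symmetric] mult_right_mono)
      finally show "\<bar>B + C * (N \<bullet> e)\<^sup>2\<bar> \<le> K * ?y\<^sup>2" .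
      have "\<bar>N \<bullet> m\<bar> \<le> norm N * norm m" by (rule Cauchy_Schwarz_ineq2)
      also have "\<dots> \<le> ?y * (K * X)" using m by (intro mult_mono) auto
      finally show "\<bar>N \<bullet> m\<bar> \<le> K * X * ?y" by (simp add: mult_ac)
      have "\<bar>D + E * (norm N)\<^sup>2\<bar> \<le> \<bar>D\<bar> * 1 + \<bar>E\<bar> * (norm N)\<^sup>2"
        using abs_triangle_ineq[of D "E * (norm N)\<^sup>2"] by (simp add: abs_mult)
      also have "\<dots> \<le> \<bar>D\<bar> * ?y\<^sup>2 + \<bar>E\<bar> * ?y\<^sup>2"
        using n2[of N] by (intro add_mono mult_left_mono) (auto simp: power2_eq_square algebra_simps)
      also have "\<dots> \<le> K * X * ?y\<^sup>2" using DE by (simp add: distrib_right[symmetric] mult_right_mono)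
      finally show "\<bar>D + E * (norm N)\<^sup>2\<bar> \<le> K * X * ?y\<^sup>2" .
    qed auto
    also have "\<dots> = h N" by (simp add: h_def algebra_simps power2_eq_square)
    finally show ?thesis .
  qed
  have int_n2: "integrable std_gauss (\<lambda>N::'a. (norm N)\<^sup>2)"
    by (rule integrable_std_gauss_bound[where C = 1 and p = 2]) (use n2 in auto)
  have int_h: "integrable std_gauss h"
    unfolding h_def by (intro Bochner_Integration.integrable_add Bochner_Integration.integrable_mult_right
        integrable_std_gauss_norm_power integrable_std_gauss_inner integrable_std_gauss_inner_mult int_n2)
      (auto)
  show int: "integrable std_gauss (\<lambda>N. F N * G N)"
  proof (rule Bochner_Integration.integrable_bound[OF int_h])
    have "0 \<le> F N * G N" for N using F G by simp
    then show "AE N in std_gauss. norm (F N * G N) \<le> norm (h N)"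
      using le by (auto intro!: always_eventually order_trans[OF _ abs_ge_self])
  qed (use meas in auto)
  have "(\<integral>N. F N * G N \<partial>std_gauss) \<le> (\<integral>N. h N \<partial>std_gauss)"
    by (rule integral_mono[OF int int_h le])
  also have "(\<integral>N. h N \<partial>std_gauss) = f * g
    + s\<^sup>2 * (B * g + f * D + (C * g) * (e \<bullet> e) + A1 * (e \<bullet> m) + (f * E) * real DIM('a))
    + 10 * (K\<^sup>2 * X) * s ^ 3 * (\<integral>N. (1 + norm N) ^ 11 \<partial>(std_gauss :: 'a measure))"
    unfolding h_def
    by (simp add: int_n2 integrable_std_gauss_norm_power integral_std_gauss_inner_mult
        integral_std_gauss_norm_square std_gauss.prob_space[simplified] del: inner_eq_zero_iff)
  also have "e \<bullet> e = 1" using e by (simp add: dot_square_norm)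
  finally show "(\<integral>N. F N * G N \<partial>std_gauss) \<le> f * g + s\<^sup>2 * ((B + C) * g + A1 * (e \<bullet> m) + f * (D + E * real DIM('a)))
      + 10 * (K\<^sup>2 * X) * (\<integral>N. (1 + norm N) ^ 11 \<partial>(std_gauss :: 'a measure)) * s ^ 3"
    by (simp add: algebra_simps)
qed

section \<open>Hyperplane reflections\<close>

definition householder :: "'a::real_inner \<Rightarrow> 'a \<Rightarrow> 'a" where
  "householder e x = x - (2 * (x \<bullet> e)) *\<^sub>R e"

lemma householder:
  assumes "norm e = 1"
  shows "linear (householder e)" "norm (householder e x) = norm x" "householder e (householder e x) = x"
    "householder e x \<bullet> y = x \<bullet> householder e y"
proof -
  have e: "e \<bullet> e = 1" using assms by (simp add: dot_square_norm)
  show "linear (householder e)"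
    unfolding householder_def by (intro linearI) (auto simp: algebra_simps inner_add_left)
  have "(norm (householder e x))\<^sup>2 = (norm x)\<^sup>2"
    unfolding householder_def power2_norm_eq_inner using e
    by (simp add: inner_diff_left inner_diff_right inner_commute algebra_simps)
  then show "norm (householder e x) = norm x" by (simp add: power2_eq_iff_nonneg)
  show "householder e (householder e x) = x"
    using e by (simp add: householder_def inner_diff_left algebra_simps)
  show "householder e x \<bullet> y = x \<bullet> householder e y"
    by (simp add: householder_def inner_simps inner_commute)
qed

context langevin
begin

section \<open>The coupled pair in the coordinates z and q, and its cost\<close>

definition zdiff :: "'n state \<times> 'n state \<Rightarrow> real^'n" where
  "zdiff zz = fst (fst zz) - fst (snd zz)"

definition qdiff :: "'n state \<times> 'n state \<Rightarrow> real^'n" where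
  "qdiff zz = zdiff zz + inverse \<gamma> *\<^sub>R (snd (fst zz) - snd (snd zz))"

definition rad :: "'n state \<times> 'n state \<Rightarrow> real" where
  "rad zz = \<alpha> * norm (zdiff zz) + norm (qdiff zz)"

text \<open>The noise of the second copy. The reflection direction q/|q| is only used for |q| >=
  \<xi>, away from its singularity; from R1 on, f has its maximal value and cannot be increased by
  any noise, so the synchronous choice is harmless.\<close>

definition rotate_noise :: "real \<Rightarrow> 'n state \<times> 'n state \<Rightarrow> real^'n \<Rightarrow> real^'n" where
  "rotate_noise \<xi> zz N = (if \<xi> \<le> norm (qdiff zz) \<and> rad zz < R1
    then householder ((1 / norm (qdiff zz)) *\<^sub>R qdiff zz) N else N)"

definition coupled_step :: "real \<Rightarrow> real \<Rightarrow> 'n state \<times> 'n state \<Rightarrow> real^'n \<Rightarrow> 'n state \<times> 'n state" where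
  "coupled_step \<xi> s zz N = (euler s (fst zz) N, euler s (snd zz) (rotate_noise \<xi> zz N))"

definition Hsum :: "'n state \<times> 'n state \<Rightarrow> real" where
  "Hsum zz = H (fst zz) + H (snd zz)"

definition weight :: "'n state \<times> 'n state \<Rightarrow> real" where
  "weight zz = 1 + \<epsilon> * Hsum zz"

definition rho :: "'n state \<times> 'n state \<Rightarrow> real" where
  "rho zz = f (rad zz) * weight zz"

text \<open>Controls the remainders. Unlike \<open>rho\<close> it does not vanish on the diagonal,
  so one-step errors measured by it cannot be absorbed into the contraction and must be made small
  through \<xi> and the step size.\<close>

definition size2 :: "'n state \<times> 'n state \<Rightarrow> real" where
  "size2 zz = 1 + (norm (fst zz))\<^sup>2 + (norm (snd zz))\<^sup>2"

lemma rho_eq_rho_cost: "rho zz = rho_cost U u \<gamma> lam \<alpha> \<epsilon> f (fst zz) (snd zz)"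
  by (simp add: rho_def rho_cost_def r_dist_def rad_def zdiff_def qdiff_def weight_def Hsum_def algebra_simps)

lemma rotate_noise:
  assumes "\<xi> > 0"
  shows "linear (rotate_noise \<xi> zz)" "norm (rotate_noise \<xi> zz x) = norm x"
    "rotate_noise \<xi> zz (rotate_noise \<xi> zz x) = x" "rotate_noise \<xi> zz x \<bullet> y = x \<bullet> rotate_noise \<xi> zz y"
proof -
  define e where "e = (1 / norm (qdiff zz)) *\<^sub>R qdiff zz"
  have e: "norm e = 1" if "\<xi> \<le> norm (qdiff zz)" using that assms by (auto simp: e_def)
  have id: "linear (\<lambda>x :: real^'n. x)" by (rule linear_ident)
  have "rotate_noise \<xi> zz = householder e \<and> norm e = 1 \<or> rotate_noise \<xi> zz = (\<lambda>x. x)"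
    using e by (auto simp: rotate_noise_def fun_eq_iff e_def)
  then show "linear (rotate_noise \<xi> zz)" "norm (rotate_noise \<xi> zz x) = norm x"
    "rotate_noise \<xi> zz (rotate_noise \<xi> zz x) = x" "rotate_noise \<xi> zz x \<bullet> y = x \<bullet> rotate_noise \<xi> zz y"
    using householder(1)[of e] householder(2,3)[of e x] householder(4)[of e x y] id by auto
qed

text \<open>The reason for the choice of \<epsilon>: the constant part of the drift of \<epsilon> H
  is 4c for each copy, 8c for the pair.\<close>

lemma eps_dA: "\<epsilon> * \<gamma> * (real CARD('n) + A) = 4 * c"
proof -
  have "real CARD('n) + A \<noteq> 0" using d A by linarith
  moreover have "t \<noteq> 0 \<Longrightarrow> 4 / \<gamma> * c / t * \<gamma> * t = 4 * c" for t using \<gamma> by simp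
  ultimately show ?thesis unfolding \<epsilon>_def by blast
qed

lemma rad_nonneg: "0 \<le> rad zz" using \<alpha> by (simp add: rad_def)

lemma Hsum_nonneg: "0 \<le> Hsum zz" using H_nonneg by (simp add: Hsum_def)

lemma weight_ge_1: "1 \<le> weight zz" using Hsum_nonneg[of zz] \<epsilon>_pos by (simp add: weight_def)

lemma rho_nonneg: "0 \<le> rho zz"
  using f_nonneg[OF rad_nonneg[of zz]] weight_ge_1[of zz] by (simp add: rho_def)

lemma size2_ge_1: "1 \<le> size2 zz" by (simp add: size2_def)

section \<open>Bounds for the Lyapunov function and its drift\<close>

lemma weight_growth:
  obtains K where "K > 0" "\<And>zz. weight zz \<le> K * size2 zz" "\<And>zz. Hsum zz \<le> K * size2 zz"
proof -
  obtain K where K: "K > 0" "\<And>z. H z \<le> K * (1 + (norm z)\<^sup>2)" using H_growth by blast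
  have 1: "Hsum zz \<le> 2 * K * size2 zz" for zz
  proof -
    have "Hsum zz \<le> K * (1 + (norm (fst zz))\<^sup>2) + K * (1 + (norm (snd zz))\<^sup>2)"
      unfolding Hsum_def using K(2) by (intro add_mono)
    also have "\<dots> = K * (1 + size2 zz)" by (simp add: size2_def algebra_simps)
    also have "\<dots> \<le> K * (2 * size2 zz)" using size2_ge_1[of zz] K by (intro mult_left_mono) auto
    finally show ?thesis by simp
  qed
  have 2: "weight zz \<le> (1 + \<epsilon> * (2 * K)) * size2 zz" for zz
  proof -
    have "\<epsilon> * Hsum zz \<le> \<epsilon> * (2 * K * size2 zz)" using 1[of zz] \<epsilon>_pos by (intro mult_left_mono) auto
    then show ?thesis using size2_ge_1[of zz] by (simp add: weight_def algebra_simps)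
  qed
  show ?thesis
  proof (rule that[of "1 + \<epsilon> * (2 * K) + 2 * K"])
    show "0 < 1 + \<epsilon> * (2 * K) + 2 * K" using K \<epsilon>_pos by (simp add: add_pos_pos)
    fix zz
    have "0 \<le> 2 * K * size2 zz" "0 \<le> (1 + \<epsilon> * (2 * K)) * size2 zz"
      using K \<epsilon>_pos size2_ge_1[of zz] by (auto intro!: mult_nonneg_nonneg add_nonneg_nonneg)
    then show "weight zz \<le> (1 + \<epsilon> * (2 * K) + 2 * K) * size2 zz" "Hsum zz \<le> (1 + \<epsilon> * (2 * K) + 2 * K) * size2 zz"
      using 1[of zz] 2[of zz] by (simp_all add: distrib_right)
  qed
qed

text \<open>By the parallelogram identity the quadratic forms at the two states sum to half of the
  forms at their difference and at their sum. The latter is nonnegative and is dropped; the half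
  turns the factor 1/4 into 1/8.\<close>

lemma Hsum_lower:
  "\<gamma>\<^sup>2 / (8 * u) * ((norm (qdiff zz) - norm (zdiff zz))\<^sup>2 + (norm (qdiff zz))\<^sup>2 - lam * (norm (zdiff zz))\<^sup>2) \<le> Hsum zz"
proof -
  define k where "k = inverse \<gamma>"
  define q where "q x y = (norm (x + y))\<^sup>2 + (norm y)\<^sup>2 - lam * (norm x)\<^sup>2" for x y :: "real^'n"
  obtain x v x' v' where zz: "zz = ((x, v), (x', v'))" by (metis prod.exhaust)
  let ?y = "k *\<^sub>R v" and ?y' = "k *\<^sub>R v'"
  have q0: "0 \<le> q x y" for x y
  proof -
    have "H (x, \<gamma> *\<^sub>R y) - U x = \<gamma>\<^sup>2 / (4 * u) * q x y" using \<gamma> by (simp add: H_expand q_def)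
    have "lam * (norm x)\<^sup>2 \<le> 1/4 * (norm x)\<^sup>2" using lam by (intro mult_right_mono) auto
    moreover have "(norm (x + y) - norm x)\<^sup>2 + (norm (x + y))\<^sup>2 - lam * (norm x)\<^sup>2 \<le> q x y"
      using quad_lower[of "x + y" x] by (simp add: q_def)
    moreover have "0 \<le> 2 * (norm (x + y) - norm x / 2)\<^sup>2 + 1/4 * (norm x)\<^sup>2" by simp
    then have "1/4 * (norm x)\<^sup>2 \<le> (norm (x + y) - norm x)\<^sup>2 + (norm (x + y))\<^sup>2"
      by (simp add: power2_eq_square algebra_simps)
    ultimately show ?thesis by linarith
  qed
  have par: "q (x - x') (?y - ?y') + q (x + x') (?y + ?y') = 2 * (q x ?y + q x' ?y')"
    unfolding q_def power2_norm_eq_inner by (simp add: inner_simps inner_commute algebra_simps)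
  have "qdiff zz - zdiff zz = ?y - ?y'" by (simp add: qdiff_def zz k_def algebra_simps)
  then have "(norm (qdiff zz) - norm (zdiff zz))\<^sup>2 + (norm (qdiff zz))\<^sup>2 - lam * (norm (zdiff zz))\<^sup>2 \<le> q (x - x') (?y - ?y')"
    using quad_lower[of "qdiff zz" "zdiff zz"] by (simp add: q_def zdiff_def zz qdiff_def k_def algebra_simps)
  also have "\<dots> \<le> 2 * (q x ?y + q x' ?y')" using par q0[of "x + x'" "?y + ?y'"] by linarith
  finally have "\<gamma>\<^sup>2 / (8 * u) * ((norm (qdiff zz) - norm (zdiff zz))\<^sup>2 + (norm (qdiff zz))\<^sup>2 - lam * (norm (zdiff zz))\<^sup>2)
     \<le> \<gamma>\<^sup>2 / (8 * u) * (2 * (q x ?y + q x' ?y'))" using u by (intro mult_left_mono) auto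
  also have "\<dots> \<le> Hsum zz"
    using U_nonneg[of x] U_nonneg[of x'] by (simp add: Hsum_def H_expand zz q_def k_def algebra_simps)
  finally show ?thesis .
qed

text \<open>48/5 c equals \<epsilon> \<gamma> (12/5)(d + A). Reaching this level leaves a surplus of
  8/5 c over the growth 8c, enough for the constant part of c times the weight and for c \<epsilon>
  H, which is at most 1/384 of the decay. \<theta> is an error that is passed through.\<close>

lemma lyapunov_dominates:
  assumes "48/5 * c - \<theta> \<le> \<epsilon> * \<gamma> * lam * Hsum zz" "0 \<le> \<theta>"
  shows "\<epsilon> * \<gamma> * (2 * (real CARD('n) + A) - lam * Hsum zz) \<le> - c * weight zz + \<theta>"
proof -
  define Y where "Y = \<epsilon> * \<gamma> * lam * Hsum zz"
  have 1: "\<epsilon> * \<gamma> * (2 * (real CARD('n) + A)) = 8 * c" using eps_dA by (simp add: algebra_simps)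
  have 2: "c * (\<epsilon> * Hsum zz) \<le> Y / 384"
    using mult_right_mono[OF c_le_lam, of "\<epsilon> * Hsum zz"] \<epsilon>_pos Hsum_nonneg[of zz] by (simp add: Y_def mult_ac)
  have "\<epsilon> * \<gamma> * (2 * (real CARD('n) + A) - lam * Hsum zz) = 8 * c - Y"
    using 1 by (simp add: Y_def algebra_simps)
  moreover have "- c * weight zz = - c - c * (\<epsilon> * Hsum zz)" by (simp add: weight_def algebra_simps)
  moreover have "48/5 * c - \<theta> \<le> Y" using assms by (simp add: Y_def)
  ultimately show ?thesis using 2 c_pos assms(2) by linarith
qed

text \<open>R1 is chosen so that a distance of at least R1 forces lam times the sum of the two
  Lyapunov functions above (12/5)(d + A).\<close>

lemma outer_drift:
  assumes "R1 \<le> rad zz"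
  shows "\<epsilon> * \<gamma> * (2 * (real CARD('n) + A) - lam * Hsum zz) \<le> - c * weight zz"
proof -
  let ?a = "norm (zdiff zz)" and ?b = "norm (qdiff zz)"
  define q where "q = (?b - ?a)\<^sup>2 + ?b\<^sup>2 - lam * ?a\<^sup>2"
  \<comment> \<open>Minimising the form q over a = |z| and b = |q| under the constraint \<alpha> a +
    b = r gives (1 - 2 lam) r^2 / (p - lam); the identity exhibits this minimum together with the
    square that is lost. It explains the factors 1 + 2\<alpha> + 2\<alpha>^2 and lam - 2 lam^2 in
    R1.\<close>
  have "q * (p - lam) = (1 - 2 * lam) * (rad zz)\<^sup>2 + ((1 - lam) * ?a - ?b - \<alpha> * (2 * ?b - ?a))\<^sup>2"
    by (simp add: q_def p_def rad_def power2_eq_square algebra_simps)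
  then have 1: "(1 - 2 * lam) * (rad zz)\<^sup>2 \<le> q * (p - lam)" by simp
  have pl: "0 < p - lam" using p_ge_1 lam by simp
  have "0 \<le> q * (p - lam)" using 1 lam2 by (meson mult_nonneg_nonneg order_trans less_imp_le zero_le_power2)
  then have "0 \<le> q" using pl by (simp add: zero_le_mult_iff)
  then have "q * (p - lam) \<le> q * p" using lam by (intro mult_left_mono) auto
  moreover have "R1\<^sup>2 \<le> (rad zz)\<^sup>2" using assms R1_pos by (intro power_mono) auto
  then have "(1 - 2 * lam) * R1\<^sup>2 \<le> (1 - 2 * lam) * (rad zz)\<^sup>2" using lam2 by (intro mult_left_mono) auto
  ultimately have 2: "(1 - 2 * lam) * R1\<^sup>2 \<le> q * p" using 1 by linarith
  have "12/5 * (real CARD('n) + A) = lam * (\<gamma>\<^sup>2 / (8 * u)) * ((1 - 2 * lam) * R1\<^sup>2 / p)"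
    unfolding R1_sq using lam2 lam u \<gamma> p_ge_1 by (simp add: field_simps)
  also have "\<dots> \<le> lam * (\<gamma>\<^sup>2 / (8 * u)) * q"
    using 2 p_ge_1 lam u by (intro mult_left_mono) (auto simp: field_simps)
  also have "\<dots> = lam * (\<gamma>\<^sup>2 / (8 * u) * q)" by (simp only: mult.assoc)
  also have "\<dots> \<le> lam * Hsum zz"
    unfolding q_def using lam by (intro mult_left_mono Hsum_lower) auto
  finally have "\<epsilon> * \<gamma> * (12/5 * (real CARD('n) + A)) \<le> \<epsilon> * \<gamma> * (lam * Hsum zz)"
    using \<epsilon>_pos \<gamma> by (intro mult_left_mono) auto
  moreover have "\<epsilon> * \<gamma> * (12/5 * (real CARD('n) + A)) = 48/5 * c" using eps_dA by (simp add: algebra_simps)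
  ultimately have "48/5 * c \<le> \<epsilon> * \<gamma> * lam * Hsum zz" by (simp only: mult.assoc)
  then show ?thesis using lyapunov_dominates[of 0 zz] by simp
qed

text \<open>Bound for the noise-free drift of \<open>rad\<close>: |z| changes at a rate of at most
  \<gamma> (|q| - |z|), |q| at a rate of at most \<gamma> w |z|, and \<alpha> - w = \<alpha> / (1 +
  \<Lambda>). Thus the surplus 1/\<Lambda> in \<alpha> is what leaves a negative multiple of
  |z|.\<close>

definition dist_drift :: "'n state \<times> 'n state \<Rightarrow> real" where
  "dist_drift zz = \<gamma> * \<alpha> * (norm (qdiff zz) - norm (zdiff zz) / (1 + \<Lambda>))"

text \<open>Close to \<open>q = 0\<close> the coupling is synchronous. In the inner half of the ball the drift of the distance
  contracts fast enough; in the outer half \<open>x - x'\<close> is so large that the Lyapunov function decreases.\<close>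

lemma synchronous_drift:
  obtains K where "K \<ge> 0"
    "\<And>zz \<xi>. 0 < \<xi> \<Longrightarrow> \<xi> \<le> 1 \<Longrightarrow> norm (qdiff zz) < \<xi> \<Longrightarrow> rad zz < R1 \<Longrightarrow>
      f' (rad zz) * dist_drift zz * weight zz + f (rad zz) * (\<epsilon> * \<gamma> * (2 * (real CARD('n) + A) - lam * Hsum zz))
        \<le> - c * (f (rad zz) * weight zz) + K * \<xi> * weight zz"
proof -
  \<comment> \<open>2 R1 / \<alpha>^2 + 2 R1 / \<alpha> is the loss per unit of \<xi> when |q| is
    neglected in the lower bound for the Lyapunov functions.\<close>
  define K1 where "K1 = \<gamma>\<^sup>2 / (8 * u) * (2 * R1 / \<alpha>\<^sup>2 + 2 * R1 / \<alpha>)"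
  define K where "K = \<gamma> * (\<alpha> + 1) + R1 * (\<epsilon> * \<gamma> * lam * K1)"
  have K1: "K1 \<ge> 0" using u R1_pos \<alpha> by (simp add: K1_def)
  have Kp: "0 \<le> \<gamma> * (\<alpha> + 1)" "0 \<le> R1 * (\<epsilon> * \<gamma> * lam * K1)" using \<gamma> \<alpha> R1_pos \<epsilon>_pos lam K1 by auto
  have K: "K \<ge> 0" using Kp by (simp add: K_def)
  have "f' (rad zz) * dist_drift zz * weight zz + f (rad zz) * (\<epsilon> * \<gamma> * (2 * (real CARD('n) + A) - lam * Hsum zz))
        \<le> - c * (f (rad zz) * weight zz) + K * \<xi> * weight zz"
    if \<xi>: "0 < \<xi>" "\<xi> \<le> 1" and q: "norm (qdiff zz) < \<xi>" and r: "rad zz < R1" for zz \<xi>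
  proof -
    let ?r = "rad zz" and ?G = "weight zz" and ?q = "norm (qdiff zz)" and ?a = "norm (zdiff zz)"
    have r0: "0 \<le> ?r" by (rule rad_nonneg)
    have G1: "1 \<le> ?G" by (rule weight_ge_1)
    have f0: "0 \<le> f ?r" using f_nonneg[OF r0] .
    have fR: "f ?r \<le> R1" using f_le_R[OF r0] .
    have f'01: "0 < f' ?r" "f' ?r \<le> 1" using f'_bounds[of ?r] r r0 by auto
    define b0 where "b0 = \<gamma> / (1 + \<Lambda>) * ?r"
    have b0: "0 \<le> b0" using \<gamma> \<Lambda>_pos r0 by (simp add: b0_def)
    have bb: "dist_drift zz \<le> \<gamma> * (\<alpha> + 1) * \<xi> - b0"
    proof -
      \<comment> \<open>\<alpha> |z| is replaced by r - |q|, which splits off the contraction b0 of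
        the whole distance at the price of terms of order |q| < \<xi>.\<close>
      have "dist_drift zz = \<gamma> * \<alpha> * ?q + \<gamma> * (?q / (1 + \<Lambda>)) - b0"
        by (simp add: dist_drift_def b0_def rad_def divide_inverse algebra_simps)
      moreover have "?q / (1 + \<Lambda>) \<le> ?q"
        using \<Lambda>_pos by (simp add: field_simps)
      then have "\<gamma> * (?q / (1 + \<Lambda>)) \<le> \<gamma> * ?q" using \<gamma> by (intro mult_left_mono) auto
      moreover have "\<gamma> * \<alpha> * ?q + \<gamma> * ?q = \<gamma> * (\<alpha> + 1) * ?q" by (simp add: algebra_simps)
      moreover have "\<gamma> * (\<alpha> + 1) * ?q \<le> \<gamma> * (\<alpha> + 1) * \<xi>" using q Kp by (intro mult_left_mono) auto
      ultimately show ?thesis by linarith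
    qed
    have "f' ?r * dist_drift zz \<le> f' ?r * (\<gamma> * (\<alpha> + 1) * \<xi> - b0)"
      using bb f'01 by (intro mult_left_mono) auto
    also have "\<dots> \<le> \<gamma> * (\<alpha> + 1) * \<xi> - f' ?r * b0"
    proof -
      have "f' ?r * (\<gamma> * (\<alpha> + 1) * \<xi>) \<le> 1 * (\<gamma> * (\<alpha> + 1) * \<xi>)"
        using f'01 \<gamma> \<alpha> \<xi> by (intro mult_right_mono mult_nonneg_nonneg) auto
      then show ?thesis by (simp add: algebra_simps)
    qed
    finally have "f' ?r * dist_drift zz * ?G \<le> (\<gamma> * (\<alpha> + 1) * \<xi> - f' ?r * b0) * ?G"
      using G1 by (intro mult_right_mono) auto
    then have drift1: "f' ?r * dist_drift zz * ?G \<le> \<gamma> * (\<alpha> + 1) * \<xi> * ?G - f' ?r * b0 * ?G"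
      by (simp add: left_diff_distrib)
    have eps8: "\<epsilon> * \<gamma> * (2 * (real CARD('n) + A)) = 8 * c" using eps_dA by (simp add: algebra_simps)
    have KG: "K * \<xi> * ?G = \<gamma> * (\<alpha> + 1) * \<xi> * ?G + R1 * (\<epsilon> * \<gamma> * lam * K1) * \<xi> * ?G"
      by (simp add: K_def algebra_simps)
    show ?thesis
    proof (cases "?r\<^sup>2 \<le> R1\<^sup>2 / 2")
      case True
      \<comment> \<open>Inner half: of the rate 9c, the part 8c cancels the possible growth of the
        Lyapunov part.\<close>
      have "9 * c * f ?r \<le> f' ?r * b0" using inner_contraction[OF r0 True] by (simp add: b0_def mult_ac)
      then have 1: "9 * c * f ?r * ?G \<le> f' ?r * b0 * ?G" using G1 by (intro mult_right_mono) auto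
      have "\<epsilon> * \<gamma> * (2 * (real CARD('n) + A) - lam * Hsum zz) \<le> 8 * c"
        using eps8 \<epsilon>_pos \<gamma> lam Hsum_nonneg[of zz] by (simp add: algebra_simps)
      then have 2: "f ?r * (\<epsilon> * \<gamma> * (2 * (real CARD('n) + A) - lam * Hsum zz)) \<le> f ?r * (8 * c)"
        using f0 by (rule mult_left_mono)
      have 3: "f ?r * (8 * c) * 1 \<le> f ?r * (8 * c) * ?G" using G1 f0 c_pos by (intro mult_left_mono) auto
      have 4: "0 \<le> R1 * (\<epsilon> * \<gamma> * lam * K1) * \<xi> * ?G" using Kp \<xi> G1 by simp
      have 5: "- c * (f ?r * ?G) = f ?r * (8 * c) * ?G - 9 * c * f ?r * ?G" by (simp add: algebra_simps)
      show ?thesis unfolding KG using drift1 1 2 3 4 5 by linarith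
    next
      case False
      have a: "?a = (?r - ?q) / \<alpha>" using \<alpha> by (simp add: rad_def field_simps)
      have aR: "?a \<le> R1 / \<alpha>" unfolding a using r \<alpha> norm_ge_zero[of "qdiff zz"]
        by (intro divide_right_mono) (linarith, simp)
      \<comment> \<open>Outer half: with |q| < \<xi>, |z| is r/\<alpha> up to order \<xi>, and r^2 >
        R1^2 / 2, so X is what the lower bound for the form becomes at \<xi> = 0.\<close>
      define X where "X = (1 - lam) * (R1\<^sup>2 / 2) / \<alpha>\<^sup>2"
      have lower: "X - (2 * R1 / \<alpha>\<^sup>2 + 2 * R1 / \<alpha>) * \<xi> \<le> (?q - ?a)\<^sup>2 + ?q\<^sup>2 - lam * ?a\<^sup>2"
      proof -
        have "?r\<^sup>2 - 2 * R1 * \<xi> \<le> (?r - ?q)\<^sup>2"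
        proof -
          have "?r * ?q \<le> R1 * \<xi>" using r r0 q by (intro mult_mono) auto
          then have "?r\<^sup>2 - 2 * R1 * \<xi> \<le> ?r\<^sup>2 - 2 * (?r * ?q)" by simp
          also have "\<dots> \<le> (?r - ?q)\<^sup>2" by (simp add: power2_diff)
          finally show ?thesis .
        qed
        then have "R1\<^sup>2 / 2 - 2 * R1 * \<xi> \<le> (?r - ?q)\<^sup>2" using False by linarith
        then have "(R1\<^sup>2 / 2 - 2 * R1 * \<xi>) / \<alpha>\<^sup>2 \<le> ?a\<^sup>2"
          unfolding a power_divide by (intro divide_right_mono) auto
        then have "(1 - lam) * ((R1\<^sup>2 / 2 - 2 * R1 * \<xi>) / \<alpha>\<^sup>2) \<le> (1 - lam) * ?a\<^sup>2"
          using lam by (intro mult_left_mono) auto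
        moreover have "(1 - lam) * ((R1\<^sup>2 / 2 - 2 * R1 * \<xi>) / \<alpha>\<^sup>2) = X - (1 - lam) * (2 * R1 * \<xi> / \<alpha>\<^sup>2)"
          by (simp add: X_def algebra_simps diff_divide_distrib)
        moreover have "(1 - lam) * (2 * R1 * \<xi> / \<alpha>\<^sup>2) \<le> 1 * (2 * R1 * \<xi> / \<alpha>\<^sup>2)"
          using lam R1_pos \<xi> by (intro mult_right_mono) auto
        moreover have "?q * ?a \<le> \<xi> * (R1 / \<alpha>)" using q aR \<xi> by (intro mult_mono) auto
        moreover have "(?q - ?a)\<^sup>2 + ?q\<^sup>2 - lam * ?a\<^sup>2 = 2 * ?q\<^sup>2 - 2 * (?q * ?a) + (1 - lam) * ?a\<^sup>2"
          by (simp add: power2_eq_square algebra_simps)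
        moreover have "(2 * R1 / \<alpha>\<^sup>2 + 2 * R1 / \<alpha>) * \<xi> = 2 * R1 * \<xi> / \<alpha>\<^sup>2 + 2 * (\<xi> * (R1 / \<alpha>))"
          by (simp add: algebra_simps)
        ultimately show ?thesis using zero_le_power2[of ?q] by linarith
      qed
      \<comment> \<open>Halving R1^2 is compensated by p >= 2 \<alpha>^2: with |q| negligible all of
        r sits in \<alpha> |z|, and the threshold (12/5)(d + A) is reached again.\<close>
      have X: "12/5 * (real CARD('n) + A) \<le> lam * (\<gamma>\<^sup>2 / (8 * u)) * X"
      proof -
        have "lam * (\<gamma>\<^sup>2 / (8 * u)) * X = 6/5 * (real CARD('n) + A) * (p / \<alpha>\<^sup>2) * ((1 - lam) / (1 - 2 * lam))"
          unfolding X_def R1_sq using lam u \<gamma> \<alpha> lam2 by (simp add: field_simps)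
        moreover have "2 \<le> p / \<alpha>\<^sup>2" using \<alpha> by (simp add: p_def field_simps add_pos_nonneg)
        moreover have "1 \<le> (1 - lam) / (1 - 2 * lam)" using lam lam2 by (simp add: field_simps)
        moreover have "6/5 * (real CARD('n) + A) * 2 * 1 \<le> 6/5 * (real CARD('n) + A) * (p / \<alpha>\<^sup>2) * ((1 - lam) / (1 - 2 * lam))"
        proof (rule mult_mono)
          show "6/5 * (real CARD('n) + A) * 2 \<le> 6/5 * (real CARD('n) + A) * (p / \<alpha>\<^sup>2)"
            using calculation(2) d A by (intro mult_left_mono) auto
          show "0 \<le> 6/5 * (real CARD('n) + A) * (p / \<alpha>\<^sup>2)"
            using p_ge_1 d A by (intro mult_nonneg_nonneg divide_nonneg_nonneg) auto
        qed (use calculation(3) in auto)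
        ultimately show ?thesis by linarith
      qed
      have "\<gamma>\<^sup>2 / (8 * u) * (X - (2 * R1 / \<alpha>\<^sup>2 + 2 * R1 / \<alpha>) * \<xi>) \<le> Hsum zz"
        using mult_left_mono[OF lower, of "\<gamma>\<^sup>2 / (8 * u)"] u Hsum_lower[of zz] by simp
      then have "lam * (\<gamma>\<^sup>2 / (8 * u) * X - K1 * \<xi>) \<le> lam * Hsum zz"
        using lam by (intro mult_left_mono) (auto simp: K1_def algebra_simps)
      then have "12/5 * (real CARD('n) + A) - lam * K1 * \<xi> \<le> lam * Hsum zz" using X by (simp add: algebra_simps)
      then have "\<epsilon> * \<gamma> * (12/5 * (real CARD('n) + A) - lam * K1 * \<xi>) \<le> \<epsilon> * \<gamma> * (lam * Hsum zz)"
        using \<epsilon>_pos \<gamma> by (intro mult_left_mono) auto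
      moreover have "\<epsilon> * \<gamma> * (12/5 * (real CARD('n) + A)) = 48/5 * c" using eps_dA by (simp add: algebra_simps)
      ultimately have "48/5 * c - \<epsilon> * \<gamma> * lam * K1 * \<xi> \<le> \<epsilon> * \<gamma> * lam * Hsum zz" by (simp add: algebra_simps)
      then have "\<epsilon> * \<gamma> * (2 * (real CARD('n) + A) - lam * Hsum zz) \<le> - c * ?G + \<epsilon> * \<gamma> * lam * K1 * \<xi>"
        using \<epsilon>_pos \<gamma> lam K1 \<xi> by (intro lyapunov_dominates) auto
      then have 1: "f ?r * (\<epsilon> * \<gamma> * (2 * (real CARD('n) + A) - lam * Hsum zz)) \<le> f ?r * (- c * ?G + \<epsilon> * \<gamma> * lam * K1 * \<xi>)"
        using f0 by (rule mult_left_mono)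
      have 2: "f ?r * (\<epsilon> * \<gamma> * lam * K1 * \<xi>) \<le> R1 * (\<epsilon> * \<gamma> * lam * K1 * \<xi>)"
        using fR \<epsilon>_pos \<gamma> lam K1 \<xi> by (intro mult_right_mono) auto
      have 3: "R1 * (\<epsilon> * \<gamma> * lam * K1 * \<xi>) * 1 \<le> R1 * (\<epsilon> * \<gamma> * lam * K1 * \<xi>) * ?G"
        using R1_pos \<epsilon>_pos \<gamma> lam K1 \<xi> G1 by (intro mult_left_mono) auto
      have 4: "0 \<le> f' ?r * b0 * ?G" using f'01 b0 G1 by simp
      have 5: "f ?r * (- c * ?G + \<epsilon> * \<gamma> * lam * K1 * \<xi>) = - c * (f ?r * ?G) + f ?r * (\<epsilon> * \<gamma> * lam * K1 * \<xi>)"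
        "R1 * (\<epsilon> * \<gamma> * lam * K1) * \<xi> * ?G = R1 * (\<epsilon> * \<gamma> * lam * K1 * \<xi>) * ?G" by (simp_all add: algebra_simps)
      show ?thesis unfolding KG using drift1 1 2 3 4 5 by linarith
    qed
  qed
  then show ?thesis using that K by blast
qed

text \<open>Noise intensity of q under reflection: N - N' = 2 (N . e) e doubles the coefficient
  \<gamma>^-1 sqrt (2 \<gamma> u).\<close>

definition \<sigma> where "\<sigma> = 2 * (inverse \<gamma> * sqrt (2 * \<gamma> * u))"

lemma \<sigma>_sq: "\<sigma>\<^sup>2 = 8 * u / \<gamma>"
  using \<gamma> u by (simp add: \<sigma>_def power_mult_distrib power_inverse) (simp add: field_simps power2_eq_square)

lemma \<sigma>_pos: "\<sigma> > 0" using \<gamma> u by (simp add: \<sigma>_def)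

text \<open>(\<sigma>^2/2) f'' = - (\<gamma> \<alpha> + 4 \<gamma> \<epsilon> mx) r f' - 9 c \<Phi>.
  The part with \<gamma> \<alpha> cancels the drift of the distance, the part with mx the
  covariation of distance and Lyapunov weight, and 9 c \<Phi> >= 9 c f covers the growth 8c of the
  Lyapunov part and leaves c. This balance dictates the two terms in the exponent of \<phi> and the
  factor 9/4 in g.\<close>

lemma reflection_drift:
  assumes r: "rad zz < R1" and q: "qdiff zz \<noteq> 0"
  defines "e \<equiv> (1 / norm (qdiff zz)) *\<^sub>R qdiff zz"
  shows "(f' (rad zz) * dist_drift zz + f'' (rad zz) / 2 * \<sigma>\<^sup>2) * weight zz
      + f' (rad zz) * \<sigma> * (\<epsilon> * (e \<bullet> (noise_coeff (fst zz) - noise_coeff (snd zz))))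
      + f (rad zz) * (\<epsilon> * \<gamma> * (2 * (real CARD('n) + A) - lam * Hsum zz))
    \<le> - c * (f (rad zz) * weight zz)"
proof -
  let ?r = "rad zz" and ?G = "weight zz" and ?q = "norm (qdiff zz)" and ?a = "norm (zdiff zz)"
  have r0: "0 \<le> ?r" by (rule rad_nonneg)
  have G1: "1 \<le> ?G" by (rule weight_ge_1)
  have f0: "0 \<le> f ?r" using f_nonneg[OF r0] .
  have f'01: "0 < f' ?r" "f' ?r \<le> 1" using f'_bounds[of ?r] r r0 by auto
  have fP: "f ?r \<le> gPhi a ?r" using f_le_gPhi[of ?r] r r0 by simp
  have e: "norm e = 1" "e \<bullet> qdiff zz = ?q"
    using q by (auto simp: e_def dot_square_norm power2_eq_square)
  have b: "dist_drift zz \<le> \<gamma> * \<alpha> * ?r"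
  proof -
    have "?q - ?a / (1 + \<Lambda>) \<le> ?r" using \<Lambda>_pos \<alpha> by (simp add: rad_def add_increasing divide_nonneg_pos)
    then show ?thesis unfolding dist_drift_def using \<gamma> \<alpha> by (intro mult_left_mono) auto
  qed
  have "f'' ?r / 2 * \<sigma>\<^sup>2 = (4 * u / \<gamma>) * (- a * ?r * f' ?r - \<kappa> * gPhi a ?r)"
    by (simp add: \<sigma>_sq prof''_def)
  also have "\<dots> = - (\<gamma> * \<alpha> + 4 * \<gamma> * \<epsilon> * mx) * (?r * f' ?r) - 9 * c * gPhi a ?r"
  proof -
    have "4 * u / \<gamma> * a = \<gamma> * \<alpha> + 4 * \<gamma> * \<epsilon> * mx"
    proof -
      have "4 * u / \<gamma> * ((1 + 1 / \<Lambda>) * L / 4) = \<gamma> * ((1 + 1 / \<Lambda>) * w)"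
        using \<gamma> by (simp add: w_def field_simps power2_eq_square)
      moreover have "4 * u / \<gamma> * (\<gamma>\<^sup>2 / u * \<epsilon> * mx) = 4 * \<gamma> * \<epsilon> * mx"
        using \<gamma> u by (simp add: field_simps power2_eq_square)
      ultimately show ?thesis by (simp only: a_def distrib_left \<alpha>_eq[symmetric])
    qed
    moreover have "4 * u / \<gamma> * \<kappa> = 9 * c" using \<gamma> u by (simp add: \<kappa>_def field_simps)
    moreover have "(4 * u / \<gamma>) * (- a * ?r * f' ?r - \<kappa> * gPhi a ?r) =
       - (4 * u / \<gamma> * a) * (?r * f' ?r) - (4 * u / \<gamma> * \<kappa>) * gPhi a ?r" by (simp add: algebra_simps)
    ultimately show ?thesis by simp
  qed
  finally have f''eq: "f'' ?r / 2 * \<sigma>\<^sup>2 = - (\<gamma> * \<alpha> + 4 * \<gamma> * \<epsilon> * mx) * (?r * f' ?r) - 9 * c * gPhi a ?r" .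
  have first: "(f' ?r * dist_drift zz + f'' ?r / 2 * \<sigma>\<^sup>2) * ?G \<le> - 4 * \<gamma> * \<epsilon> * mx * (?r * f' ?r) * ?G - 9 * c * f ?r * ?G"
  proof -
    have "f' ?r * dist_drift zz \<le> f' ?r * (\<gamma> * \<alpha> * ?r)" using b f'01 by (intro mult_left_mono) auto
    moreover have "9 * c * f ?r \<le> 9 * c * gPhi a ?r" using fP c_pos by (intro mult_left_mono) auto
    ultimately have "f' ?r * dist_drift zz + f'' ?r / 2 * \<sigma>\<^sup>2 \<le> - 4 * \<gamma> * \<epsilon> * mx * (?r * f' ?r) - 9 * c * f ?r"
      unfolding f''eq by (simp add: algebra_simps)
    then have "(f' ?r * dist_drift zz + f'' ?r / 2 * \<sigma>\<^sup>2) * ?G \<le> (- 4 * \<gamma> * \<epsilon> * mx * (?r * f' ?r) - 9 * c * f ?r) * ?G"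
      using G1 by (intro mult_right_mono) auto
    then show ?thesis by (simp add: left_diff_distrib)
  qed
  have second: "f' ?r * \<sigma> * (\<epsilon> * (e \<bullet> (noise_coeff (fst zz) - noise_coeff (snd zz)))) \<le> 4 * \<gamma> * \<epsilon> * mx * (?r * f' ?r)"
  proof -
    \<comment> \<open>The covariation involves only q - z/2, whose component along e is at most |q|
      + |z|/2 <= mx r; this is the origin of max(1, 1/(2\<alpha>)).\<close>
    have nd: "noise_coeff (fst zz) - noise_coeff (snd zz) = (sqrt (2 * \<gamma> / u) * \<gamma>) *\<^sub>R (qdiff zz - (1/2) *\<^sub>R zdiff zz)"
    proof -
      have "snd (fst zz) - snd (snd zz) = \<gamma> *\<^sub>R (qdiff zz - zdiff zz)" using \<gamma> by (simp add: qdiff_def)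
      moreover have "noise_coeff (fst zz) - noise_coeff (snd zz) =
          sqrt (2 * \<gamma> / u) *\<^sub>R ((\<gamma> / 2) *\<^sub>R zdiff zz + (snd (fst zz) - snd (snd zz)))"
        by (simp add: noise_coeff_def zdiff_def algebra_simps)
      moreover have "(\<gamma> / 2) *\<^sub>R zdiff zz + \<gamma> *\<^sub>R (qdiff zz - zdiff zz) = \<gamma> *\<^sub>R (qdiff zz - (1/2) *\<^sub>R zdiff zz)"
        by (simp add: vec_eq_iff field_simps)
      ultimately show ?thesis by simp
    qed
    have s4: "\<sigma> * (sqrt (2 * \<gamma> / u) * \<gamma>) = 4 * \<gamma>"
    proof -
      have "sqrt (2 * \<gamma> * u) * sqrt (2 * \<gamma> / u) = sqrt ((2 * \<gamma>)\<^sup>2)"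
        using u by (simp flip: real_sqrt_mult add: power2_eq_square)
      also have "\<dots> = 2 * \<gamma>" using \<gamma> by (simp only: real_sqrt_abs)
      finally show ?thesis using \<gamma> by (simp add: \<sigma>_def field_simps)
    qed
    have "e \<bullet> (qdiff zz - (1/2) *\<^sub>R zdiff zz) \<le> mx * ?r"
    proof -
      have "- (e \<bullet> zdiff zz) \<le> ?a" using norm_cauchy_schwarz[of "- e" "zdiff zz"] e by simp
      then have "e \<bullet> (qdiff zz - (1/2) *\<^sub>R zdiff zz) \<le> ?q + ?a / 2" using e by (simp add: inner_diff_right)
      also have "\<dots> \<le> mx * ?q + mx * (\<alpha> * ?a)"
      proof (rule add_mono)
        show "?q \<le> mx * ?q" using mx_ge_1 by (simp add: mult_le_cancel_right1)
        have "1/2 \<le> mx * \<alpha>" using mx_ge_1(2) \<alpha> by (simp add: field_simps)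
        then have "1/2 * ?a \<le> mx * \<alpha> * ?a" by (intro mult_right_mono) auto
        then show "?a / 2 \<le> mx * (\<alpha> * ?a)" by (simp add: mult_ac)
      qed
      finally show ?thesis by (simp add: rad_def algebra_simps)
    qed
    then have "4 * \<gamma> * \<epsilon> * f' ?r * (e \<bullet> (qdiff zz - (1/2) *\<^sub>R zdiff zz)) \<le> 4 * \<gamma> * \<epsilon> * f' ?r * (mx * ?r)"
      using \<gamma> \<epsilon>_pos f'01 by (intro mult_left_mono) auto
    moreover have "f' ?r * \<sigma> * (\<epsilon> * (e \<bullet> (noise_coeff (fst zz) - noise_coeff (snd zz))))
        = (\<sigma> * (sqrt (2 * \<gamma> / u) * \<gamma>)) * \<epsilon> * f' ?r * (e \<bullet> (qdiff zz - (1/2) *\<^sub>R zdiff zz))"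
      unfolding nd by simp
    ultimately have "f' ?r * \<sigma> * (\<epsilon> * (e \<bullet> (noise_coeff (fst zz) - noise_coeff (snd zz))))
        \<le> 4 * \<gamma> * \<epsilon> * f' ?r * (mx * ?r)" unfolding s4 by (simp only:)
    also have "\<dots> = 4 * \<gamma> * \<epsilon> * mx * (?r * f' ?r)" by simp
    finally show ?thesis .
  qed
  have "4 * \<gamma> * \<epsilon> * mx * (?r * f' ?r) * 1 \<le> 4 * \<gamma> * \<epsilon> * mx * (?r * f' ?r) * ?G"
    using \<gamma> \<epsilon>_pos mx_ge_1 r0 f'01 G1 by (intro mult_left_mono) auto
  moreover have eps8: "\<epsilon> * \<gamma> * (2 * (real CARD('n) + A)) = 8 * c" using eps_dA by (simp add: algebra_simps)
  moreover have "\<epsilon> * \<gamma> * (2 * (real CARD('n) + A) - lam * Hsum zz) \<le> 8 * c"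
    using eps8 \<epsilon>_pos \<gamma> lam Hsum_nonneg[of zz] by (simp add: algebra_simps)
  then have "f ?r * (\<epsilon> * \<gamma> * (2 * (real CARD('n) + A) - lam * Hsum zz)) \<le> f ?r * (8 * c)"
    using f0 by (rule mult_left_mono)
  moreover have "f ?r * (8 * c) * 1 \<le> f ?r * (8 * c) * ?G" using G1 f0 c_pos by (intro mult_left_mono) auto
  moreover have "- c * (f ?r * ?G) = f ?r * (8 * c) * ?G - 9 * c * f ?r * ?G" by (simp add: algebra_simps)
  ultimately show ?thesis using first second by linarith
qed

text \<open>The coordinate q = z + \<gamma>^-1 (v - v') is natural because friction cancels in it: z
  relaxes towards q, and q is moved only by the noise and by the gradient difference.\<close>

lemma zdiff_qdiff_step:
  assumes zz': "zz' = coupled_step \<xi> s zz N"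
  defines "N' \<equiv> rotate_noise \<xi> zz N"
  shows "zdiff zz' = (1 - s\<^sup>2 * \<gamma>) *\<^sub>R zdiff zz + (s\<^sup>2 * \<gamma>) *\<^sub>R qdiff zz"
    and "qdiff zz' = (qdiff zz + (s * (\<sigma> / 2)) *\<^sub>R (N - N'))
      - (s\<^sup>2 * (u / \<gamma>)) *\<^sub>R (gradU (fst (fst zz)) - gradU (fst (snd zz)))"
proof -
  obtain x v x' v' where zz: "zz = ((x, v), (x', v'))" by (metis prod.exhaust)
  have gi: "\<gamma> * (inverse \<gamma> * t) = t" for t using \<gamma> by simp
  show 1: "zdiff zz' = (1 - s\<^sup>2 * \<gamma>) *\<^sub>R zdiff zz + (s\<^sup>2 * \<gamma>) *\<^sub>R qdiff zz"
    by (simp add: zz' coupled_step_def euler_def zdiff_def qdiff_def zz gi algebra_simps)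
  have s: "inverse \<gamma> * (s * sqrt (2 * \<gamma> * u)) = s * (\<sigma> / 2)" by (simp add: \<sigma>_def)
  have "inverse \<gamma> *\<^sub>R (snd (fst zz') - snd (snd zz')) = inverse \<gamma> *\<^sub>R (v - v') - s\<^sup>2 *\<^sub>R (v - v')
      - (s\<^sup>2 * (u / \<gamma>)) *\<^sub>R (gradU x - gradU x') + (inverse \<gamma> * (s * sqrt (2 * \<gamma> * u))) *\<^sub>R (N - N')"
    by (simp add: zz' coupled_step_def euler_def zz N'_def gi algebra_simps divide_inverse)
  then show "qdiff zz' = (qdiff zz + (s * (\<sigma> / 2)) *\<^sub>R (N - N'))
      - (s\<^sup>2 * (u / \<gamma>)) *\<^sub>R (gradU (fst (fst zz)) - gradU (fst (snd zz)))"
    unfolding s qdiff_def[of zz'] 1 by (simp add: qdiff_def zdiff_def zz gi algebra_simps)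
qed

text \<open>Triangle inequality for both coordinates, the Lipschitz bound, and w = \<alpha>
  \<Lambda> / (1 + \<Lambda>). The condition s^2 \<gamma> <= 1 makes the new z a convex combination
  of z and q. The noise is left untouched inside the norm.\<close>

lemma rad_step:
  assumes s: "0 < s" "s\<^sup>2 * \<gamma> \<le> 1"
  shows "rad (coupled_step \<xi> s zz N) \<le> \<alpha> * norm (zdiff zz)
    + norm (qdiff zz + (s * (\<sigma> / 2)) *\<^sub>R (N - rotate_noise \<xi> zz N)) + s\<^sup>2 * dist_drift zz"
proof -
  let ?zz = "coupled_step \<xi> s zz N" and ?a = "norm (zdiff zz)" and ?q = "norm (qdiff zz)"
  let ?m = "qdiff zz + (s * (\<sigma> / 2)) *\<^sub>R (N - rotate_noise \<xi> zz N)"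
  let ?g = "gradU (fst (fst zz)) - gradU (fst (snd zz))"
  note step = zdiff_qdiff_step[of ?zz \<xi> s zz N, OF refl]
  have "norm (zdiff ?zz) \<le> (1 - s\<^sup>2 * \<gamma>) * ?a + s\<^sup>2 * \<gamma> * ?q"
    unfolding step(1) using s \<gamma> norm_triangle_ineq[of "(1 - s\<^sup>2 * \<gamma>) *\<^sub>R zdiff zz" "(s\<^sup>2 * \<gamma>) *\<^sub>R qdiff zz"] by simp
  then have 1: "\<alpha> * norm (zdiff ?zz) \<le> \<alpha> * ((1 - s\<^sup>2 * \<gamma>) * ?a + s\<^sup>2 * \<gamma> * ?q)"
    using \<alpha> by (intro mult_left_mono) auto
  have "norm ?g \<le> L * ?a" using grad_Lip by (simp add: zdiff_def)
  then have "s\<^sup>2 * (u / \<gamma>) * norm ?g \<le> s\<^sup>2 * (u / \<gamma>) * (L * ?a)" using u \<gamma> by (intro mult_left_mono) auto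
  then have 2: "norm (qdiff ?zz) \<le> norm ?m + s\<^sup>2 * (u / \<gamma>) * (L * ?a)"
    unfolding step(2) using norm_triangle_ineq4[of ?m "(s\<^sup>2 * (u / \<gamma>)) *\<^sub>R ?g"] u \<gamma> by simp
  have w\<alpha>: "w = \<alpha> * \<Lambda> / (1 + \<Lambda>)"
  proof -
    have "\<alpha> * \<Lambda> = (\<Lambda> + 1) * w" using \<Lambda>_pos by (subst \<alpha>_eq) (simp add: field_simps)
    then show ?thesis using \<Lambda>_pos by (simp add: field_simps)
  qed
  have "u / \<gamma> * L = \<gamma> * w" using \<gamma> by (simp add: w_def power2_eq_square)
  also have "\<dots> = \<gamma> * \<alpha> - \<gamma> * \<alpha> / (1 + \<Lambda>)" unfolding w\<alpha> using \<Lambda>_pos by (simp add: field_simps)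
  finally have uL: "u / \<gamma> * L = \<gamma> * \<alpha> - \<gamma> * \<alpha> / (1 + \<Lambda>)" .
  have "s\<^sup>2 * (u / \<gamma>) * (L * ?a) = s\<^sup>2 * (u / \<gamma> * L) * ?a" by simp
  also have "\<dots> = s\<^sup>2 * (\<gamma> * \<alpha> - \<gamma> * \<alpha> / (1 + \<Lambda>)) * ?a" unfolding uL ..
  finally have 3: "s\<^sup>2 * (u / \<gamma>) * (L * ?a) = s\<^sup>2 * (\<gamma> * \<alpha> - \<gamma> * \<alpha> / (1 + \<Lambda>)) * ?a" .
  have "\<alpha> * ((1 - s\<^sup>2 * \<gamma>) * ?a + s\<^sup>2 * \<gamma> * ?q) + (norm ?m + s\<^sup>2 * (\<gamma> * \<alpha> - \<gamma> * \<alpha> / (1 + \<Lambda>)) * ?a)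
      = \<alpha> * ?a + norm ?m + s\<^sup>2 * dist_drift zz"
    by (simp add: dist_drift_def algebra_simps)
  then show ?thesis using 1 2 3 unfolding rad_def[of ?zz] by linarith
qed

lemma rad_step_synchronous:
  assumes "0 < s" "s\<^sup>2 * \<gamma> \<le> 1" "\<not> (\<xi> \<le> norm (qdiff zz) \<and> rad zz < R1)"
  shows "rad (coupled_step \<xi> s zz N) \<le> rad zz + s\<^sup>2 * dist_drift zz"
  using rad_step[OF assms(1,2), of \<xi> zz N] assms(3) unfolding rotate_noise_def rad_def by auto

text \<open>The reflected noise moves q along its own direction, so |q| turns into the modulus of
  the scalar |q| + s \<sigma> \<zeta>, with no transversal second-order contribution.\<close>

lemma rad_step_reflection:
  fixes N :: "real^'n"
  assumes s: "0 < s" "s\<^sup>2 * \<gamma> \<le> 1" and \<xi>: "0 < \<xi>" "\<xi> \<le> norm (qdiff zz)" and r: "rad zz < R1"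
  defines "\<zeta> \<equiv> N \<bullet> ((1 / norm (qdiff zz)) *\<^sub>R qdiff zz)"
  shows "rad (coupled_step \<xi> s zz N) \<le> rad zz + (\<bar>norm (qdiff zz) + s * \<sigma> * \<zeta>\<bar> - norm (qdiff zz)) + s\<^sup>2 * dist_drift zz"
proof -
  define e where "e = (1 / norm (qdiff zz)) *\<^sub>R qdiff zz"
  have q0: "norm (qdiff zz) > 0" using \<xi> by linarith
  have "N - rotate_noise \<xi> zz N = (2 * \<zeta>) *\<^sub>R e"
    using \<xi> r by (simp add: rotate_noise_def householder_def \<zeta>_def e_def)
  moreover have "qdiff zz = norm (qdiff zz) *\<^sub>R e" using q0 by (simp add: e_def)
  ultimately have "qdiff zz + (s * (\<sigma> / 2)) *\<^sub>R (N - rotate_noise \<xi> zz N) = (norm (qdiff zz) + s * \<sigma> * \<zeta>) *\<^sub>R e"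
    by (metis (no_types, lifting) mult.assoc mult.left_commute nonzero_mult_div_cancel_left scaleR_add_left
        scaleR_scaleR times_divide_eq_left times_divide_eq_right zero_neq_numeral)
  moreover have "norm e = 1" using q0 by (simp add: e_def)
  ultimately have "norm (qdiff zz + (s * (\<sigma> / 2)) *\<^sub>R (N - rotate_noise \<xi> zz N)) = \<bar>norm (qdiff zz) + s * \<sigma> * \<zeta>\<bar>"
    by simp
  then show ?thesis using rad_step[OF s, of \<xi> zz N] by (simp add: rad_def)
qed

section \<open>One coupled step: expansion of the weight and of the profile\<close>

lemma noise_coeff_growth:
  obtains K where "K > 0" "\<And>z. norm (noise_coeff z) \<le> K * (1 + norm z)"
proof
  let ?K = "sqrt (2 * \<gamma> / u) * (\<gamma> / 2 + 1)"
  show "?K > 0" using \<gamma> u by (intro mult_pos_pos) auto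
  fix z :: "'n state"
  have "norm ((\<gamma> / 2) *\<^sub>R fst z + snd z) \<le> \<gamma> / 2 * norm (fst z) + norm (snd z)"
    using norm_triangle_ineq[of "(\<gamma> / 2) *\<^sub>R fst z" "snd z"] \<gamma> by simp
  also have "\<dots> \<le> \<gamma> / 2 * norm z + norm z"
    using norm_fst_snd_le[of z] \<gamma> by (intro add_mono mult_left_mono) auto
  also have "\<dots> = (\<gamma> / 2 + 1) * norm z" by (simp add: algebra_simps)
  also have "\<dots> \<le> (\<gamma> / 2 + 1) * (1 + norm z)" using \<gamma> by (intro mult_left_mono) auto
  finally have "sqrt (2 * \<gamma> / u) * norm ((\<gamma> / 2) *\<^sub>R fst z + snd z) \<le> sqrt (2 * \<gamma> / u) * ((\<gamma> / 2 + 1) * (1 + norm z))"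
    using \<gamma> u by (intro mult_left_mono) auto
  then show "norm (noise_coeff z) \<le> ?K * (1 + norm z)" using \<gamma> u by (simp add: noise_coeff_def)
qed

lemma one_plus_norm_le_size2:
  "(1 + norm (fst zz)) + (1 + norm (snd zz)) \<le> 4 * size2 zz"
proof -
  have "(1 + a) + (1 + b) \<le> 4 * (1 + a\<^sup>2 + b\<^sup>2)" for a b :: real
  proof -
    have *: "2 * t \<le> 1 + t\<^sup>2" for t :: real using zero_le_power2[of "t - 1"] by (simp add: power2_diff)
    show ?thesis using *[of a] *[of b] zero_le_power2[of a] zero_le_power2[of b] by argo
  qed
  then show ?thesis unfolding size2_def .
qed

text \<open>Coefficient of the first copy's noise in the increment of \<open>weight\<close>; the
  reflection is self-adjoint and is moved from the noise to the coefficient.\<close>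

definition noise_grad :: "real \<Rightarrow> 'n state \<times> 'n state \<Rightarrow> real^'n" where
  "noise_grad \<xi> zz = \<epsilon> *\<^sub>R (noise_coeff (fst zz) + rotate_noise \<xi> zz (noise_coeff (snd zz)))"

text \<open>The rotated noise has the same norm as the original one, so the second-order terms of
  the two copies simply add up.\<close>

lemma weight_step:
  obtains K where "K > 0"
    "\<And>s zz N \<xi>. 0 < s \<Longrightarrow> s \<le> 1 \<Longrightarrow> 0 < \<xi> \<Longrightarrow>
      weight (coupled_step \<xi> s zz N) \<le> weight zz + s * (N \<bullet> noise_grad \<xi> zz)
        + s\<^sup>2 * (\<epsilon> * \<gamma> * (2 * A - lam * Hsum zz) + 2 * \<epsilon> * \<gamma> * (norm N)\<^sup>2)
        + K * s ^ 3 * (size2 zz * (1 + norm N)\<^sup>2)"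
    "\<And>zz \<xi>. 0 < \<xi> \<Longrightarrow> norm (noise_grad \<xi> zz) \<le> K * size2 zz"
    "\<And>zz. \<bar>\<epsilon> * \<gamma> * (2 * A - lam * Hsum zz)\<bar> + \<bar>2 * \<epsilon> * \<gamma>\<bar> \<le> K * size2 zz"
proof -
  obtain K1 where K1: "K1 > 0" "\<And>s z N. 0 < s \<Longrightarrow> s \<le> 1 \<Longrightarrow>
      H (euler s z N) \<le> H z + s * (noise_coeff z \<bullet> N) + s\<^sup>2 * (\<gamma> * (A - lam * H z + (norm N)\<^sup>2))
        + K1 * s ^ 3 * ((1 + (norm z)\<^sup>2) * (1 + norm N)\<^sup>2)" using H_step by blast
  obtain K2 where K2: "K2 > 0" "\<And>z. norm (noise_coeff z) \<le> K2 * (1 + norm z)" using noise_coeff_growth by blast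
  obtain K3 where K3: "K3 > 0" "\<And>zz. Hsum zz \<le> K3 * size2 zz" using weight_growth by metis
  define k1 where "k1 = \<epsilon> * (2 * K1)"
  define k2 where "k2 = \<epsilon> * (K2 * 4)"
  define k3 where "k3 = \<epsilon> * \<gamma> * (2 * A + lam * K3) + 2 * \<epsilon> * \<gamma>"
  have k: "k1 > 0" "k2 > 0" "k3 > 0" using K1 K2 K3 \<epsilon>_pos \<gamma> A lam
    by (auto simp: k1_def k2_def k3_def intro!: add_pos_pos mult_pos_pos)
  define K where "K = k1 + k2 + k3"
  have K: "K > 0" "k1 \<le> K" "k2 \<le> K" "k3 \<le> K" using k by (auto simp: K_def)
  have up: "k * t \<le> K * t" if "k \<le> K" "0 \<le> t" for k t using that by (rule mult_right_mono)
  show ?thesis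
  proof (rule that[OF K(1)])
    fix s \<xi> :: real and zz :: "'n state \<times> 'n state" and N :: "real^'n"
    assume s: "0 < s" "s \<le> 1" and \<xi>: "0 < \<xi>"
    let ?N = "rotate_noise \<xi> zz N" and ?y = "(1 + norm N)\<^sup>2"
    have nN: "norm ?N = norm N" using rotate_noise[OF \<xi>] by simp
    have "weight (coupled_step \<xi> s zz N) = 1 + \<epsilon> * (H (euler s (fst zz) N) + H (euler s (snd zz) ?N))"
      by (simp add: weight_def Hsum_def coupled_step_def)
    also have "\<dots> \<le> 1 + \<epsilon> * ((H (fst zz) + s * (noise_coeff (fst zz) \<bullet> N) + s\<^sup>2 * (\<gamma> * (A - lam * H (fst zz) + (norm N)\<^sup>2))
        + K1 * s ^ 3 * ((1 + (norm (fst zz))\<^sup>2) * ?y))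
       + (H (snd zz) + s * (noise_coeff (snd zz) \<bullet> ?N) + s\<^sup>2 * (\<gamma> * (A - lam * H (snd zz) + (norm N)\<^sup>2))
        + K1 * s ^ 3 * ((1 + (norm (snd zz))\<^sup>2) * ?y)))"
      using K1(2)[OF s, of "fst zz" N] K1(2)[OF s, of "snd zz" ?N] \<epsilon>_pos unfolding nN
      by (intro add_left_mono mult_left_mono add_mono) auto
    also have "noise_coeff (snd zz) \<bullet> ?N = rotate_noise \<xi> zz (noise_coeff (snd zz)) \<bullet> N"
      using rotate_noise(4)[OF \<xi>] by simp
    also have "1 + \<epsilon> * ((H (fst zz) + s * (noise_coeff (fst zz) \<bullet> N) + s\<^sup>2 * (\<gamma> * (A - lam * H (fst zz) + (norm N)\<^sup>2))
        + K1 * s ^ 3 * ((1 + (norm (fst zz))\<^sup>2) * ?y))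
       + (H (snd zz) + s * (rotate_noise \<xi> zz (noise_coeff (snd zz)) \<bullet> N) + s\<^sup>2 * (\<gamma> * (A - lam * H (snd zz) + (norm N)\<^sup>2))
        + K1 * s ^ 3 * ((1 + (norm (snd zz))\<^sup>2) * ?y)))
     = weight zz + s * (N \<bullet> noise_grad \<xi> zz)
        + s\<^sup>2 * (\<epsilon> * \<gamma> * (2 * A - lam * Hsum zz) + 2 * \<epsilon> * \<gamma> * (norm N)\<^sup>2)
        + \<epsilon> * K1 * (s ^ 3 * ((1 + size2 zz) * ?y))"
      by (simp add: weight_def Hsum_def noise_grad_def size2_def inner_simps inner_commute[of N] algebra_simps)
    also have "\<epsilon> * K1 * (s ^ 3 * ((1 + size2 zz) * ?y)) \<le> \<epsilon> * K1 * (s ^ 3 * ((2 * size2 zz) * ?y))"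
      using \<epsilon>_pos K1 s size2_ge_1[of zz] by (intro mult_left_mono mult_right_mono) auto
    also have "\<dots> = k1 * (s ^ 3 * (size2 zz * ?y))" by (simp add: k1_def)
    also have "\<dots> \<le> K * (s ^ 3 * (size2 zz * ?y))" using K s size2_ge_1[of zz] by (intro up) auto
    finally show "weight (coupled_step \<xi> s zz N) \<le> weight zz + s * (N \<bullet> noise_grad \<xi> zz)
        + s\<^sup>2 * (\<epsilon> * \<gamma> * (2 * A - lam * Hsum zz) + 2 * \<epsilon> * \<gamma> * (norm N)\<^sup>2)
        + K * s ^ 3 * (size2 zz * (1 + norm N)\<^sup>2)" by (simp add: mult.assoc)
  next
    fix zz :: "'n state \<times> 'n state" and \<xi> :: real assume \<xi>: "0 < \<xi>"
    have "norm (noise_grad \<xi> zz) \<le> \<epsilon> * (norm (noise_coeff (fst zz)) + norm (noise_coeff (snd zz)))"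
      unfolding noise_grad_def using \<epsilon>_pos
      norm_triangle_ineq[of "noise_coeff (fst zz)" "rotate_noise \<xi> zz (noise_coeff (snd zz))"] rotate_noise(2)[OF \<xi>]
      by (simp add: mult_left_mono)
    also have "\<dots> \<le> \<epsilon> * (K2 * (1 + norm (fst zz)) + K2 * (1 + norm (snd zz)))"
      using K2 \<epsilon>_pos by (intro mult_left_mono add_mono) auto
    also have "\<dots> = \<epsilon> * (K2 * ((1 + norm (fst zz)) + (1 + norm (snd zz))))" by (simp add: algebra_simps)
    also have "\<dots> \<le> \<epsilon> * (K2 * (4 * size2 zz))"
      using one_plus_norm_le_size2[of zz] \<epsilon>_pos K2 by (intro mult_left_mono) auto
    also have "\<dots> = k2 * size2 zz" by (simp add: k2_def)
    also have "\<dots> \<le> K * size2 zz" using K size2_ge_1[of zz] by (intro up) auto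
    finally show "norm (noise_grad \<xi> zz) \<le> K * size2 zz" .
  next
    fix zz :: "'n state \<times> 'n state"
    have S: "1 \<le> size2 zz" by (rule size2_ge_1)
    have "\<bar>2 * A - lam * Hsum zz\<bar> \<le> 2 * A + lam * Hsum zz"
      using A lam Hsum_nonneg[of zz] mult_nonneg_nonneg[of lam "Hsum zz"] by (auto simp: abs_if)
    also have "\<dots> \<le> 2 * A * size2 zz + lam * (K3 * size2 zz)"
      using A lam K3 S by (intro add_mono mult_left_mono) auto
    finally have "\<epsilon> * \<gamma> * \<bar>2 * A - lam * Hsum zz\<bar> \<le> \<epsilon> * \<gamma> * (2 * A * size2 zz + lam * (K3 * size2 zz))"
      using \<epsilon>_pos \<gamma> by (intro mult_left_mono) auto
    moreover have "2 * \<epsilon> * \<gamma> * 1 \<le> 2 * \<epsilon> * \<gamma> * size2 zz" using S \<epsilon>_pos \<gamma> by (intro mult_left_mono) auto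
    ultimately have "\<bar>\<epsilon> * \<gamma> * (2 * A - lam * Hsum zz)\<bar> + \<bar>2 * \<epsilon> * \<gamma>\<bar> \<le> k3 * size2 zz"
    proof -
      assume *: "\<epsilon> * \<gamma> * \<bar>2 * A - lam * Hsum zz\<bar> \<le> \<epsilon> * \<gamma> * (2 * A * size2 zz + lam * (K3 * size2 zz))"
        "2 * \<epsilon> * \<gamma> * 1 \<le> 2 * \<epsilon> * \<gamma> * size2 zz"
      have "\<bar>\<epsilon> * \<gamma> * (2 * A - lam * Hsum zz)\<bar> = \<epsilon> * \<gamma> * \<bar>2 * A - lam * Hsum zz\<bar>" "\<bar>2 * \<epsilon> * \<gamma>\<bar> = 2 * \<epsilon> * \<gamma> * 1"
        using \<epsilon>_pos \<gamma> by (simp_all add: abs_mult)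
      moreover have "k3 * size2 zz = \<epsilon> * \<gamma> * (2 * A * size2 zz + lam * (K3 * size2 zz)) + 2 * \<epsilon> * \<gamma> * size2 zz"
        by (simp add: k3_def algebra_simps)
      ultimately show ?thesis using * by linarith
    qed
    also have "\<dots> \<le> K * size2 zz" using K S by (intro up) auto
    finally show "\<bar>\<epsilon> * \<gamma> * (2 * A - lam * Hsum zz)\<bar> + \<bar>2 * \<epsilon> * \<gamma>\<bar> \<le> K * size2 zz" .
  qed
qed

lemma dist_drift_bound:
  assumes "rad zz < R1"
  shows "\<bar>dist_drift zz\<bar> \<le> \<gamma> * \<alpha> * (R1 + R1 / \<alpha>)"
proof -
  have q: "norm (qdiff zz) \<le> R1" using assms \<alpha> by (simp add: rad_def) (smt (verit) mult_nonneg_nonneg norm_ge_zero)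
  have "\<alpha> * norm (zdiff zz) \<le> R1" using assms norm_ge_zero[of "qdiff zz"] unfolding rad_def by linarith
  then have a: "norm (zdiff zz) \<le> R1 / \<alpha>" using \<alpha> by (simp add: field_simps)
  have "norm (zdiff zz) / (1 + \<Lambda>) \<le> norm (zdiff zz) / 1" using \<Lambda>_pos by (intro divide_left_mono) auto
  then have "norm (zdiff zz) / (1 + \<Lambda>) \<le> R1 / \<alpha>" using a by simp
  moreover have "0 \<le> norm (zdiff zz) / (1 + \<Lambda>)" using \<Lambda>_pos by simp
  ultimately have "\<bar>norm (qdiff zz) - norm (zdiff zz) / (1 + \<Lambda>)\<bar> \<le> R1 + R1 / \<alpha>"
    using q norm_ge_zero[of "qdiff zz"] R1_pos by linarith
  then show ?thesis unfolding dist_drift_def abs_mult using \<gamma> \<alpha> by (intro mult_mono) auto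
qed

text \<open>The modulus of |q| + s \<sigma> \<zeta> differs from this number only when the noise
  exceeds |q| >= \<xi>. Then s \<sigma> y / \<xi> >= 1, and inserting this factor twice makes the
  overshoot m cubic in s, at the price of \<xi>^-2. Gaussian tails are thus handled by powers
  alone.\<close>

lemma profile_step_reflection:
  assumes \<xi>: "0 < \<xi>" "\<xi> \<le> 1"
  obtains K where "K > 0"
    "\<And>s zz N. 0 < s \<Longrightarrow> s \<le> 1 \<Longrightarrow> s\<^sup>2 * \<gamma> \<le> 1 \<Longrightarrow> \<xi> \<le> norm (qdiff zz) \<Longrightarrow> rad zz < R1 \<Longrightarrow>
      f (rad (coupled_step \<xi> s zz N)) \<le> f (rad zz)
        + s * (f' (rad zz) * \<sigma> * (N \<bullet> ((1 / norm (qdiff zz)) *\<^sub>R qdiff zz)))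
        + s\<^sup>2 * (f' (rad zz) * dist_drift zz + f'' (rad zz) / 2 * \<sigma>\<^sup>2 * (N \<bullet> ((1 / norm (qdiff zz)) *\<^sub>R qdiff zz))\<^sup>2)
        + K * s ^ 3 * (1 + norm N) ^ 9"
proof -
  obtain C where C: "C \<ge> 0" "\<And>r s. \<lbrakk>0 \<le> r; r \<le> R1; 0 \<le> s\<rbrakk> \<Longrightarrow>
      f s \<le> f r + f' r * (s - r) + f'' r / 2 * (s - r)\<^sup>2 + C * \<bar>s - r\<bar> ^ 3" using f_calculus by metis
  define Kb where "Kb = \<gamma> * \<alpha> * (R1 + R1 / \<alpha>)"
  define Kf where "Kf = (a + \<kappa>) * R1"
  define Km where "Km = 2 * \<sigma> ^ 3 / \<xi>\<^sup>2"
  define K where "K = Km + Kf * (2 * \<sigma> * (Kb + Km) + (Kb + Km)\<^sup>2) + C * (\<sigma> + (Kb + Km)) ^ 3"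
  have pos: "Kb \<ge> 0" "Kf \<ge> 0" "Km > 0" using \<gamma> \<alpha> R1_pos a_pos \<kappa>_pos \<sigma>_pos \<xi> by (auto simp: Kb_def Kf_def Km_def)
  have K: "K > 0" using pos \<sigma>_pos C(1) by (simp add: K_def add_pos_nonneg)
  show ?thesis
  proof (rule that[OF K])
    fix s :: real and zz :: "'n state \<times> 'n state" and N :: "real^'n"
    assume s: "0 < s" "s \<le> 1" "s\<^sup>2 * \<gamma> \<le> 1" and q: "\<xi> \<le> norm (qdiff zz)" and r: "rad zz < R1"
    define \<zeta> where "\<zeta> = N \<bullet> ((1 / norm (qdiff zz)) *\<^sub>R qdiff zz)"
    define y where "y = 1 + norm N"
    let ?q = "norm (qdiff zz)" and ?r = "rad zz" and ?b = "dist_drift zz"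
    define D where "D = (\<bar>?q + s * \<sigma> * \<zeta>\<bar> - ?q) + s\<^sup>2 * ?b"
    \<comment> \<open>D splits into the linear noise term and \<delta> = O(s^2 y^3), so only s
      \<sigma> \<zeta> contributes to its square at order s^2.\<close>
    define \<delta> where "\<delta> = D - s * \<sigma> * \<zeta>"
    have r0: "0 \<le> ?r" by (rule rad_nonneg)
    have y1: "1 \<le> y" by (simp add: y_def)
    have \<zeta>: "\<bar>\<zeta>\<bar> \<le> y"
    proof -
      have "norm ((1 / ?q) *\<^sub>R qdiff zz) = 1" using q \<xi> by auto
      then show ?thesis using Cauchy_Schwarz_ineq2[of N "(1 / ?q) *\<^sub>R qdiff zz"] by (simp add: \<zeta>_def y_def)
    qed
    have s\<zeta>: "\<bar>s * \<sigma> * \<zeta>\<bar> \<le> s * \<sigma> * y" using \<zeta> s \<sigma>_pos by (simp add: abs_mult)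
    define m where "m = \<bar>?q + s * \<sigma> * \<zeta>\<bar> - ?q - s * \<sigma> * \<zeta>"
    have m: "0 \<le> m" "m \<le> Km * s ^ 3 * y ^ 3"
    proof -
      show "0 \<le> m" unfolding m_def using abs_ge_self[of "?q + s * \<sigma> * \<zeta>"] by linarith
      show "m \<le> Km * s ^ 3 * y ^ 3"
      proof (cases "0 \<le> ?q + s * \<sigma> * \<zeta>")
        case True
        then show ?thesis using pos s y1 by (simp add: m_def)
      next
        case False
        define t where "t = s * \<sigma> * y"
        have t: "\<xi> \<le> t" using False q s\<zeta> by (simp add: t_def abs_if split: if_splits)
        have "m = - 2 * (s * \<sigma> * \<zeta>) - 2 * ?q" using False by (simp add: m_def)
        then have "m \<le> 2 * t" using s\<zeta> norm_ge_zero[of "qdiff zz"] unfolding t_def by linarith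
        also have "\<dots> \<le> 2 * t * (t / \<xi>)\<^sup>2"
        proof -
          have "1 \<le> (t / \<xi>)\<^sup>2" using t \<xi> by (intro one_le_power) simp
          then show ?thesis using t \<xi> by (simp add: mult_le_cancel_left1)
        qed
        also have "\<dots> = Km * s ^ 3 * y ^ 3"
          by (simp add: Km_def t_def power_mult_distrib power_divide power2_eq_square power3_eq_cube)
        finally show ?thesis .
      qed
    qed
    have \<delta>_eq: "\<delta> = m + s\<^sup>2 * ?b" by (simp add: \<delta>_def D_def m_def)
    have b: "\<bar>?b\<bar> \<le> Kb" using dist_drift_bound[OF r] by (simp add: Kb_def)
    have sy: "s ^ i * y ^ j \<le> s ^ k * y ^ l" if "k \<le> i" "j \<le> l" for i j k l
      using that s y1 by (intro mult_mono power_decreasing power_increasing) auto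
    have \<delta>: "\<bar>\<delta>\<bar> \<le> (Kb + Km) * (s\<^sup>2 * y ^ 3)"
    proof -
      have "\<bar>\<delta>\<bar> \<le> m + s\<^sup>2 * \<bar>?b\<bar>" unfolding \<delta>_eq
        using abs_triangle_ineq[of m "s\<^sup>2 * ?b"] m(1) by (simp add: abs_mult)
      also have "\<dots> \<le> Km * (s ^ 3 * y ^ 3) + Kb * (s ^ 2 * y ^ 0)"
        using m(2) b by (intro add_mono) (auto simp: mult.assoc mult.commute[of Kb] mult_left_mono)
      also have "\<dots> \<le> Km * (s ^ 2 * y ^ 3) + Kb * (s ^ 2 * y ^ 3)"
        using pos by (intro add_mono mult_left_mono sy) auto
      finally show ?thesis by (simp add: algebra_simps)
    qed
    have D: "rad (coupled_step \<xi> s zz N) \<le> ?r + D"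
      using rad_step_reflection[OF s(1,3) \<xi>(1) q r, of N] by (simp add: D_def \<zeta>_def)
    then have rD: "0 \<le> ?r + D" using rad_nonneg order_trans by blast
    have "f (rad (coupled_step \<xi> s zz N)) \<le> f (?r + D)" using D rad_nonneg by (intro f_mono) auto
    also have "\<dots> \<le> f ?r + f' ?r * D + f'' ?r / 2 * D\<^sup>2 + C * \<bar>D\<bar> ^ 3"
      using C(2)[OF r0 _ rD] r by simp
    also have "f' ?r * D = s * (f' ?r * \<sigma> * \<zeta>) + s\<^sup>2 * (f' ?r * ?b) + f' ?r * m"
      by (simp add: D_def m_def algebra_simps)
    also have "f'' ?r / 2 * D\<^sup>2 = s\<^sup>2 * (f'' ?r / 2 * \<sigma>\<^sup>2 * \<zeta>\<^sup>2) + f'' ?r / 2 * (2 * (s * \<sigma> * \<zeta>) * \<delta> + \<delta>\<^sup>2)"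
    proof -
      have "D = s * \<sigma> * \<zeta> + \<delta>" by (simp add: \<delta>_def)
      then show ?thesis by (simp add: power2_eq_square field_simps)
    qed
    also have "f' ?r * m \<le> Km * (s ^ 3 * y ^ 9)"
    proof -
      have "f' ?r * m \<le> 1 * (Km * s ^ 3 * y ^ 3)"
        using f'_bounds(3,4)[OF r0] r m by (intro mult_mono) auto
      also have "\<dots> = Km * (s ^ 3 * y ^ 3)" by simp
      also have "\<dots> \<le> Km * (s ^ 3 * y ^ 9)" using pos by (intro mult_left_mono sy) auto
      finally show ?thesis .
    qed
    also have "f'' ?r / 2 * (2 * (s * \<sigma> * \<zeta>) * \<delta> + \<delta>\<^sup>2) \<le> Kf * (2 * \<sigma> * (Kb + Km) + (Kb + Km)\<^sup>2) * (s ^ 3 * y ^ 9)"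
    proof -
      have t1: "\<bar>2 * (s * \<sigma> * \<zeta>) * \<delta>\<bar> \<le> 2 * \<sigma> * (Kb + Km) * (s ^ 3 * y ^ 9)"
      proof -
        have "\<bar>2 * (s * \<sigma> * \<zeta>) * \<delta>\<bar> = 2 * (\<bar>s * \<sigma> * \<zeta>\<bar> * \<bar>\<delta>\<bar>)" by (simp add: abs_mult)
        also have "\<dots> \<le> 2 * ((s * \<sigma> * y) * ((Kb + Km) * (s\<^sup>2 * y ^ 3)))"
          using s\<zeta> \<delta> s \<sigma>_pos y1 by (intro mult_left_mono mult_mono) auto
        also have "\<dots> = 2 * \<sigma> * (Kb + Km) * (s ^ 3 * y ^ 4)" by (simp add: power2_eq_square power3_eq_cube power4_eq_xxxx)
        also have "\<dots> \<le> 2 * \<sigma> * (Kb + Km) * (s ^ 3 * y ^ 9)" using pos \<sigma>_pos by (intro mult_left_mono sy) auto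
        finally show ?thesis .
      qed
      have t2: "\<delta>\<^sup>2 \<le> (Kb + Km)\<^sup>2 * (s ^ 3 * y ^ 9)"
      proof -
        have "\<delta>\<^sup>2 = \<bar>\<delta>\<bar>\<^sup>2" by simp
        also have "\<dots> \<le> ((Kb + Km) * (s\<^sup>2 * y ^ 3))\<^sup>2" using \<delta> by (intro power_mono) auto
        also have "\<dots> = (Kb + Km)\<^sup>2 * (s ^ 4 * y ^ 6)" by (simp add: power_mult_distrib flip: power_mult)
        also have "\<dots> \<le> (Kb + Km)\<^sup>2 * (s ^ 3 * y ^ 9)" by (intro mult_left_mono sy) auto
        finally show ?thesis .
      qed
      have "f'' ?r / 2 * (2 * (s * \<sigma> * \<zeta>) * \<delta> + \<delta>\<^sup>2) \<le> \<bar>f'' ?r\<bar> * (\<bar>2 * (s * \<sigma> * \<zeta>) * \<delta>\<bar> + \<delta>\<^sup>2)"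
      proof -
        have "f'' ?r / 2 * (2 * (s * \<sigma> * \<zeta>) * \<delta> + \<delta>\<^sup>2) \<le> \<bar>f'' ?r / 2\<bar> * \<bar>2 * (s * \<sigma> * \<zeta>) * \<delta> + \<delta>\<^sup>2\<bar>"
          by (metis abs_ge_self abs_mult)
        also have "\<dots> \<le> \<bar>f'' ?r\<bar> * (\<bar>2 * (s * \<sigma> * \<zeta>) * \<delta>\<bar> + \<delta>\<^sup>2)"
          using abs_triangle_ineq[of "2 * (s * \<sigma> * \<zeta>) * \<delta>" "\<delta>\<^sup>2"] by (intro mult_mono) auto
        finally show ?thesis .
      qed
      also have "\<dots> \<le> Kf * (2 * \<sigma> * (Kb + Km) * (s ^ 3 * y ^ 9) + (Kb + Km)\<^sup>2 * (s ^ 3 * y ^ 9))"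
        using f''_bounds(2)[OF r0] r t1 t2 pos by (intro mult_mono add_mono) (auto simp: Kf_def)
      finally show ?thesis by (simp add: algebra_simps)
    qed
    \<comment> \<open>Cubing the bound const * s y^3 for |D| is the source of the ninth power of
      y.\<close>
    also have "C * \<bar>D\<bar> ^ 3 \<le> C * (\<sigma> + (Kb + Km)) ^ 3 * (s ^ 3 * y ^ 9)"
    proof -
      have "\<bar>D\<bar> \<le> \<bar>s * \<sigma> * \<zeta>\<bar> + \<bar>\<delta>\<bar>" by (simp add: \<delta>_def)
      also have "\<dots> \<le> \<sigma> * (s ^ 1 * y ^ 1) + (Kb + Km) * (s ^ 2 * y ^ 3)"
        using s\<zeta> \<delta> by (intro add_mono) (auto simp: mult_ac)
      also have "\<dots> \<le> \<sigma> * (s ^ 1 * y ^ 3) + (Kb + Km) * (s ^ 1 * y ^ 3)"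
        using pos \<sigma>_pos by (intro add_mono mult_left_mono sy) auto
      finally have "\<bar>D\<bar> \<le> (\<sigma> + (Kb + Km)) * (s * y ^ 3)" by (simp add: algebra_simps)
      then have "\<bar>D\<bar> ^ 3 \<le> ((\<sigma> + (Kb + Km)) * (s * y ^ 3)) ^ 3" by (intro power_mono) auto
      also have "\<dots> = (\<sigma> + (Kb + Km)) ^ 3 * (s ^ 3 * y ^ 9)" by (simp add: power_mult_distrib flip: power_mult)
      finally show ?thesis using C(1) by (simp add: mult.assoc mult_left_mono)
    qed
    finally have "f (rad (coupled_step \<xi> s zz N)) \<le> f ?r
        + s * (f' ?r * \<sigma> * \<zeta>) + s\<^sup>2 * (f' ?r * ?b + f'' ?r / 2 * \<sigma>\<^sup>2 * \<zeta>\<^sup>2) + K * (s ^ 3 * y ^ 9)"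
      by (simp add: K_def algebra_simps)
    then show "f (rad (coupled_step \<xi> s zz N)) \<le> f (rad zz)
        + s * (f' (rad zz) * \<sigma> * (N \<bullet> ((1 / norm (qdiff zz)) *\<^sub>R qdiff zz)))
        + s\<^sup>2 * (f' (rad zz) * dist_drift zz + f'' (rad zz) / 2 * \<sigma>\<^sup>2 * (N \<bullet> ((1 / norm (qdiff zz)) *\<^sub>R qdiff zz))\<^sup>2)
        + K * s ^ 3 * (1 + norm N) ^ 9"
      by (simp add: \<zeta>_def y_def mult.assoc)
  qed
qed

section \<open>Continuity and measurability\<close>

lemma continuous_H: "continuous_on S H"
  unfolding lyapH_def
  by (intro continuous_intros continuous_on_compose2[OF continuous_U[of UNIV]]) auto

lemma continuous_rad: "continuous_on S rad"
  unfolding rad_def[abs_def] zdiff_def qdiff_def by (intro continuous_intros)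

lemma continuous_rho: "continuous_on S rho"
  unfolding rho_def[abs_def] weight_def Hsum_def
  by (intro continuous_intros continuous_on_compose2[OF continuous_f continuous_rad]
      continuous_on_compose2[OF continuous_H[of UNIV]]) (auto simp: rad_nonneg)

lemma measurable_fst_snd_borel[measurable]:
  "fst \<in> borel_measurable (borel :: ('a::topological_space \<times> 'b::topological_space) measure)"
  "snd \<in> borel_measurable (borel :: ('a::topological_space \<times> 'b::topological_space) measure)"
  by (auto intro!: borel_measurable_continuous_onI continuous_intros)

lemma measurable_gradU[measurable]: "gradU \<in> borel_measurable borel"
  by (rule borel_measurable_continuous_onI[OF continuous_gradU])

lemma measurable_H[measurable]: "H \<in> borel_measurable borel"
  by (rule borel_measurable_continuous_onI[OF continuous_H])

lemma measurable_rad[measurable]: "rad \<in> borel_measurable borel"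
  by (rule borel_measurable_continuous_onI[OF continuous_rad])

lemma measurable_rho[measurable]: "rho \<in> borel_measurable borel"
  by (rule borel_measurable_continuous_onI[OF continuous_rho])

lemma measurable_f_rad[measurable]: "(\<lambda>zz. f (rad zz)) \<in> borel_measurable borel"
  by (intro borel_measurable_continuous_onI continuous_on_compose2[OF continuous_f continuous_rad])
    (auto simp: rad_nonneg)

lemma measurable_weight[measurable]: "weight \<in> borel_measurable borel"
  unfolding weight_def[abs_def] Hsum_def by measurable

lemma measurable_size2[measurable]: "size2 \<in> borel_measurable borel"
  unfolding size2_def[abs_def] by measurable

lemma measurable_qdiff[measurable]: "qdiff \<in> borel_measurable borel"
  unfolding qdiff_def[abs_def] zdiff_def by measurable

lemma measurable_euler[measurable (raw)]:
  assumes [measurable]: "g \<in> borel_measurable M" "h \<in> borel_measurable M"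
  shows "(\<lambda>x. euler s (g x) (h x)) \<in> borel_measurable M"
  unfolding euler_def by (intro borel_measurable_Pair) measurable

lemma measurable_rotate_noise[measurable (raw)]:
  assumes [measurable]: "g \<in> borel_measurable M" "h \<in> borel_measurable M"
  shows "(\<lambda>x. rotate_noise \<xi> (g x) (h x)) \<in> borel_measurable M"
  unfolding rotate_noise_def householder_def by measurable

lemma measurable_coupled_step[measurable (raw)]:
  assumes [measurable]: "g \<in> borel_measurable M" "h \<in> borel_measurable M"
  shows "(\<lambda>x. coupled_step \<xi> s (g x) (h x)) \<in> borel_measurable M"
  unfolding coupled_step_def by (intro borel_measurable_Pair) measurable

text \<open>The constant K0 in front of \<xi> is fixed before \<xi>, whereas K, which inherits the
  factor \<xi>^-2 of the reflection remainder, may depend on it. This order allows \<xi> to be made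
  small first.\<close>

lemma one_step_expansion:
  obtains K0 where "K0 \<ge> 0"
    "\<And>\<xi>. 0 < \<xi> \<Longrightarrow> \<xi> \<le> 1 \<Longrightarrow> \<exists>K\<ge>0. \<forall>s zz. 0 < s \<longrightarrow> s \<le> 1 \<longrightarrow> s\<^sup>2 * \<gamma> \<le> 1 \<longrightarrow>
      integrable std_gauss (\<lambda>N. rho (coupled_step \<xi> s zz N)) \<and>
      (\<integral>N. rho (coupled_step \<xi> s zz N) \<partial>std_gauss) \<le> rho zz + s\<^sup>2 * (- c * rho zz + K0 * \<xi> * size2 zz) + K * size2 zz * s ^ 3"
proof -
  obtain Ks where Ks: "Ks \<ge> 0"
    "\<And>zz \<xi>. 0 < \<xi> \<Longrightarrow> \<xi> \<le> 1 \<Longrightarrow> norm (qdiff zz) < \<xi> \<Longrightarrow> rad zz < R1 \<Longrightarrow>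
      f' (rad zz) * dist_drift zz * weight zz + f (rad zz) * (\<epsilon> * \<gamma> * (2 * (real CARD('n) + A) - lam * Hsum zz))
        \<le> - c * (f (rad zz) * weight zz) + Ks * \<xi> * weight zz"
    using synchronous_drift by metis
  obtain Kw where Kw: "Kw > 0" "\<And>zz. weight zz \<le> Kw * size2 zz" using weight_growth by metis
  obtain Kg where Kg: "Kg > 0"
    "\<And>s zz N \<xi>. 0 < s \<Longrightarrow> s \<le> 1 \<Longrightarrow> 0 < \<xi> \<Longrightarrow>
      weight (coupled_step \<xi> s zz N) \<le> weight zz + s * (N \<bullet> noise_grad \<xi> zz)
        + s\<^sup>2 * (\<epsilon> * \<gamma> * (2 * A - lam * Hsum zz) + 2 * \<epsilon> * \<gamma> * (norm N)\<^sup>2)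
        + Kg * s ^ 3 * (size2 zz * (1 + norm N)\<^sup>2)"
    "\<And>zz \<xi>. 0 < \<xi> \<Longrightarrow> norm (noise_grad \<xi> zz) \<le> Kg * size2 zz"
    "\<And>zz. \<bar>\<epsilon> * \<gamma> * (2 * A - lam * Hsum zz)\<bar> + \<bar>2 * \<epsilon> * \<gamma>\<bar> \<le> Kg * size2 zz"
    using weight_step by metis
  define M where "M = (\<integral>N. (1 + norm N) ^ 11 \<partial>(std_gauss :: (real^'n) measure))"
  have M0: "0 \<le> M" unfolding M_def by (intro integral_nonneg_AE) auto
  show ?thesis
  proof (rule that[of "Ks * Kw"])
    show "0 \<le> Ks * Kw" using Ks Kw by simp
    fix \<xi> :: real assume \<xi>: "0 < \<xi>" "\<xi> \<le> 1"
    obtain Kf where Kf: "Kf > 0"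
      "\<And>s zz N. 0 < s \<Longrightarrow> s \<le> 1 \<Longrightarrow> s\<^sup>2 * \<gamma> \<le> 1 \<Longrightarrow> \<xi> \<le> norm (qdiff zz) \<Longrightarrow> rad zz < R1 \<Longrightarrow>
      f (rad (coupled_step \<xi> s zz N)) \<le> f (rad zz)
        + s * (f' (rad zz) * \<sigma> * (N \<bullet> ((1 / norm (qdiff zz)) *\<^sub>R qdiff zz)))
        + s\<^sup>2 * (f' (rad zz) * dist_drift zz + f'' (rad zz) / 2 * \<sigma>\<^sup>2 * (N \<bullet> ((1 / norm (qdiff zz)) *\<^sub>R qdiff zz))\<^sup>2)
        + Kf * s ^ 3 * (1 + norm N) ^ 9"
      using profile_step_reflection[OF \<xi>] by metis
    define Kb where "Kb = \<gamma> * \<alpha> * (R1 + R1 / \<alpha>)"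
    define Kp where "Kp = (a + \<kappa>) * R1"
    define K where "K = R1 + \<sigma> + (Kb + Kp * \<sigma>\<^sup>2) + Kw + Kg + Kf"
    have pos: "0 \<le> R1" "0 \<le> \<sigma>" "0 \<le> Kb" "0 \<le> Kp * \<sigma>\<^sup>2" "0 \<le> Kw" "0 \<le> Kg" "0 \<le> Kf"
      using R1_pos \<sigma>_pos \<gamma> \<alpha> a_pos \<kappa>_pos Kw Kg Kf by (auto simp: Kb_def Kp_def)
    have K: "0 \<le> K" "R1 \<le> K" "\<sigma> \<le> K" "Kb + Kp * \<sigma>\<^sup>2 \<le> K" "Kw \<le> K" "Kg \<le> K" "Kf \<le> K"
      unfolding K_def using pos by linarith+
    have "integrable std_gauss (\<lambda>N. rho (coupled_step \<xi> s zz N)) \<and>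
      (\<integral>N. rho (coupled_step \<xi> s zz N) \<partial>std_gauss) \<le> rho zz + s\<^sup>2 * (- c * rho zz + Ks * Kw * \<xi> * size2 zz) + 10 * K\<^sup>2 * M * size2 zz * s ^ 3"
      if s: "0 < s" "s \<le> 1" "s\<^sup>2 * \<gamma> \<le> 1" for s zz
    proof -
      let ?r = "rad zz" and ?G = "weight zz" and ?X = "size2 zz" and ?m = "noise_grad \<xi> zz"
      define D where "D = \<epsilon> * \<gamma> * (2 * A - lam * Hsum zz)"
      have r0: "0 \<le> ?r" by (rule rad_nonneg)
      have X1: "1 \<le> ?X" by (rule size2_ge_1)
      have up: "k * t \<le> K * t" if "k \<le> K" "0 \<le> t" for k t using that by (rule mult_right_mono)
      have f_abs: "\<bar>f ?r\<bar> \<le> K" using f_nonneg[OF r0] f_le_R[OF r0] K by simp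
      have G_abs: "\<bar>?G\<bar> \<le> K * ?X" using weight_ge_1[of zz] Kw(2)[of zz] up[OF K(5), of ?X] X1 by linarith
      have m_abs: "norm ?m \<le> K * ?X" using Kg(3)[OF \<xi>(1), of zz] up[OF K(6), of ?X] X1 by linarith
      have D_abs: "\<bar>D\<bar> + \<bar>2 * \<epsilon> * \<gamma>\<bar> \<le> K * ?X"
        unfolding D_def using Kg(4)[of zz] up[OF K(6), of ?X] X1 by linarith
      have F0: "0 \<le> f (rad (coupled_step \<xi> s zz N))" for N by (intro f_nonneg rad_nonneg)
      have G0: "0 \<le> weight (coupled_step \<xi> s zz N)" for N using weight_ge_1[of "coupled_step \<xi> s zz N"] by simp
      have G_step: "weight (coupled_step \<xi> s zz N) \<le> ?G + s * (N \<bullet> ?m)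
        + s\<^sup>2 * (D + 2 * \<epsilon> * \<gamma> * (norm N)\<^sup>2) + K * s ^ 3 * (?X * (1 + norm N)\<^sup>2)" for N
      proof -
        have "Kg * s ^ 3 * (?X * (1 + norm N)\<^sup>2) \<le> K * s ^ 3 * (?X * (1 + norm N)\<^sup>2)"
          using K(6) s X1 by (intro mult_right_mono) auto
        then show ?thesis using Kg(2)[OF s(1,2) \<xi>(1), of zz N] unfolding D_def by linarith
      qed
      have meas: "(\<lambda>N. f (rad (coupled_step \<xi> s zz N))) \<in> borel_measurable borel"
        "(\<lambda>N. weight (coupled_step \<xi> s zz N)) \<in> borel_measurable borel"
        by (intro measurable_compose[OF _ measurable_f_rad] measurable_compose[OF _ measurable_weight] measurable_coupled_step
          measurable_const measurable_ident_sets refl; simp)+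
      have dD: "D + 2 * \<epsilon> * \<gamma> * real DIM(real^'n) = \<epsilon> * \<gamma> * (2 * (real CARD('n) + A) - lam * Hsum zz)"
        by (simp add: D_def algebra_simps)
      note gpb = gauss_product_bound[OF meas s(1,2) X1 K(1) _ f_abs _ _ G_abs m_abs D_abs F0 _ G0 G_step,
          folded rho_def, unfolded dD, folded M_def]
      \<comment> \<open>Common end of the three regimes, which differ only in the coefficients A1,
        B, C of the expansion of f.\<close>
      have conclude: ?thesis
        if e: "norm e = 1" and A1: "\<bar>A1\<bar> \<le> K" and BC: "\<bar>B\<bar> + \<bar>C\<bar> \<le> K"
          and F: "\<And>N. f (rad (coupled_step \<xi> s zz N)) \<le> f ?r + s * (A1 * (N \<bullet> e)) + s\<^sup>2 * (B + C * (N \<bullet> e)\<^sup>2) + K * s ^ 3 * (1 + norm N) ^ 9"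
          and drift: "(B + C) * ?G + A1 * (e \<bullet> ?m) + f ?r * (\<epsilon> * \<gamma> * (2 * (real CARD('n) + A) - lam * Hsum zz))
            \<le> - c * (f ?r * ?G) + Ks * \<xi> * ?G" for e A1 B C
      proof -
        have KG: "Ks * \<xi> * ?G \<le> Ks * Kw * \<xi> * ?X"
          using mult_left_mono[OF Kw(2)[of zz], of "Ks * \<xi>"] Ks \<xi> by (simp add: mult_ac)
        have "s\<^sup>2 * ((B + C) * ?G + A1 * (e \<bullet> ?m) + f ?r * (\<epsilon> * \<gamma> * (2 * (real CARD('n) + A) - lam * Hsum zz)))
          \<le> s\<^sup>2 * (- c * rho zz + Ks * Kw * \<xi> * ?X)"
          using drift KG by (intro mult_left_mono) (auto simp: rho_def)
        moreover have "10 * (K\<^sup>2 * ?X) * M * s ^ 3 = 10 * K\<^sup>2 * M * ?X * s ^ 3" by simp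
        ultimately show ?thesis
          using gpb[OF e A1 BC F] by (intro conjI) (assumption, linarith)
      qed
      \<comment> \<open>Without reflection the expansion of f has no noise term; any unit vector
        serves as direction.\<close>
      obtain e0 :: "real^'n" where e0: "norm e0 = 1" using vector_choose_size[of 1] by auto
      have K9: "0 \<le> K * s ^ 3 * (1 + norm N) ^ 9" for N :: "real^'n" using K s by simp
      have G1: "1 \<le> ?G" by (rule weight_ge_1)
      have KsG: "0 \<le> Ks * \<xi> * ?G" using Ks \<xi> G1 by simp
      consider "R1 \<le> ?r" | "?r < R1" "norm (qdiff zz) < \<xi>" | "?r < R1" "\<xi> \<le> norm (qdiff zz)" by linarith
      then show ?thesis
      proof cases
        case 1
        show ?thesis
        proof (rule conclude[OF e0, of 0 0 0])
          fix N :: "real^'n"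
          \<comment> \<open>Beyond R1 the profile has its maximal value, so no step can raise it,
            whatever the noise; the decay comes from the weight alone.\<close>
          have "f (rad (coupled_step \<xi> s zz N)) \<le> f ?r"
            using f_ge_R[OF 1] f_mono[OF rad_nonneg, of "coupled_step \<xi> s zz N" "max R1 (rad (coupled_step \<xi> s zz N))"]
              f_ge_R[of "max R1 (rad (coupled_step \<xi> s zz N))"] by simp
          then show "f (rad (coupled_step \<xi> s zz N)) \<le> f ?r + s * (0 * (N \<bullet> e0)) + s\<^sup>2 * (0 + 0 * (N \<bullet> e0)\<^sup>2) + K * s ^ 3 * (1 + norm N) ^ 9"
            using K9[of N] by simp
        next
          have "f ?r * (\<epsilon> * \<gamma> * (2 * (real CARD('n) + A) - lam * Hsum zz)) \<le> f ?r * (- c * ?G)"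
            using outer_drift[OF 1] f_nonneg[OF r0] by (intro mult_left_mono)
          then show "(0 + 0) * ?G + 0 * (e0 \<bullet> ?m) + f ?r * (\<epsilon> * \<gamma> * (2 * (real CARD('n) + A) - lam * Hsum zz))
            \<le> - c * (f ?r * ?G) + Ks * \<xi> * ?G" using KsG by (simp add: mult_ac)
        qed (use K in auto)
      next
        case 2
        have f'01: "0 < f' ?r" "f' ?r \<le> 1" using f'_bounds[OF r0] 2 by auto
        have "\<bar>f' ?r * dist_drift zz\<bar> \<le> 1 * Kb"
          unfolding abs_mult using f'01 dist_drift_bound[OF 2(1)] by (intro mult_mono) (auto simp: Kb_def)
        then have B: "\<bar>f' ?r * dist_drift zz\<bar> + \<bar>0\<bar> \<le> K" using K pos by simp
        show ?thesis
        proof (rule conclude[OF e0 _ B, of 0])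
          fix N :: "real^'n"
          let ?r' = "rad (coupled_step \<xi> s zz N)"
          have "?r' \<le> ?r + s\<^sup>2 * dist_drift zz" using 2 by (intro rad_step_synchronous s) auto
          have "f ?r' \<le> f ?r + f' ?r * (?r' - ?r)"
            using 2 by (intro f_tangent rad_nonneg) auto
          also have "\<dots> \<le> f ?r + f' ?r * (s\<^sup>2 * dist_drift zz)"
            using \<open>?r' \<le> ?r + s\<^sup>2 * dist_drift zz\<close> f'01 by (intro add_left_mono mult_left_mono) auto
          finally show "f ?r' \<le> f ?r + s * (0 * (N \<bullet> e0)) + s\<^sup>2 * (f' ?r * dist_drift zz + 0 * (N \<bullet> e0)\<^sup>2) + K * s ^ 3 * (1 + norm N) ^ 9"
            using K9[of N] by (simp add: mult_ac)
        next
          show "(f' ?r * dist_drift zz + 0) * ?G + 0 * (e0 \<bullet> ?m) + f ?r * (\<epsilon> * \<gamma> * (2 * (real CARD('n) + A) - lam * Hsum zz))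
            \<le> - c * (f ?r * ?G) + Ks * \<xi> * ?G" using Ks(2)[OF \<xi> 2(2,1)] by simp
        qed (use K in auto)
      next
        case 3
        define e where "e = (1 / norm (qdiff zz)) *\<^sub>R qdiff zz"
        have q0: "qdiff zz \<noteq> 0" using 3 \<xi> by auto
        have e1: "norm e = 1" using q0 by (simp add: e_def)
        have f'01: "0 < f' ?r" "f' ?r \<le> 1" using f'_bounds[OF r0] 3 by auto
        have A1: "\<bar>f' ?r * \<sigma>\<bar> \<le> K"
        proof -
          have "\<bar>f' ?r * \<sigma>\<bar> \<le> 1 * \<sigma>" unfolding abs_mult using f'01 pos by (intro mult_mono) auto
          then show ?thesis using K by simp
        qed
        have B: "\<bar>f' ?r * dist_drift zz\<bar> + \<bar>f'' ?r / 2 * \<sigma>\<^sup>2\<bar> \<le> K"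
        proof -
          have "\<bar>f' ?r * dist_drift zz\<bar> \<le> 1 * Kb"
            unfolding abs_mult using f'01 dist_drift_bound[OF 3(1)] by (intro mult_mono) (auto simp: Kb_def)
          moreover have "\<bar>f'' ?r / 2 * \<sigma>\<^sup>2\<bar> \<le> Kp * \<sigma>\<^sup>2"
            unfolding abs_mult using f''_bounds(2)[OF r0] 3 by (intro mult_mono) (auto simp: Kp_def)
          ultimately show ?thesis using K by simp
        qed
        show ?thesis
        proof (rule conclude[OF e1 A1 B])
          fix N :: "real^'n"
          have "Kf * s ^ 3 * (1 + norm N) ^ 9 \<le> K * s ^ 3 * (1 + norm N) ^ 9"
            using K s by (intro mult_right_mono) auto
          then show "f (rad (coupled_step \<xi> s zz N)) \<le> f ?r + s * (f' ?r * \<sigma> * (N \<bullet> e)) + s\<^sup>2 * (f' ?r * dist_drift zz + f'' ?r / 2 * \<sigma>\<^sup>2 * (N \<bullet> e)\<^sup>2) + K * s ^ 3 * (1 + norm N) ^ 9"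
            using Kf(2)[OF s 3(2,1), of N] unfolding e_def by linarith
        next
          \<comment> \<open>The reflection sends e to -e, so along e the sum of the two coefficients
            becomes their difference, which is controlled by the distance of the states.\<close>
          have em: "e \<bullet> ?m = \<epsilon> * (e \<bullet> (noise_coeff (fst zz) - noise_coeff (snd zz)))"
          proof -
            have "e \<bullet> rotate_noise \<xi> zz (noise_coeff (snd zz)) = householder e e \<bullet> noise_coeff (snd zz)"
              using 3 e1 by (simp add: rotate_noise_def e_def[symmetric] householder(4))
            also have "householder e e = - e" using e1 by (simp add: householder_def dot_square_norm algebra_simps)
                (simp add: scaleR_2)
            finally show ?thesis by (simp add: noise_grad_def inner_simps)
          qed
          show "(f' ?r * dist_drift zz + f'' ?r / 2 * \<sigma>\<^sup>2) * ?G + f' ?r * \<sigma> * (e \<bullet> ?m)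
            + f ?r * (\<epsilon> * \<gamma> * (2 * (real CARD('n) + A) - lam * Hsum zz)) \<le> - c * (f ?r * ?G) + Ks * \<xi> * ?G"
            unfolding em using reflection_drift[OF 3(1) q0, folded e_def] KsG by linarith
        qed
      qed
    qed
    then show "\<exists>K\<ge>0. \<forall>s zz. 0 < s \<longrightarrow> s \<le> 1 \<longrightarrow> s\<^sup>2 * \<gamma> \<le> 1 \<longrightarrow>
      integrable std_gauss (\<lambda>N. rho (coupled_step \<xi> s zz N)) \<and>
      (\<integral>N. rho (coupled_step \<xi> s zz N) \<partial>std_gauss) \<le> rho zz + s\<^sup>2 * (- c * rho zz + Ks * Kw * \<xi> * size2 zz) + K * size2 zz * s ^ 3"
      using K(1) M0 by (intro exI[of _ "10 * K\<^sup>2 * M"]) auto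
  qed
qed

text \<open>\<xi> is chosen to make K0 \<xi> <= \<eta>/2, and then s0 to make K s <= \<eta>/2 for
  the K belonging to that \<xi>. The form with extended nonnegative integrals can be iterated for
  arbitrary initial laws.\<close>

lemma one_step_contraction:
  assumes \<eta>: "\<eta> > 0"
  obtains \<xi> s0 where "0 < \<xi>" "0 < s0" "s0 \<le> 1"
    "\<And>s zz. 0 < s \<Longrightarrow> s \<le> s0 \<Longrightarrow> (\<integral>\<^sup>+N. ennreal (rho (coupled_step \<xi> s zz N)) \<partial>std_gauss)
      \<le> ennreal (1 - c * s\<^sup>2) * ennreal (rho zz) + ennreal (\<eta> * s\<^sup>2) * ennreal (size2 zz)"
    "\<And>s. 0 < s \<Longrightarrow> s \<le> s0 \<Longrightarrow> 0 \<le> 1 - c * s\<^sup>2"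
proof -
  obtain K0 where K0: "K0 \<ge> 0"
    "\<And>\<xi>. 0 < \<xi> \<Longrightarrow> \<xi> \<le> 1 \<Longrightarrow> \<exists>K\<ge>0. \<forall>s zz. 0 < s \<longrightarrow> s \<le> 1 \<longrightarrow> s\<^sup>2 * \<gamma> \<le> 1 \<longrightarrow>
      integrable std_gauss (\<lambda>N. rho (coupled_step \<xi> s zz N)) \<and>
      (\<integral>N. rho (coupled_step \<xi> s zz N) \<partial>std_gauss) \<le> rho zz + s\<^sup>2 * (- c * rho zz + K0 * \<xi> * size2 zz) + K * size2 zz * s ^ 3"
    using one_step_expansion by metis
  define \<xi> where "\<xi> = min 1 (\<eta> / (2 * (K0 + 1)))"
  have \<xi>: "0 < \<xi>" "\<xi> \<le> 1" "\<xi> \<le> \<eta> / (2 * (K0 + 1))" using \<eta> K0 by (auto simp: \<xi>_def)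
  have half: "t * (\<eta> / (2 * t)) = \<eta> / 2" if "t > 0" for t using that by simp
  have K0\<xi>: "K0 * \<xi> \<le> \<eta> / 2"
  proof -
    have "K0 * \<xi> \<le> (K0 + 1) * (\<eta> / (2 * (K0 + 1)))" using \<xi> K0 by (intro mult_mono) auto
    also have "\<dots> = \<eta> / 2" by (rule half) (use K0(1) in simp)
    finally show ?thesis .
  qed
  obtain K where K: "K \<ge> 0" "\<And>s zz. 0 < s \<Longrightarrow> s \<le> 1 \<Longrightarrow> s\<^sup>2 * \<gamma> \<le> 1 \<Longrightarrow>
      integrable std_gauss (\<lambda>N. rho (coupled_step \<xi> s zz N)) \<and>
      (\<integral>N. rho (coupled_step \<xi> s zz N) \<partial>std_gauss) \<le> rho zz + s\<^sup>2 * (- c * rho zz + K0 * \<xi> * size2 zz) + K * size2 zz * s ^ 3"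
    using K0(2)[OF \<xi>(1,2)] by metis
  define s0 where "s0 = min 1 (min (1 / (\<gamma> + c + 1)) (\<eta> / (2 * (K + 1))))"
  have s0: "0 < s0" "s0 \<le> 1" "s0 \<le> 1 / (\<gamma> + c + 1)" "s0 \<le> \<eta> / (2 * (K + 1))"
    using \<eta> K(1) \<gamma> c_pos by (auto simp: s0_def)
  have small: "s\<^sup>2 * (\<gamma> + c) \<le> 1" if "0 < s" "s \<le> s0" for s
  proof -
    have "s \<le> 1 / (\<gamma> + c + 1)" using that s0(3) by linarith
    then have "s * (\<gamma> + c + 1) \<le> 1" using \<gamma> c_pos by (simp add: pos_le_divide_eq)
    moreover have "s * s \<le> s * 1" using that s0 by (intro mult_left_mono) auto
    then have "s * s * (\<gamma> + c) \<le> s * 1 * (\<gamma> + c)" using \<gamma> c_pos by (intro mult_right_mono) auto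
    ultimately show ?thesis using that by (simp add: power2_eq_square algebra_simps)
  qed
  have sg: "s\<^sup>2 * \<gamma> \<le> 1" and sc: "0 \<le> 1 - c * s\<^sup>2" if "0 < s" "s \<le> s0" for s
  proof -
    have "0 \<le> s\<^sup>2 * \<gamma>" "0 \<le> s\<^sup>2 * c" using \<gamma> c_pos by auto
    then show "s\<^sup>2 * \<gamma> \<le> 1" "0 \<le> 1 - c * s\<^sup>2" using small[OF that] by (auto simp: algebra_simps)
  qed
  show ?thesis
  proof (rule that[OF \<xi>(1) s0(1,2) _ sc])
    fix s :: real and zz assume s: "0 < s" "s \<le> s0"
    have s1: "s \<le> 1" using s s0 by simp
    note Ks = K(2)[OF s(1) s1 sg[OF s], of zz]
    have "K * s \<le> \<eta> / 2"
    proof -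
      have "K * s \<le> (K + 1) * (\<eta> / (2 * (K + 1)))" using s s0(4) K by (intro mult_mono) auto
      also have "\<dots> = \<eta> / 2" by (rule half) (use K(1) in simp)
      finally show ?thesis .
    qed
    then have "s\<^sup>2 * size2 zz * (K0 * \<xi> + K * s) \<le> s\<^sup>2 * size2 zz * \<eta>"
      using K0\<xi> size2_ge_1[of zz] by (intro mult_left_mono) auto
    then have "(\<integral>N. rho (coupled_step \<xi> s zz N) \<partial>std_gauss) \<le> (1 - c * s\<^sup>2) * rho zz + \<eta> * s\<^sup>2 * size2 zz"
      using Ks by (simp add: power2_eq_square power3_eq_cube algebra_simps)
    then have "(\<integral>\<^sup>+N. ennreal (rho (coupled_step \<xi> s zz N)) \<partial>std_gauss)
      \<le> ennreal ((1 - c * s\<^sup>2) * rho zz + \<eta> * s\<^sup>2 * size2 zz)"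
      using Ks rho_nonneg by (subst nn_integral_eq_integral) (auto intro!: ennreal_leI)
    then show "(\<integral>\<^sup>+N. ennreal (rho (coupled_step \<xi> s zz N)) \<partial>std_gauss)
      \<le> ennreal (1 - c * s\<^sup>2) * ennreal (rho zz) + ennreal (\<eta> * s\<^sup>2) * ennreal (size2 zz)"
      using sc[OF s] rho_nonneg[of zz] \<eta> size2_ge_1[of zz] by (simp add: ennreal_mult ennreal_plus)
  qed
qed

text \<open>The linear term m . N depends on the state but has mean zero, so it is enough to know
  that some m exists.\<close>

lemma euler_norm_square:
  obtains K where "K > 0"
    "\<And>s z. 0 < s \<Longrightarrow> s \<le> 1 \<Longrightarrow> \<exists>m. \<forall>N.
      (norm (euler s z N))\<^sup>2 \<le> (norm z)\<^sup>2 + s\<^sup>2 * (K * (1 + (norm z)\<^sup>2)) + s * (m \<bullet> N) + s\<^sup>2 * K * (norm N)\<^sup>2"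
proof -
  obtain Kg where Kg: "Kg > 0" "\<And>z :: 'n state. norm (gradU (fst z)) \<le> Kg * (1 + norm z)"
    using grad_growth_sq by metis
  define \<tau> where "\<tau> = sqrt (2 * \<gamma> * u)"
  define Kb where "Kb = \<gamma> + u * Kg"
  have \<tau>: "\<tau> > 0" using \<gamma> u by (simp add: \<tau>_def)
  have Kb: "Kb > 0" using \<gamma> u Kg by (simp add: Kb_def add_pos_pos)
  define K1 where "K1 = 2 * (3 + 2 * Kb + Kb\<^sup>2)"
  define K where "K = K1 + \<tau>\<^sup>2"
  have K1: "0 < K1" using Kb by (auto simp: K1_def intro!: add_pos_nonneg)
  have K: "0 < K" "K1 \<le> K" "\<tau>\<^sup>2 \<le> K" using K1 by (auto simp: K_def add_pos_nonneg)
  show ?thesis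
  proof (rule that[OF K(1)])
    fix s :: real and z :: "'n state" assume s: "0 < s" "s \<le> 1"
    obtain x v where z: "z = (x, v)" by (cases z)
    define b where "b = \<gamma> *\<^sub>R v + u *\<^sub>R gradU x"
    define m where "m = (2 * \<tau>) *\<^sub>R (v - s\<^sup>2 *\<^sub>R b)"
    let ?M = "1 + norm z"
    have M: "?M\<^sup>2 \<le> 2 * (1 + (norm z)\<^sup>2)" "1 \<le> ?M" using one_plus_norm_square[of "norm z"] by auto
    have s2: "s\<^sup>2 \<le> 1" "s ^ 4 \<le> s\<^sup>2" using s by (auto simp: power_le_one intro!: power_decreasing)
    have nx: "norm x \<le> ?M" "norm v \<le> ?M" using norm_fst_snd_le[of z] by (auto simp: z)
    have nb: "norm b \<le> Kb * ?M"
    proof -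
      have "norm b \<le> \<gamma> * norm v + u * norm (gradU x)"
        unfolding b_def using norm_triangle_ineq[of "\<gamma> *\<^sub>R v" "u *\<^sub>R gradU x"] \<gamma> u by simp
      also have "\<dots> \<le> \<gamma> * ?M + u * (Kg * ?M)"
        using nx Kg(2)[of z] \<gamma> u by (intro add_mono mult_left_mono) (auto simp: z)
      finally show ?thesis by (simp add: Kb_def algebra_simps)
    qed
    have e1: "(norm (x + s\<^sup>2 *\<^sub>R v))\<^sup>2 = (norm x)\<^sup>2 + s\<^sup>2 * (2 * (x \<bullet> v)) + s ^ 4 * (norm v)\<^sup>2"
      unfolding power2_norm_eq_inner
      by (simp add: inner_simps inner_commute[of v x] algebra_simps power2_eq_square power4_eq_xxxx)
    have e2: "(norm (v - s\<^sup>2 *\<^sub>R b + (s * \<tau>) *\<^sub>R N))\<^sup>2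
        = (norm v)\<^sup>2 - s\<^sup>2 * (2 * (v \<bullet> b)) + s ^ 4 * (norm b)\<^sup>2 + s * (m \<bullet> N) + s\<^sup>2 * \<tau>\<^sup>2 * (norm N)\<^sup>2" for N
      unfolding power2_norm_eq_inner m_def
      by (simp add: inner_simps inner_commute[of b v] inner_commute[of N v] inner_commute[of N b])
        (simp add: algebra_simps power2_eq_square power4_eq_xxxx)
    have b1: "2 * (x \<bullet> v) \<le> 2 * (?M * ?M)" "- (2 * (v \<bullet> b)) \<le> 2 * (?M * (Kb * ?M))"
      "(norm v)\<^sup>2 \<le> ?M\<^sup>2" "(norm b)\<^sup>2 \<le> (Kb * ?M)\<^sup>2"
    proof -
      have "x \<bullet> v \<le> norm x * norm v" by (rule norm_cauchy_schwarz)
      also have "\<dots> \<le> ?M * ?M" using nx by (intro mult_mono) auto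
      finally show "2 * (x \<bullet> v) \<le> 2 * (?M * ?M)" by simp
      have "- (v \<bullet> b) \<le> norm v * norm b" using norm_cauchy_schwarz[of "- v" b] by simp
      also have "\<dots> \<le> ?M * (Kb * ?M)" using nx nb by (intro mult_mono) auto
      finally show "- (2 * (v \<bullet> b)) \<le> 2 * (?M * (Kb * ?M))" by linarith
      show "(norm v)\<^sup>2 \<le> ?M\<^sup>2" "(norm b)\<^sup>2 \<le> (Kb * ?M)\<^sup>2" using nx nb by (auto intro: power_mono)
    qed
    have "s\<^sup>2 * (2 * (?M * ?M)) + s\<^sup>2 * ?M\<^sup>2 + s\<^sup>2 * (2 * (?M * (Kb * ?M))) + s\<^sup>2 * (Kb * ?M)\<^sup>2
        = s\<^sup>2 * ((3 + 2 * Kb + Kb\<^sup>2) * ?M\<^sup>2)"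
      by (simp add: power2_eq_square algebra_simps)
    also have "\<dots> \<le> s\<^sup>2 * ((3 + 2 * Kb + Kb\<^sup>2) * (2 * (1 + (norm z)\<^sup>2)))"
      using M Kb by (intro mult_left_mono) auto
    also have "\<dots> = s\<^sup>2 * (K1 * (1 + (norm z)\<^sup>2))" by (simp add: K1_def algebra_simps)
    also have "\<dots> \<le> s\<^sup>2 * (K * (1 + (norm z)\<^sup>2))" using K by (intro mult_left_mono mult_right_mono) auto
    finally have Q: "s\<^sup>2 * (2 * (?M * ?M)) + s\<^sup>2 * ?M\<^sup>2 + s\<^sup>2 * (2 * (?M * (Kb * ?M))) + s\<^sup>2 * (Kb * ?M)\<^sup>2
        \<le> s\<^sup>2 * (K * (1 + (norm z)\<^sup>2))" .
    have "(norm (euler s z N))\<^sup>2 \<le> (norm z)\<^sup>2 + s\<^sup>2 * (K * (1 + (norm z)\<^sup>2)) + s * (m \<bullet> N) + s\<^sup>2 * K * (norm N)\<^sup>2" for N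
    proof -
    have "(norm (euler s z N))\<^sup>2 = (norm (x + s\<^sup>2 *\<^sub>R v))\<^sup>2 + (norm (v - s\<^sup>2 *\<^sub>R b + (s * \<tau>) *\<^sub>R N))\<^sup>2"
      by (simp add: norm_state euler_def z b_def \<tau>_def)
    also have "\<dots> = (norm z)\<^sup>2 + (s\<^sup>2 * (2 * (x \<bullet> v)) + s ^ 4 * (norm v)\<^sup>2 + s\<^sup>2 * (- (2 * (v \<bullet> b))) + s ^ 4 * (norm b)\<^sup>2)
        + s * (m \<bullet> N) + s\<^sup>2 * \<tau>\<^sup>2 * (norm N)\<^sup>2"
      unfolding e1 e2 norm_state z by simp
    also have "\<dots> \<le> (norm z)\<^sup>2 + (s\<^sup>2 * (2 * (?M * ?M)) + s\<^sup>2 * ?M\<^sup>2 + s\<^sup>2 * (2 * (?M * (Kb * ?M))) + s\<^sup>2 * (Kb * ?M)\<^sup>2)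
        + s * (m \<bullet> N) + s\<^sup>2 * K * (norm N)\<^sup>2"
      using b1 s2 K(3) by (intro add_mono order_refl mult_left_mono mult_right_mono mult_mono) auto
    finally show ?thesis using Q by linarith
    qed
    then show "\<exists>m. \<forall>N. (norm (euler s z N))\<^sup>2 \<le> (norm z)\<^sup>2 + s\<^sup>2 * (K * (1 + (norm z)\<^sup>2)) + s * (m \<bullet> N) + s\<^sup>2 * K * (norm N)\<^sup>2"
      by blast
  qed
qed

text \<open>The factor 1 + K s^2 compounds over n steps to at most exp (K n s^2), so the mean of the
  quadratic weight stays controlled on a fixed time horizon n s^2 = T.\<close>

lemma size2_step:
  obtains K where "K > 0"
    "\<And>s zz \<xi>. 0 < s \<Longrightarrow> s \<le> 1 \<Longrightarrow> 0 < \<xi> \<Longrightarrow> (\<integral>\<^sup>+N. ennreal (size2 (coupled_step \<xi> s zz N)) \<partial>std_gauss)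
      \<le> ennreal (1 + K * s\<^sup>2) * ennreal (size2 zz)"
proof -
  obtain K where K: "K > 0" "\<And>s z. 0 < s \<Longrightarrow> s \<le> 1 \<Longrightarrow> \<exists>m. \<forall>N.
      (norm (euler s z N))\<^sup>2 \<le> (norm z)\<^sup>2 + s\<^sup>2 * (K * (1 + (norm z)\<^sup>2)) + s * (m \<bullet> N) + s\<^sup>2 * K * (norm N)\<^sup>2"
    using euler_norm_square by metis
  define K' where "K' = 2 * K + 2 * K * real CARD('n)"
  have K': "K' > 0" using K by (simp add: K'_def add_pos_nonneg)
  show ?thesis
  proof (rule that[OF K'])
    fix s \<xi> :: real and zz :: "'n state \<times> 'n state" assume s: "0 < s" "s \<le> 1" and \<xi>: "0 < \<xi>"
    obtain m1 where m1: "\<And>N. (norm (euler s (fst zz) N))\<^sup>2 \<le> (norm (fst zz))\<^sup>2 + s\<^sup>2 * (K * (1 + (norm (fst zz))\<^sup>2)) + s * (m1 \<bullet> N) + s\<^sup>2 * K * (norm N)\<^sup>2"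
      using K(2)[OF s] by metis
    obtain m2 where m2: "\<And>N. (norm (euler s (snd zz) N))\<^sup>2 \<le> (norm (snd zz))\<^sup>2 + s\<^sup>2 * (K * (1 + (norm (snd zz))\<^sup>2)) + s * (m2 \<bullet> N) + s\<^sup>2 * K * (norm N)\<^sup>2"
      using K(2)[OF s] by metis
    define m where "m = m1 + rotate_noise \<xi> zz m2"
    define h where "h N = size2 zz + s\<^sup>2 * (K * (1 + size2 zz)) + s * (N \<bullet> m) + (2 * s\<^sup>2 * K) * (norm N)\<^sup>2" for N
    have le: "size2 (coupled_step \<xi> s zz N) \<le> h N" for N
      using m1[of N] m2[of "rotate_noise \<xi> zz N"] rotate_noise(2)[OF \<xi>, of zz N]
        rotate_noise(4)[OF \<xi>, of zz m2 N]
      by (simp add: h_def size2_def coupled_step_def m_def inner_simps inner_commute[of N] algebra_simps)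
    have int_n2: "integrable std_gauss (\<lambda>N::real^'n. (norm N)\<^sup>2)"
      by (rule integrable_std_gauss_bound[where C = 1 and p = 2]) (auto intro!: power_mono)
    have int_h: "integrable std_gauss h"
      unfolding h_def by (intro Bochner_Integration.integrable_add Bochner_Integration.integrable_mult_right
          int_n2 integrable_std_gauss_inner) auto
    have h0: "0 \<le> h N" for N using le[of N] size2_ge_1[of "coupled_step \<xi> s zz N"] by linarith
    have "(\<integral>\<^sup>+N. ennreal (size2 (coupled_step \<xi> s zz N)) \<partial>std_gauss) \<le> (\<integral>\<^sup>+N. ennreal (h N) \<partial>std_gauss)"
      using le by (intro nn_integral_mono ennreal_leI) auto
    also have "\<dots> = ennreal (\<integral>N. h N \<partial>std_gauss)"
      using h0 by (intro nn_integral_eq_integral int_h) auto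
    also have "(\<integral>N. h N \<partial>std_gauss) = size2 zz + s\<^sup>2 * (K * (1 + size2 zz)) + (2 * s\<^sup>2 * K) * real CARD('n)"
      unfolding h_def by (simp add: int_n2 integral_std_gauss_norm_square std_gauss.prob_space[simplified])
    also have "ennreal \<dots> \<le> ennreal ((1 + K' * s\<^sup>2) * size2 zz)"
    proof (intro ennreal_leI)
      have X: "1 \<le> size2 zz" by (rule size2_ge_1)
      have "s\<^sup>2 * (K * (1 + size2 zz)) \<le> s\<^sup>2 * (K * (2 * size2 zz))" using X K by (intro mult_left_mono) auto
      moreover have "2 * s\<^sup>2 * K * real CARD('n) * 1 \<le> 2 * s\<^sup>2 * K * real CARD('n) * size2 zz"
        using X K by (intro mult_left_mono) auto
      moreover have "(1 + K' * s\<^sup>2) * size2 zz = size2 zz + s\<^sup>2 * (K * (2 * size2 zz)) + 2 * s\<^sup>2 * K * real CARD('n) * size2 zz"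
        by (simp add: K'_def algebra_simps)
      ultimately show "size2 zz + s\<^sup>2 * (K * (1 + size2 zz)) + 2 * s\<^sup>2 * K * real CARD('n) \<le> (1 + K' * s\<^sup>2) * size2 zz"
        by linarith
    qed
    also have "\<dots> = ennreal (1 + K' * s\<^sup>2) * ennreal (size2 zz)"
      using K' size2_ge_1[of zz] by (intro ennreal_mult) auto
    finally show "(\<integral>\<^sup>+N. ennreal (size2 (coupled_step \<xi> s zz N)) \<partial>std_gauss)
      \<le> ennreal (1 + K' * s\<^sup>2) * ennreal (size2 zz)" .
  qed
qed

end

section \<open>Euler approximation of the diffusion\<close>

text \<open>The quantity e k + \<omega> is multiplied by at most 1 + q in each step.\<close>

lemma discrete_gronwall:
  fixes e :: "nat \<Rightarrow> real"
  assumes "e 0 \<le> 0" "0 \<le> q" and step: "\<And>k. k < n \<Longrightarrow> e (Suc k) \<le> (1 + q) * e k + q * \<omega>"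
  shows "k \<le> n \<Longrightarrow> e k \<le> ((1 + q) ^ k - 1) * \<omega>"
proof (induction k)
  case (Suc k)
  have "e (Suc k) \<le> (1 + q) * e k + q * \<omega>" using Suc by (intro step) auto
  also have "\<dots> \<le> (1 + q) * (((1 + q) ^ k - 1) * \<omega>) + q * \<omega>"
    using Suc assms by (intro add_right_mono mult_left_mono) auto
  also have "\<dots> = ((1 + q) ^ Suc k - 1) * \<omega>" by (simp add: algebra_simps)
  finally show ?case .
qed (use assms in simp)

context langevin
begin

section \<open>Pathwise convergence of the Euler scheme\<close>

primrec euler_path :: "real \<Rightarrow> (nat \<Rightarrow> real^'n) \<Rightarrow> 'n state \<Rightarrow> nat \<Rightarrow> 'n state" where
  "euler_path s N z 0 = z"
| "euler_path s N z (Suc k) = euler s (euler_path s N z k) (N k)"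

definition force :: "'n state \<Rightarrow> real^'n" where
  "force z = \<gamma> *\<^sub>R snd z + u *\<^sub>R gradU (fst z)"

lemma force_Lipschitz: "norm (force z - force z') \<le> (\<gamma> + u * L) * norm (z - z')"
proof -
  have "norm (force z - force z') = norm (\<gamma> *\<^sub>R (snd z - snd z') + u *\<^sub>R (gradU (fst z) - gradU (fst z')))"
    by (simp add: force_def algebra_simps)
  also have "\<dots> \<le> \<gamma> * norm (snd z - snd z') + u * norm (gradU (fst z) - gradU (fst z'))"
    using norm_triangle_ineq[of "\<gamma> *\<^sub>R (snd z - snd z')" "u *\<^sub>R (gradU (fst z) - gradU (fst z'))"] \<gamma> u by simp
  also have "\<dots> \<le> \<gamma> * norm (z - z') + u * (L * norm (z - z'))"
  proof -
    have "norm (gradU (fst z) - gradU (fst z')) \<le> L * norm (fst z - fst z')" by (rule grad_Lip)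
    also have "\<dots> \<le> L * norm (z - z')" using norm_fst_snd_le(1)[of "z - z'"] L by (intro mult_left_mono) auto
    finally show ?thesis using norm_fst_snd_le(2)[of "z - z'"] \<gamma> u by (intro add_mono mult_left_mono) auto
  qed
  finally show ?thesis by (simp add: algebra_simps)
qed

text \<open>The noise is additive and the scheme uses the exact increments of b, so b cancels in the
  error and only two ordinary integrals are left. On each step their integrands differ from the
  values used by the scheme by the oscillation of the path and the error so far; the discrete
  Gronwall bound sums this up.\<close>

lemma euler_path_converges:
  fixes x v b :: "real \<Rightarrow> real^'n"
  assumes cont: "continuous_on {0..} x" "continuous_on {0..} v"
    and x: "\<And>t. 0 \<le> t \<Longrightarrow> x t = x 0 + integral {0..t} v"
    and v: "\<And>t. 0 \<le> t \<Longrightarrow> v t = v 0 - integral {0..t} (\<lambda>s. \<gamma> *\<^sub>R v s + u *\<^sub>R gradU (x s)) + sqrt (2 * \<gamma> * u) *\<^sub>R b t"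
    and T: "T > 0"
  defines "h \<equiv> \<lambda>n. T / real (Suc n)"
  shows "(\<lambda>n. euler_path (sqrt (h n)) (\<lambda>k. (1 / sqrt (h n)) *\<^sub>R (b (real (Suc k) * h n) - b (real k * h n))) (x 0, v 0) (Suc n))
    \<longlonglongrightarrow> (x T, v T)"
proof -
  define z where "z t = (x t, v t)" for t
  define \<Lambda>' where "\<Lambda>' = 1 + \<gamma> + u * L"
  have L': "\<Lambda>' > 0" using \<gamma> u L by (simp add: \<Lambda>'_def add_pos_pos)
  have cz: "continuous_on {0..} z" unfolding z_def by (intro continuous_intros cont)
  have cf: "continuous_on {0..} (\<lambda>t. force (z t))"
    unfolding force_def z_def by (auto intro!: continuous_intros cont continuous_on_compose2[OF continuous_gradU[of UNIV]])
  have int: "v integrable_on {p..q}" "(\<lambda>t. force (z t)) integrable_on {p..q}" if "0 \<le> p" for p q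
    using that by (auto intro!: integrable_continuous_real continuous_on_subset[OF cont(2)] continuous_on_subset[OF cf])
  have dx: "x q = x p + integral {p..q} v" if "0 \<le> p" "p \<le> q" for p q
  proof -
    have "integral {0..p} v + integral {p..q} v = integral {0..q} v"
      using that by (intro Henstock_Kurzweil_Integration.integral_combine int) auto
    then show ?thesis using x[of p] x[of q] that by (simp add: algebra_simps)
  qed
  have dv: "v q = v p - integral {p..q} (\<lambda>t. force (z t)) + sqrt (2 * \<gamma> * u) *\<^sub>R (b q - b p)" if "0 \<le> p" "p \<le> q" for p q
  proof -
    have I: "integral {0..p} (\<lambda>t. force (z t)) + integral {p..q} (\<lambda>t. force (z t)) = integral {0..q} (\<lambda>t. force (z t))"
      using that by (intro Henstock_Kurzweil_Integration.integral_combine int) auto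
    have "v t = v 0 - integral {0..t} (\<lambda>t. force (z t)) + sqrt (2 * \<gamma> * u) *\<^sub>R b t" if "0 \<le> t" for t
      using v[OF that] by (simp add: force_def z_def)
    from this[of p] this[of q] have vpq: "v p = v 0 - integral {0..p} (\<lambda>t. force (z t)) + sqrt (2 * \<gamma> * u) *\<^sub>R b p"
      "v q = v 0 - integral {0..q} (\<lambda>t. force (z t)) + sqrt (2 * \<gamma> * u) *\<^sub>R b q" using that by auto
    show ?thesis unfolding vpq I[symmetric] by (simp add: algebra_simps)
  qed
  have "uniformly_continuous_on {0..T} z"
    by (intro compact_uniformly_continuous continuous_on_subset[OF cz]) auto
  note uc = uniformly_continuous_onE[OF this]
  show ?thesis
  proof (rule LIMSEQ_I)
    fix r :: real assume r: "r > 0"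
    \<comment> \<open>The Gronwall factor is at most exp (T \<Lambda>'), so this oscillation gives a
      final error of at most r/2.\<close>
    define \<omega> where "\<omega> = r / (2 * exp (T * \<Lambda>'))"
    have \<omega>: "\<omega> > 0" using r by (simp add: \<omega>_def)
    obtain \<delta> where \<delta>: "\<delta> > 0" "\<And>s t. s \<in> {0..T} \<Longrightarrow> t \<in> {0..T} \<Longrightarrow> dist s t < \<delta> \<Longrightarrow> dist (z s) (z t) < \<omega>"
      using uc[OF \<omega>] by metis
    obtain n0 where n0: "T / \<delta> < real n0" using reals_Archimedean2 by blast
    have "norm (euler_path (sqrt (h n)) (\<lambda>k. (1 / sqrt (h n)) *\<^sub>R (b (real (Suc k) * h n) - b (real k * h n))) (x 0, v 0) (Suc n)
        - (x T, v T)) < r" if n: "n \<ge> n0" for n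
    proof -
      define y where "y k = euler_path (sqrt (h n)) (\<lambda>k. (1 / sqrt (h n)) *\<^sub>R (b (real (Suc k) * h n) - b (real k * h n))) (x 0, v 0) k" for k
      define e where "e k = norm (z (real k * h n) - y k)" for k
      have h0: "h n > 0" using T by (simp add: h_def)
      have h\<delta>: "h n < \<delta>"
      proof -
        have "T / \<delta> < real (Suc n)" using n0 n by linarith
        then show ?thesis using \<delta>(1) by (simp add: h_def field_simps)
      qed
      have hT: "real (Suc n) * h n = T" by (simp add: h_def)
      have ysuc: "y (Suc k) = (fst (y k) + h n *\<^sub>R snd (y k),
          snd (y k) - h n *\<^sub>R force (y k) + sqrt (2 * \<gamma> * u) *\<^sub>R (b (real (Suc k) * h n) - b (real k * h n)))" for k
        using h0 by (simp add: y_def euler_def force_def real_sqrt_ge_0_iff)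
      have step: "e (Suc k) \<le> (1 + h n * \<Lambda>') * e k + (h n * \<Lambda>') * \<omega>" if k: "k < Suc n" for k
      proof -
        let ?p = "real k * h n" and ?q = "real (Suc k) * h n"
        have pq: "0 \<le> ?p" "?p \<le> ?q" "?q = ?p + h n" using h0 by (auto simp: algebra_simps)
        have qT: "?q \<le> T" unfolding hT[symmetric] using k h0 by (intro mult_right_mono) auto
        have close: "norm (z t - y k) \<le> \<omega> + e k" if "t \<in> {?p..?q}" for t
        proof -
          have "?p \<le> t" "t \<le> ?q" using that by auto
          then have "0 \<le> t" "t \<le> T" "\<bar>t - ?p\<bar> < \<delta>" "?p \<le> T" using pq qT h\<delta> by linarith+
          then have "dist (z t) (z ?p) < \<omega>" using pq(1) by (intro \<delta>(2)) (auto simp: dist_real_def)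
          moreover have "norm (z t - y k) \<le> norm (z t - z ?p) + norm (z ?p - y k)"
            using norm_triangle_ineq[of "z t - z ?p" "z ?p - y k"] by simp
          ultimately show ?thesis by (simp add: e_def dist_norm)
        qed
        have int_bound: "norm (integral {?p..?q} g - h n *\<^sub>R c0) \<le> B * h n"
          if "g integrable_on {?p..?q}" "\<And>t. t \<in> {?p..?q} \<Longrightarrow> norm (g t - c0) \<le> B" "0 \<le> B" for g :: "real \<Rightarrow> real^'n" and c0 B
        proof -
          have "integral {?p..?q} (\<lambda>t. g t - c0) = integral {?p..?q} g - h n *\<^sub>R c0"
            using that(1) pq by (subst Henstock_Kurzweil_Integration.integral_diff) auto
          moreover have "norm (integral (cbox ?p ?q) (\<lambda>t. g t - c0)) \<le> B * measure lborel (cbox ?p ?q)"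
          proof (rule integrable_bound)
            show "(\<lambda>t. g t - c0) integrable_on cbox ?p ?q"
              using that(1) by (intro Henstock_Kurzweil_Integration.integrable_diff) (auto simp: cbox_interval)
          qed (use that in \<open>auto simp: cbox_interval\<close>)
          ultimately show ?thesis using pq by (simp add: cbox_interval)
        qed
        have e0: "0 \<le> \<omega> + e k" using \<omega> by (simp add: e_def)
        have b1: "norm (integral {?p..?q} v - h n *\<^sub>R snd (y k)) \<le> (\<omega> + e k) * h n"
        proof (rule int_bound[OF int(1)[OF pq(1)] _ e0])
          fix t assume "t \<in> {?p..?q}"
          then show "norm (v t - snd (y k)) \<le> \<omega> + e k"
            using close[of t] norm_fst_snd_le(2)[of "z t - y k"] by (simp add: z_def)
        qed
        have b2: "norm (integral {?p..?q} (\<lambda>t. force (z t)) - h n *\<^sub>R force (y k)) \<le> ((\<gamma> + u * L) * (\<omega> + e k)) * h n"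
        proof (rule int_bound[OF int(2)[OF pq(1)]])
          fix t assume "t \<in> {?p..?q}"
          then have "(\<gamma> + u * L) * norm (z t - y k) \<le> (\<gamma> + u * L) * (\<omega> + e k)"
            using close \<gamma> u L by (intro mult_left_mono) auto
          then show "norm (force (z t) - force (y k)) \<le> (\<gamma> + u * L) * (\<omega> + e k)"
            using force_Lipschitz order_trans by blast
        qed (use e0 \<gamma> u L in auto)
        have "z ?q - y (Suc k) = (z ?p - y k) + (integral {?p..?q} v - h n *\<^sub>R snd (y k), 0)
            - (0, integral {?p..?q} (\<lambda>t. force (z t)) - h n *\<^sub>R force (y k))"
          unfolding ysuc using dx[OF pq(1,2)] dv[OF pq(1,2)]
          by (cases "y k") (simp add: z_def algebra_simps)
        also have "norm \<dots> \<le> e k + norm (integral {?p..?q} v - h n *\<^sub>R snd (y k))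
            + norm (integral {?p..?q} (\<lambda>t. force (z t)) - h n *\<^sub>R force (y k))"
        proof -
          have "norm (P + (p, 0) - (0, q)) \<le> norm P + norm p + norm q" for P :: "'n state" and p q
            using norm_triangle_ineq4[of "P + (p, 0)" "(0, q)"] norm_triangle_ineq[of P "(p, 0)"]
            by (simp add: norm_Pair)
          then show ?thesis unfolding e_def .
        qed
        finally have "e (Suc k) \<le> e k + (\<omega> + e k) * h n + ((\<gamma> + u * L) * (\<omega> + e k)) * h n"
          using b1 b2 unfolding e_def by linarith
        then show ?thesis by (simp add: \<Lambda>'_def algebra_simps)
      qed
      have "e (Suc n) \<le> ((1 + h n * \<Lambda>') ^ Suc n - 1) * \<omega>"
      proof (rule discrete_gronwall[where n = "Suc n"])
        show "e 0 \<le> 0" by (simp add: e_def y_def z_def)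
      qed (use step h0 L' in auto)
      also have "\<dots> \<le> exp (T * \<Lambda>') * \<omega>"
      proof (rule mult_right_mono)
        have "(1 + h n * \<Lambda>') ^ Suc n \<le> exp (h n * \<Lambda>') ^ Suc n"
          using exp_ge_add_one_self[of "h n * \<Lambda>'"] h0 L' by (intro power_mono) auto
        also have "\<dots> = exp (real (Suc n) * (h n * \<Lambda>'))" by (rule exp_of_nat_mult[symmetric])
        also have "real (Suc n) * (h n * \<Lambda>') = T * \<Lambda>'" using hT by (simp only: mult.assoc[symmetric])
        finally show "(1 + h n * \<Lambda>') ^ Suc n - 1 \<le> exp (T * \<Lambda>')" by linarith
      qed (use \<omega> in simp)
      also have "\<dots> = r / 2" by (simp add: \<omega>_def)
      finally have "e (Suc n) < r" using r by linarith
      then show ?thesis unfolding e_def hT by (simp add: z_def y_def norm_minus_commute)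
    qed
    then show "\<exists>no. \<forall>n\<ge>no. norm (euler_path (sqrt (h n)) (\<lambda>k. (1 / sqrt (h n)) *\<^sub>R (b (real (Suc k) * h n) - b (real k * h n))) (x 0, v 0) (Suc n)
        - (x T, v T)) < r" by blast
  qed
qed

section \<open>Laws of the Euler scheme\<close>

primrec euler_law :: "real \<Rightarrow> 'n state measure \<Rightarrow> nat \<Rightarrow> 'n state measure" where
  "euler_law s \<mu> 0 = \<mu>"
| "euler_law s \<mu> (Suc k) = distr (euler_law s \<mu> k \<Otimes>\<^sub>M std_gauss) borel (\<lambda>(z, N). euler s z N)"

lemma sets_euler_law:
  assumes "sets \<mu> = sets borel"
  shows "sets (euler_law s \<mu> k) = sets borel"
  using assms by (cases k) auto

lemma nn_integral_euler_law_Suc: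
  assumes "prob_space \<mu>" and \<mu>: "sets \<mu> = sets borel" and [measurable]: "g \<in> borel_measurable borel"
  shows "(\<integral>\<^sup>+z. g z \<partial>euler_law s \<mu> (Suc k)) = (\<integral>\<^sup>+z. (\<integral>\<^sup>+N. g (euler s z N) \<partial>std_gauss) \<partial>euler_law s \<mu> k)"
proof -
  note [measurable_cong] = sets_euler_law[OF \<mu>]
  show ?thesis
    by (simp add: nn_integral_distr std_gauss.nn_integral_fst[symmetric] split_beta')
qed

text \<open>Pairs of time step and coordinate, as the Brownian increments are indexed in
  \<open>std_BM\<close>.\<close>

abbreviation noise_index :: "nat \<Rightarrow> (nat \<times> 'n) set" where
  "noise_index n \<equiv> {..<n} \<times> UNIV"

abbreviation noise_space :: "nat \<Rightarrow> (nat \<times> 'n \<Rightarrow> real) measure" where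
  "noise_space n \<equiv> \<Pi>\<^sub>M i\<in>noise_index n. std_normal"

definition noise_vec :: "(nat \<times> 'n \<Rightarrow> real) \<Rightarrow> nat \<Rightarrow> real^'n" where
  "noise_vec \<omega> k = (\<chi> j. \<omega> (k, j))"

lemma measurable_noise_component:
  "i \<in> I \<Longrightarrow> (\<lambda>\<omega>. \<omega> i) \<in> borel_measurable (\<Pi>\<^sub>M i\<in>I. std_normal)"
  using measurable_component_singleton[of i I "\<lambda>_. std_normal"] by simp

lemma noise_vec_eq_sum: "noise_vec \<omega> k = (\<Sum>i\<in>{k} \<times> UNIV. \<omega> i *\<^sub>R axis (snd i) 1)"
proof -
  have "(\<Sum>i\<in>{k} \<times> (UNIV :: 'n set). \<omega> i *\<^sub>R (axis (snd i) 1 :: real^'n)) = (\<Sum>j\<in>UNIV. \<omega> (k, j) *\<^sub>R axis j 1)"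
    using sum.cartesian_product[of "\<lambda>k j. \<omega> (k, j) *\<^sub>R (axis j 1 :: real^'n)" UNIV "{k}"] by (simp add: split_beta')
  also have "\<dots> = noise_vec \<omega> k"
    by (simp add: noise_vec_def vec_eq_iff axis_def if_distrib cong: if_cong)
  finally show ?thesis by simp
qed

lemma measurable_noise_vec:
  assumes "\<And>j. (k, j) \<in> I"
  shows "(\<lambda>\<omega>. noise_vec \<omega> k) \<in> borel_measurable (\<Pi>\<^sub>M i\<in>I. std_normal)"
  unfolding noise_vec_eq_sum using assms
  by (intro borel_measurable_sum borel_measurable_scaleR measurable_noise_component borel_measurable_const) auto

lemma distr_noise_vec: "distr (\<Pi>\<^sub>M i\<in>{k} \<times> UNIV. std_normal) borel (\<lambda>\<omega>. noise_vec \<omega> k) = std_gauss"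
proof -
  have "bij_betw (\<lambda>i. axis (snd i) 1 :: real^'n) ({k} \<times> UNIV) Basis"
  proof (rule bij_betw_imageI)
    show "inj_on (\<lambda>i. axis (snd i) 1 :: real^'n) ({k} \<times> UNIV)"
      by (auto simp: inj_on_def axis_eq_axis)
    show "(\<lambda>i. axis (snd i) 1 :: real^'n) ` ({k} \<times> UNIV) = Basis"
      by (auto simp: Basis_vec_def image_iff)
  qed
  from std_gauss_eq_PiM_reindex[OF this] show ?thesis unfolding noise_vec_eq_sum by simp
qed

lemma measurable_euler_path:
  assumes "k \<le> n" and \<mu>: "sets \<mu> = sets borel"
  shows "(\<lambda>(z, \<omega>). euler_path s (noise_vec \<omega>) z k) \<in> borel_measurable (\<mu> \<Otimes>\<^sub>M noise_space n)"
  using assms(1)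
proof (induction k)
  case 0
  note [measurable_cong] = \<mu>
  show ?case by (simp add: split_beta') measurable
next
  case (Suc k)
  have 1: "(\<lambda>x. euler_path s (noise_vec (snd x)) (fst x) k) \<in> borel_measurable (\<mu> \<Otimes>\<^sub>M noise_space n)"
    using Suc by (simp add: split_beta')
  have 2: "(\<lambda>x. noise_vec (snd x) k) \<in> borel_measurable (\<mu> \<Otimes>\<^sub>M noise_space n)"
    using Suc(2) by (intro measurable_compose[OF measurable_snd measurable_noise_vec]) auto
  show ?case using measurable_euler[OF 1 2] by (simp add: split_beta')
qed

lemma euler_path_cong: "(\<And>k. k < n \<Longrightarrow> N k = N' k) \<Longrightarrow> euler_path s N z n = euler_path s N' z n"
  by (induction n) auto

lemma prob_space_noise_space: "prob_space (noise_space n)"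
  by (intro prob_space_PiM prob_space_std_normal)

text \<open>Identifies the scheme driven by n independent blocks of normals with n applications of
  the Markov kernel. The induction integrates out the last block, on which the earlier steps do not
  depend.\<close>

lemma nn_integral_euler_path:
  assumes "prob_space \<mu>" and \<mu>: "sets \<mu> = sets borel" and g: "g \<in> borel_measurable borel"
  shows "(\<integral>\<^sup>+x. g (euler_path s (noise_vec (snd x)) (fst x) n) \<partial>(\<mu> \<Otimes>\<^sub>M noise_space n)) = (\<integral>\<^sup>+z. g z \<partial>euler_law s \<mu> n)"
  using g
proof (induction n arbitrary: g)
  case 0
  interpret prob_space "noise_space 0" by (rule prob_space_noise_space)
  note [measurable] = 0 and [measurable_cong] = \<mu>
  have "(\<integral>\<^sup>+x. g (fst x) \<partial>(\<mu> \<Otimes>\<^sub>M noise_space 0)) = (\<integral>\<^sup>+z. (\<integral>\<^sup>+\<omega>. g z \<partial>noise_space 0) \<partial>\<mu>)"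
    by (subst nn_integral_fst[symmetric]) auto
  then show ?case by (simp add: emeasure_space_1[simplified])
next
  case (Suc n)
  note g[measurable] = Suc.prems and [measurable_cong] = \<mu>
  interpret product_prob_space "\<lambda>_::nat \<times> 'n. std_normal"
    by (intro product_prob_space.intro product_sigma_finite.intro prob_space_std_normal
        prob_space_imp_sigma_finite product_prob_space_axioms.intro)
  interpret Q: prob_space "noise_space n" by (rule prob_space_noise_space)
  interpret Q': prob_space "noise_space (Suc n)" by (rule prob_space_noise_space)
  let ?J = "{n} \<times> (UNIV :: 'n set)"
  have idx: "noise_index (Suc n) = noise_index n \<union> ?J" by auto
  have dis: "noise_index n \<inter> ?J = {}" "finite (noise_index n)" "finite ?J" by auto
  define G where "G y = (\<integral>\<^sup>+N. g (euler s y N) \<partial>std_gauss)" for y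
  have G[measurable]: "G \<in> borel_measurable borel" unfolding G_def by measurable
  have meas: "(\<lambda>x. g (euler_path s (noise_vec (snd x)) (fst x) (Suc n))) \<in> borel_measurable (\<mu> \<Otimes>\<^sub>M noise_space (Suc n))"
    using measurable_compose[OF measurable_euler_path[where k = "Suc n" and n = "Suc n" and s = s, OF order_refl \<mu>] g] by (simp add: split_beta')
  have measn: "(\<lambda>x. G (euler_path s (noise_vec (snd x)) (fst x) n)) \<in> borel_measurable (\<mu> \<Otimes>\<^sub>M noise_space n)"
    using measurable_compose[OF measurable_euler_path[where k = n and n = n and s = s, OF order_refl \<mu>] G] by (simp add: split_beta')
  have inner: "(\<integral>\<^sup>+\<omega>. g (euler_path s (noise_vec \<omega>) z (Suc n)) \<partial>noise_space (Suc n)) = (\<integral>\<^sup>+\<omega>. G (euler_path s (noise_vec \<omega>) z n) \<partial>noise_space n)" if z: "z \<in> space \<mu>" for z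
  proof -
    have mz: "(\<lambda>\<omega>. g (euler_path s (noise_vec \<omega>) z (Suc n))) \<in> borel_measurable (noise_space (Suc n))"
      using measurable_compose[OF measurable_Pair1'[OF z] meas] by simp
    have "(\<integral>\<^sup>+\<omega>. g (euler_path s (noise_vec \<omega>) z (Suc n)) \<partial>noise_space (Suc n)) =
        (\<integral>\<^sup>+\<omega>. (\<integral>\<^sup>+\<omega>'. g (euler_path s (noise_vec (merge (noise_index n) ?J (\<omega>, \<omega>'))) z (Suc n)) \<partial>(\<Pi>\<^sub>M i\<in>?J. std_normal)) \<partial>noise_space n)"
      using product_nn_integral_fold[OF dis, of "\<lambda>\<omega>. g (euler_path s (noise_vec \<omega>) z (Suc n))"] mz by (simp only: idx)
    also have "\<dots> = (\<integral>\<^sup>+\<omega>. (\<integral>\<^sup>+\<omega>'. g (euler s (euler_path s (noise_vec \<omega>) z n) (noise_vec \<omega>' n)) \<partial>(\<Pi>\<^sub>M i\<in>?J. std_normal)) \<partial>noise_space n)"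
    proof -
      have "euler_path s (noise_vec (merge (noise_index n) ?J (\<omega>, \<omega>'))) z n = euler_path s (noise_vec \<omega>) z n" for \<omega> \<omega>'
        by (rule euler_path_cong) (auto simp: noise_vec_def merge_def)
      moreover have "noise_vec (merge (noise_index n) ?J (\<omega>, \<omega>')) n = noise_vec \<omega>' n" for \<omega> \<omega>'
        by (auto simp: noise_vec_def merge_def)
      ultimately show ?thesis by simp
    qed
    also have "\<dots> = (\<integral>\<^sup>+\<omega>. G (euler_path s (noise_vec \<omega>) z n) \<partial>noise_space n)"
    proof -
      have m: "(\<lambda>\<omega>. noise_vec \<omega> n) \<in> borel_measurable (\<Pi>\<^sub>M i\<in>?J. std_normal)" by (rule measurable_noise_vec) simp
      have "(\<integral>\<^sup>+\<omega>'. g (euler s y (noise_vec \<omega>' n)) \<partial>(\<Pi>\<^sub>M i\<in>?J. std_normal)) = G y" for y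
        unfolding G_def distr_noise_vec[of n, symmetric] by (subst nn_integral_distr[OF m]) auto
      then show ?thesis by simp
    qed
    finally show ?thesis .
  qed
  have "(\<integral>\<^sup>+x. g (euler_path s (noise_vec (snd x)) (fst x) (Suc n)) \<partial>(\<mu> \<Otimes>\<^sub>M noise_space (Suc n))) =
      (\<integral>\<^sup>+z. (\<integral>\<^sup>+\<omega>. g (euler_path s (noise_vec \<omega>) z (Suc n)) \<partial>noise_space (Suc n)) \<partial>\<mu>)"
    using Q'.nn_integral_fst[OF meas] by simp
  also have "\<dots> = (\<integral>\<^sup>+z. (\<integral>\<^sup>+\<omega>. G (euler_path s (noise_vec \<omega>) z n) \<partial>noise_space n) \<partial>\<mu>)"
    by (rule nn_integral_cong) (rule inner)
  also have "\<dots> = (\<integral>\<^sup>+x. G (euler_path s (noise_vec (snd x)) (fst x) n) \<partial>(\<mu> \<Otimes>\<^sub>M noise_space n))"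
    using Q.nn_integral_fst[OF measn] by simp
  also have "\<dots> = (\<integral>\<^sup>+z. G z \<partial>euler_law s \<mu> n)" by (rule Suc.IH) measurable
  also have "\<dots> = (\<integral>\<^sup>+z. g z \<partial>euler_law s \<mu> (Suc n))"
    unfolding G_def by (rule nn_integral_euler_law_Suc[symmetric]) (use assms in auto)
  finally show ?case .
qed

text \<open>The scaled increments are independent standard normals, and jointly independent of the
  initial state because they are measurable with respect to the sigma-algebra generated by the
  Brownian motion.\<close>

lemma solution_noise_law:
  fixes n :: nat
  assumes sol: "langevin_solution gradU u \<gamma> M B X V" and h: "h > 0"
  defines "I \<equiv> noise_index (Suc n)"
    and "\<zeta> \<equiv> \<lambda>(k, j) \<omega>. (1 / sqrt h) * ((B (real (Suc k) * h) \<omega> - B (real k * h) \<omega>) $ j)"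
  shows "distr M (borel \<Otimes>\<^sub>M noise_space (Suc n)) (\<lambda>\<omega>. ((X 0 \<omega>, V 0 \<omega>), \<lambda>i\<in>I. \<zeta> i \<omega>))
      = law_at M X V 0 \<Otimes>\<^sub>M noise_space (Suc n)"
    and "(\<lambda>\<omega>. ((X 0 \<omega>, V 0 \<omega>), \<lambda>i\<in>I. \<zeta> i \<omega>)) \<in> measurable M (borel \<Otimes>\<^sub>M noise_space (Suc n))"
proof -
  have bm: "std_BM M B" using sol by (simp add: langevin_solution_def)
  interpret prob_space M using bm by (simp add: std_BM_def)
  have XV: "(\<lambda>\<omega>. (X 0 \<omega>, V 0 \<omega>)) \<in> borel_measurable M"
    using sol by (intro borel_measurable_Pair) (auto simp: langevin_solution_def)
  have Ine: "I \<noteq> {}" by (auto simp: I_def)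
  define ts where "ts i = real i * h" for i :: nat
  have ts: "0 \<le> ts 0" "\<forall>i<Suc n. ts i < ts (Suc i)" using h by (auto simp: ts_def algebra_simps)
  have incr: "indep_vars (\<lambda>_. borel) (\<lambda>(i,j) \<omega>. (B (ts (Suc i)) \<omega> - B (ts i) \<omega>) $ j) I"
    and dist: "\<And>i j. i < Suc n \<Longrightarrow> distributed M lborel (\<lambda>\<omega>. (B (ts (Suc i)) \<omega> - B (ts i) \<omega>) $ j)
            (normal_density 0 (sqrt (ts (Suc i) - ts i)))"
    using bm ts unfolding std_BM_def I_def by auto
  have indep: "indep_vars (\<lambda>_. borel) \<zeta> I"
  proof -
    have "indep_vars (\<lambda>_. borel) (\<lambda>i \<omega>. (1 / sqrt h) * (case i of (i,j) \<Rightarrow> \<lambda>\<omega>. (B (ts (Suc i)) \<omega> - B (ts i) \<omega>) $ j) \<omega>) I"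
      by (rule indep_vars_compose2[OF incr]) auto
    then show ?thesis
      by (rule indep_vars_cong[THEN iffD1, rotated -1]) (auto simp: \<zeta>_def ts_def)
  qed
  have std: "distr M borel (\<zeta> i) = std_normal" if i: "i \<in> I" for i
  proof -
    obtain k j where kj: "i = (k, j)" "k < Suc n" using i by (auto simp: I_def)
    have "ts (Suc k) - ts k = h" by (simp add: ts_def algebra_simps)
    then have "distributed M lborel (\<lambda>\<omega>. 0 + (1 / sqrt h) * ((B (ts (Suc k)) \<omega> - B (ts k) \<omega>) $ j))
        (normal_density (0 + (1 / sqrt h) * 0) (\<bar>1 / sqrt h\<bar> * sqrt h))"
      using dist[OF kj(2), of j] h by (intro normal_density_affine) auto
    then have "distributed M lborel (\<zeta> i) std_normal_density"
      using h by (simp add: kj \<zeta>_def ts_def)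
    then have "distr M lborel (\<zeta> i) = std_normal" by (rule distributed_distr_eq_density)
    moreover have "distr M lborel (\<zeta> i) = distr M borel (\<zeta> i)" by (rule distr_cong) auto
    ultimately show ?thesis by simp
  qed
  have rv: "\<zeta> i \<in> borel_measurable M" if "i \<in> I" for i
    using indep that by (auto simp: indep_vars_def)
  have joint: "distr M (\<Pi>\<^sub>M i\<in>I. borel) (\<lambda>\<omega>. \<lambda>i\<in>I. \<zeta> i \<omega>) = (\<Pi>\<^sub>M i\<in>I. distr M borel (\<zeta> i))"
    using indep_vars_iff_distr_eq_PiM'[OF Ine rv] indep by simp
  also have "\<dots> = (\<Pi>\<^sub>M i\<in>I. std_normal)" by (rule PiM_cong) (auto simp: std)
  finally have joint: "distr M (\<Pi>\<^sub>M i\<in>I. borel) (\<lambda>\<omega>. \<lambda>i\<in>I. \<zeta> i \<omega>) = noise_space (Suc n)"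
    by (simp add: I_def)
  have setsP: "sets (\<Pi>\<^sub>M i\<in>I. (borel :: real measure)) = sets (noise_space (Suc n))"
    unfolding I_def by (rule sets_PiM_cong) auto
  have Nm: "(\<lambda>\<omega>. \<lambda>i\<in>I. \<zeta> i \<omega>) \<in> measurable M (\<Pi>\<^sub>M i\<in>I. borel)"
    by (rule measurable_restrict) (rule rv)
  \<comment> \<open>The sigma-algebra of the Brownian motion over all times; independence from it is
    passed on to the smaller one generated by the increments.\<close>
  define \<B> where "\<B> = sigma (space M) (\<Union>t\<in>{0..}. {B t -` A \<inter> space M | A. A \<in> sets borel})"
  have gen: "(\<Union>t\<in>{0..}. {B t -` A \<inter> space M | A. A \<in> sets borel}) \<subseteq> Pow (space M)" by auto
  have sp\<B>: "space \<B> = space M" and sets\<B>: "sets \<B> = sigma_sets (space M) (\<Union>t\<in>{0..}. {B t -` A \<inter> space M | A. A \<in> sets borel})"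
    unfolding \<B>_def using gen by (simp_all add: space_measure_of sets_measure_of)
  have B\<B>: "B t \<in> borel_measurable \<B>" if "0 \<le> t" for t
  proof (rule measurableI)
    fix A :: "(real^'n) set" assume "A \<in> sets borel"
    then have "B t -` A \<inter> space M \<in> (\<Union>t\<in>{0..}. {B t -` A \<inter> space M | A. A \<in> sets borel})" using that by auto
    then show "B t -` A \<inter> space \<B> \<in> sets \<B>" unfolding sp\<B> sets\<B> by (rule sigma_sets.Basic)
  qed simp
  have N\<B>: "(\<lambda>\<omega>. \<lambda>i\<in>I. \<zeta> i \<omega>) \<in> measurable \<B> (\<Pi>\<^sub>M i\<in>I. borel)"
  proof (rule measurable_restrict)
    fix i assume "i \<in> I"
    obtain k j where kj: "i = (k, j)" by (cases i)
    have [measurable]: "B (real (Suc k) * h) \<in> borel_measurable \<B>" "B (real k * h) \<in> borel_measurable \<B>"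
      using h by (auto intro!: B\<B>)
    show "\<zeta> i \<in> borel_measurable \<B>" unfolding \<zeta>_def kj prod.case
      by (intro borel_measurable_times borel_measurable_const measurable_compose[OF _ borel_measurable_continuous_onI, of _ _ "\<lambda>x. x $ j"]
          continuous_intros borel_measurable_diff) measurable
  qed
  have "indep_set (sigma_sets (space M) {(\<lambda>\<omega>. (X 0 \<omega>, V 0 \<omega>)) -` A \<inter> space M | A. A \<in> sets borel})
      (sets \<B>)"
    using sol unfolding langevin_solution_def sets\<B> by simp
  then have "indep_set (sigma_sets (space M) {(\<lambda>\<omega>. (X 0 \<omega>, V 0 \<omega>)) -` A \<inter> space M | A. A \<in> sets borel})
      (sigma_sets (space M) {(\<lambda>\<omega>. \<lambda>i\<in>I. \<zeta> i \<omega>) -` A \<inter> space M | A. A \<in> sets (\<Pi>\<^sub>M i\<in>I. borel)})"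
    unfolding indep_set_def
  proof (rule indep_sets_mono_sets)
    have "sigma_sets (space M) {(\<lambda>\<omega>. \<lambda>i\<in>I. \<zeta> i \<omega>) -` A \<inter> space M | A. A \<in> sets (\<Pi>\<^sub>M i\<in>I. borel)} \<subseteq> sets \<B>"
      using measurable_sets[OF N\<B>] unfolding sp\<B>[symmetric] by (intro sets.sigma_sets_subset) auto
    then show "case_bool (sigma_sets (space M) {(\<lambda>\<omega>. (X 0 \<omega>, V 0 \<omega>)) -` A \<inter> space M | A. A \<in> sets borel})
      (sigma_sets (space M) {(\<lambda>\<omega>. \<lambda>i\<in>I. \<zeta> i \<omega>) -` A \<inter> space M | A. A \<in> sets (\<Pi>\<^sub>M i\<in>I. borel)}) b
      \<subseteq> case_bool (sigma_sets (space M) {(\<lambda>\<omega>. (X 0 \<omega>, V 0 \<omega>)) -` A \<inter> space M | A. A \<in> sets borel}) (sets \<B>) b" for b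
      by (cases b) auto
  qed
  note ind = indep_setD[OF this]
  have "law_at M X V 0 \<Otimes>\<^sub>M noise_space (Suc n) =
      distr M (borel \<Otimes>\<^sub>M (\<Pi>\<^sub>M i\<in>I. borel)) (\<lambda>\<omega>. ((X 0 \<omega>, V 0 \<omega>), \<lambda>i\<in>I. \<zeta> i \<omega>))"
    unfolding joint[symmetric] law_at_def
  proof (rule pair_measure_eqI)
    show "sigma_finite_measure (distr M borel (\<lambda>\<omega>. (X 0 \<omega>, V 0 \<omega>)))"
      "sigma_finite_measure (distr M (\<Pi>\<^sub>M i\<in>I. borel) (\<lambda>\<omega>. \<lambda>i\<in>I. \<zeta> i \<omega>))"
      by (intro prob_space_imp_sigma_finite prob_space_distr XV Nm)+
    show "sets (distr M borel (\<lambda>\<omega>. (X 0 \<omega>, V 0 \<omega>)) \<Otimes>\<^sub>M distr M (\<Pi>\<^sub>M i\<in>I. borel) (\<lambda>\<omega>. \<lambda>i\<in>I. \<zeta> i \<omega>))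
      = sets (distr M (borel \<Otimes>\<^sub>M (\<Pi>\<^sub>M i\<in>I. borel)) (\<lambda>\<omega>. ((X 0 \<omega>, V 0 \<omega>), \<lambda>i\<in>I. \<zeta> i \<omega>)))"
      unfolding sets_distr by (rule sets_pair_measure_cong) simp_all
    fix A C assume "A \<in> sets (distr M borel (\<lambda>\<omega>. (X 0 \<omega>, V 0 \<omega>)))" "C \<in> sets (distr M (\<Pi>\<^sub>M i\<in>I. borel) (\<lambda>\<omega>. \<lambda>i\<in>I. \<zeta> i \<omega>))"
    then have A: "A \<in> sets borel" and C: "C \<in> sets (\<Pi>\<^sub>M i\<in>I. borel)" by auto
    let ?a = "(\<lambda>\<omega>. (X 0 \<omega>, V 0 \<omega>)) -` A \<inter> space M" and ?c = "(\<lambda>\<omega>. \<lambda>i\<in>I. \<zeta> i \<omega>) -` C \<inter> space M"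
    have "emeasure (distr M (borel \<Otimes>\<^sub>M (\<Pi>\<^sub>M i\<in>I. borel)) (\<lambda>\<omega>. ((X 0 \<omega>, V 0 \<omega>), \<lambda>i\<in>I. \<zeta> i \<omega>))) (A \<times> C) = emeasure M (?a \<inter> ?c)"
      using A C by (subst emeasure_distr[OF measurable_Pair[OF XV Nm]]) (auto intro!: arg_cong[where f = "emeasure M"])
    also have "\<dots> = emeasure M ?a * emeasure M ?c"
    proof -
      have "prob (?a \<inter> ?c) = prob ?a * prob ?c"
        using A C by (intro ind sigma_sets.Basic) auto
      then show ?thesis by (simp add: emeasure_eq_measure ennreal_mult)
    qed
    also have "\<dots> = emeasure (distr M borel (\<lambda>\<omega>. (X 0 \<omega>, V 0 \<omega>))) A * emeasure (distr M (\<Pi>\<^sub>M i\<in>I. borel) (\<lambda>\<omega>. \<lambda>i\<in>I. \<zeta> i \<omega>)) C"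
      using A C by (simp add: emeasure_distr[OF XV] emeasure_distr[OF Nm])
    finally show "emeasure (distr M borel (\<lambda>\<omega>. (X 0 \<omega>, V 0 \<omega>))) A * emeasure (distr M (\<Pi>\<^sub>M i\<in>I. borel) (\<lambda>\<omega>. \<lambda>i\<in>I. \<zeta> i \<omega>)) C =
      emeasure (distr M (borel \<Otimes>\<^sub>M (\<Pi>\<^sub>M i\<in>I. borel)) (\<lambda>\<omega>. ((X 0 \<omega>, V 0 \<omega>), \<lambda>i\<in>I. \<zeta> i \<omega>))) (A \<times> C)" ..
  qed
  moreover have "distr M (borel \<Otimes>\<^sub>M (\<Pi>\<^sub>M i\<in>I. borel)) (\<lambda>\<omega>. ((X 0 \<omega>, V 0 \<omega>), \<lambda>i\<in>I. \<zeta> i \<omega>)) =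
      distr M (borel \<Otimes>\<^sub>M noise_space (Suc n)) (\<lambda>\<omega>. ((X 0 \<omega>, V 0 \<omega>), \<lambda>i\<in>I. \<zeta> i \<omega>))"
    by (rule distr_cong) (auto intro!: sets_pair_measure_cong setsP)
  ultimately show "distr M (borel \<Otimes>\<^sub>M noise_space (Suc n)) (\<lambda>\<omega>. ((X 0 \<omega>, V 0 \<omega>), \<lambda>i\<in>I. \<zeta> i \<omega>))
      = law_at M X V 0 \<Otimes>\<^sub>M noise_space (Suc n)" by simp
  show "(\<lambda>\<omega>. ((X 0 \<omega>, V 0 \<omega>), \<lambda>i\<in>I. \<zeta> i \<omega>)) \<in> measurable M (borel \<Otimes>\<^sub>M noise_space (Suc n))"
    using measurable_Pair[OF XV Nm] measurable_cong_sets[OF refl sets_pair_measure_cong[OF refl setsP]] by blast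
qed

section \<open>The Euler scheme attached to a solution\<close>

definition solution_euler :: "(real \<Rightarrow> 'a \<Rightarrow> real^'n) \<Rightarrow> (real \<Rightarrow> 'a \<Rightarrow> real^'n) \<Rightarrow> (real \<Rightarrow> 'a \<Rightarrow> real^'n) \<Rightarrow> real \<Rightarrow> nat \<Rightarrow> 'a \<Rightarrow> 'n state" where
  "solution_euler B X V T n \<omega> = euler_path (sqrt (T / real (Suc n)))
    (\<lambda>k. (1 / sqrt (T / real (Suc n))) *\<^sub>R (B (real (Suc k) * (T / real (Suc n))) \<omega> - B (real k * (T / real (Suc n))) \<omega>))
    (X 0 \<omega>, V 0 \<omega>) (Suc n)"

lemma sets_law_at[simp]: "sets (law_at M X V t) = sets borel"
  by (simp add: law_at_def)

lemma prob_space_law_at: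
  assumes "langevin_solution gradU u \<gamma> M B X V" "t \<ge> 0"
  shows "prob_space (law_at M X V t)"
proof -
  interpret prob_space M using assms by (simp add: langevin_solution_def std_BM_def)
  show ?thesis unfolding law_at_def
    using assms by (intro prob_space_distr borel_measurable_Pair) (auto simp: langevin_solution_def)
qed

lemma distr_solution_euler:
  assumes sol: "langevin_solution gradU u \<gamma> M B X V" and T: "T > 0"
  shows "solution_euler B X V T n \<in> borel_measurable M"
    and "distr M borel (solution_euler B X V T n) = euler_law (sqrt (T / real (Suc n))) (law_at M X V 0) (Suc n)"
proof -
  define h where "h = T / real (Suc n)"
  have h: "h > 0" using T by (simp add: h_def)
  define \<zeta> where "\<zeta> = (\<lambda>(k, j) \<omega>. (1 / sqrt h) * ((B (real (Suc k) * h) \<omega> - B (real k * h) \<omega>) $ j))"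
  define \<Phi> where "\<Phi> \<omega> = ((X 0 \<omega>, V 0 \<omega>), \<lambda>i\<in>noise_index (Suc n). \<zeta> i \<omega>)" for \<omega>
  define \<Psi> where "\<Psi> x = euler_path (sqrt h) (noise_vec (snd x)) (fst x) (Suc n)" for x
  note nl = solution_noise_law[OF sol h, of n, folded \<zeta>_def, folded \<Phi>_def]
  \<comment> \<open>The scheme factors through the initial state and finitely many normalised
    increments, whose joint law is known.\<close>
  have eq: "solution_euler B X V T n = (\<lambda>\<omega>. \<Psi> (\<Phi> \<omega>))"
    unfolding solution_euler_def \<Psi>_def \<Phi>_def h_def[symmetric] fst_conv snd_conv
    by (intro ext euler_path_cong) (simp add: noise_vec_def \<zeta>_def vec_eq_iff)
  have \<Psi>: "\<Psi> \<in> borel_measurable (borel \<Otimes>\<^sub>M noise_space (Suc n))"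
    using measurable_euler_path[where k = "Suc n" and n = "Suc n" and s = "sqrt h", OF order_refl refl] by (simp add: \<Psi>_def[abs_def] split_beta')
  show m: "solution_euler B X V T n \<in> borel_measurable M"
    unfolding eq by (rule measurable_compose[OF nl(2) \<Psi>])
  have P0: "prob_space (law_at M X V 0)" by (rule prob_space_law_at[OF sol]) simp
  show "distr M borel (solution_euler B X V T n) = euler_law (sqrt (T / real (Suc n))) (law_at M X V 0) (Suc n)"
  proof (rule measure_eqI)
    fix A assume "A \<in> sets (distr M borel (solution_euler B X V T n))"
    then have A[measurable]: "A \<in> sets borel" by simp
    have "emeasure (distr M borel (solution_euler B X V T n)) A = (\<integral>\<^sup>+z. indicator A z \<partial>distr M borel (solution_euler B X V T n))"
      by simp
    also have "\<dots> = (\<integral>\<^sup>+\<omega>. indicator A (\<Psi> (\<Phi> \<omega>)) \<partial>M)"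
      using m unfolding eq by (subst nn_integral_distr) auto
    also have "\<dots> = (\<integral>\<^sup>+x. indicator A (\<Psi> x) \<partial>distr M (borel \<Otimes>\<^sub>M noise_space (Suc n)) \<Phi>)"
      using \<Psi> by (subst nn_integral_distr[OF nl(2)]) auto
    also have "\<dots> = (\<integral>\<^sup>+x. indicator A (euler_path (sqrt h) (noise_vec (snd x)) (fst x) (Suc n)) \<partial>(law_at M X V 0 \<Otimes>\<^sub>M noise_space (Suc n)))"
      unfolding nl(1) \<Psi>_def ..
    also have "\<dots> = (\<integral>\<^sup>+z. indicator A z \<partial>euler_law (sqrt h) (law_at M X V 0) (Suc n))"
      by (rule nn_integral_euler_path[OF P0]) auto
    also have "\<dots> = emeasure (euler_law (sqrt h) (law_at M X V 0) (Suc n)) A"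
      using sets_euler_law[of "law_at M X V 0" "sqrt h" "Suc n"] by (intro nn_integral_indicator) (simp del: euler_law.simps)
    finally show "emeasure (distr M borel (solution_euler B X V T n)) A = emeasure (euler_law (sqrt (T / real (Suc n))) (law_at M X V 0) (Suc n)) A"
      by (simp only: h_def)
  qed (simp add: sets_euler_law del: euler_law.simps(2))
qed

lemma solution_euler_tendsto:
  assumes sol: "langevin_solution gradU u \<gamma> M B X V" and T: "T > 0" and \<omega>: "\<omega> \<in> space M"
  shows "(\<lambda>n. solution_euler B X V T n \<omega>) \<longlonglongrightarrow> (X T \<omega>, V T \<omega>)"
  unfolding solution_euler_def
proof (rule euler_path_converges[OF _ _ _ _ T])
  have *: "continuous_on {0..} (\<lambda>t. X t \<omega>)" "continuous_on {0..} (\<lambda>t. V t \<omega>)"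
    "\<forall>t\<ge>0. X t \<omega> = X 0 \<omega> + integral {0..t} (\<lambda>s. V s \<omega>) \<and>
      V t \<omega> = V 0 \<omega> - integral {0..t} (\<lambda>s. \<gamma> *\<^sub>R V s \<omega> + u *\<^sub>R gradU (X s \<omega>)) + sqrt (2 * \<gamma> * u) *\<^sub>R B t \<omega>"
    using sol \<omega> unfolding langevin_solution_def by blast+
  show "continuous_on {0..} (\<lambda>t. X t \<omega>)" "continuous_on {0..} (\<lambda>t. V t \<omega>)" by (rule *)+
  show "X t \<omega> = X 0 \<omega> + integral {0..t} (\<lambda>s. V s \<omega>)" if "0 \<le> t" for t using *(3) that by blast
  show "V t \<omega> = V 0 \<omega> - integral {0..t} (\<lambda>s. \<gamma> *\<^sub>R V s \<omega> + u *\<^sub>R gradU (X s \<omega>)) + sqrt (2 * \<gamma> * u) *\<^sub>R B t \<omega>"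
    if "0 \<le> t" for t using *(3) that by blast
qed

text \<open>Dominated convergence on the probability space of the solution. The result mentions laws
  only, so it can be combined with couplings that live elsewhere.\<close>

lemma euler_law_tendsto:
  assumes sol: "langevin_solution gradU u \<gamma> M B X V" and T: "T > 0"
    and g: "continuous_on UNIV g" "\<And>z. \<bar>g z\<bar> \<le> (C :: real)"
  shows "(\<lambda>n. \<integral>z. g z \<partial>euler_law (sqrt (T / real (Suc n))) (law_at M X V 0) (Suc n)) \<longlonglongrightarrow> (\<integral>z. g z \<partial>law_at M X V T)"
proof -
  interpret prob_space M using sol by (simp add: langevin_solution_def std_BM_def)
  have [measurable]: "g \<in> borel_measurable borel" using g(1) by (rule borel_measurable_continuous_onI)
  note [measurable] = distr_solution_euler(1)[OF sol T]
  have XV[measurable]: "(\<lambda>\<omega>. (X T \<omega>, V T \<omega>)) \<in> borel_measurable M"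
    using sol T by (intro borel_measurable_Pair) (auto simp: langevin_solution_def)
  have "(\<lambda>n. \<integral>\<omega>. g (solution_euler B X V T n \<omega>) \<partial>M) \<longlonglongrightarrow> (\<integral>\<omega>. g (X T \<omega>, V T \<omega>) \<partial>M)"
  proof (rule integral_dominated_convergence[where w = "\<lambda>_. C"])
    show "AE \<omega> in M. (\<lambda>n. g (solution_euler B X V T n \<omega>)) \<longlonglongrightarrow> g (X T \<omega>, V T \<omega>)"
      using solution_euler_tendsto[OF sol T] g(1)
      by (intro AE_I2) (auto simp: continuous_on_eq_continuous_at intro: isCont_tendsto_compose)
  qed (use g(2) in auto)
  moreover have "(\<integral>z. g z \<partial>euler_law (sqrt (T / real (Suc n))) (law_at M X V 0) (Suc n)) =
      (\<integral>\<omega>. g (solution_euler B X V T n \<omega>) \<partial>M)" for n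
    unfolding distr_solution_euler(2)[OF sol T, symmetric] by (rule integral_distr) measurable
  moreover have "(\<integral>z. g z \<partial>law_at M X V T) = (\<integral>\<omega>. g (X T \<omega>, V T \<omega>) \<partial>M)"
    unfolding law_at_def by (rule integral_distr) measurable
  ultimately show ?thesis by (simp only:)
qed

text \<open>Along each path the scheme converges and hence is bounded, so the events that some
  approximation exceeds k decrease to the empty set. This yields tightness uniformly in n for
  arbitrary initial laws.\<close>

lemma euler_law_tight:
  assumes sol: "langevin_solution gradU u \<gamma> M B X V" and T: "T > 0" and e: "e > 0"
  obtains K where "\<And>n. measure (euler_law (sqrt (T / real (Suc n))) (law_at M X V 0) (Suc n)) {z. norm z > K} < e"
proof -
  interpret prob_space M using sol by (simp add: langevin_solution_def std_BM_def)
  note [measurable] = distr_solution_euler(1)[OF sol T]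
  define E where "E k = {\<omega> \<in> space M. \<exists>n. norm (solution_euler B X V T n \<omega>) > real k}" for k :: nat
  have E: "range E \<subseteq> events" unfolding E_def by auto
  have "E k \<subseteq> E j" if "j \<le> k" for j k
  proof
    fix \<omega> assume "\<omega> \<in> E k"
    then obtain n where "\<omega> \<in> space M" "norm (solution_euler B X V T n \<omega>) > real k" by (auto simp: E_def)
    moreover have "real j \<le> real k" using that by simp
    ultimately show "\<omega> \<in> E j" unfolding E_def using order_le_less_trans by blast
  qed
  then have "decseq E" unfolding decseq_def by blast
  from finite_Lim_measure_decseq[OF E this] have lim: "(\<lambda>k. prob (E k)) \<longlonglongrightarrow> prob (\<Inter>k. E k)" .
  have "(\<Inter>k. E k) = {}"
  proof -
    have "\<exists>k. \<omega> \<notin> E k" if "\<omega> \<in> space M" for \<omega>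
    proof -
      have "Bseq (\<lambda>n. solution_euler B X V T n \<omega>)"
        using solution_euler_tendsto[OF sol T that] by (intro convergent_imp_Bseq) (auto simp: convergent_def)
      then obtain K where K: "\<And>n. norm (solution_euler B X V T n \<omega>) \<le> K" by (auto simp: Bseq_def)
      obtain k where "K \<le> real k" using real_arch_simple by blast
      then have "norm (solution_euler B X V T n \<omega>) \<le> real k" for n using K order_trans by blast
      then show ?thesis by (intro exI[of _ k]) (auto simp: E_def not_less)
    qed
    then show ?thesis unfolding E_def by blast
  qed
  with lim e have "eventually (\<lambda>k. prob (E k) < e) sequentially"
    by (intro order_tendstoD(2)[where y = 0]) auto
  then obtain k where k: "prob (E k) < e" by (auto simp: eventually_sequentially)
  have "measure (euler_law (sqrt (T / real (Suc n))) (law_at M X V 0) (Suc n)) {z. norm z > real k} < e" for n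
  proof -
    have "measure (euler_law (sqrt (T / real (Suc n))) (law_at M X V 0) (Suc n)) {z. norm z > real k}
        = prob (solution_euler B X V T n -` {z. norm z > real k} \<inter> space M)"
      unfolding distr_solution_euler(2)[OF sol T, symmetric] by (subst measure_distr) auto
    also have "\<dots> \<le> prob (E k)"
      using E by (intro finite_measure_mono) (auto simp: E_def)
    finally show ?thesis using k by simp
  qed
  then show ?thesis using that by blast
qed

end

section \<open>Coupled Euler chains\<close>

lemma prob_space_norm_tight:
  fixes \<mu> :: "'a::real_normed_vector measure"
  assumes "prob_space \<mu>" and sets: "sets \<mu> = sets borel" and e: "e > 0"
  obtains K where "measure \<mu> {x. norm x > K} < e"
proof -
  interpret prob_space \<mu> by fact
  define E where "E k = {x :: 'a. norm x > real k}" for k :: nat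
  have "open (E k)" for k unfolding E_def by (intro open_Collect_less continuous_intros)
  then have E: "range E \<subseteq> events" using sets by auto
  have "decseq E" unfolding decseq_def E_def
    by (intro allI impI subsetI, unfold mem_Collect_eq) (meson of_nat_mono order_le_less_trans)
  from finite_Lim_measure_decseq[OF E this] have lim: "(\<lambda>k. prob (E k)) \<longlonglongrightarrow> prob (\<Inter>k. E k)" .
  have "x \<notin> (\<Inter>k. E k)" for x
  proof -
    obtain k where "norm x \<le> real k" using real_arch_simple by blast
    then have "x \<notin> E k" by (simp add: E_def)
    then show ?thesis by blast
  qed
  then have "(\<Inter>k. E k) = {}" by blast
  with lim e have "eventually (\<lambda>k. prob (E k) < e) sequentially"
    by (intro order_tendstoD(2)[where y = 0]) auto
  then obtain k where "prob (E k) < e" by (auto simp: eventually_sequentially)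
  then show ?thesis using that[of "real k"] by (simp add: E_def)
qed

context langevin
begin

text \<open>The law of (starting pair, current pair). The starting pair is carried along unchanged
  so that a cut-off depending on it passes through every step as a constant factor.\<close>

primrec coupled_law :: "real \<Rightarrow> real \<Rightarrow> ('n state \<times> 'n state) measure \<Rightarrow> nat \<Rightarrow>
    (('n state \<times> 'n state) \<times> ('n state \<times> 'n state)) measure" where
  "coupled_law \<xi> s \<Gamma> 0 = distr \<Gamma> borel (\<lambda>zz. (zz, zz))"
| "coupled_law \<xi> s \<Gamma> (Suc k) = distr (coupled_law \<xi> s \<Gamma> k \<Otimes>\<^sub>M std_gauss) borel
    (\<lambda>(zz, N). (fst zz, coupled_step \<xi> s (snd zz) N))"

lemma sets_coupled_law[simp, measurable_cong]: "sets (coupled_law \<xi> s \<Gamma> k) = sets borel"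
  by (cases k) auto

lemma measurable_coupled_law_step:
  "(\<lambda>(zz, N). (fst zz, coupled_step \<xi> s (snd zz) N)) \<in> borel_measurable (coupled_law \<xi> s \<Gamma> k \<Otimes>\<^sub>M std_gauss)"
  unfolding split_beta' by (intro borel_measurable_Pair measurable_coupled_step) measurable

context
  fixes \<Gamma> :: "('n state \<times> 'n state) measure"
  assumes \<Gamma>: "prob_space \<Gamma>" "sets \<Gamma> = sets borel"
begin

lemma prob_space_coupled_law: "prob_space (coupled_law \<xi> s \<Gamma> k)"
proof (induction k)
  case 0
  interpret prob_space \<Gamma> by (rule \<Gamma>)
  note [measurable_cong] = \<Gamma>(2)
  show ?case by (simp, rule prob_space_distr, rule borel_measurable_Pair) measurable
next
  case (Suc k)
  interpret prob_space "coupled_law \<xi> s \<Gamma> k" by fact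
  interpret pair_prob_space "coupled_law \<xi> s \<Gamma> k" "std_gauss :: (real^'n) measure" ..
  show ?case unfolding coupled_law.simps by (rule prob_space_distr) (rule measurable_coupled_law_step)
qed

lemma nn_integral_coupled_law_0:
  assumes [measurable]: "g \<in> borel_measurable borel"
  shows "(\<integral>\<^sup>+x. g x \<partial>coupled_law \<xi> s \<Gamma> 0) = (\<integral>\<^sup>+zz. g (zz, zz) \<partial>\<Gamma>)"
proof -
  note [measurable_cong] = \<Gamma>(2)
  have "(\<lambda>zz. (zz, zz)) \<in> borel_measurable \<Gamma>" by (rule borel_measurable_Pair) measurable
  then show ?thesis by (simp add: nn_integral_distr)
qed

lemma nn_integral_coupled_law_Suc:
  assumes [measurable]: "g \<in> borel_measurable borel"
  shows "(\<integral>\<^sup>+x. g x \<partial>coupled_law \<xi> s \<Gamma> (Suc k)) =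
    (\<integral>\<^sup>+x. (\<integral>\<^sup>+N. g (fst x, coupled_step \<xi> s (snd x) N) \<partial>std_gauss) \<partial>coupled_law \<xi> s \<Gamma> k)"
proof -
  have m: "(\<lambda>x. g (fst (fst x), coupled_step \<xi> s (snd (fst x)) (snd x))) \<in> borel_measurable (coupled_law \<xi> s \<Gamma> k \<Otimes>\<^sub>M std_gauss)"
    using measurable_compose[OF measurable_coupled_law_step assms] by (simp add: split_beta')
  have "(\<integral>\<^sup>+x. g x \<partial>coupled_law \<xi> s \<Gamma> (Suc k)) =
      (\<integral>\<^sup>+x. g (fst (fst x), coupled_step \<xi> s (snd (fst x)) (snd x)) \<partial>(coupled_law \<xi> s \<Gamma> k \<Otimes>\<^sub>M std_gauss))"
    unfolding coupled_law.simps by (subst nn_integral_distr[OF measurable_coupled_law_step]) (auto simp: split_beta')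
  then show ?thesis using std_gauss.nn_integral_fst[OF m] by simp
qed

lemma nn_integral_coupled_law_initial:
  assumes [measurable]: "g \<in> borel_measurable borel"
  shows "(\<integral>\<^sup>+x. g (fst x) \<partial>coupled_law \<xi> s \<Gamma> k) = (\<integral>\<^sup>+zz. g zz \<partial>\<Gamma>)"
proof (induction k)
  case 0
  show ?case by (subst nn_integral_coupled_law_0) auto
next
  case (Suc k)
  have "(\<integral>\<^sup>+x. g (fst x) \<partial>coupled_law \<xi> s \<Gamma> (Suc k)) = (\<integral>\<^sup>+x. g (fst x) \<partial>coupled_law \<xi> s \<Gamma> k)"
    by (subst nn_integral_coupled_law_Suc) (auto simp: std_gauss.emeasure_space_1[simplified])
  then show ?case using Suc by simp
qed

lemma nn_integral_coupled_law_fst: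
  assumes "g \<in> borel_measurable borel"
  shows "(\<integral>\<^sup>+x. g (fst (snd x)) \<partial>coupled_law \<xi> s \<Gamma> k) = (\<integral>\<^sup>+z. g z \<partial>euler_law s (distr \<Gamma> borel fst) k)"
  using assms
proof (induction k arbitrary: g)
  case 0
  note [measurable] = 0 and [measurable_cong] = \<Gamma>(2)
  show ?case by (subst nn_integral_coupled_law_0) (auto simp: nn_integral_distr)
next
  case (Suc k)
  note [measurable] = Suc.prems and [measurable_cong] = \<Gamma>(2)
  interpret prob_space \<Gamma> by (rule \<Gamma>)
  have P: "prob_space (distr \<Gamma> borel fst)" by (rule prob_space_distr) measurable
  have "(\<integral>\<^sup>+x. g (fst (snd x)) \<partial>coupled_law \<xi> s \<Gamma> (Suc k)) =
      (\<integral>\<^sup>+x. (\<integral>\<^sup>+N. g (euler s (fst (snd x)) N) \<partial>std_gauss) \<partial>coupled_law \<xi> s \<Gamma> k)"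
    by (subst nn_integral_coupled_law_Suc) (auto simp: coupled_step_def)
  also have "\<dots> = (\<integral>\<^sup>+z. (\<integral>\<^sup>+N. g (euler s z N) \<partial>std_gauss) \<partial>euler_law s (distr \<Gamma> borel fst) k)"
    by (rule Suc.IH) measurable
  also have "\<dots> = (\<integral>\<^sup>+z. g z \<partial>euler_law s (distr \<Gamma> borel fst) (Suc k))"
    by (rule nn_integral_euler_law_Suc[symmetric]) (use P in auto)
  finally show ?case .
qed

text \<open>The rotated noise is again Gaussian, so the second marginal follows the same scheme.\<close>

lemma nn_integral_coupled_law_snd:
  assumes \<xi>: "0 < \<xi>" and "g \<in> borel_measurable borel"
  shows "(\<integral>\<^sup>+x. g (snd (snd x)) \<partial>coupled_law \<xi> s \<Gamma> k) = (\<integral>\<^sup>+z. g z \<partial>euler_law s (distr \<Gamma> borel snd) k)"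
  using assms(2)
proof (induction k arbitrary: g)
  case 0
  note [measurable] = 0 and [measurable_cong] = \<Gamma>(2)
  show ?case by (subst nn_integral_coupled_law_0) (auto simp: nn_integral_distr)
next
  case (Suc k)
  note [measurable] = Suc.prems and [measurable_cong] = \<Gamma>(2)
  interpret prob_space \<Gamma> by (rule \<Gamma>)
  have P: "prob_space (distr \<Gamma> borel snd)" by (rule prob_space_distr) measurable
  have rot: "(\<integral>\<^sup>+N. g (euler s z (rotate_noise \<xi> zz N)) \<partial>std_gauss) = (\<integral>\<^sup>+N. g (euler s z N) \<partial>std_gauss)" for z zz
  proof -
    have [measurable]: "rotate_noise \<xi> zz \<in> borel_measurable borel" using measurable_rotate_noise[of "\<lambda>_. zz" borel "\<lambda>N. N" \<xi>] by simp
    have "(\<integral>\<^sup>+N. g (euler s z N) \<partial>std_gauss) = (\<integral>\<^sup>+N. g (euler s z N) \<partial>distr std_gauss borel (rotate_noise \<xi> zz))"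
      by (simp only: distr_std_gauss_involution[OF rotate_noise(1-3)[OF \<xi>]])
    also have "\<dots> = (\<integral>\<^sup>+N. g (euler s z (rotate_noise \<xi> zz N)) \<partial>std_gauss)"
      by (subst nn_integral_distr) auto
    finally show ?thesis ..
  qed
  have "(\<integral>\<^sup>+x. g (snd (snd x)) \<partial>coupled_law \<xi> s \<Gamma> (Suc k)) =
      (\<integral>\<^sup>+x. (\<integral>\<^sup>+N. g (euler s (snd (snd x)) N) \<partial>std_gauss) \<partial>coupled_law \<xi> s \<Gamma> k)"
    by (subst nn_integral_coupled_law_Suc) (auto simp: coupled_step_def rot)
  also have "\<dots> = (\<integral>\<^sup>+z. (\<integral>\<^sup>+N. g (euler s z N) \<partial>std_gauss) \<partial>euler_law s (distr \<Gamma> borel snd) k)"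
    by (rule Suc.IH) measurable
  also have "\<dots> = (\<integral>\<^sup>+z. g z \<partial>euler_law s (distr \<Gamma> borel snd) (Suc k))"
    by (rule nn_integral_euler_law_Suc[symmetric]) (use P in auto)
  finally show ?case .
qed

lemma distr_coupled_law:
  "distr (coupled_law \<xi> s \<Gamma> k) borel fst = \<Gamma>"
  "distr (coupled_law \<xi> s \<Gamma> k) borel (\<lambda>x. fst (snd x)) = euler_law s (distr \<Gamma> borel fst) k"
  "0 < \<xi> \<Longrightarrow> distr (coupled_law \<xi> s \<Gamma> k) borel (\<lambda>x. snd (snd x)) = euler_law s (distr \<Gamma> borel snd) k"
proof -
  have *: "distr K borel h = M" if [simp]: "sets M = sets borel" and [measurable]: "h \<in> borel_measurable K"
    and "\<And>g. g \<in> borel_measurable borel \<Longrightarrow> (\<integral>\<^sup>+x. g (h x) \<partial>K) = (\<integral>\<^sup>+z. g z \<partial>M)"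
    for K :: "'x measure" and M :: "('y::topological_space) measure" and h
  proof (rule measure_eqI)
    fix A assume "A \<in> sets (distr K borel h)"
    then have [measurable]: "A \<in> sets borel" by simp
    have "emeasure (distr K borel h) A = (\<integral>\<^sup>+z. indicator A z \<partial>distr K borel h)" by simp
    also have "\<dots> = (\<integral>\<^sup>+x. indicator A (h x) \<partial>K)" by (subst nn_integral_distr) auto
    also have "\<dots> = emeasure M A" using that(3)[of "indicator A"] by simp
    finally show "emeasure (distr K borel h) A = emeasure M A" .
  qed simp
  show "distr (coupled_law \<xi> s \<Gamma> k) borel fst = \<Gamma>"
    by (rule *) (use \<Gamma> nn_integral_coupled_law_initial in auto)
  show "distr (coupled_law \<xi> s \<Gamma> k) borel (\<lambda>x. fst (snd x)) = euler_law s (distr \<Gamma> borel fst) k"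
    by (rule *) (use nn_integral_coupled_law_fst in \<open>auto simp: sets_euler_law\<close>)
  show "distr (coupled_law \<xi> s \<Gamma> k) borel (\<lambda>x. snd (snd x)) = euler_law s (distr \<Gamma> borel snd) k" if "0 < \<xi>"
    by (rule *) (use nn_integral_coupled_law_snd[OF that] in \<open>auto simp: sets_euler_law\<close>)
qed

text \<open>Since \<psi> depends on the starting pair only, it factors out of each inner integral,
  and the weighted means a of \<open>rho\<close> and b of \<open>size2\<close> satisfy a linear
  recursion: b grows by 1 + K s^2, a contracts by 1 - c s^2 with source \<eta> s^2 b. With extended
  nonnegative values both means may be infinite here.\<close>

lemma coupled_law_contraction:
  assumes \<xi>: "0 < \<xi>" and \<eta>: "0 \<le> \<eta>" and K: "0 \<le> K" and cs: "0 \<le> 1 - c * s\<^sup>2"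
    and rho: "\<And>zz. (\<integral>\<^sup>+N. ennreal (rho (coupled_step \<xi> s zz N)) \<partial>std_gauss)
      \<le> ennreal (1 - c * s\<^sup>2) * ennreal (rho zz) + ennreal (\<eta> * s\<^sup>2) * ennreal (size2 zz)"
    and size: "\<And>zz. (\<integral>\<^sup>+N. ennreal (size2 (coupled_step \<xi> s zz N)) \<partial>std_gauss)
      \<le> ennreal (1 + K * s\<^sup>2) * ennreal (size2 zz)"
    and \<psi>[measurable]: "\<psi> \<in> borel_measurable borel"
  shows "(\<integral>\<^sup>+x. \<psi> (fst x) * ennreal (rho (snd x)) \<partial>coupled_law \<xi> s \<Gamma> n) \<le>
      ennreal (exp (- c * (real n * s\<^sup>2))) * (\<integral>\<^sup>+zz. \<psi> zz * ennreal (rho zz) \<partial>\<Gamma>)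
      + ennreal (\<eta> * (real n * s\<^sup>2) * exp (K * (real n * s\<^sup>2))) * (\<integral>\<^sup>+zz. \<psi> zz * ennreal (size2 zz) \<partial>\<Gamma>)"
proof -
  define a where "a k = (\<integral>\<^sup>+x. \<psi> (fst x) * ennreal (rho (snd x)) \<partial>coupled_law \<xi> s \<Gamma> k)" for k
  define b where "b k = (\<integral>\<^sup>+x. \<psi> (fst x) * ennreal (size2 (snd x)) \<partial>coupled_law \<xi> s \<Gamma> k)" for k
  define q where "q = 1 - c * s\<^sup>2"
  define p1 where "p1 = 1 + K * s\<^sup>2"
  have q: "0 \<le> q" "q \<le> 1" using cs c_pos by (auto simp: q_def)
  have p1: "1 \<le> p1" using K by (simp add: p1_def)
  have b_step: "b (Suc k) \<le> ennreal p1 * b k" for k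
  proof -
    have "b (Suc k) = (\<integral>\<^sup>+x. \<psi> (fst x) * (\<integral>\<^sup>+N. ennreal (size2 (coupled_step \<xi> s (snd x) N)) \<partial>std_gauss) \<partial>coupled_law \<xi> s \<Gamma> k)"
      unfolding b_def by (subst nn_integral_coupled_law_Suc) (auto simp: nn_integral_cmult)
    also have "\<dots> \<le> (\<integral>\<^sup>+x. ennreal p1 * (\<psi> (fst x) * ennreal (size2 (snd x))) \<partial>coupled_law \<xi> s \<Gamma> k)"
      using size by (intro nn_integral_mono) (auto simp: p1_def mult.left_commute intro!: mult_left_mono)
    finally show ?thesis unfolding b_def by (simp add: nn_integral_cmult)
  qed
  have a_step: "a (Suc k) \<le> ennreal q * a k + ennreal (\<eta> * s\<^sup>2) * b k" for k
  proof -
    have "a (Suc k) = (\<integral>\<^sup>+x. \<psi> (fst x) * (\<integral>\<^sup>+N. ennreal (rho (coupled_step \<xi> s (snd x) N)) \<partial>std_gauss) \<partial>coupled_law \<xi> s \<Gamma> k)"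
      unfolding a_def by (subst nn_integral_coupled_law_Suc) (auto simp: nn_integral_cmult)
    also have "\<dots> \<le> (\<integral>\<^sup>+x. \<psi> (fst x) * (ennreal q * ennreal (rho (snd x)) + ennreal (\<eta> * s\<^sup>2) * ennreal (size2 (snd x))) \<partial>coupled_law \<xi> s \<Gamma> k)"
      using rho by (intro nn_integral_mono) (auto simp: q_def intro!: mult_left_mono)
    also have "\<dots> = (\<integral>\<^sup>+x. ennreal q * (\<psi> (fst x) * ennreal (rho (snd x))) + ennreal (\<eta> * s\<^sup>2) * (\<psi> (fst x) * ennreal (size2 (snd x))) \<partial>coupled_law \<xi> s \<Gamma> k)"
      by (intro nn_integral_cong) (simp add: distrib_left mult.left_commute)
    finally show ?thesis unfolding a_def b_def by (simp add: nn_integral_cmult nn_integral_add)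
  qed
  have b_bound: "b k \<le> ennreal (p1 ^ k) * b 0" for k
  proof (induction k)
    case (Suc k)
    have "b (Suc k) \<le> ennreal p1 * (ennreal (p1 ^ k) * b 0)"
      using b_step[of k] mult_left_mono[OF Suc, of "ennreal p1"] by (rule order_trans) simp
    also have "\<dots> = ennreal (p1 ^ Suc k) * b 0" using p1 by (simp add: ennreal_mult mult.assoc)
    finally show ?case .
  qed simp
  \<comment> \<open>The power p1^n, not p1^k, keeps the bound linear in k and lets the induction
    close.\<close>
  have a_bound: "a k \<le> ennreal (q ^ k) * a 0 + ennreal (\<eta> * (real k * s\<^sup>2) * p1 ^ n) * b 0" if "k \<le> n" for k
    using that
  proof (induction k)
    case (Suc k)
    have pk: "p1 ^ k \<le> p1 ^ n" using p1 Suc by (intro power_increasing) auto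
    have "a (Suc k) \<le> ennreal q * (ennreal (q ^ k) * a 0 + ennreal (\<eta> * (real k * s\<^sup>2) * p1 ^ n) * b 0)
        + ennreal (\<eta> * s\<^sup>2) * (ennreal (p1 ^ n) * b 0)"
    proof (rule order_trans[OF a_step], intro add_mono mult_left_mono)
      show "a k \<le> ennreal (q ^ k) * a 0 + ennreal (\<eta> * (real k * s\<^sup>2) * p1 ^ n) * b 0" using Suc by simp
      show "b k \<le> ennreal (p1 ^ n) * b 0"
        by (rule order_trans[OF b_bound mult_right_mono[OF ennreal_leI[OF pk]]]) simp
    qed auto
    also have "\<dots> = ennreal (q ^ Suc k) * a 0 + (ennreal (q * (\<eta> * (real k * s\<^sup>2) * p1 ^ n)) + ennreal (\<eta> * s\<^sup>2 * p1 ^ n)) * b 0"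
      using q \<eta> p1 by (simp add: ennreal_mult distrib_left distrib_right mult.assoc add.assoc)
    also have "ennreal (q * (\<eta> * (real k * s\<^sup>2) * p1 ^ n)) + ennreal (\<eta> * s\<^sup>2 * p1 ^ n) \<le> ennreal (\<eta> * (real (Suc k) * s\<^sup>2) * p1 ^ n)"
    proof -
      have "q * (\<eta> * (real k * s\<^sup>2) * p1 ^ n) \<le> 1 * (\<eta> * (real k * s\<^sup>2) * p1 ^ n)"
        using q \<eta> p1 by (intro mult_right_mono) auto
      then have "q * (\<eta> * (real k * s\<^sup>2) * p1 ^ n) + \<eta> * s\<^sup>2 * p1 ^ n \<le> \<eta> * (real (Suc k) * s\<^sup>2) * p1 ^ n"
        by (simp add: algebra_simps)
      moreover have "ennreal (q * (\<eta> * (real k * s\<^sup>2) * p1 ^ n)) + ennreal (\<eta> * s\<^sup>2 * p1 ^ n) =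
          ennreal (q * (\<eta> * (real k * s\<^sup>2) * p1 ^ n) + \<eta> * s\<^sup>2 * p1 ^ n)"
        using q \<eta> p1 by (intro ennreal_plus[symmetric] mult_nonneg_nonneg) auto
      ultimately show ?thesis by (simp only: ennreal_leI)
    qed
    finally show ?case by (simp add: mult_right_mono add_left_mono)
  qed simp
  have "q ^ n \<le> exp (- c * (real n * s\<^sup>2))"
  proof -
    have "q ^ n \<le> exp (- c * s\<^sup>2) ^ n"
      using q exp_ge_add_one_self[of "- c * s\<^sup>2"] by (intro power_mono) (auto simp: q_def)
    also have "\<dots> = exp (real n * (- c * s\<^sup>2))" by (rule exp_of_nat_mult[symmetric])
    also have "real n * (- c * s\<^sup>2) = - c * (real n * s\<^sup>2)" by simp
    finally show ?thesis .
  qed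
  moreover have "p1 ^ n \<le> exp (K * (real n * s\<^sup>2))"
  proof -
    have "p1 ^ n \<le> exp (K * s\<^sup>2) ^ n"
      using p1 exp_ge_add_one_self[of "K * s\<^sup>2"] by (intro power_mono) (auto simp: p1_def)
    also have "\<dots> = exp (real n * (K * s\<^sup>2))" by (rule exp_of_nat_mult[symmetric])
    also have "real n * (K * s\<^sup>2) = K * (real n * s\<^sup>2)" by simp
    finally show ?thesis .
  qed
  then have "\<eta> * (real n * s\<^sup>2) * p1 ^ n \<le> \<eta> * (real n * s\<^sup>2) * exp (K * (real n * s\<^sup>2))"
    using \<eta> by (intro mult_left_mono) auto
  ultimately have "a n \<le> ennreal (exp (- c * (real n * s\<^sup>2))) * a 0 + ennreal (\<eta> * (real n * s\<^sup>2) * exp (K * (real n * s\<^sup>2))) * b 0"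
    by (intro order_trans[OF a_bound[OF order_refl]] add_mono mult_right_mono ennreal_leI) auto
  moreover have "a 0 = (\<integral>\<^sup>+zz. \<psi> zz * ennreal (rho zz) \<partial>\<Gamma>)" "b 0 = (\<integral>\<^sup>+zz. \<psi> zz * ennreal (size2 zz) \<partial>\<Gamma>)"
    unfolding a_def b_def by (subst nn_integral_coupled_law_0; auto)+
  ultimately show ?thesis unfolding a_def by simp
qed

end

section \<open>Passage to the limit in the coupled schemes\<close>

lemma coupling_contraction:
  fixes X1 V1 :: "real \<Rightarrow> 'a \<Rightarrow> real^'n" and X2 V2 :: "real \<Rightarrow> 'b \<Rightarrow> real^'n"
  assumes sol1: "langevin_solution gradU u \<gamma> M1 B1 X1 V1" and sol2: "langevin_solution gradU u \<gamma> M2 B2 X2 V2"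
    and T: "T > 0" and \<Gamma>: "\<Gamma> \<in> couplings (law_at M1 X1 V1 0) (law_at M2 X2 V2 0)"
  obtains \<Gamma>' where "\<Gamma>' \<in> couplings (law_at M1 X1 V1 T) (law_at M2 X2 V2 T)"
    "(\<integral>\<^sup>+p. ennreal (rho p) \<partial>\<Gamma>') \<le> ennreal (exp (- c * T)) * (\<integral>\<^sup>+p. ennreal (rho p) \<partial>\<Gamma>)"
proof -
  have \<Gamma>1: "prob_space \<Gamma>" "sets \<Gamma> = sets borel"
    and \<Gamma>2: "distr \<Gamma> borel fst = law_at M1 X1 V1 0" "distr \<Gamma> borel snd = law_at M2 X2 V2 0"
    using \<Gamma> by (auto simp: couplings_def)
  \<comment> \<open>Tolerances tending to 0; each m gets its own threshold \<xi> m and step bound s0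
    m, and along this diagonal sequence the accumulated error \<open>\<eta> m * Cb\<close>
    vanishes.\<close>
  define \<eta> where "\<eta> m = 1 / real (Suc m)" for m
  have \<eta>: "\<eta> m > 0" for m by (simp add: \<eta>_def)
  have "\<exists>\<xi> s0. 0 < \<xi> \<and> 0 < s0 \<and>
    (\<forall>s zz. 0 < s \<longrightarrow> s \<le> s0 \<longrightarrow> s \<le> 1 \<and> 0 \<le> 1 - c * s\<^sup>2 \<and> (\<integral>\<^sup>+N. ennreal (rho (coupled_step \<xi> s zz N)) \<partial>std_gauss)
      \<le> ennreal (1 - c * s\<^sup>2) * ennreal (rho zz) + ennreal (\<eta> m * s\<^sup>2) * ennreal (size2 zz))" for m
    by (rule one_step_contraction[OF \<eta>[of m]]) (meson order_trans)
  then obtain \<xi> s0 where \<xi>: "\<And>m. 0 < \<xi> m" and s0: "\<And>m. 0 < s0 m"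
    and step: "\<And>m s zz. 0 < s \<Longrightarrow> s \<le> s0 m \<Longrightarrow> s \<le> 1 \<and> 0 \<le> 1 - c * s\<^sup>2 \<and>
      (\<integral>\<^sup>+N. ennreal (rho (coupled_step (\<xi> m) s zz N)) \<partial>std_gauss)
      \<le> ennreal (1 - c * s\<^sup>2) * ennreal (rho zz) + ennreal (\<eta> m * s\<^sup>2) * ennreal (size2 zz)"
    by metis
  obtain K where K: "K > 0" "\<And>s zz \<xi>. 0 < s \<Longrightarrow> s \<le> 1 \<Longrightarrow> 0 < \<xi> \<Longrightarrow>
      (\<integral>\<^sup>+N. ennreal (size2 (coupled_step \<xi> s zz N)) \<partial>std_gauss) \<le> ennreal (1 + K * s\<^sup>2) * ennreal (size2 zz)"
    using size2_step by metis
  have "\<exists>n\<ge>m. sqrt (T / real (Suc n)) \<le> s0 m" for m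
  proof -
    obtain n1 :: nat where n1: "T / (s0 m)\<^sup>2 < real n1" using reals_Archimedean2 by blast
    have "T / (s0 m)\<^sup>2 \<le> real (Suc (max m n1))" using n1 by simp
    then have "T / real (Suc (max m n1)) \<le> (s0 m)\<^sup>2" using s0[of m] by (simp add: field_simps)
    then have "sqrt (T / real (Suc (max m n1))) \<le> s0 m" using s0[of m] by (intro real_le_lsqrt) auto
    then show ?thesis by (intro exI[of _ "max m n1"]) auto
  qed
  \<comment> \<open>The step count is at least m, so it tends to infinity and the Euler laws
    converge along it.\<close>
  then obtain n where n: "\<And>m. m \<le> n m" "\<And>m. sqrt (T / real (Suc (n m))) \<le> s0 m" by metis
  have n_top: "filterlim n at_top at_top" by (rule filterlim_at_top_mono[OF filterlim_ident]) (simp add: n)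
  define s where "s m = sqrt (T / real (Suc (n m)))" for m
  have s: "0 < s m" "s m \<le> s0 m" for m using T n by (auto simp: s_def)
  have sT: "real (Suc (n m)) * (s m)\<^sup>2 = T" for m using T by (simp add: s_def)
  define J where "J m = coupled_law (\<xi> m) (s m) \<Gamma> (Suc (n m))" for m
  have J: "prob_space (J m)" "sets (J m) = sets borel" for m
    unfolding J_def by (rule prob_space_coupled_law[OF \<Gamma>1]) (rule sets_coupled_law)
  note [measurable_cong] = J(2)
  have J0: "distr (J m) borel fst = \<Gamma>" for m unfolding J_def by (rule distr_coupled_law(1)[OF \<Gamma>1])
  have J1: "distr (J m) borel (\<lambda>x. fst (snd x)) = euler_law (sqrt (T / real (Suc (n m)))) (law_at M1 X1 V1 0) (Suc (n m))" for m
    using distr_coupled_law(2)[OF \<Gamma>1, of "\<xi> m" "s m" "Suc (n m)"] unfolding J_def \<Gamma>2 s_def .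
  have J2: "distr (J m) borel (\<lambda>x. snd (snd x)) = euler_law (sqrt (T / real (Suc (n m)))) (law_at M2 X2 V2 0) (Suc (n m))" for m
    using distr_coupled_law(3)[OF \<Gamma>1 \<xi>[of m], of "s m" "Suc (n m)"] unfolding J_def \<Gamma>2 s_def .
  \<comment> \<open>Each of the three components has tight marginals: the fixed \<Gamma> for the
    starting pair, and the two families of Euler laws.\<close>
  have tight: "\<exists>K. \<forall>m. measure (J m) {x. norm x > K} < e" if e: "e > 0" for e
  proof -
    have e3: "e / 3 > 0" using e by simp
    obtain K0 where K0: "measure \<Gamma> {x. norm x > K0} < e / 3" using prob_space_norm_tight[OF \<Gamma>1 e3] by blast
    obtain K1 where K1: "\<And>n. measure (euler_law (sqrt (T / real (Suc n))) (law_at M1 X1 V1 0) (Suc n)) {z. norm z > K1} < e / 3"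
      using euler_law_tight[OF sol1 T e3] by blast
    obtain K2 where K2: "\<And>n. measure (euler_law (sqrt (T / real (Suc n))) (law_at M2 X2 V2 0) (Suc n)) {z. norm z > K2} < e / 3"
      using euler_law_tight[OF sol2 T e3] by blast
    have "measure (J m) {x. norm x > K0 + K1 + K2} < e" for m
    proof -
      interpret prob_space "J m" by (rule J)
      have sp: "space (J m) = UNIV" using sets_eq_imp_space_eq[OF J(2), of m] by simp
      let ?A0 = "{x. norm (fst x) > K0} :: (('n state \<times> 'n state) \<times> 'n state \<times> 'n state) set"
      let ?A1 = "{x. norm (fst (snd x)) > K1} :: (('n state \<times> 'n state) \<times> 'n state \<times> 'n state) set"
      let ?A2 = "{x. norm (snd (snd x)) > K2} :: (('n state \<times> 'n state) \<times> 'n state \<times> 'n state) set"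
      have m0: "?A0 \<in> events" and m1: "?A1 \<in> events" and m2: "?A2 \<in> events"
        unfolding J(2) by (auto intro!: borel_open open_Collect_less continuous_intros)
      have norm3: "norm x \<le> norm (fst x) + (norm (fst (snd x)) + norm (snd (snd x)))" for x :: "('n state \<times> 'n state) \<times> 'n state \<times> 'n state"
        using norm_Pair_le[of "fst x" "snd x"] norm_Pair_le[of "fst (snd x)" "snd (snd x)"] by simp
      have "{x. norm x > K0 + K1 + K2} \<subseteq> ?A0 \<union> (?A1 \<union> ?A2)"
      proof
        fix x :: "('n state \<times> 'n state) \<times> 'n state \<times> 'n state" assume "x \<in> {x. norm x > K0 + K1 + K2}"
        then show "x \<in> ?A0 \<union> (?A1 \<union> ?A2)" unfolding Un_iff mem_Collect_eq using norm3[of x] by linarith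
      qed
      then have "prob {x. norm x > K0 + K1 + K2} \<le> prob (?A0 \<union> (?A1 \<union> ?A2))"
        using m0 m1 m2 by (intro finite_measure_mono) auto
      also have "\<dots> \<le> prob ?A0 + (prob ?A1 + prob ?A2)"
        using measure_Un_le[of ?A0 "J m" "?A1 \<union> ?A2"] measure_Un_le[of ?A1 "J m" ?A2] m0 m1 m2 by auto
      also have "prob ?A0 = measure \<Gamma> {x. norm x > K0}"
        unfolding J0[of m, symmetric] by (subst measure_distr) (auto simp: sp vimage_def)
      also have "prob ?A1 = measure (euler_law (sqrt (T / real (Suc (n m)))) (law_at M1 X1 V1 0) (Suc (n m))) {z. norm z > K1}"
        unfolding J1[symmetric] by (subst measure_distr) (auto simp: sp vimage_def)
      also have "prob ?A2 = measure (euler_law (sqrt (T / real (Suc (n m)))) (law_at M2 X2 V2 0) (Suc (n m))) {z. norm z > K2}"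
        unfolding J2[symmetric] by (subst measure_distr) (auto simp: sp vimage_def)
      finally show ?thesis using K0 K1[of "n m"] K2[of "n m"] by linarith
    qed
    then show ?thesis by blast
  qed
  obtain r JJ where r: "strict_mono (r :: nat \<Rightarrow> nat)" and JJ: "prob_space JJ" "sets JJ = sets borel"
    and conv: "\<And>g :: _ \<Rightarrow> real. continuous_on UNIV g \<Longrightarrow> (\<exists>C. \<forall>x. \<bar>g x\<bar> \<le> C) \<Longrightarrow>
      (\<lambda>m. integral\<^sup>L (J (r m)) g) \<longlonglongrightarrow> integral\<^sup>L JJ g"
    by (rule prokhorov_euclidean[of J, OF J tight]) (blast+)?
  interpret JJ: prob_space JJ by (rule JJ)
  note [measurable_cong] = JJ(2)
  have r_top: "filterlim r at_top at_top" using r by (rule filterlim_subseq)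
  have nr_top: "filterlim (\<lambda>m. n (r m)) at_top at_top" using filterlim_compose[OF n_top r_top] .
  \<comment> \<open>The marginals of the limit are identified through bounded continuous functions,
    along which the marginals of \<open>J m\<close> converge to the laws of the diffusions.\<close>
  have marginal: "distr JJ borel h = \<nu>"
    if h: "continuous_on UNIV h" and \<nu>: "prob_space \<nu>" "sets \<nu> = sets borel"
      and lim: "\<And>g :: 'n state \<Rightarrow> real. continuous_on UNIV g \<Longrightarrow> (\<And>z. \<bar>g z\<bar> \<le> 1) \<Longrightarrow> (\<lambda>m. \<integral>z. g z \<partial>distr (J (r m)) borel h) \<longlonglongrightarrow> (\<integral>z. g z \<partial>\<nu>)"
    for h :: "_ \<Rightarrow> 'n state" and \<nu>
  proof (rule borel_measure_eqI_bounded_continuous)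
    have [measurable]: "h \<in> borel_measurable borel" by (rule borel_measurable_continuous_onI[OF h])
    show "prob_space (distr JJ borel h)" by (rule JJ.prob_space_distr) measurable
    fix g :: "'n state \<Rightarrow> real" assume g: "continuous_on UNIV g" and g01: "\<And>x. 0 \<le> g x \<and> g x \<le> 1"
    have [measurable]: "g \<in> borel_measurable borel" by (rule borel_measurable_continuous_onI[OF g])
    have g1: "\<bar>g z\<bar> \<le> 1" for z using g01[of z] by auto
    have "(\<lambda>m. \<integral>x. g (h x) \<partial>J (r m)) \<longlonglongrightarrow> (\<integral>x. g (h x) \<partial>JJ)"
      using g1 by (intro conv continuous_on_compose2[OF g h] exI[of _ 1] allI) auto
    moreover have "(\<integral>z. g z \<partial>distr (J (r m)) borel h) = (\<integral>x. g (h x) \<partial>J (r m))" for m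
      by (rule integral_distr) measurable
    moreover have "(\<integral>z. g z \<partial>distr JJ borel h) = (\<integral>x. g (h x) \<partial>JJ)"
      by (rule integral_distr) measurable
    ultimately show "integral\<^sup>L (distr JJ borel h) g = integral\<^sup>L \<nu> g"
      using lim[OF g g1] LIMSEQ_unique by simp
  qed (use \<nu> in auto)
  define \<Gamma>' where "\<Gamma>' = distr JJ borel snd"
  have "distr \<Gamma>' borel fst = distr JJ borel (\<lambda>x. fst (snd x))"
    unfolding \<Gamma>'_def by (subst distr_distr) (auto simp: comp_def)
  also have "\<dots> = law_at M1 X1 V1 T"
  proof (rule marginal)
    show "(\<lambda>m. \<integral>z. g z \<partial>distr (J (r m)) borel (\<lambda>x. fst (snd x))) \<longlonglongrightarrow> (\<integral>z. g z \<partial>law_at M1 X1 V1 T)"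
      if "continuous_on UNIV g" "\<And>z. \<bar>g z\<bar> \<le> 1" for g :: "'n state \<Rightarrow> real"
      unfolding J1 using filterlim_compose[OF euler_law_tendsto[OF sol1 T that] nr_top] .
  qed (use prob_space_law_at[OF sol1] T in \<open>auto intro!: continuous_intros\<close>)
  finally have G1: "distr \<Gamma>' borel fst = law_at M1 X1 V1 T" .
  have "distr \<Gamma>' borel snd = distr JJ borel (\<lambda>x. snd (snd x))"
    unfolding \<Gamma>'_def by (subst distr_distr) (auto simp: comp_def)
  also have "\<dots> = law_at M2 X2 V2 T"
  proof (rule marginal)
    show "(\<lambda>m. \<integral>z. g z \<partial>distr (J (r m)) borel (\<lambda>x. snd (snd x))) \<longlonglongrightarrow> (\<integral>z. g z \<partial>law_at M2 X2 V2 T)"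
      if "continuous_on UNIV g" "\<And>z. \<bar>g z\<bar> \<le> 1" for g :: "'n state \<Rightarrow> real"
      unfolding J2 using filterlim_compose[OF euler_law_tendsto[OF sol2 T that] nr_top] .
  qed (use prob_space_law_at[OF sol2] T in \<open>auto intro!: continuous_intros\<close>)
  finally have G2: "distr \<Gamma>' borel snd = law_at M2 X2 V2 T" .
  have "prob_space \<Gamma>'" unfolding \<Gamma>'_def by (rule JJ.prob_space_distr) measurable
  with G1 G2 have coup: "\<Gamma>' \<in> couplings (law_at M1 X1 V1 T) (law_at M2 X2 V2 T)"
    by (simp add: couplings_def \<Gamma>'_def)
  define R where "R = ennreal (exp (- c * T)) * (\<integral>\<^sup>+p. ennreal (rho p) \<partial>\<Gamma>)"
  \<comment> \<open>A continuous cut-off of the starting pair, 1 up to radius k and 0 from radius k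
    + 1 on. It makes the weighted mean of \<open>size2\<close> finite for arbitrary initial
    laws.\<close>
  define \<psi> where "\<psi> k zz = max 0 (min 1 (real k + 1 - norm zz))" for k and zz :: "'n state \<times> 'n state"
  have \<psi>: "0 \<le> \<psi> k zz" "\<psi> k zz \<le> 1" for k zz by (auto simp: \<psi>_def)
  have c\<psi>: "continuous_on UNIV (\<psi> k)" for k unfolding \<psi>_def by (intro continuous_intros)
  have [measurable]: "\<psi> k \<in> borel_measurable borel" for k by (rule borel_measurable_continuous_onI[OF c\<psi>])
  \<comment> \<open>A bounded continuous minorant of \<open>rho\<close>, as weak convergence
    requires; it increases to \<open>rho\<close> as k grows.\<close>
  define g where "g k x = \<psi> k (fst x) * min (rho (snd x)) (real k)" for k and x :: "('n state \<times> 'n state) \<times> 'n state \<times> 'n state"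
  have g0: "0 \<le> g k x" "g k x \<le> real k" for k x
    using \<psi>[of k "fst x"] rho_nonneg[of "snd x"] mult_mono[of "\<psi> k (fst x)" 1 "min (rho (snd x)) (real k)" "real k"]
    by (auto simp: g_def)
  have cg: "continuous_on UNIV (g k)" for k
    unfolding g_def by (intro continuous_intros continuous_on_compose2[OF c\<psi>] continuous_on_compose2[OF continuous_rho[of UNIV]]) auto
  have [measurable]: "g k \<in> borel_measurable borel" for k by (rule borel_measurable_continuous_onI[OF cg])
  \<comment> \<open>For fixed k the error is \<eta> m times a constant depending on k. It is removed
    by letting m tend to infinity first, and k only afterwards.\<close>
  have g_bound: "(\<integral>\<^sup>+x. ennreal (g k x) \<partial>JJ) \<le> R" for k
  proof -
    define S where "S = (\<integral>\<^sup>+zz. ennreal (\<psi> k zz) * ennreal (size2 zz) \<partial>\<Gamma>)"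
    have "S \<le> (\<integral>\<^sup>+zz. ennreal (1 + (real k + 1)\<^sup>2 + (real k + 1)\<^sup>2) \<partial>\<Gamma>)"
      unfolding S_def
    proof (rule nn_integral_mono)
      fix zz
      show "ennreal (\<psi> k zz) * ennreal (size2 zz) \<le> ennreal (1 + (real k + 1)\<^sup>2 + (real k + 1)\<^sup>2)"
      proof (cases "norm zz \<le> real k + 1")
        case True
        have "size2 zz \<le> 1 + (real k + 1)\<^sup>2 + (real k + 1)\<^sup>2"
          unfolding size2_def using True norm_fst_le[of "fst zz" "snd zz"] norm_snd_le[of "snd zz" "fst zz"]
          by (intro add_mono power_mono order_refl) auto
        then have "\<psi> k zz * size2 zz \<le> 1 * (1 + (real k + 1)\<^sup>2 + (real k + 1)\<^sup>2)"
          using \<psi>[of k zz] size2_ge_1[of zz] by (intro mult_mono) auto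
        moreover have "ennreal (\<psi> k zz) * ennreal (size2 zz) = ennreal (\<psi> k zz * size2 zz)"
          using \<psi>[of k zz] size2_ge_1[of zz] by (subst ennreal_mult) auto
        ultimately show ?thesis by (simp only: ennreal_leI mult_1)
      next
        case False
        then show ?thesis by (simp add: \<psi>_def)
      qed
    qed
    also have "\<dots> = ennreal (1 + (real k + 1)\<^sup>2 + (real k + 1)\<^sup>2)"
      using prob_space.emeasure_space_1[OF \<Gamma>1(1)] by simp
    finally have S: "S \<le> ennreal (1 + (real k + 1)\<^sup>2 + (real k + 1)\<^sup>2)" .
    define Cb where "Cb = T * exp (K * T) * (1 + (real k + 1)\<^sup>2 + (real k + 1)\<^sup>2)"
    have Jm: "ennreal (\<integral>x. g k x \<partial>J m) \<le> R + ennreal (\<eta> m * Cb)" for m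
    proof -
      interpret Jm: prob_space "J m" by (rule J)
      have "ennreal (\<integral>x. g k x \<partial>J m) = (\<integral>\<^sup>+x. ennreal (g k x) \<partial>J m)"
      proof (rule nn_integral_eq_integral[symmetric])
        show "integrable (J m) (g k)"
          by (rule Jm.integrable_const_bound[where B = "real k"]) (use g0 in auto)
      qed (use g0 in auto)
      also have "\<dots> \<le> (\<integral>\<^sup>+x. ennreal (\<psi> k (fst x)) * ennreal (rho (snd x)) \<partial>J m)"
        using \<psi> rho_nonneg by (intro nn_integral_mono) (auto simp: g_def simp flip: ennreal_mult intro!: ennreal_leI mult_left_mono)
      also have "\<dots> \<le> ennreal (exp (- c * (real (Suc (n m)) * (s m)\<^sup>2))) * (\<integral>\<^sup>+zz. ennreal (\<psi> k zz) * ennreal (rho zz) \<partial>\<Gamma>)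
          + ennreal (\<eta> m * (real (Suc (n m)) * (s m)\<^sup>2) * exp (K * (real (Suc (n m)) * (s m)\<^sup>2))) * S"
        unfolding J_def S_def
        using step[OF s, of m] K \<xi>[of m] s[of m] \<eta>[of m]
        by (intro coupled_law_contraction[OF \<Gamma>1 \<xi>]) (auto simp: less_imp_le)
      also have "\<dots> = ennreal (exp (- c * T)) * (\<integral>\<^sup>+zz. ennreal (\<psi> k zz) * ennreal (rho zz) \<partial>\<Gamma>)
          + ennreal (\<eta> m * T * exp (K * T)) * S" unfolding sT ..
      also have "\<dots> \<le> R + ennreal (\<eta> m * Cb)"
      proof (rule add_mono)
        have "ennreal (\<psi> k zz) * ennreal (rho zz) \<le> ennreal (rho zz)" for zz
          using mult_right_mono[OF ennreal_leI[OF \<psi>(2)], of "ennreal (rho zz)" k zz] by simp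
        then show "ennreal (exp (- c * T)) * (\<integral>\<^sup>+zz. ennreal (\<psi> k zz) * ennreal (rho zz) \<partial>\<Gamma>) \<le> R"
          unfolding R_def by (intro mult_left_mono nn_integral_mono) auto
        have "ennreal (\<eta> m * T * exp (K * T)) * S \<le> ennreal (\<eta> m * T * exp (K * T)) * ennreal (1 + (real k + 1)\<^sup>2 + (real k + 1)\<^sup>2)"
          using S by (intro mult_left_mono) auto
        also have "\<dots> = ennreal (\<eta> m * Cb)"
          using \<eta>[of m] T by (subst ennreal_mult[symmetric]) (auto simp: Cb_def mult_ac)
        finally show "ennreal (\<eta> m * T * exp (K * T)) * S \<le> ennreal (\<eta> m * Cb)" .
      qed
      finally show ?thesis .
    qed
    have lim1: "(\<lambda>m. ennreal (\<integral>x. g k x \<partial>J (r m))) \<longlonglongrightarrow> ennreal (\<integral>x. g k x \<partial>JJ)"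
      using g0[of k] by (intro tendsto_ennrealI conv cg) (auto intro!: exI[of _ "real k"])
    have "(\<lambda>m. \<eta> m * Cb) \<longlonglongrightarrow> 0 * Cb"
      unfolding \<eta>_def by (intro tendsto_mult tendsto_const LIMSEQ_inverse_real_of_nat[unfolded inverse_eq_divide])
    then have "(\<lambda>m. \<eta> (r m) * Cb) \<longlonglongrightarrow> 0" using filterlim_compose[OF _ r_top] by simp
    then have "(\<lambda>m. R + ennreal (\<eta> (r m) * Cb)) \<longlonglongrightarrow> R + ennreal 0"
      by (intro tendsto_add tendsto_const tendsto_ennrealI)
    then have "ennreal (\<integral>x. g k x \<partial>JJ) \<le> R"
      using LIMSEQ_le[OF lim1, of "\<lambda>m. R + ennreal (\<eta> (r m) * Cb)"] Jm by simp
    moreover have "(\<integral>\<^sup>+x. ennreal (g k x) \<partial>JJ) = ennreal (\<integral>x. g k x \<partial>JJ)"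
    proof (rule nn_integral_eq_integral)
      show "integrable JJ (g k)"
        by (rule JJ.integrable_const_bound[where B = "real k"]) (use g0 in auto)
    qed (use g0 in auto)
    ultimately show ?thesis by simp
  qed
  have "(\<integral>\<^sup>+p. ennreal (rho p) \<partial>\<Gamma>') = (\<integral>\<^sup>+x. ennreal (rho (snd x)) \<partial>JJ)"
    unfolding \<Gamma>'_def by (subst nn_integral_distr) auto
  \<comment> \<open>The cut-offs are removed by Fatou's lemma; at each point g k is eventually equal
    to \<open>rho\<close>.\<close>
  also have "\<dots> = (\<integral>\<^sup>+x. liminf (\<lambda>k. ennreal (g k x)) \<partial>JJ)"
  proof (rule nn_integral_cong)
    fix x :: "('n state \<times> 'n state) \<times> 'n state \<times> 'n state"
    obtain k0 :: nat where k0: "max (norm (fst x)) (rho (snd x)) \<le> real k0" using real_arch_simple by blast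
    have "g k x = rho (snd x)" if "k \<ge> k0" for k
    proof -
      have "real k0 \<le> real k" using that by simp
      then have "norm (fst x) \<le> real k" "rho (snd x) \<le> real k" using k0 by linarith+
      then show ?thesis by (simp add: g_def \<psi>_def min_def max_def)
    qed
    then have "eventually (\<lambda>k. ennreal (g k x) = ennreal (rho (snd x))) sequentially"
      by (intro eventually_sequentiallyI[of k0]) simp
    then have "(\<lambda>k. ennreal (g k x)) \<longlonglongrightarrow> ennreal (rho (snd x))" by (rule tendsto_eventually)
    then show "ennreal (rho (snd x)) = liminf (\<lambda>k. ennreal (g k x))"
      using lim_imp_Liminf[OF sequentially_bot] by metis
  qed
  also have "\<dots> \<le> liminf (\<lambda>k. \<integral>\<^sup>+x. ennreal (g k x) \<partial>JJ)"
    by (rule nn_integral_liminf) measurable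
  also have "\<dots> \<le> R"
  proof -
    have "liminf (\<lambda>k. \<integral>\<^sup>+x. ennreal (g k x) \<partial>JJ) \<le> liminf (\<lambda>k. R)"
      by (rule Liminf_mono) (simp add: g_bound)
    then show ?thesis by (simp add: Liminf_const)
  qed
  finally show ?thesis using that[OF coup] by (simp add: R_def)
qed

section \<open>From couplings to the transportation cost\<close>

lemma W_cost_contraction:
  fixes X1 V1 :: "real \<Rightarrow> 'a \<Rightarrow> real^'n" and X2 V2 :: "real \<Rightarrow> 'b \<Rightarrow> real^'n"
  assumes sol1: "langevin_solution gradU u \<gamma> M1 B1 X1 V1" and sol2: "langevin_solution gradU u \<gamma> M2 B2 X2 V2"
    and t: "t \<ge> 0"
  defines "\<rho> \<equiv> rho_cost U u \<gamma> lam \<alpha> \<epsilon> f"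
  shows "W_cost \<rho> (law_at M1 X1 V1 t) (law_at M2 X2 V2 t)
    \<le> ennreal (exp (- c * t)) * W_cost \<rho> (law_at M1 X1 V1 0) (law_at M2 X2 V2 0)"
proof (cases "t = 0")
  case False
  then have T: "t > 0" using t by simp
  have W: "W_cost \<rho> \<mu> \<nu> = (INF \<Gamma>\<in>couplings \<mu> \<nu>. \<integral>\<^sup>+ p. ennreal (rho p) \<partial>\<Gamma>)" for \<mu> \<nu>
    by (simp add: W_cost_def \<rho>_def rho_eq_rho_cost)
  let ?Wt = "W_cost \<rho> (law_at M1 X1 V1 t) (law_at M2 X2 V2 t)"
  let ?W0 = "W_cost \<rho> (law_at M1 X1 V1 0) (law_at M2 X2 V2 0)"
  have inv: "ennreal (exp (c * t)) * ennreal (exp (- c * t)) = 1"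
    by (simp flip: ennreal_mult exp_add)
  \<comment> \<open>The factor is moved to the left so that the claim becomes a lower bound for an
    infimum, to be checked coupling by coupling.\<close>
  have "ennreal (exp (c * t)) * ?Wt \<le> ?W0"
    unfolding W[of "law_at M1 X1 V1 0"]
  proof (rule INF_greatest)
    fix \<Gamma> assume "\<Gamma> \<in> couplings (law_at M1 X1 V1 0) (law_at M2 X2 V2 0)"
    from coupling_contraction[OF sol1 sol2 T this]
    obtain \<Gamma>' where \<Gamma>': "\<Gamma>' \<in> couplings (law_at M1 X1 V1 t) (law_at M2 X2 V2 t)"
      "(\<integral>\<^sup>+p. ennreal (rho p) \<partial>\<Gamma>') \<le> ennreal (exp (- c * t)) * (\<integral>\<^sup>+p. ennreal (rho p) \<partial>\<Gamma>)" by blast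
    have "?Wt \<le> (\<integral>\<^sup>+p. ennreal (rho p) \<partial>\<Gamma>')" unfolding W by (rule INF_lower[OF \<Gamma>'(1)])
    also note \<Gamma>'(2)
    finally have "ennreal (exp (c * t)) * ?Wt \<le> ennreal (exp (c * t)) * (ennreal (exp (- c * t)) * (\<integral>\<^sup>+p. ennreal (rho p) \<partial>\<Gamma>))"
      by (intro mult_left_mono) auto
    then show "ennreal (exp (c * t)) * ?Wt \<le> (\<integral>\<^sup>+p. ennreal (rho p) \<partial>\<Gamma>)"
      by (simp only: mult.assoc[symmetric] inv mult_1)
  qed
  then have "ennreal (exp (- c * t)) * (ennreal (exp (c * t)) * ?Wt) \<le> ennreal (exp (- c * t)) * ?W0"
    by (intro mult_left_mono) auto
  then show ?thesis
    using inv by (simp only: mult.assoc[symmetric] mult.commute[of "ennreal (exp (- c * t))" "ennreal (exp (c * t))"] mult_1)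
qed simp

end

text \<open>Along a ray the Lipschitz gradient gives x . gradU x <= L |x|^2 + O(|x|), while the
  drift condition with U >= 0 asks for at least lam \<gamma>^2 |x|^2 / (2u) - 2A. Comparing the
  quadratic terms for large |x| yields the claim.\<close>

lemma lambda_le_of_drift:
  fixes U :: "real^('n::finite) \<Rightarrow> real" and gradU :: "real^'n \<Rightarrow> real^'n"
  assumes pos: "u > 0" "\<gamma> > 0" "L > 0" "lam > 0"
    and U_nonneg: "\<And>x. U x \<ge> 0"
    and grad_Lip: "\<And>x y. norm (gradU x - gradU y) \<le> L * norm (x - y)"
    and drift: "\<And>x. x \<bullet> gradU x / 2 \<ge> lam * (U x + \<gamma>^2 / u * (norm x)^2 / 4) - A"
  shows "lam \<le> 2 * (L * u / \<gamma>\<^sup>2)"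
proof (rule ccontr)
  assume "\<not> ?thesis"
  then have "0 < lam - 2 * (L * u / \<gamma>\<^sup>2)" by simp
  then have "0 < (lam - 2 * (L * u / \<gamma>\<^sup>2)) * (\<gamma>\<^sup>2 / (4 * u))" using pos by (intro mult_pos_pos) auto
  also have "\<dots> = lam * \<gamma>\<^sup>2 / (4 * u) - L / 2" using pos by (simp add: field_simps)
  finally have D: "0 < lam * \<gamma>\<^sup>2 / (4 * u) - L / 2" (is "0 < ?D") .
  define g0 where "g0 = norm (gradU 0)"
  obtain e :: "real^'n" where e: "norm e = 1" using vector_choose_size[of 1] by auto
  have bound: "?D * t\<^sup>2 \<le> A + t * g0 / 2" if t: "t \<ge> 0" for t
  proof -
    let ?x = "t *\<^sub>R e"
    have nx: "norm ?x = t" using e t by simp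
    have "norm (gradU ?x) \<le> g0 + L * t"
      using grad_Lip[of ?x 0] norm_triangle_ineq2[of "gradU ?x" "gradU 0"] nx by (simp add: g0_def)
    then have "norm ?x * norm (gradU ?x) \<le> t * (g0 + L * t)" unfolding nx using t by (intro mult_left_mono) auto
    then have "?x \<bullet> gradU ?x \<le> t * (g0 + L * t)" using norm_cauchy_schwarz[of ?x "gradU ?x"] by linarith
    moreover have "lam * (\<gamma>\<^sup>2 / u * (norm ?x)\<^sup>2 / 4) \<le> lam * (U ?x + \<gamma>\<^sup>2 / u * (norm ?x)\<^sup>2 / 4)"
      using U_nonneg pos by (intro mult_left_mono) auto
    moreover have "lam * (U ?x + \<gamma>\<^sup>2 / u * (norm ?x)\<^sup>2 / 4) \<le> ?x \<bullet> gradU ?x / 2 + A"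
      using drift[of ?x] by simp
    ultimately have "lam * (\<gamma>\<^sup>2 / u * t\<^sup>2 / 4) \<le> t * (g0 + L * t) / 2 + A"
      unfolding nx by (meson add_right_mono divide_right_mono order_trans zero_le_numeral)
    then have "lam * (\<gamma>\<^sup>2 / u * t\<^sup>2 / 4) - A \<le> t * (g0 + L * t) / 2" by (simp only: le_diff_eq diff_le_eq)
    moreover have "?D * t\<^sup>2 = lam * (\<gamma>\<^sup>2 / u * t\<^sup>2 / 4) - t * (g0 + L * t) / 2 + t * g0 / 2"
      by (simp add: algebra_simps power2_eq_square add_divide_distrib)
    ultimately show ?thesis by linarith
  qed
  \<comment> \<open>Chosen so that \<open>?D * t\<close> exceeds |A| + g0 and t >= 1, which
    contradicts the quadratic bound.\<close>
  define t where "t = 1 + (\<bar>A\<bar> + g0) / ?D"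
  have g0: "g0 \<ge> 0" by (simp add: g0_def)
  have t1: "t \<ge> 1" using D g0 by (simp add: t_def)
  have "?D * t = ?D + \<bar>A\<bar> + g0" unfolding t_def distrib_left using D by simp
  then have "\<bar>A\<bar> + g0 < ?D * t" using D by linarith
  then have "(\<bar>A\<bar> + g0) * t < ?D * t * t" using t1 by (intro mult_strict_right_mono) auto
  then have "(\<bar>A\<bar> + g0) * t < ?D * t\<^sup>2" by (simp only: power2_eq_square mult.assoc)
  moreover have "A + t * g0 / 2 \<le> (\<bar>A\<bar> + g0) * t"
  proof -
    have "A \<le> \<bar>A\<bar> * 1" by simp
    also have "\<dots> \<le> \<bar>A\<bar> * t" using t1 by (intro mult_left_mono) auto
    finally have "A \<le> \<bar>A\<bar> * t" .
    moreover have "t * g0 / 2 \<le> t * g0" using t1 g0 by simp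
    ultimately show ?thesis by (simp add: algebra_simps)
  qed
  moreover have "?D * t\<^sup>2 \<le> A + t * g0 / 2" using t1 by (intro bound) simp
  ultimately show False by (meson leD order_trans)
qed

theorem theorem1p4:
  fixes U :: "real^('n::finite) \<Rightarrow> real" and gradU :: "real^('n::finite) \<Rightarrow> real^('n::finite)"
    and u \<gamma> L A lam :: real
  assumes u_pos: "u > 0" and gamma_pos: "\<gamma> > 0"
    and L_pos: "L > 0" and A_pos: "A > 0"
    and lam_pos: "lam > 0" and lam_le: "lam \<le> 1/4"
    and U_C1: "\<forall>x. (U has_derivative (\<lambda>h. gradU x \<bullet> h)) (at x)"
    and U_nonneg: "\<forall>x. U x \<ge> 0"
    and grad_Lip: "\<forall>x y. norm (gradU x - gradU y) \<le> L * norm (x - y)"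
    and drift: "\<forall>x. x \<bullet> gradU x / 2 \<ge> lam * (U x + \<gamma>^2 / u * (norm x)^2 / 4) - A"
  shows "\<exists>\<alpha> \<epsilon> (f :: real \<Rightarrow> real).
    (let d = real CARD('n);
         R1 = 4 * sqrt (6/5) * sqrt (1 + 2*\<alpha> + 2*\<alpha>^2) * sqrt (d + A) * sqrt u / \<gamma>
              / sqrt (lam - 2*lam^2);
         \<Lambda> = L * R1^2 / 8;
         c = \<gamma> / 384 * min (lam * L * u / \<gamma>^2)
                   (min (sqrt \<Lambda> * exp (-\<Lambda>) * L * u / \<gamma>^2) (sqrt \<Lambda> * exp (-\<Lambda>)));
         \<eta> = 1 / \<Lambda>;
         \<phi> = (\<lambda>s. exp (-(1 + \<eta>) * L * s^2 / 8
                      - \<gamma>^2 / u * \<epsilon> * max 1 (1 / (2*\<alpha>)) * s^2 / 2));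
         \<Phi> = (\<lambda>s. integral {0..s} \<phi>);
         g = (\<lambda>r. 1 - 9/4 * c * \<gamma> / u * integral {0..r} (\<lambda>s. \<Phi> s / \<phi> s));
         \<rho> = rho_cost U u \<gamma> lam \<alpha> \<epsilon> f
     in \<alpha> > 0 \<and> \<epsilon> > 0 \<and>
        \<Lambda> = 12/5 * (1 + 2*\<alpha> + 2*\<alpha>^2) * (d + A) * L * u / \<gamma>^2 / lam / (1 - 2*lam) \<and>
        \<alpha> = (1 + 1/\<Lambda>) * L * u / \<gamma>^2 \<and> \<alpha> \<le> 11/6 * L * u / \<gamma>^2 \<and>
        \<epsilon> = 4 / \<gamma> * c / (d + A) \<and>
        continuous_on {0..} f \<and> mono_on {0..} f \<and> concave_on {0..} f \<and>
        f 0 = 0 \<and> (\<forall>r\<ge>0. f r \<ge> 0) \<and>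
        (\<forall>r\<ge>0. f r = integral {0..min r R1} (\<lambda>s. \<phi> s * g s)) \<and>
        (\<forall>r\<ge>R1. f r = f R1) \<and>
        (\<exists>f' f''. continuous_on {0<..<R1} f'' \<and>
           (\<forall>r\<in>{0<..<R1}. (f has_real_derivative f' r) (at r) \<and>
                            (f' has_real_derivative f'' r) (at r) \<and>
                            1/2 * exp (-2) * exp (-L * r^2 / 8) \<le> f' r \<and>
                            f' r \<le> exp (-L * r^2 / 8))) \<and>
        (\<forall>(M1 :: 'a measure) B1 X1 V1 (M2 :: 'b measure) B2 X2 V2 t.
           langevin_solution gradU u \<gamma> M1 B1 X1 V1 \<longrightarrow>
           langevin_solution gradU u \<gamma> M2 B2 X2 V2 \<longrightarrow> t \<ge> 0 \<longrightarrow>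
           W_cost \<rho> (law_at M1 X1 V1 t) (law_at M2 X2 V2 t)
             \<le> ennreal (exp (-c * t)) * W_cost \<rho> (law_at M1 X1 V1 0) (law_at M2 X2 V2 0)))"
proof -
  \<comment> \<open>\<Lambda> = C (1 + 2\<alpha> + 2\<alpha>^2) w with w = L u / \<gamma>^2, the
    shape in which the fixed point equation is solved.\<close>
  define C where "C = 12/5 * (real CARD('n) + A) / (lam * (1 - 2 * lam))"
  have C: "C > 0" unfolding C_def using A_pos lam_pos lam_le by (intro divide_pos_pos mult_pos_pos add_nonneg_pos) auto
  have w: "L * u / \<gamma>\<^sup>2 > 0" using u_pos gamma_pos L_pos by simp
  obtain \<alpha> where \<alpha>: "\<alpha> > 0" "\<alpha> = (1 + 1 / (C * (1 + 2*\<alpha> + 2*\<alpha>\<^sup>2) * (L * u / \<gamma>\<^sup>2))) * (L * u / \<gamma>\<^sup>2)"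
    using fixpoint_alpha_exists[OF C w] by blast
  have "C * q * (L * u / \<gamma>\<^sup>2) = 12/5 * q * (real CARD('n) + A) * L * u / \<gamma>\<^sup>2 / lam / (1 - 2*lam)" for q
    by (simp add: C_def divide_divide_eq_left mult_ac)
  then have fixpoint: "\<alpha> = (1 + 1 / (12/5 * (1 + 2*\<alpha> + 2*\<alpha>\<^sup>2) * (real CARD('n) + A) * L * u / \<gamma>\<^sup>2 / lam / (1 - 2*lam)))
      * L * u / \<gamma>\<^sup>2"
    using \<alpha>(2) by simp
  have lam_w: "lam \<le> 2 * (L * u / \<gamma>\<^sup>2)"
    using u_pos gamma_pos L_pos lam_pos U_nonneg grad_Lip drift by (intro lambda_le_of_drift[of u \<gamma> L lam U gradU A]) auto
  interpret langevin A u \<gamma> L lam \<alpha> U gradU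
  proof unfold_locales
    show "1 \<le> real CARD('n)" by (simp add: Suc_le_eq)
    show "\<alpha> = (1 + 1 / (12/5 * (1 + 2*\<alpha> + 2*\<alpha>\<^sup>2) * (real CARD('n) + A) * L * u / \<gamma>\<^sup>2 / lam / (1 - 2*lam)))
      * L * u / \<gamma>\<^sup>2" by (rule fixpoint)
  qed (use assms \<alpha>(1) lam_w in auto)
  \<comment> \<open>The two Gaussian exponents of the statement merge into the single parameter
    \<open>a\<close>.\<close>
  have phi: "exp (-(1 + 1 / \<Lambda>) * L * s^2 / 8 - \<gamma>^2 / u * \<epsilon> * mx * s^2 / 2) = gphi a s" for s
    by (auto simp: gphi_def a_def algebra_simps add_divide_distrib diff_divide_distrib)
  have derivs: "\<exists>f' f''. continuous_on {0<..<R1} f'' \<and>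
           (\<forall>r\<in>{0<..<R1}. (f has_real_derivative f' r) (at r) \<and>
                            (f' has_real_derivative f'' r) (at r) \<and>
                            1/2 * exp (-2) * exp (-L * r^2 / 8) \<le> f' r \<and>
                            f' r \<le> exp (-L * r^2 / 8))"
  proof (intro exI conjI ballI)
    show "continuous_on {0<..<R1} f''"
      using f_derivs(3) by (intro continuous_at_imp_continuous_on) auto
    fix r assume r: "r \<in> {0<..<R1}"
    then show "(f has_real_derivative f' r) (at r)" "(f' has_real_derivative f'' r) (at r)"
      using f_derivs by auto
    show "1/2 * exp (-2) * exp (-L * r^2 / 8) \<le> f' r"
      using f'_bounds(1)[of r] gphi_lower[of r] r by simp
    show "f' r \<le> exp (-L * r^2 / 8)"
      using f'_bounds(2)[of r] gphi_upper[of r] r by simp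
  qed
  show ?thesis
  \<comment> \<open>After unfolding the local definitions of the statement, each is folded back to
    the constant of the locale, so that every conjunct becomes one of its facts.\<close>
  proof (rule exI[of _ \<alpha>], rule exI[of _ \<epsilon>], rule exI[of _ f],
      unfold Let_def R1_def[symmetric] \<Lambda>_def[symmetric] c_def[symmetric] mx_def[symmetric] phi gPhi_def[symmetric]
        \<kappa>_def[symmetric] gfac_def[symmetric], intro conjI)
    show "0 < \<alpha>" by (rule \<alpha>(1))
    show "0 < \<epsilon>" by (rule \<epsilon>_pos)
    show "\<Lambda> = 12/5 * (1 + 2*\<alpha> + 2*\<alpha>^2) * (real CARD('n) + A) * L * u / \<gamma>^2 / lam / (1 - 2*lam)"
      by (rule \<Lambda>_formula)
    show "\<alpha> = (1 + 1/\<Lambda>) * L * u / \<gamma>^2" using \<alpha>_eq by (simp add: w_def)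
    show "\<alpha> \<le> 11/6 * L * u / \<gamma>^2" using \<alpha>_le by (simp add: w_def)
    show "\<epsilon> = 4 / \<gamma> * c / (real CARD('n) + A)" by (rule \<epsilon>_def)
    show "continuous_on {0..} f" by (rule continuous_f)
    show "mono_on {0..} f" by (auto intro!: mono_onI f_mono)
    show "concave_on {0..} f" by (rule concave_f)
    show "f 0 = 0" by simp
    show "\<forall>r\<ge>0. 0 \<le> f r" using f_nonneg by blast
    show "\<forall>r\<ge>0. f r = integral {0..min r R1} (\<lambda>s. gphi a s * gfac a \<kappa> s)" by (simp add: prof_def)
    show "\<forall>r\<ge>R1. f r = f R1" using f_ge_R by blast
    show "\<exists>f' f''. continuous_on {0<..<R1} f'' \<and>
           (\<forall>r\<in>{0<..<R1}. (f has_real_derivative f' r) (at r) \<and>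
                            (f' has_real_derivative f'' r) (at r) \<and>
                            1/2 * exp (-2) * exp (-L * r^2 / 8) \<le> f' r \<and>
                            f' r \<le> exp (-L * r^2 / 8))" by (rule derivs)
  qed (use W_cost_contraction in blast)
qed

end
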